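(* Let $V$, $M$, $\mu_V$ be as in the context, $D$ the matrix Szegő function of $M|_E$, $U_1,\dots,U_g\in\mathrm U(r)$ the unitary matrices with $D_+=D_-U_j$ on $\Sigma_j$, let $\omega_j=2\pi\mu_V([a_j,b_g])$, let $n\ge1$, and put $$K_j=e^{-in\omega_j}U_j\in\mathrm U(r),\qquad j=1,\dots,g.$$ If $N$ solves Problem N with the data $K_1,\dots,K_g$, then $$\mathcal N(z)=\mathsf D_\infty\,N(z)\,\mathsf D(z)$$ solves Problem $\mathcal N$, and conversely (every solution of Problem $\mathcal N$ is of this form with $N$ a solution of Problem N). In particular Problem $\mathcal N$ has exactly one solution.
   Context: Fix $g\ge0$, $r\ge1$ and real numbers $a_0<b_0<a_1<\cdots<a_g<b_g$; $\mathcal E=\{a_0,b_0,\dots,a_g,b_g\}$, $E=\bigcup_{\ell=0}^g[a_\ell,b_\ell]$, $\Sigma_j=(b_{j-1},a_j)$ for $j=1,\dots,g$, $\Omega_0=\widehat{\mathbb C}\setminus[a_0,b_g]$. Subscripts $\pm$ denote (continuous) boundary values from $\{\pm\operatorname{Im}z>0\}$. $\mathrm U(r)$: $r\times r$ unitary matrices; for a scalar $f\ne0$, $f^{\sigma_3}=\operatorname{diag}(fI_r,f^{-1}I_r)$; $X^{-*}=(X^{-1})^*$. Assumptions: (a) $V$ is real valued and real analytic on $\mathbb R$ with $V(x)/\log(1+|x|^2)\to+\infty$ as $|x|\to\infty$; (b) the equilibrium measure $\mu_V$ in the external field $V$ (the unique probability measure on $\mathbb R$ minimising $\iint\log|x-y|^{-1}d\mu(x)d\mu(y)+\int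 V\,d\mu$) is supported on $E$ and is regular: its density is positive on the interior of $E$, vanishes like a square root at each point of $\mathcal E$, and the Euler–Lagrange inequality is strict on $\mathbb R\setminus E$; (c) $M(x)=Q(x)Q(x)^*$ is $r\times r$, Hermitian positive definite for $x\in\mathbb R$; (d) $Q$ is real analytic on $E$ and $\|Q(x)\|$ grows at most polynomially as $|x|\to\infty$. Szegő function $D$ of $M|_E$: the (unique) function $D:\Omega_0\to\mathbb C^{r\times r}$, holomorphic and pointwise invertible, with $D,D^{-1}$ bounded on $\Omega_0$, $D(\infty)$ Hermitian positive definite, $M=D_\pm D_\pm^*$ on $E$, and $D_+=D_-U_j$ on $\Sigma_j$ for constant $U_j\in\mathrm U(r)$. Put $D^\sharp(z)=D(\bar z)^*$ and $$\mathsf D(z)=\begin{pmatrix}D(z)^{-1}&0_r\\0_r&D^\sharp(z)\end{pmatrix},\qquad\mathsf D_\infty=\begin{pmatrix}D(\infty)&0_r\\0_r&D(\infty)^{-*}\end{pmatrix}.$$ Problem N (data $K_1,\dots,K_g\in\mathrm U(r)$): find $N:\mathbb C\setminus[a_0,b_g]\to\mathbb C^{2r\times2r}$ holomorphic with $N_+=N_-\begin{pmatrix}0&I_r\\-I_r&0\end{pmatrix}$ on $(a_k,b_k)$, $k=0,\dots,g$; $N_+=N_-\operatorname{diag}(K_j,K_j^{-1})$ on $\Sigma_j$, $j=1,\dots,g$; $N(z)=I_{2r}+O(z^{-1})$ as $z\to\infty$; $N(z)=O(|z-e|^{-1/4})$ as $z\to e$ for $e\in\mathcal E$. Problem $\mathcal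 N$ (for given $n$): find $\mathcal N:\mathbb C\setminus[a_0,b_g]\to\mathbb C^{2r\times2r}$ analytic with $\mathcal N_+=\mathcal N_-\begin{pmatrix}0_r&M\\-M^{-1}&0_r\end{pmatrix}$ on $(a_\ell,b_\ell)$, $\ell=0,\dots,g$; $\mathcal N_+=\mathcal N_-e^{-in\omega_j\sigma_3}$ on $\Sigma_j$, $j=1,\dots,g$; $\mathcal N(z)=I_{2r}+O(z^{-1})$ as $z\to\infty$; $\mathcal N(z)=O(|z-e|^{-1/4})$ as $z\to e$, $e\in\mathcal E$. *)

theory Defs
  imports "HOL-Probability.Probability" "HOL-Library.Landau_Symbols"
begin

definition adj :: "complex ^ 'n ^ 'm \<Rightarrow> complex ^ 'm ^ 'n" where
  "adj A = (\<chi> i j. cnj (A $ j $ i))"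

definition unitary_mat :: "complex ^ 'n ^ 'n \<Rightarrow> bool" where
  "unitary_mat A \<longleftrightarrow> A ** adj A = mat 1 \<and> adj A ** A = mat 1"

definition hermitian_pos_def :: "complex ^ 'n ^ 'n \<Rightarrow> bool" where
  "hermitian_pos_def A \<longleftrightarrow>
     adj A = A \<and> (\<forall>v. v \<noteq> 0 \<longrightarrow> 0 < Re (\<Sum>i\<in>UNIV. cnj (v $ i) * (A *v v) $ i))"

definition cscale :: "complex \<Rightarrow> complex ^ 'n ^ 'n \<Rightarrow> complex ^ 'n ^ 'n" where
  "cscale c A = (\<chi> i j. c * A $ i $ j)"

text \<open>A \<open>2r \<times> 2r\<close> matrix is indexed by the disjoint sum of two copies of the index type
  of size \<open>r\<close>; \<open>Inl\<close> is the first block of indices.\<close>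

definition block_mat :: "complex ^ 'r ^ 'r \<Rightarrow> complex ^ 'r ^ 'r \<Rightarrow> complex ^ 'r ^ 'r
    \<Rightarrow> complex ^ 'r ^ 'r \<Rightarrow> complex ^ ('r + 'r) ^ ('r + 'r)" where
  "block_mat A B C D = (\<chi> i j. case i of
       Inl k \<Rightarrow> (case j of Inl l \<Rightarrow> A $ k $ l | Inr l \<Rightarrow> B $ k $ l)
     | Inr k \<Rightarrow> (case j of Inl l \<Rightarrow> C $ k $ l | Inr l \<Rightarrow> D $ k $ l))"

definition block_diag :: "complex ^ 'r ^ 'r \<Rightarrow> complex ^ 'r ^ 'r
    \<Rightarrow> complex ^ ('r + 'r) ^ ('r + 'r)" where
  "block_diag A D = block_mat A 0 0 D"

text \<open>\<open>sigma3_power f\<close> is \<open>f\<close> to the power \<open>\<sigma>\<^sub>3\<close>; recall that \<open>mat f\<close> is \<open>f\<close> times the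
  identity matrix.\<close>

definition sigma3_power :: "complex \<Rightarrow> complex ^ ('r::finite + 'r) ^ ('r + 'r)" where
  "sigma3_power f = block_diag (mat f) (mat (inverse f))"

definition ordered_endpoints :: "nat \<Rightarrow> (nat \<Rightarrow> real) \<Rightarrow> (nat \<Rightarrow> real) \<Rightarrow> bool" where
  "ordered_endpoints g a b \<longleftrightarrow> (\<forall>k\<le>g. a k < b k) \<and> (\<forall>k<g. b k < a (Suc k))"

definition endpoints :: "nat \<Rightarrow> (nat \<Rightarrow> real) \<Rightarrow> (nat \<Rightarrow> real) \<Rightarrow> real set" where
  "endpoints g a b = a ` {0..g} \<union> b ` {0..g}"

definition bands :: "nat \<Rightarrow> (nat \<Rightarrow> real) \<Rightarrow> (nat \<Rightarrow> real) \<Rightarrow> real set" where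
  "bands g a b = (\<Union>k\<in>{0..g}. {a k..b k})"

definition gap :: "(nat \<Rightarrow> real) \<Rightarrow> (nat \<Rightarrow> real) \<Rightarrow> nat \<Rightarrow> real set" where
  "gap a b j = {b (j - 1)<..<a j}"

definition slit_plane :: "nat \<Rightarrow> (nat \<Rightarrow> real) \<Rightarrow> (nat \<Rightarrow> real) \<Rightarrow> complex set" where
  "slit_plane g a b = - (complex_of_real ` {a 0..b g})"

text \<open>Functions on the slit plane are total functions whose values on the slit are irrelevant.
  Holomorphy and the growth conditions below only involve points of the slit plane, boundary
  values are limits from the open half planes.\<close>

definition mat_holomorphic_on :: "(complex \<Rightarrow> complex ^ 'n ^ 'm) \<Rightarrow> complex set \<Rightarrow> bool" where
  "mat_holomorphic_on F S \<longleftrightarrow> (\<forall>i j. (\<lambda>z. F z $ i $ j) holomorphic_on S)"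

text \<open>As for \<open>analytic_on\<close>, the expansion must hold in a full neighbourhood of each point of
  \<open>S\<close>, also at boundary points of \<open>S\<close>.\<close>

definition real_analytic_on :: "(real \<Rightarrow> 'a::real_normed_vector) \<Rightarrow> real set \<Rightarrow> bool" where
  "real_analytic_on f S \<longleftrightarrow> (\<forall>x0\<in>S. \<exists>c. \<exists>\<epsilon>>0. \<forall>x. \<bar>x - x0\<bar> < \<epsilon> \<longrightarrow>
     (\<lambda>k. (x - x0) ^ k *\<^sub>R c k) sums f x)"

text \<open>\<open>boundary_plus F x L\<close> says that \<open>F\<^sub>+(x)\<close> exists and equals \<open>L\<close>. Since the limit is taken
  without restriction in the open half plane, the boundary values are automatically continuous
  on any set of real points where they exist.\<close>

definition boundary_plus :: "(complex \<Rightarrow> 'a::topological_space) \<Rightarrow> real \<Rightarrow> 'a \<Rightarrow> bool" where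
  "boundary_plus F x L \<longleftrightarrow> (F \<longlongrightarrow> L) (at (complex_of_real x) within {z. Im z > 0})"

definition boundary_minus :: "(complex \<Rightarrow> 'a::topological_space) \<Rightarrow> real \<Rightarrow> 'a \<Rightarrow> bool" where
  "boundary_minus F x L \<longleftrightarrow> (F \<longlongrightarrow> L) (at (complex_of_real x) within {z. Im z < 0})"

definition jump_at :: "(complex \<Rightarrow> complex ^ 'n ^ 'n) \<Rightarrow> real \<Rightarrow> complex ^ 'n ^ 'n \<Rightarrow> bool" where
  "jump_at F x J \<longleftrightarrow>
     (\<exists>Fp Fm. boundary_plus F x Fp \<and> boundary_minus F x Fm \<and> Fp = Fm ** J)"

text \<open>Integral with values in the extended reals. In \<^typ>\<open>ereal\<close>, \<open>\<infinity> - \<infinity> = \<infinity>\<close>, so an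
  integral whose positive and negative parts are both infinite has the value \<open>\<infinity>\<close>.\<close>

definition ereal_integral :: "'a measure \<Rightarrow> ('a \<Rightarrow> ereal) \<Rightarrow> ereal" where
  "ereal_integral M f =
     enn2ereal (\<integral>\<^sup>+ x. e2ennreal (f x) \<partial>M) - enn2ereal (\<integral>\<^sup>+ x. e2ennreal (- f x) \<partial>M)"

text \<open>The diagonal must be treated separately because \<open>ln 0 = 0\<close> in the library: with the
  value \<open>0\<close> there, point masses would have finite energy.\<close>

definition log_kernel :: "real \<Rightarrow> real \<Rightarrow> ereal" where
  "log_kernel x y = (if x = y then \<infinity> else ereal (ln (1 / \<bar>x - y\<bar>)))"

text \<open>Suppose \<open>V x / ln (1 + x\<^sup>2)\<close> tends to infinity. The second summand is then never \<open>-\<infinity>\<close>,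
  and if it is finite, then \<open>ln (1 + x\<^sup>2)\<close> is integrable, so the first one is well defined and
  not \<open>-\<infinity>\<close>. If it is infinite, the sum is \<open>\<infinity>\<close> whatever the first summand is, since
  \<open>-\<infinity> + \<infinity> = \<infinity>\<close> in \<^typ>\<open>ereal\<close>.\<close>

definition weighted_energy :: "(real \<Rightarrow> real) \<Rightarrow> real measure \<Rightarrow> ereal" where
  "weighted_energy V \<mu> =
     ereal_integral (\<mu> \<Otimes>\<^sub>M \<mu>) (\<lambda>(x, y). log_kernel x y) + ereal_integral \<mu> (\<lambda>x. ereal (V x))"

definition borel_prob :: "real measure \<Rightarrow> bool" where
  "borel_prob \<mu> \<longleftrightarrow> prob_space \<mu> \<and> sets \<mu> = sets borel"

definition equilibrium_measure :: "(real \<Rightarrow> real) \<Rightarrow> real measure \<Rightarrow> bool" where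
  "equilibrium_measure V \<mu> \<longleftrightarrow> borel_prob \<mu> \<and>
     (\<forall>\<nu>. borel_prob \<nu> \<longrightarrow> weighted_energy V \<mu> \<le> weighted_energy V \<nu>)"

definition measure_support :: "real measure \<Rightarrow> real set" where
  "measure_support \<mu> = {x. \<forall>\<epsilon>>0. emeasure \<mu> (ball x \<epsilon>) > 0}"

text \<open>The density is taken to be its continuous version on the support, and \<open>l\<close> is the
  Euler--Lagrange constant.\<close>

definition regular_equilibrium ::
    "nat \<Rightarrow> (nat \<Rightarrow> real) \<Rightarrow> (nat \<Rightarrow> real) \<Rightarrow> (real \<Rightarrow> real) \<Rightarrow> real measure \<Rightarrow> bool" where
  "regular_equilibrium g a b V \<mu> \<longleftrightarrow>
     measure_support \<mu> = bands g a b \<and>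
     (\<exists>\<psi>::real \<Rightarrow> real. \<psi> \<in> borel_measurable borel \<and> \<mu> = density lborel (\<lambda>x. ennreal (\<psi> x)) \<and>
        continuous_on (bands g a b) \<psi> \<and>
        (\<forall>x\<in>interior (bands g a b). 0 < \<psi> x) \<and>
        (\<forall>e\<in>endpoints g a b. \<exists>c>0.
           ((\<lambda>x. \<psi> x / sqrt \<bar>x - e\<bar>) \<longlongrightarrow> c) (at e within bands g a b))) \<and>
     (\<exists>l. (\<forall>x\<in>bands g a b. 2 * (LINT y|\<mu>. ln (1 / \<bar>x - y\<bar>)) + V x = l) \<and>
          (\<forall>x. x \<notin> bands g a b \<longrightarrow> 2 * (LINT y|\<mu>. ln (1 / \<bar>x - y\<bar>)) + V x > l))"

text \<open>The function lives on the Riemann sphere without the slit: \<open>Dinf\<close> is its value at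
  infinity, and holomorphy at infinity is expressed in the chart \<open>w = 1 / z\<close>.\<close>

definition szego_function :: "nat \<Rightarrow> (nat \<Rightarrow> real) \<Rightarrow> (nat \<Rightarrow> real) \<Rightarrow> (real \<Rightarrow> complex ^ 'r ^ 'r)
    \<Rightarrow> (complex \<Rightarrow> complex ^ 'r ^ 'r) \<Rightarrow> complex ^ 'r ^ 'r \<Rightarrow> bool" where
  "szego_function g a b M D Dinf \<longleftrightarrow>
     mat_holomorphic_on D (slit_plane g a b) \<and>
     mat_holomorphic_on (\<lambda>w. if w = 0 then Dinf else D (1 / w))
       {w. w = 0 \<or> 1 / w \<in> slit_plane g a b} \<and>
     (\<forall>z\<in>slit_plane g a b. invertible (D z)) \<and> invertible Dinf \<and>
     bounded (D ` slit_plane g a b) \<and>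
     bounded ((\<lambda>z. matrix_inv (D z)) ` slit_plane g a b) \<and>
     hermitian_pos_def Dinf \<and>
     (\<forall>x\<in>bands g a b. \<exists>Dp Dm. boundary_plus D x Dp \<and> boundary_minus D x Dm \<and>
        M x = Dp ** adj Dp \<and> M x = Dm ** adj Dm) \<and>
     (\<forall>j\<in>{1..g}. \<exists>U. unitary_mat U \<and> (\<forall>x\<in>gap a b j. jump_at D x U))"

definition sharp :: "(complex \<Rightarrow> complex ^ 'r ^ 'r) \<Rightarrow> complex \<Rightarrow> complex ^ 'r ^ 'r" where
  "sharp D z = adj (D (cnj z))"

definition szego_block :: "(complex \<Rightarrow> complex ^ 'r ^ 'r) \<Rightarrow> complex
    \<Rightarrow> complex ^ ('r + 'r) ^ ('r + 'r)" where
  "szego_block D z = block_diag (matrix_inv (D z)) (sharp D z)"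

definition szego_block_inf :: "complex ^ 'r ^ 'r \<Rightarrow> complex ^ ('r + 'r) ^ ('r + 'r)" where
  "szego_block_inf Dinf = block_diag Dinf (adj (matrix_inv Dinf))"

definition rh_normalised :: "nat \<Rightarrow> (nat \<Rightarrow> real) \<Rightarrow> (nat \<Rightarrow> real)
    \<Rightarrow> (complex \<Rightarrow> complex ^ 'n ^ 'n) \<Rightarrow> bool" where
  "rh_normalised g a b N \<longleftrightarrow>
     mat_holomorphic_on N (slit_plane g a b) \<and>
     (\<lambda>z. norm (N z - mat 1)) \<in> O[at_infinity](\<lambda>z. norm (inverse z)) \<and>
     (\<forall>e\<in>endpoints g a b. (\<lambda>z. norm (N z)) \<in>
        O[at (complex_of_real e) within slit_plane g a b](
          \<lambda>z. norm (z - complex_of_real e) powr (- 1 / 4)))"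

definition solves_problem_N :: "nat \<Rightarrow> (nat \<Rightarrow> real) \<Rightarrow> (nat \<Rightarrow> real) \<Rightarrow> (nat \<Rightarrow> complex ^ 'r ^ 'r)
    \<Rightarrow> (complex \<Rightarrow> complex ^ ('r + 'r) ^ ('r + 'r)) \<Rightarrow> bool" where
  "solves_problem_N g a b K N \<longleftrightarrow>
     rh_normalised g a b N \<and>
     (\<forall>k\<in>{0..g}. \<forall>x\<in>{a k<..<b k}. jump_at N x (block_mat 0 (mat 1) (- mat 1) 0)) \<and>
     (\<forall>j\<in>{1..g}. \<forall>x\<in>gap a b j. jump_at N x (block_diag (K j) (matrix_inv (K j))))"

definition solves_problem_calN :: "nat \<Rightarrow> (nat \<Rightarrow> real) \<Rightarrow> (nat \<Rightarrow> real)
    \<Rightarrow> (real \<Rightarrow> complex ^ 'r ^ 'r) \<Rightarrow> (nat \<Rightarrow> real) \<Rightarrow> nat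
    \<Rightarrow> (complex \<Rightarrow> complex ^ ('r + 'r) ^ ('r + 'r)) \<Rightarrow> bool" where
  "solves_problem_calN g a b M \<omega> n N \<longleftrightarrow>
     rh_normalised g a b N \<and>
     (\<forall>k\<in>{0..g}. \<forall>x\<in>{a k<..<b k}. jump_at N x (block_mat 0 (M x) (- matrix_inv (M x)) 0)) \<and>
     (\<forall>j\<in>{1..g}. \<forall>x\<in>gap a b j.
        jump_at N x (sigma3_power (exp (- \<i> * of_nat n * of_real (\<omega> j)))))"

end

theory Submission
  imports Defs "HOL-Complex_Analysis.Great_Picard"
begin

text \<open>Unitarity of the jump data on the gaps makes the swap matrix \<open>Y\<close> intertwine every jump of Problem N
  with its adjoint, so for two solutions with the same data the product of the first, \<open>Y\<close> and the
  adjoint reflection of the second has no jump and is constant. This yields invertibility and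
  uniqueness. Applied to one row of a solution that decays at infinity, the same pairing with the corner
  matrix gives a scalar function whose real part has a sign on the bands; a Phragmen-Lindelof argument
  shows that the decaying solution vanishes.

  For existence, start from the explicit scalar solution with trivial data and change the datum in one
  gap at a time along the connected group \<open>U(r)\<close>. A small change in the gap \<open>j\<close> amounts to factorizing a
  matrix function close to \<open>1\<close> on an annulus around the gap that crosses the real line only in the
  adjacent bands. By compactness of \<open>U(r)\<close> and the vanishing lemma, the solutions are bounded on the
  annulus uniformly in the datum, so the admissible step size is uniform and finitely many steps reach
  every datum. Finally, the problem with weight \<open>M\<close> is conjugated to Problem N by the Szego function; its boundary
  values satisfy \<open>M = D\<^sub>- D\<^sub>-\<^sup>* = D\<^sub>+ D\<^sub>+\<^sup>*\<close> on the bands and \<open>D\<^sub>+ = D\<^sub>- U\<^sub>j\<close> on the gaps.\<close>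

text \<open>The obstacle is that the \<open>K j\<close> need not commute. Data that can be
  diagonalised simultaneously split into scalar problems with explicit solutions; in general no
  formula is at hand, so existence has to come from a continuity argument and a priori bounds. A
  single gap can be treated in isolation because the band jump does not depend on the data and
  conjugates diag(P, 1) into diag(1, P). Multiplying from the right by the first matrix above the
  axis and by the second below it keeps the jump on the adjacent bands and turns the datum K of the
  gap into K P. Every quantity that is extended or compared is built from at most two factors of
  order |z - e|^(-1/4). Its singularities have order at most 1/2: they are removable once there is
  no jump, and a barrier of order 3/4 dominates them in the half plane. The vanishing lemma hinges
  on a mismatch of orders at infinity. A solution tending to 0 is O(1/z), so its pairing with itself
  is O(1/z^2), whereas a function that does not vanish identically and has nonnegative real part in
  the half plane can have at most a simple zero at infinity.\<close>

section \<open>Matrix inverses, adjoints and the Frobenius norm\<close>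

lemma matrix_inv_mult:
  fixes A :: "complex ^ 'n ^ 'n"
  assumes "invertible A"
  shows "A ** matrix_inv A = mat 1" "matrix_inv A ** A = mat 1"
proof -
  have "\<exists>B. A ** B = mat 1 \<and> B ** A = mat 1"
    using assms unfolding invertible_def .
  then have "A ** matrix_inv A = mat 1 \<and> matrix_inv A ** A = mat 1"
    unfolding matrix_inv_def by (rule someI_ex)
  then show "A ** matrix_inv A = mat 1" "matrix_inv A ** A = mat 1" by blast+
qed

lemma matrix_inv_unique:
  fixes A :: "complex ^ 'n ^ 'n"
  assumes "A ** B = mat 1"
  shows "matrix_inv A = B" "invertible A" "B ** A = mat 1"
proof -
  show BA: "B ** A = mat 1" using assms matrix_left_right_inverse by blast
  show inv: "invertible A" using assms BA unfolding invertible_def by blast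
  have "matrix_inv A = matrix_inv A ** (A ** B)" by (simp add: assms)
  also have "\<dots> = B" by (simp add: matrix_mul_assoc matrix_inv_mult[OF inv])
  finally show "matrix_inv A = B" .
qed

lemma adj_nth [simp]: "adj A $ i $ j = cnj (A $ j $ i)"
  by (simp add: adj_def)

lemma adj_mult: "adj (A ** B) = adj B ** adj A"
  by (simp add: vec_eq_iff matrix_matrix_mult_def mult.commute)

lemma adj_adj [simp]: "adj (adj A) = A"
  by (simp add: vec_eq_iff)

lemma adj_mat1 [simp]: "adj (mat 1) = mat 1"
  by (simp add: vec_eq_iff mat_def)

lemma adj_add: "adj (A + B) = adj A + adj B"
  by (simp add: vec_eq_iff)

lemma norm_matrix_sq:
  fixes A :: "complex ^ 'n ^ 'm"
  shows "(norm A)\<^sup>2 = (\<Sum>i\<in>UNIV. \<Sum>j\<in>UNIV. (norm (A $ i $ j))\<^sup>2)"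
  by (simp add: norm_vec_def L2_set_def sum_nonneg)

lemma norm_adj [simp]: "norm (adj A) = norm A"
proof -
  have "(norm (adj A))\<^sup>2 = (norm A)\<^sup>2"
    unfolding norm_matrix_sq by (subst sum.swap) simp
  then show ?thesis by (simp add: power2_eq_iff_nonneg)
qed

lemma norm_entry_le:
  fixes A :: "'a::real_normed_vector ^ 'n ^ 'm"
  shows "norm (A $ i $ j) \<le> norm A"
  by (rule order_trans[OF Finite_Cartesian_Product.norm_nth_le Finite_Cartesian_Product.norm_nth_le])

text \<open>The norm of nested vectors is the Frobenius norm; Cauchy-Schwarz in each entry makes it
  submultiplicative with constant 1.\<close>

lemma norm_matrix_mult:
  fixes A :: "complex ^ 'n ^ 'm" and B :: "complex ^ 'k ^ 'n"
  shows "norm (A ** B) \<le> norm A * norm B"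
proof -
  have "(norm (A ** B))\<^sup>2 \<le>
    (\<Sum>i\<in>UNIV. \<Sum>j\<in>UNIV. (\<Sum>k\<in>UNIV. (norm (A $ i $ k))\<^sup>2) * (\<Sum>k\<in>UNIV. (norm (B $ k $ j))\<^sup>2))"
    unfolding norm_matrix_sq
  proof (intro sum_mono)
    fix i :: 'm and j :: 'k
    have "norm ((A ** B) $ i $ j) \<le> (\<Sum>k\<in>UNIV. norm (A $ i $ k) * norm (B $ k $ j))"
      using norm_sum[of "\<lambda>k. A $ i $ k * B $ k $ j" UNIV] by (simp add: matrix_matrix_mult_def norm_mult)
    then have "(norm ((A ** B) $ i $ j))\<^sup>2 \<le> (\<Sum>k\<in>UNIV. norm (A $ i $ k) * norm (B $ k $ j))\<^sup>2"
      by (simp add: power_mono)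
    also have "\<dots> \<le> (\<Sum>k\<in>UNIV. (norm (A $ i $ k))\<^sup>2) * (\<Sum>k\<in>UNIV. (norm (B $ k $ j))\<^sup>2)"
      by (rule Cauchy_Schwarz_ineq_sum)
    finally show "(norm ((A ** B) $ i $ j))\<^sup>2 \<le>
      (\<Sum>k\<in>UNIV. (norm (A $ i $ k))\<^sup>2) * (\<Sum>k\<in>UNIV. (norm (B $ k $ j))\<^sup>2)" .
  qed
  also have "\<dots> = (\<Sum>i\<in>UNIV. \<Sum>k\<in>UNIV. (norm (A $ i $ k))\<^sup>2) * (\<Sum>j\<in>UNIV. \<Sum>k\<in>UNIV. (norm (B $ k $ j))\<^sup>2)"
    by (simp add: sum_product)
  also have "(\<Sum>j\<in>UNIV. \<Sum>k\<in>UNIV. (norm (B $ k $ j))\<^sup>2) = (\<Sum>k\<in>UNIV. \<Sum>j\<in>UNIV. (norm (B $ k $ j))\<^sup>2)"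
    by (rule sum.swap)
  also have "(\<Sum>i\<in>UNIV. \<Sum>k\<in>UNIV. (norm (A $ i $ k))\<^sup>2) * \<dots> = (norm A * norm B)\<^sup>2"
    by (simp add: norm_matrix_sq power_mult_distrib)
  finally show ?thesis by (rule power2_le_imp_le) simp
qed

lemma bounded_bilinear_matrix_mult:
  "bounded_bilinear ((**) :: complex ^ 'n ^ 'm \<Rightarrow> complex ^ 'k ^ 'n \<Rightarrow> complex ^ 'k ^ 'm)"
proof
  show "\<exists>K. \<forall>(a :: complex ^ 'n ^ 'm) (b :: complex ^ 'k ^ 'n). norm (a ** b) \<le> norm a * norm b * K"
    by (rule exI[of _ 1]) (simp add: norm_matrix_mult)
qed (simp_all add: vec_eq_iff matrix_matrix_mult_def distrib_left distrib_right sum.distrib scaleR_sum_right)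

lemmas tendsto_matrix_mult = bounded_bilinear.tendsto[OF bounded_bilinear_matrix_mult]

lemma bounded_linear_adj: "bounded_linear (adj :: complex ^ 'n ^ 'm \<Rightarrow> _)"
  by (rule bounded_linear_intro[where K=1]) (auto simp: vec_eq_iff)

lemmas tendsto_adj = bounded_linear.tendsto[OF bounded_linear_adj]

lemma tendsto_matrix_iff:
  fixes F :: "'a \<Rightarrow> complex ^ 'n ^ 'm"
  shows "(F \<longlongrightarrow> L) G \<longleftrightarrow> (\<forall>i j. ((\<lambda>z. F z $ i $ j) \<longlongrightarrow> L $ i $ j) G)"
proof
  assume "(F \<longlongrightarrow> L) G"
  then show "\<forall>i j. ((\<lambda>z. F z $ i $ j) \<longlongrightarrow> L $ i $ j) G"
    by (intro allI tendsto_vec_nth)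
next
  assume "\<forall>i j. ((\<lambda>z. F z $ i $ j) \<longlongrightarrow> L $ i $ j) G"
  then have "((\<lambda>z. F z $ i) \<longlongrightarrow> L $ i) G" for i
    by (intro vec_tendstoI) blast
  then show "(F \<longlongrightarrow> L) G"
    by (rule vec_tendstoI)
qed

lemma norm_matrix_le_entries:
  fixes A :: "complex ^ 'n ^ 'm"
  assumes "\<And>i j. norm (A $ i $ j) \<le> e"
  shows "norm A \<le> real (CARD('m) * CARD('n)) * e"
proof -
  have "norm A \<le> (\<Sum>i\<in>UNIV. norm (A $ i))" unfolding norm_vec_def by (rule L2_set_le_sum) auto
  also have "\<dots> \<le> (\<Sum>i\<in>(UNIV::'m set). \<Sum>j\<in>(UNIV::'n set). norm (A $ i $ j))"
    by (intro sum_mono) (simp add: norm_vec_def L2_set_le_sum)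
  also have "\<dots> \<le> (\<Sum>i\<in>(UNIV::'m set). \<Sum>j\<in>(UNIV::'n set). e)"
    by (intro sum_mono assms)
  finally show ?thesis by (simp add: mult.assoc)
qed

subsection \<open>Block matrices\<close>

lemma sum_UNIV_Plus:
  "(\<Sum>i\<in>(UNIV :: ('r::finite + 'r) set). f i) = (\<Sum>k\<in>UNIV. f (Inl k)) + (\<Sum>k\<in>UNIV. f (Inr k))"
  using sum.Plus[of "UNIV :: 'r set" "UNIV :: 'r set" f] by (simp add: o_def)

lemma block_mat_nth [simp]:
  "block_mat A B C D $ Inl k $ Inl l = A $ k $ l"
  "block_mat A B C D $ Inl k $ Inr l = B $ k $ l"
  "block_mat A B C D $ Inr k $ Inl l = C $ k $ l"
  "block_mat A B C D $ Inr k $ Inr l = D $ k $ l"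
  by (simp_all add: block_mat_def)

lemma matrix_eq_block_iff:
  fixes A B :: "complex ^ ('r::finite + 'r) ^ ('r + 'r)"
  shows "A = B \<longleftrightarrow> (\<forall>k l. A $ Inl k $ Inl l = B $ Inl k $ Inl l \<and> A $ Inl k $ Inr l = B $ Inl k $ Inr l \<and>
     A $ Inr k $ Inl l = B $ Inr k $ Inl l \<and> A $ Inr k $ Inr l = B $ Inr k $ Inr l)"
  (is "_ \<longleftrightarrow> ?R")
proof
  assume ?R
  have "A $ i $ j = B $ i $ j" for i j
    using \<open>?R\<close> by (cases i; cases j) auto
  then show "A = B" by (simp add: vec_eq_iff)
qed simp

lemma block_mat_mult:
  "block_mat A B C D ** block_mat A' B' C' D' =
     block_mat (A ** A' + B ** C') (A ** B' + B ** D') (C ** A' + D ** C') (C ** B' + D ** D')"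
  by (simp add: matrix_eq_block_iff matrix_matrix_mult_def sum_UNIV_Plus)

lemma mat_1_block: "(mat 1 :: complex ^ ('r::finite + 'r) ^ ('r + 'r)) = block_mat (mat 1) 0 0 (mat 1)"
  by (simp add: matrix_eq_block_iff mat_def)

lemma adj_block_mat: "adj (block_mat A B C D) = block_mat (adj A) (adj C) (adj B) (adj D)"
  by (simp add: matrix_eq_block_iff)

lemma matrix_mult_0 [simp]:
  "(A :: complex ^ 'n ^ 'm) ** (0 :: complex ^ 'k ^ 'n) = 0" "(0 :: complex ^ 'n ^ 'm) ** (B :: complex ^ 'k ^ 'n) = 0"
  by (simp_all add: vec_eq_iff matrix_matrix_mult_def)

lemma adj_0 [simp]: "adj 0 = 0"
  by (simp add: vec_eq_iff)

lemma tendsto_block_mat: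
  assumes "(A \<longlongrightarrow> A') F" "(B \<longlongrightarrow> B') F" "(C \<longlongrightarrow> C') F" "(D \<longlongrightarrow> D') F"
  shows "((\<lambda>z. block_mat (A z) (B z) (C z) (D z)) \<longlongrightarrow> block_mat A' B' C' D') F"
  unfolding tendsto_matrix_iff
proof (intro allI)
  fix i j
  show "((\<lambda>z. block_mat (A z) (B z) (C z) (D z) $ i $ j) \<longlongrightarrow> block_mat A' B' C' D' $ i $ j) F"
    using assms by (cases i; cases j) (simp_all add: tendsto_matrix_iff)
qed

subsection \<open>Matrix valued holomorphic functions\<close>

lemma mat_holomorphic_on_mult:
  assumes "mat_holomorphic_on F S" "mat_holomorphic_on G S"
  shows "mat_holomorphic_on (\<lambda>z. F z ** G z) S"
  using assms unfolding mat_holomorphic_on_def matrix_matrix_mult_def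
  by (auto intro!: holomorphic_intros)

lemma mat_holomorphic_on_const [simp]: "mat_holomorphic_on (\<lambda>z. C) S"
  by (simp add: mat_holomorphic_on_def)

lemma mat_holomorphic_on_subset:
  "mat_holomorphic_on F S \<Longrightarrow> T \<subseteq> S \<Longrightarrow> mat_holomorphic_on F T"
  by (auto simp: mat_holomorphic_on_def intro: holomorphic_on_subset)

lemma mat_holomorphic_on_cong:
  assumes "\<And>z. z \<in> S \<Longrightarrow> F z = G z" "mat_holomorphic_on F S"
  shows "mat_holomorphic_on G S"
  unfolding mat_holomorphic_on_def
proof (intro allI)
  fix i j
  have "(\<lambda>z. F z $ i $ j) holomorphic_on S" using assms(2) by (simp add: mat_holomorphic_on_def)
  then show "(\<lambda>z. G z $ i $ j) holomorphic_on S"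
    by (rule holomorphic_transform) (simp add: assms(1))
qed

lemma mat_holomorphic_on_Un:
  assumes "mat_holomorphic_on F S" "mat_holomorphic_on F T" "open S" "open T"
  shows "mat_holomorphic_on F (S \<union> T)"
  using assms by (auto simp: mat_holomorphic_on_def holomorphic_on_Un)

lemma mat_holomorphic_on_imp_continuous_on:
  assumes "mat_holomorphic_on F S"
  shows "continuous_on S F"
  using assms unfolding mat_holomorphic_on_def continuous_on_def tendsto_matrix_iff
  using holomorphic_on_imp_continuous_on continuous_on_def by blast

lemma mat_holomorphic_on_block:
  assumes "mat_holomorphic_on A S" "mat_holomorphic_on B S" "mat_holomorphic_on C S" "mat_holomorphic_on D S"
  shows "mat_holomorphic_on (\<lambda>z. block_mat (A z) (B z) (C z) (D z)) S"
  unfolding mat_holomorphic_on_def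
proof (intro allI)
  fix i j
  show "(\<lambda>z. block_mat (A z) (B z) (C z) (D z) $ i $ j) holomorphic_on S"
    using assms by (cases i; cases j) (simp_all add: mat_holomorphic_on_def)
qed

lemma mat_holomorphic_on_det:
  assumes "mat_holomorphic_on F S"
  shows "(\<lambda>z. det (F z)) holomorphic_on S"
  using assms unfolding mat_holomorphic_on_def det_def
  by (auto intro!: holomorphic_intros)

text \<open>Cramer's rule writes each entry of the inverse as a quotient of two determinants, which
  are polynomials in the entries.\<close>

lemma mat_holomorphic_on_matrix_inv:
  fixes F :: "complex \<Rightarrow> complex ^ 'n ^ 'n"
  assumes "mat_holomorphic_on F S" and inv: "\<And>z. z \<in> S \<Longrightarrow> invertible (F z)"
  shows "mat_holomorphic_on (\<lambda>z. matrix_inv (F z)) S"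
  unfolding mat_holomorphic_on_def
proof (intro allI)
  fix k l :: 'n
  have ent: "matrix_inv (F z) $ k $ l = det (\<chi> i j. if j = k then axis l 1 $ i else F z $ i $ j) / det (F z)"
    if "z \<in> S" for z
  proof -
    have d: "det (F z) \<noteq> 0" using inv[OF that] invertible_det_nz by blast
    have "F z *v (matrix_inv (F z) *v axis l 1) = axis l 1"
      by (simp add: matrix_vector_mul_assoc matrix_inv_mult[OF inv[OF that]])
    then have "matrix_inv (F z) *v axis l 1 = (\<chi> k. det (\<chi> i j. if j = k then axis l 1 $ i else F z $ i $ j) / det (F z))"
      by (simp add: cramer[OF d])
    moreover have "(matrix_inv (F z) *v axis l 1) $ k = matrix_inv (F z) $ k $ l"
      by (simp add: matrix_vector_mult_def axis_def if_distrib[of "(*) _"] cong: if_cong)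
    ultimately show ?thesis by simp
  qed
  have "mat_holomorphic_on (\<lambda>z. \<chi> i j. if j = k then axis l 1 $ i else F z $ i $ j) S"
    unfolding mat_holomorphic_on_def
  proof (intro allI)
    fix i j
    show "(\<lambda>z. (\<chi> i j. if j = k then axis l 1 $ i else F z $ i $ j) $ i $ j) holomorphic_on S"
      using assms(1) by (cases "j = k") (simp_all add: mat_holomorphic_on_def)
  qed
  then have "(\<lambda>z. det (\<chi> i j. if j = k then axis l 1 $ i else F z $ i $ j) / det (F z)) holomorphic_on S"
    using inv invertible_det_nz by (intro holomorphic_on_divide mat_holomorphic_on_det assms(1)) auto
  then show "(\<lambda>z. matrix_inv (F z) $ k $ l) holomorphic_on S"
    by (rule holomorphic_transform) (simp add: ent)
qed

lemma mat_holomorphic_on_sharp: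
  assumes "mat_holomorphic_on F S" "open S" "\<And>z. z \<in> S \<Longrightarrow> cnj z \<in> S"
  shows "mat_holomorphic_on (sharp F) S"
proof -
  have "cnj ` S = S"
  proof
    show "cnj ` S \<subseteq> S" using assms(3) by blast
    show "S \<subseteq> cnj ` S" using assms(3) by (metis complex_cnj_cnj imageI subsetI)
  qed
  have "(\<lambda>z. cnj (F (cnj z) $ j $ i)) holomorphic_on S" for i j
    using holomorphic_on_compose_cnj_cnj[of "\<lambda>z. F z $ j $ i" S] assms(1,2) \<open>cnj ` S = S\<close>
    by (simp add: o_def mat_holomorphic_on_def)
  then show ?thesis by (simp add: mat_holomorphic_on_def sharp_def)
qed

lemma tendsto_matrix_inv:
  fixes F :: "'a \<Rightarrow> complex ^ 'n ^ 'n"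
  assumes "(F \<longlongrightarrow> A) G" "eventually (\<lambda>z. invertible (F z)) G" and A: "invertible A"
  shows "((\<lambda>z. matrix_inv (F z)) \<longlongrightarrow> matrix_inv A) G"
  unfolding tendsto_matrix_iff
proof (intro allI)
  fix k l :: 'n
  define R where "R B = det (\<chi> i j. if j = k then axis l 1 $ i else B $ i $ j) / det B" for B :: "complex ^ 'n ^ 'n"
  have ent: "matrix_inv B $ k $ l = R B" if "invertible B" for B :: "complex ^ 'n ^ 'n"
  proof -
    have d: "det B \<noteq> 0" using that invertible_det_nz by blast
    have "B *v (matrix_inv B *v axis l 1) = axis l 1"
      by (simp add: matrix_vector_mul_assoc matrix_inv_mult[OF that])
    then have "matrix_inv B *v axis l 1 = (\<chi> k. det (\<chi> i j. if j = k then axis l 1 $ i else B $ i $ j) / det B)"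
      by (simp add: cramer[OF d])
    moreover have "(matrix_inv B *v axis l 1) $ k = matrix_inv B $ k $ l"
      by (simp add: matrix_vector_mult_def axis_def if_distrib[of "(*) _"] cong: if_cong)
    ultimately show ?thesis by (simp add: R_def)
  qed
  have e: "((\<lambda>z. F z $ i $ j) \<longlongrightarrow> A $ i $ j) G" for i j
    using assms(1) by (simp add: tendsto_matrix_iff)
  have "((\<lambda>z. R (F z)) \<longlongrightarrow> R A) G"
    unfolding R_def
    using A invertible_det_nz unfolding det_def
    by (intro tendsto_divide tendsto_sum tendsto_mult tendsto_const tendsto_prod)
       (auto intro!: e simp flip: det_def)
  then have "((\<lambda>z. matrix_inv (F z) $ k $ l) \<longlongrightarrow> R A) G"
    by (rule Lim_transform_eventually) (use assms(2) in eventually_elim, simp add: ent)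
  then show "((\<lambda>z. matrix_inv (F z) $ k $ l) \<longlongrightarrow> matrix_inv A $ k $ l) G"
    by (simp add: ent[OF A])
qed

subsection \<open>Extension across the real line\<close>

lemma at_upper_ne_bot: "at (complex_of_real x) within {z. Im z > 0} \<noteq> bot"
proof -
  have "complex_of_real x islimpt {z. Im z > 0}"
    unfolding islimpt_approachable
  proof (intro allI impI)
    fix e :: real assume "e > 0"
    then show "\<exists>y\<in>{z. Im z > 0}. y \<noteq> complex_of_real x \<and> dist y (complex_of_real x) < e"
      by (intro bexI[of _ "Complex x (e/2)"]) (auto simp: complex_eq_iff dist_norm cmod_def)
  qed
  then show ?thesis using trivial_limit_within by blast
qed

lemma at_lower_ne_bot: "at (complex_of_real x) within {z. Im z < 0} \<noteq> bot"
proof -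
  have "complex_of_real x islimpt {z. Im z < 0}"
    unfolding islimpt_approachable
  proof (intro allI impI)
    fix e :: real assume "e > 0"
    then show "\<exists>y\<in>{z. Im z < 0}. y \<noteq> complex_of_real x \<and> dist y (complex_of_real x) < e"
      by (intro bexI[of _ "Complex x (-e/2)"]) (auto simp: complex_eq_iff dist_norm cmod_def)
  qed
  then show ?thesis using trivial_limit_within by blast
qed

lemma nonreal_Un: "- (\<real> :: complex set) = {z. Im z > 0} \<union> {z. Im z < 0}"
  by (auto simp: complex_is_Real_iff)

lemma at_nonreal_ne_bot: "at (complex_of_real x) within - \<real> \<noteq> bot"
  unfolding nonreal_Un at_within_union using at_upper_ne_bot by (simp add: sup_eq_bot_iff)

lemma tendsto_nonreal_iff:
  "(f \<longlongrightarrow> L) (at (complex_of_real x) within - \<real>) \<longleftrightarrow> boundary_plus f x L \<and> boundary_minus f x L"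
  unfolding nonreal_Un boundary_plus_def boundary_minus_def by (rule Lim_within_Un)

lemma open_nonreal: "open (- (\<real> :: complex set))"
  by (simp add: closed_complex_Reals open_Compl)

text \<open>Continuity of \<open>L\<close> is automatic. The limit at \<open>x\<close> is taken over
  all nonreal points nearby, so closeness of \<open>f\<close> to \<open>L x\<close> off the axis
  passes to the limits \<open>L y\<close> at neighbouring real points.\<close>

lemma continuous_on_glue_reals:
  fixes f :: "complex \<Rightarrow> complex"
  assumes V: "open V" and cont: "continuous_on (V - \<real>) f"
    and L: "\<And>x. complex_of_real x \<in> V \<Longrightarrow> (f \<longlongrightarrow> L x) (at (complex_of_real x) within - \<real>)"
  shows "continuous_on V (\<lambda>z. if z \<in> \<real> then L (Re z) else f z)"
proof -
  define F where "F z = (if z \<in> \<real> then L (Re z) else f z)" for z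
  have opn: "open (V - \<real>)" using V by (simp add: closed_complex_Reals open_Diff)
  have "isCont F z" if z: "z \<in> V" for z
  proof (cases "z \<in> \<real>")
    case False
    then have "isCont f z" using cont opn z by (simp add: continuous_on_eq_continuous_at)
    moreover have "eventually (\<lambda>w. F w = f w) (nhds z)"
      using eventually_nhds_in_open[OF open_nonreal, of z] False
      by (auto simp: F_def elim: eventually_mono)
    ultimately show ?thesis using isCont_cong by blast
  next
    case True
    then obtain x where x: "z = complex_of_real x" by (auto elim: Reals_cases)
    have Fz: "F z = L x" by (simp add: F_def x)
    show ?thesis unfolding continuous_at_eps_delta
    proof (intro allI impI)
      fix e :: real assume "e > 0"
      then obtain d1 where d1: "d1 > 0"
        "\<And>w. w \<in> - \<real> \<Longrightarrow> w \<noteq> z \<Longrightarrow> dist w z < d1 \<Longrightarrow> dist (f w) (L x) < e / 2"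
        using L[of x] z unfolding x tendsto_iff eventually_at
        by (metis half_gt_zero)
      obtain d2 where d2: "d2 > 0" "ball z d2 \<subseteq> V" using V z openE by blast
      have "dist (F w) (F z) < e" if w: "dist w z < min d1 d2" for w
      proof (cases "w \<in> \<real>")
        case False
        moreover have "w \<noteq> z" using False True by auto
        ultimately show ?thesis using d1(2)[of w] w True \<open>e > 0\<close> x by (auto simp: F_def)
      next
        case wr: True
        then obtain y where y: "w = complex_of_real y" by (auto elim: Reals_cases)
        have "w \<in> V" using w d2 by (auto simp: dist_commute)
        then have lim: "(f \<longlongrightarrow> L y) (at w within - \<real>)" using L y by auto
        have "eventually (\<lambda>v. v \<in> ball z (min d1 d2)) (at w within - \<real>)"
          unfolding eventually_at_topological using w
          by (intro exI[of _ "ball z (min d1 d2)"]) (auto simp: dist_commute)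
        moreover have "eventually (\<lambda>v. v \<in> - \<real>) (at w within - \<real>)"
          by (simp add: eventually_at_filter)
        ultimately have "eventually (\<lambda>v. norm (f v - L x) \<le> e / 2) (at w within - \<real>)"
        proof eventually_elim
          case (elim v)
          moreover have "v \<noteq> z" using elim \<open>z \<in> \<real>\<close> by auto
          ultimately show ?case using d1(2)[of v] by (auto simp: dist_norm norm_minus_commute)
        qed
        then have "norm (L y - L x) \<le> e / 2"
          using lim at_nonreal_ne_bot[of y] unfolding y
          by (intro Lim_norm_ubound[OF _ tendsto_diff[OF _ tendsto_const]]) auto
        then show ?thesis using \<open>e > 0\<close> by (simp add: F_def Fz[unfolded F_def] y x dist_norm)
      qed
      then show "\<exists>d>0. \<forall>w. dist w z < d \<longrightarrow> dist (F w) (F z) < e"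
        using d1(1) d2(1) by (intro exI[of _ "min d1 d2"]) auto
    qed
  qed
  then have "continuous_on V F" by (simp add: continuous_at_imp_continuous_on)
  then show ?thesis by (simp add: F_def)
qed

text \<open>The points are removed one at a time. The extension over one point agrees with the old
  function near each other point, so the remaining limit conditions survive.\<close>

lemma removable_finite:
  fixes F :: "complex \<Rightarrow> complex"
  assumes "finite T" "open U" "F holomorphic_on (U - T)"
    and "\<And>t. t \<in> T \<Longrightarrow> t \<in> U \<Longrightarrow> ((\<lambda>z. (z - t) * F z) \<longlongrightarrow> 0) (at t)"
  shows "\<exists>G. G holomorphic_on U \<and> (\<forall>z\<in>U - T. G z = F z)"
  using assms
proof (induction T arbitrary: F rule: finite_induct)
  case empty
  then show ?case by auto
next
  case (insert t T)
  have opn: "open (U - T)" using insert by (simp add: open_Diff finite_imp_closed)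
  have "\<exists>g. g holomorphic_on (U - T) \<and> (\<forall>z\<in>U - insert t T. g z = F z)"
  proof (cases "t \<in> U")
    case False
    then have "U - insert t T = U - T" by auto
    then show ?thesis using insert.prems by auto
  next
    case True
    have "\<exists>g. g holomorphic_on (U - T) \<and> (\<forall>z\<in>(U - T) - {t}. g z = F z)"
    proof (subst holomorphic_on_extend_lim)
      have "U - T - {t} = U - insert t T" by auto
      then show "F holomorphic_on U - T - {t}" using insert.prems by simp
      show "t \<in> interior (U - T)" using opn True insert.hyps by (simp add: interior_open)
      show "((\<lambda>z. (z - t) * F z) \<longlongrightarrow> 0) (at t)" using insert.prems True by auto
    qed
    moreover have "(U - T) - {t} = U - insert t T" by auto
    ultimately show ?thesis by simp
  qed
  then obtain g where g: "g holomorphic_on (U - T)" "\<And>z. z \<in> U - insert t T \<Longrightarrow> g z = F z" by blast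
  have "((\<lambda>z. (z - s) * g z) \<longlongrightarrow> 0) (at s)" if s: "s \<in> T" "s \<in> U" for s
  proof (rule Lim_transform_eventually)
    show "((\<lambda>z. (z - s) * F z) \<longlongrightarrow> 0) (at s)" using insert.prems s by auto
    have "open (U - (insert t T - {s}))"
      using insert by (intro open_Diff finite_imp_closed) auto
    moreover have "s \<in> U - (insert t T - {s})" using s by auto
    ultimately have "eventually (\<lambda>z. z \<in> U - (insert t T - {s}) - {s}) (at s)"
      by (rule eventually_at_in_open)
    then show "eventually (\<lambda>z. (z - s) * F z = (z - s) * g z) (at s)"
      by eventually_elim (use g(2) in auto)
  qed
  from insert.IH[OF \<open>open U\<close> g(1) this]
  obtain G where "G holomorphic_on U" "\<forall>z\<in>U - T. G z = g z" by blast
  then show ?case using g(2) by (intro exI[of _ G]) auto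
qed

text \<open>Away from \<open>T\<close> the glued function is continuous, and pasting along the axis
  makes it holomorphic. The points of \<open>T\<close> are then isolated singularities weaker than a
  simple pole.\<close>

lemma holomorphic_extend_across_reals:
  fixes f :: "complex \<Rightarrow> complex"
  assumes U: "open U" and T: "finite T" and hol: "f holomorphic_on (U - \<real>)"
    and match: "\<And>x. complex_of_real x \<in> U \<Longrightarrow> x \<notin> T \<Longrightarrow> \<exists>L. boundary_plus f x L \<and> boundary_minus f x L"
    and growth: "\<And>x. x \<in> T \<Longrightarrow> complex_of_real x \<in> U \<Longrightarrow>
      ((\<lambda>z. norm (f z) * norm (z - complex_of_real x)) \<longlongrightarrow> 0) (at (complex_of_real x) within - \<real>)"
  shows "\<exists>F. F holomorphic_on U \<and> (\<forall>z\<in>U - \<real>. F z = f z)"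
proof -
  define T' where "T' = complex_of_real ` T"
  define V where "V = U - T'"
  have T': "finite T'" using T by (simp add: T'_def)
  have V: "open V" using U T' by (simp add: V_def open_Diff finite_imp_closed)
  define L where "L x = (SOME L. boundary_plus f x L \<and> boundary_minus f x L)" for x
  have L: "(f \<longlongrightarrow> L x) (at (complex_of_real x) within - \<real>)" if "complex_of_real x \<in> V" for x
    unfolding tendsto_nonreal_iff L_def by (rule someI_ex, rule match) (use that in \<open>auto simp: V_def T'_def\<close>)
  define F where "F z = (if z \<in> \<real> then L (Re z) else f z)" for z
  have VR: "V - \<real> = U - \<real>" by (auto simp: V_def T'_def)
  have contF: "continuous_on V F"
    unfolding F_def using V L hol VR
    by (intro continuous_on_glue_reals) (auto simp: holomorphic_on_imp_continuous_on)
  have hol': "F holomorphic_on V - \<real>"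
    using hol unfolding VR by (rule holomorphic_transform) (auto simp: F_def)
  have "F holomorphic_on V"
  proof (rule holomorphic_on_paste_across_line[OF V, where d="\<i>" and k=0])
    show "F holomorphic_on V \<inter> {z. \<i> \<bullet> z < 0}" "F holomorphic_on V \<inter> {z. 0 < \<i> \<bullet> z}"
      by (rule holomorphic_on_subset[OF hol']; auto simp: complex_is_Real_iff)+
  qed (use contF in auto)
  then have FV: "F holomorphic_on U - T'" by (simp add: V_def)
  have "((\<lambda>z. (z - t) * F z) \<longlongrightarrow> 0) (at t)" if t: "t \<in> T'" "t \<in> U" for t
  proof -
    obtain x where x: "x \<in> T" "t = complex_of_real x" using t by (auto simp: T'_def)
    have lim: "((\<lambda>z. norm (f z) * norm (z - t)) \<longlongrightarrow> 0) (at t within - \<real>)"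
      using growth x t by simp
    have opn: "open (U - (T' - {t}))" using U T' by (simp add: open_Diff finite_imp_closed)
    \<comment> \<open>The growth condition speaks of nonreal points only. Real points near
      \<open>t\<close> inherit the same bound because the value there is a limit from the nonreal
      side.\<close>
    have ev: "eventually (\<lambda>z. norm ((z - t) * F z) \<le> e) (at t)" if "e > 0" for e
    proof -
      have "eventually (\<lambda>z. norm (f z) * norm (z - t) < e) (at t within - \<real>)"
        using order_tendstoD(2)[OF lim \<open>e > 0\<close>] .
      then obtain d1 where d1: "d1 > 0" "\<And>z. z \<notin> \<real> \<Longrightarrow> z \<noteq> t \<Longrightarrow> dist z t < d1 \<Longrightarrow> norm (f z) * norm (z - t) < e"
        unfolding eventually_at by auto
      obtain d2 where d2: "d2 > 0" "ball t d2 \<subseteq> U - (T' - {t})"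
        using opn t by (metis DiffD2 DiffI openE singletonI)
      have "norm ((w - t) * F w) \<le> e" if w: "w \<noteq> t" "dist w t < min d1 d2" for w
      proof (cases "w \<in> \<real>")
        case False
        then show ?thesis using d1(2)[of w] w by (auto simp: F_def norm_mult mult.commute)
      next
        case True
        then obtain y where y: "w = complex_of_real y" by (auto elim: Reals_cases)
        have wV: "w \<in> V" using w d2 by (auto simp: V_def dist_commute)
        have "((\<lambda>v. (v - t) * f v) \<longlongrightarrow> (w - t) * L y) (at w within - \<real>)"
          using L[of y] wV y by (auto intro!: tendsto_intros)
        moreover have "eventually (\<lambda>v. norm ((v - t) * f v) \<le> e) (at w within - \<real>)"
        proof -
          have "eventually (\<lambda>v. v \<in> ball t (min d1 d2)) (at w within - \<real>)"
            unfolding eventually_at_topological using w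
            by (intro exI[of _ "ball t (min d1 d2)"]) (auto simp: dist_commute)
          moreover have "eventually (\<lambda>v. v \<in> - \<real>) (at w within - \<real>)"
            by (simp add: eventually_at_filter)
          ultimately show ?thesis
          proof eventually_elim
            case (elim v)
            moreover have "v \<noteq> t" using elim x by auto
            ultimately show ?case using d1(2)[of v] by (auto simp: dist_commute norm_mult mult.commute)
          qed
        qed
        ultimately have "norm ((w - t) * L y) \<le> e"
          using at_nonreal_ne_bot[of y] unfolding y by (intro Lim_norm_ubound) auto
        then show ?thesis by (simp add: F_def y)
      qed
      then show ?thesis unfolding eventually_at
        using d1(1) d2(1) by (intro exI[of _ "min d1 d2"]) auto
    qed
    show ?thesis unfolding tendsto_iff
    proof (intro allI impI)
      fix e :: real assume "e > 0"
      show "eventually (\<lambda>z. dist ((z - t) * F z) 0 < e) (at t)"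
        using ev[of "e / 2", OF half_gt_zero[OF \<open>e > 0\<close>]] by eventually_elim (use \<open>e > 0\<close> in simp)
    qed
  qed
  from removable_finite[OF T' U FV this]
  obtain G where G: "G holomorphic_on U" "\<forall>z\<in>U - T'. G z = F z" by blast
  have "G z = f z" if z: "z \<in> U - \<real>" for z
  proof -
    have "z \<in> U - T'" using z by (auto simp: T'_def)
    then show ?thesis using G(2) z by (simp add: F_def)
  qed
  then show ?thesis using G(1) by blast
qed

lemma mat_holomorphic_extend_across_reals:
  fixes f :: "complex \<Rightarrow> complex ^ 'n ^ 'm"
  assumes U: "open U" and T: "finite T" and hol: "mat_holomorphic_on f (U - \<real>)"
    and match: "\<And>x. complex_of_real x \<in> U \<Longrightarrow> x \<notin> T \<Longrightarrow> \<exists>L. boundary_plus f x L \<and> boundary_minus f x L"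
    and growth: "\<And>x. x \<in> T \<Longrightarrow> complex_of_real x \<in> U \<Longrightarrow>
      ((\<lambda>z. norm (f z) * norm (z - complex_of_real x)) \<longlongrightarrow> 0) (at (complex_of_real x) within - \<real>)"
  shows "\<exists>F. mat_holomorphic_on F U \<and> (\<forall>z\<in>U - \<real>. F z = f z)"
proof -
  have "\<exists>F. F holomorphic_on U \<and> (\<forall>z\<in>U - \<real>. F z = f z $ i $ j)" for i j
  proof (rule holomorphic_extend_across_reals[OF U T])
    show "(\<lambda>z. f z $ i $ j) holomorphic_on U - \<real>" using hol by (simp add: mat_holomorphic_on_def)
  next
    fix x assume "complex_of_real x \<in> U" "x \<notin> T"
    then obtain L where L: "boundary_plus f x L" "boundary_minus f x L" using match by blast
    then show "\<exists>L. boundary_plus (\<lambda>z. f z $ i $ j) x L \<and> boundary_minus (\<lambda>z. f z $ i $ j) x L"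
      unfolding boundary_plus_def boundary_minus_def by (intro exI[of _ "L $ i $ j"]) (auto intro: tendsto_vec_nth)
  next
    fix x assume x: "x \<in> T" "complex_of_real x \<in> U"
    show "((\<lambda>z. norm (f z $ i $ j) * norm (z - complex_of_real x)) \<longlongrightarrow> 0) (at (complex_of_real x) within - \<real>)"
      by (rule tendsto_sandwich[OF _ _ tendsto_const growth[OF x]])
         (auto intro!: always_eventually mult_right_mono norm_entry_le)
  qed
  then have ex: "\<exists>F. F holomorphic_on U \<and> (\<forall>z\<in>U - \<real>. F z = f z $ i $ j)" for i j .
  define F where "F i j = (SOME F. F holomorphic_on U \<and> (\<forall>z\<in>U - \<real>. F z = f z $ i $ j))" for i j
  have F: "F i j holomorphic_on U \<and> (\<forall>z\<in>U - \<real>. F i j z = f z $ i $ j)" for i j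
    unfolding F_def by (rule someI_ex[OF ex])
  show ?thesis
  proof (intro exI[of _ "\<lambda>z. \<chi> i j. F i j z"] conjI ballI)
    show "mat_holomorphic_on (\<lambda>z. \<chi> i j. F i j z) U" using F by (simp add: mat_holomorphic_on_def)
    show "(\<chi> i j. F i j z) = f z" if "z \<in> U - \<real>" for z
      using F that by (simp add: vec_eq_iff)
  qed
qed

subsection \<open>Behaviour at infinity\<close>

text \<open>A limit at infinity makes the chart function continuous at 0, so the singularity there
  is removable. The centre \<open>c\<close> is free so that the exterior of any circle becomes a
  disc around 0.\<close>

lemma holomorphic_at_infinity_chart:
  fixes f :: "complex \<Rightarrow> complex"
  assumes r: "r > 0" and hol: "f holomorphic_on {z. norm (z - c) > r}" and lim: "(f \<longlongrightarrow> L) at_infinity"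
  shows "(\<lambda>w. if w = 0 then L else f (c + inverse w)) holomorphic_on ball 0 (inverse r)"
proof (rule no_isolated_singularity[where K = "{0}"])
  let ?g = "\<lambda>w. if w = 0 then L else f (c + inverse w)"
  have sub: "(\<lambda>w. c + inverse w) ` (ball 0 (inverse r) - {0}) \<subseteq> {z. norm (z - c) > r}"
  proof clarsimp
    fix w :: complex assume w: "norm w < inverse r" "w \<noteq> 0"
    have "r = inverse (inverse r)" by simp
    also have "\<dots> < inverse (norm w)" using w by (intro less_imp_inverse_less) auto
    finally show "r < norm (inverse w)" by (simp add: norm_inverse)
  qed
  have "(\<lambda>w. f (c + inverse w)) holomorphic_on ball 0 (inverse r) - {0}"
    by (rule holomorphic_on_compose_gen[unfolded o_def, OF _ hol sub]) (auto intro!: holomorphic_intros)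
  then show hol': "?g holomorphic_on ball 0 (inverse r) - {0}"
    by (rule holomorphic_transform) auto
  have "isCont ?g w" if "w \<in> ball 0 (inverse r)" for w
  proof (cases "w = 0")
    case True
    have "filterlim (\<lambda>w. c + inverse w) at_infinity (at (0::complex))"
      by (intro tendsto_add_filterlim_at_infinity[OF tendsto_const] filterlim_inverse_at_infinity)
    then have "((\<lambda>w. f (c + inverse w)) \<longlongrightarrow> L) (at 0)" using lim filterlim_compose by blast
    then have "(?g \<longlongrightarrow> L) (at 0)"
      by (rule Lim_transform_eventually) (simp add: eventually_at_filter)
    then show ?thesis using True by (simp add: isCont_def)
  next
    case False
    then show ?thesis using that holomorphic_on_imp_continuous_on[OF hol']
      by (simp add: continuous_on_eq_continuous_at open_Diff)
  qed
  then show "continuous_on (ball 0 (inverse r)) ?g"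
    by (simp add: continuous_at_imp_continuous_on)
qed auto

text \<open>A mere limit already forces the rate 1/z: the chart function is differentiable at 0, so
  its difference quotient stays bounded.\<close>

lemma holomorphic_at_infinity_bigo:
  fixes f :: "complex \<Rightarrow> complex"
  assumes r: "r > 0" and hol: "f holomorphic_on {z. norm (z - c) > r}" and lim: "(f \<longlongrightarrow> L) at_infinity"
  shows "\<exists>C R. \<forall>z. norm z > R \<longrightarrow> norm (f z - L) \<le> C * norm (inverse z)"
proof -
  let ?g = "\<lambda>w. if w = 0 then L else f (0 + inverse w)"
  define r' where "r' = r + norm c"
  have r': "r' > 0" using r by (simp add: r'_def add_pos_nonneg)
  have "{z. norm (z - 0) > r'} \<subseteq> {z. norm (z - c) > r}"
  proof
    fix z :: complex assume "z \<in> {z. norm (z - 0) > r'}"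
    moreover have "norm z \<le> norm (z - c) + norm c" by (metis diff_add_cancel norm_triangle_ineq)
    ultimately show "z \<in> {z. norm (z - c) > r}" by (simp add: r'_def)
  qed
  then have "f holomorphic_on {z. norm (z - 0) > r'}" using hol holomorphic_on_subset by blast
  then have g: "?g holomorphic_on ball 0 (inverse r')"
    using r' lim by (intro holomorphic_at_infinity_chart)
  have "0 \<in> ball (0::complex) (inverse r')" using r' by simp
  then have "?g field_differentiable (at 0)" using g holomorphic_on_imp_differentiable_at open_ball by blast
  then obtain D where "(?g has_field_derivative D) (at 0)" by (auto simp: field_differentiable_def)
  then have "((\<lambda>w. (?g w - ?g 0) / (w - 0)) \<longlongrightarrow> D) (at 0)" by (simp only: has_field_derivative_iff)
  then have "((\<lambda>w. norm ((?g w - ?g 0) / (w - 0))) \<longlongrightarrow> norm D) (at 0)" by (rule tendsto_norm)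
  then have "eventually (\<lambda>w. norm ((?g w - ?g 0) / (w - 0)) < norm D + 1) (at 0)"
    by (rule order_tendstoD) simp
  then obtain d where d: "d > 0" "\<And>w. w \<noteq> 0 \<Longrightarrow> norm w < d \<Longrightarrow> norm ((?g w - ?g 0) / (w - 0)) < norm D + 1"
    unfolding eventually_at by (auto simp: dist_norm)
  have "norm (f z - L) \<le> (norm D + 1) * norm (inverse z)" if z: "norm z > inverse d" for z
  proof -
    have zpos: "norm z > 0" using z d(1) by (metis inverse_positive_iff_positive order_less_trans)
    then have z0: "z \<noteq> 0" by auto
    have "norm (inverse z) < d" using z d(1) zpos
      by (simp add: norm_inverse) (metis inverse_inverse_eq inverse_less_imp_less inverse_positive_iff_positive)
    then have "norm ((f z - L) / inverse z) < norm D + 1" using d(2)[of "inverse z"] z0 by simp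
    moreover have "norm (f z - L) = norm ((f z - L) / inverse z) * norm (inverse z)"
      using z0 by (simp flip: norm_mult)
    ultimately show ?thesis by (simp add: mult_right_mono)
  qed
  then show ?thesis by blast
qed

text \<open>This is the maximum principle on the disc of radius 1/s in the chart w = 1/(z - c), with
  infinity as its centre.\<close>

lemma exterior_maximum_principle:
  fixes f :: "complex \<Rightarrow> complex"
  assumes r: "r > 0" "r < s" and hol: "f holomorphic_on {z. norm (z - c) > r}" and lim: "(f \<longlongrightarrow> L) at_infinity"
    and bnd: "\<And>z. norm (z - c) = s \<Longrightarrow> norm (f z) \<le> B" and z: "norm (z - c) \<ge> s"
  shows "norm (f z) \<le> B"
proof -
  let ?g = "\<lambda>w. if w = 0 then L else f (c + inverse w)"
  have g: "?g holomorphic_on ball 0 (inverse r)"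
    using r(1) hol lim by (rule holomorphic_at_infinity_chart)
  have sr: "inverse s < inverse r" "inverse s > 0" using r by auto
  have sub: "cball 0 (inverse s) \<subseteq> ball (0::complex) (inverse r)" using sr by auto
  have fr: "norm (?g w) \<le> B" if "w \<in> frontier (cball 0 (inverse s))" for w
  proof -
    have "norm w = inverse s" using that sr by simp
    moreover from this have "w \<noteq> 0" using sr by auto
    ultimately show ?thesis using bnd[of "c + inverse w"] by (simp add: norm_inverse)
  qed
  define w where "w = inverse (z - c)"
  have w: "w \<in> cball 0 (inverse s)" "w \<noteq> 0" using z r by (auto simp: w_def norm_inverse intro!: le_imp_inverse_le)
  have "norm (?g w) \<le> B"
  proof (rule maximum_modulus_frontier[where f = ?g and S = "cball 0 (inverse s)"])
    show "?g holomorphic_on interior (cball 0 (inverse s))"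
      by (rule holomorphic_on_subset[OF g]) (use sr in auto)
    show "continuous_on (closure (cball 0 (inverse s))) ?g"
      using holomorphic_on_imp_continuous_on[OF holomorphic_on_subset[OF g sub]] by simp
  qed (use fr w in auto)
  then show ?thesis using w by (simp add: w_def)
qed

subsection \<open>A Phragmen-Lindelof principle in the upper half plane\<close>

lemma open_upper: "open {z. Im z > 0}" and convex_upper: "convex {z. Im z > 0}"
  by (simp_all add: open_halfspace_Im_gt convex_halfspace_Im_gt)

text \<open>The power scales an argument below \<open>pi / 2\<close> by 3/4, so the result stays
  within \<open>3 * pi / 8\<close> of the positive axis, where the real part controls the
  modulus.\<close>

lemma Re_powr_right_half_plane:
  assumes "Re w > 0"
  shows "Re (w powr (- complex_of_real (3/4))) \<ge> cos (3 * pi / 8) * norm w powr (- 3 / 4)"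
proof -
  have w0: "w \<noteq> 0" using assms by auto
  have "\<bar>Arg w\<bar> < pi / 2" using assms w0 Arg_Re_pos[of w] by simp
  then have "\<bar>3 / 4 * Arg w\<bar> \<le> 3 * pi / 8" by (simp add: abs_mult)
  moreover have "3 * pi / 8 \<le> pi" by simp
  ultimately have "cos (3 * pi / 8) \<le> cos \<bar>3 / 4 * Arg w\<bar>"
    by (intro cos_monotone_0_pi_le) auto
  then have c: "cos (3 * pi / 8) \<le> cos (3 / 4 * Arg w)" by (simp only: cos_abs_real)
  have "Re (w powr (- complex_of_real (3/4))) = exp (- (3 / 4) * ln (norm w)) * cos (3 / 4 * Arg w)"
    using w0 by (simp add: powr_def Re_exp Arg_eq_Im_Ln)
  also have "exp (- (3 / 4) * ln (norm w)) = norm w powr (- 3 / 4)" using w0 by (simp add: powr_def)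
  finally show ?thesis using mult_right_mono[OF c, of "norm w powr (- 3 / 4)"] by (simp add: mult.commute)
qed

text \<open>A small multiple of the barrier \<open>v\<close> is added. Its exponent 3/4 exceeds the
  growth order 1/2 of \<open>p\<close> at the points of \<open>E\<close>, and it is below 1, so that
  after the rotation by -i, which maps the upper half plane to the right one, each term keeps a
  positive real part.\<close>

lemma Phragmen_Lindelof_upper:
  fixes p :: "complex \<Rightarrow> complex" and E :: "real set"
  assumes hol: "p holomorphic_on {z. Im z > 0}" and E: "finite E"
    and bdry: "\<And>x. x \<notin> E \<Longrightarrow> \<exists>l. boundary_plus p x l \<and> Re l \<ge> 0"
    and growth: "\<And>e. e \<in> E \<Longrightarrow> \<exists>C. eventually (\<lambda>z. norm (p z) \<le> C * norm (z - complex_of_real e) powr (- 1 / 2))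
       (at (complex_of_real e) within {z. Im z > 0})"
    and lim: "(p \<longlongrightarrow> 0) at_infinity"
    and z: "Im z > 0"
  shows "Re (p z) \<ge> 0"
proof -
  define v where "v z = (\<Sum>e\<in>E. (- \<i> * (z - complex_of_real e)) powr (- complex_of_real (3/4)))" for z
  define \<kappa> where "\<kappa> = cos (3 * pi / 8)"
  have \<kappa>: "\<kappa> > 0" unfolding \<kappa>_def by (rule cos_gt_zero_pi) auto
  have term_ge: "Re ((- \<i> * (z - complex_of_real e)) powr (- complex_of_real (3/4))) \<ge> \<kappa> * norm (z - complex_of_real e) powr (- 3 / 4)"
    if "Im z > 0" for z e
  proof -
    have "norm (- \<i> * (z - complex_of_real e)) = norm (z - complex_of_real e)" by (simp add: norm_mult)
    then show ?thesis using Re_powr_right_half_plane[of "- \<i> * (z - complex_of_real e)"] that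
      unfolding \<kappa>_def by simp
  qed
  have term_nn: "Re ((- \<i> * (z - complex_of_real e)) powr (- complex_of_real (3/4))) \<ge> 0" if "Im z > 0" for z e
    using term_ge[OF that, of e] \<kappa> by (meson less_imp_le mult_nonneg_nonneg order_trans powr_ge_zero)
  have v_nn: "Re (v z) \<ge> 0" if "Im z > 0" for z
    unfolding v_def Re_sum using term_nn[OF that] by (intro sum_nonneg)
  have v_ge: "Re (v z) \<ge> \<kappa> * norm (z - complex_of_real e) powr (- 3 / 4)" if "Im z > 0" "e \<in> E" for z e
  proof -
    have "Re ((- \<i> * (z - complex_of_real e)) powr (- complex_of_real (3/4))) \<le> Re (v z)"
      unfolding v_def Re_sum using E that term_nn by (intro member_le_sum) auto
    then show ?thesis using term_ge[OF that(1), of e] by linarith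
  qed
  have v_hol: "v holomorphic_on {z. Im z > 0}"
    unfolding v_def
  proof (intro holomorphic_on_sum holomorphic_on_powr holomorphic_intros)
    fix e z assume "z \<in> {z. 0 < Im z}"
    then show "- \<i> * (z - complex_of_real e) \<notin> \<real>\<^sub>\<le>\<^sub>0" by (auto simp: complex_nonpos_Reals_iff)
  qed
  \<comment> \<open>If the real part of \<open>q\<close> were negative somewhere, a sublevel set
    \<open>A\<close> would be nonempty and compact inside the open half plane. The minimum of the
    real part over \<open>A\<close> then contradicts the maximum principle.\<close>
  have main: "Re (p z + complex_of_real \<eta> * v z) \<ge> 0" if \<eta>: "\<eta> > 0" and z: "Im z > 0" for \<eta> z
  proof (rule ccontr)
    define q where "q z = p z + complex_of_real \<eta> * v z" for z
    assume "\<not> ?thesis"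
    then have neg: "Re (q z) < 0" by (simp add: q_def)
    define \<delta> where "\<delta> = - Re (q z)"
    have \<delta>: "\<delta> > 0" using neg by (simp add: \<delta>_def)
    define A where "A = {w. Im w > 0 \<and> Re (q w) \<le> - \<delta>}"
    have zA: "z \<in> A" using z by (simp add: A_def \<delta>_def)
    have q_ge: "Re (q w) \<ge> Re (p w)" if "Im w > 0" for w
      using v_nn[OF that] \<eta> by (simp add: q_def)
    have q_hol: "q holomorphic_on {z. Im z > 0}"
      unfolding q_def by (intro holomorphic_intros hol v_hol)
    obtain R where R: "\<And>w. norm w \<ge> R \<Longrightarrow> norm (p w) < \<delta>"
      using tendstoD[OF lim \<delta>] by (auto simp: eventually_at_infinity)
    have "bounded A"
      unfolding bounded_iff
    proof (intro exI[of _ R] ballI)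
      fix w assume w: "w \<in> A"
      show "norm w \<le> R"
      proof (rule ccontr)
        assume "\<not> norm w \<le> R"
        then have "norm (p w) < \<delta>" using R by simp
        then have "Re (p w) > - \<delta>" using abs_Re_le_cmod[of "p w"] by linarith
        then show False using q_ge[of w] w by (simp add: A_def)
      qed
    qed
    moreover have "closed A"
      \<comment> \<open>The set \<open>A\<close> cannot accumulate at the real axis: off
        \<open>E\<close> the boundary values of \<open>p\<close> have nonnegative real part, and at
        a point of \<open>E\<close> the barrier outweighs the growth of \<open>p\<close>.\<close>
      unfolding closed_limpt
    proof (intro allI impI)
      fix x assume x: "x islimpt A"
      have "x \<in> closure {w. Im w > 0}"
        using x by (auto simp: A_def closure_def intro: islimpt_subset)
      moreover have "closure {w. Im w > 0} \<subseteq> {w. Im w \<ge> 0}"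
        by (intro closure_minimal closed_halfspace_Im_ge) auto
      ultimately have "Im x \<ge> 0" by blast
      show "x \<in> A"
      proof (cases "Im x > 0")
        case True
        have "isCont q x" using q_hol True open_upper
          by (metis (mono_tags) continuous_on_eq_continuous_at holomorphic_on_imp_continuous_on mem_Collect_eq)
        then have "((\<lambda>w. Re (q w)) \<longlongrightarrow> Re (q x)) (at x within A)"
          by (intro tendsto_Re) (auto simp: isCont_def intro: tendsto_within_subset)
        moreover have "eventually (\<lambda>w. Re (q w) \<le> - \<delta>) (at x within A)"
          by (simp add: eventually_at_filter A_def)
        ultimately have "Re (q x) \<le> - \<delta>"
          using x trivial_limit_within[of x A] by (intro tendsto_upperbound) auto
        then show ?thesis using True by (simp add: A_def)
      next
        case False
        then have x0: "x = complex_of_real (Re x)" using \<open>Im x \<ge> 0\<close> by (simp add: complex_eq_iff)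
        have "eventually (\<lambda>w. Re (q w) > - \<delta>) (at x within {w. Im w > 0})"
        proof (cases "Re x \<in> E")
          case False
          then obtain l where l: "boundary_plus p (Re x) l" "Re l \<ge> 0" using bdry by blast
          have "((\<lambda>w. Re (p w)) \<longlongrightarrow> Re l) (at x within {w. Im w > 0})"
            using l(1) x0 by (intro tendsto_Re) (simp add: boundary_plus_def)
          then have "eventually (\<lambda>w. Re (p w) > - \<delta>) (at x within {w. Im w > 0})"
            by (rule order_tendstoD) (use l \<delta> in auto)
          moreover have "eventually (\<lambda>w. Im w > 0) (at x within {w. Im w > 0})"
            by (simp add: eventually_at_filter)
          ultimately show ?thesis by eventually_elim (use q_ge in force)
        next
          case True
          then obtain C where C: "eventually (\<lambda>w. norm (p w) \<le> C * norm (w - x) powr (- 1 / 2)) (at x within {w. Im w > 0})"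
            using growth[OF True] x0 by metis
          have "((\<lambda>w. norm (w - x)) \<longlongrightarrow> 0) (at x within {w. Im w > 0})"
            by (rule tendsto_eq_intros | simp)+
          then have "((\<lambda>w. norm (w - x) powr (1/4)) \<longlongrightarrow> 0 powr (1/4)) (at x within {w. Im w > 0})"
            by (intro tendsto_powr2 tendsto_const) auto
          then have "((\<lambda>w. C * norm (w - x) powr (1/4)) \<longlongrightarrow> C * 0) (at x within {w. Im w > 0})"
            by (intro tendsto_mult tendsto_const) simp
          then have "eventually (\<lambda>w. C * norm (w - x) powr (1/4) < \<eta> * \<kappa>) (at x within {w. Im w > 0})"
            by (rule order_tendstoD) (use \<eta> \<kappa> in simp)
          moreover have "eventually (\<lambda>w. Im w > 0) (at x within {w. Im w > 0})"
            by (simp add: eventually_at_filter)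
          ultimately show ?thesis using C
          proof eventually_elim
            case (elim w)
            have wx: "norm (w - x) > 0" using elim x0 False by auto
            have "norm (w - x) powr (- 1 / 2) = norm (w - x) powr (1/4) * norm (w - x) powr (- 3 / 4)"
              by (simp flip: powr_add)
            then have "norm (p w) \<le> (C * norm (w - x) powr (1/4)) * norm (w - x) powr (- 3 / 4)"
              using elim by (simp add: mult.assoc)
            also have "\<dots> \<le> (\<eta> * \<kappa>) * norm (w - x) powr (- 3 / 4)"
              using elim by (intro mult_right_mono) auto
            also have "\<dots> \<le> \<eta> * Re (v w)"
              using v_ge[of w "Re x"] True elim x0 \<eta> by (simp add: mult.assoc)
            finally have "Re (q w) \<ge> 0" using abs_Re_le_cmod[of "p w"] by (simp add: q_def)
            then show ?case using \<delta> by linarith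
          qed
        qed
        then have "eventually (\<lambda>w. Re (q w) > - \<delta>) (at x within A)"
          by (rule filter_leD[OF at_le, rotated]) (auto simp: A_def)
        moreover have "eventually (\<lambda>w. Re (q w) \<le> - \<delta>) (at x within A)"
          by (simp add: eventually_at_filter A_def)
        ultimately have "eventually (\<lambda>w. False) (at x within A)"
          by eventually_elim simp
        then show ?thesis using x trivial_limit_within[of x A] by (simp add: trivial_limit_def)
      qed
    qed
    ultimately have "compact A" by (simp add: compact_eq_bounded_closed)
    moreover have "continuous_on A (\<lambda>w. Re (q w))"
      by (intro continuous_intros continuous_on_subset[OF holomorphic_on_imp_continuous_on[OF q_hol]]) (auto simp: A_def)
    ultimately obtain \<xi> where \<xi>: "\<xi> \<in> A" "\<And>w. w \<in> A \<Longrightarrow> Re (q \<xi>) \<le> Re (q w)"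
      using continuous_attains_inf[of A "\<lambda>w. Re (q w)"] zA by blast
    have \<xi>_min: "Re (q \<xi>) \<le> Re (q w)" if "Im w > 0" for w
      using \<xi> that by (cases "w \<in> A") (auto simp: A_def)
    \<comment> \<open>The modulus of exp(-q) is exp(-Re q), so a minimum of the real part becomes a
      maximum of the modulus. Constancy would put the whole half plane into the bounded set
      \<open>A\<close>.\<close>
    have "(\<lambda>w. exp (- q w)) constant_on {w. Im w > 0}"
    proof (rule maximum_modulus_principle[where U = "{w. Im w > 0}" and \<xi> = \<xi>])
      show "(\<lambda>w. exp (- q w)) holomorphic_on {w. Im w > 0}" by (intro holomorphic_intros q_hol)
      show "connected {w. Im w > 0}" by (simp add: convex_connected convex_upper)
    qed (use \<xi> \<xi>_min in \<open>auto simp: A_def open_upper\<close>)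
    then obtain c where c: "\<And>w. Im w > 0 \<Longrightarrow> exp (- q w) = c" by (auto simp: constant_on_def)
    have "w \<in> A" if "Im w > 0" for w
    proof -
      have "exp (- q w) = exp (- q \<xi>)" using c that \<xi>(1) by (simp add: A_def)
      then have "norm (exp (- q w)) = norm (exp (- q \<xi>))" by simp
      then have "Re (q w) = Re (q \<xi>)" by (simp add: norm_exp_eq_Re)
      then show ?thesis using \<xi>(1) that by (simp add: A_def)
    qed
    moreover obtain B where "\<And>w. w \<in> A \<Longrightarrow> norm w \<le> B" using \<open>bounded A\<close> bounded_iff by metis
    ultimately have "norm (\<i> * complex_of_real (\<bar>B\<bar> + 1)) \<le> B" by force
    then show False by (simp only: norm_mult norm_of_real) auto
  qed
  show ?thesis
  proof (rule field_le_epsilon)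
    fix e :: real assume "e > 0"
    define \<eta> where "\<eta> = e / (Re (v z) + 1)"
    have v1: "Re (v z) + 1 > 0" using v_nn[OF z] by linarith
    then have \<eta>: "\<eta> > 0" using \<open>e > 0\<close> by (simp add: \<eta>_def)
    have "\<eta> * Re (v z) \<le> e"
      using v1 \<open>e > 0\<close> v_nn[OF z] by (simp add: \<eta>_def field_simps)
    then show "0 \<le> Re (p z) + e" using main[OF \<eta> z] by simp
  qed
qed

text \<open>In the chart at infinity the decay forces a zero of order at least 2. Such a zero turns
  the half disc of angle pi into all directions, so the real part would be negative
  somewhere.\<close>

lemma nonneg_Re_decay_imp_zero:
  fixes p :: "complex \<Rightarrow> complex"
  assumes R: "R > 0" and hol: "p holomorphic_on {z. norm z > R}" and lim: "((\<lambda>z. z * p z) \<longlongrightarrow> 0) at_infinity"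
    and nn: "\<And>z. norm z > R \<Longrightarrow> Im z > 0 \<Longrightarrow> Re (p z) \<ge> 0"
    and z: "norm z > R"
  shows "p z = 0"
proof -
  have lim0: "(p \<longlongrightarrow> 0) at_infinity"
  proof -
    have "((\<lambda>z. inverse z * (z * p z)) \<longlongrightarrow> 0 * 0) at_infinity"
      by (intro tendsto_mult lim tendsto_inverse_0)
    moreover have "eventually (\<lambda>z. inverse z * (z * p z) = p z) at_infinity"
      using eventually_not_equal_at_infinity[of "0::complex"] by eventually_elim simp
    ultimately have "(p \<longlongrightarrow> 0 * 0) at_infinity" by (rule Lim_transform_eventually)
    then show ?thesis by simp
  qed
  define q where "q w = (if w = 0 then 0 else p (0 + inverse w))" for w
  have q: "q holomorphic_on ball 0 (inverse R)"
    unfolding q_def using R hol lim0 by (intro holomorphic_at_infinity_chart) auto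
  have q_lim: "((\<lambda>w. q w / w) \<longlongrightarrow> 0) (at 0)"
  proof -
    have "((\<lambda>w. inverse w * p (inverse w)) \<longlongrightarrow> 0) (at 0)"
      using filterlim_compose[OF lim filterlim_inverse_at_infinity] .
    then show ?thesis
      by (rule Lim_transform_eventually) (simp add: eventually_at_filter q_def field_simps)
  qed
  have q0: "q 0 = 0" by (simp add: q_def)
  have zero0: "0 \<in> ball (0::complex) (inverse R)" using R by simp
  have "q w = 0" if w: "w \<in> ball 0 (inverse R)" for w
  proof (rule ccontr)
    assume "q w \<noteq> 0"
    then have nc: "\<not> q constant_on ball 0 (inverse R)"
      using w zero0 unfolding constant_on_def q_def by metis
    obtain h d n where h: "0 < n" "0 < d" "ball (0::complex) d \<subseteq> ball 0 (inverse R)" "h holomorphic_on ball 0 d"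
      "\<And>w. w \<in> ball 0 d \<Longrightarrow> q w = (w - 0) ^ n * h w" "\<And>w. w \<in> ball 0 d \<Longrightarrow> h w \<noteq> 0"
    proof (rule holomorphic_factor_zero_nonconstant[OF q open_ball connected_ball zero0 q0 nc])
      fix h d n
      assume "0 < (n::nat)" "0 < d" "ball (0::complex) d \<subseteq> ball 0 (inverse R)" "h holomorphic_on ball 0 d"
        "\<And>w. w \<in> ball 0 d \<Longrightarrow> q w = (w - 0) ^ n * h w" "\<And>w. w \<in> ball 0 d \<Longrightarrow> h w \<noteq> 0"
      then show thesis by (rule that)
    qed
    have h0: "h 0 \<noteq> 0" using h(2,6) by simp
    have hc: "(h \<longlongrightarrow> h 0) (at 0)"
      using holomorphic_on_imp_continuous_on[OF h(4)] h(2)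
      by (simp add: continuous_on_eq_continuous_at isCont_def)
    have n2: "n \<ge> 2"
    proof (rule ccontr)
      assume "\<not> n \<ge> 2"
      then have n1: "n = 1" using h(1) by linarith
      have "eventually (\<lambda>w. w \<in> ball 0 d - {0}) (at (0::complex))"
        using h(2) by (intro eventually_at_in_open) auto
      then have "eventually (\<lambda>w. h w = q w / w) (at 0)"
        by eventually_elim (use h(5) n1 in auto)
      then have "((\<lambda>w. q w / w) \<longlongrightarrow> h 0) (at 0)" by (rule Lim_transform_eventually[OF hc])
      then show False using q_lim h0 LIM_unique by blast
    qed
    \<comment> \<open>The rays with angles -\<open>\<phi> k\<close> are mapped by the n-th power to
      four directions a quarter turn apart. The offset \<open>pi / 4\<close> and \<open>n\<close>
      \<ge> 2 keep all four angles strictly inside (0, pi), so that 1/w lies in the upper half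
      plane.\<close>
    define \<phi> where "\<phi> k = (pi / 4 + real k * (pi / 2)) / real n" for k :: nat
    define u where "u k = exp (- \<i> * complex_of_real (\<phi> k))" for k
    have \<phi>: "0 < \<phi> k" "\<phi> k < pi" if "k < 4" for k
    proof -
      show "0 < \<phi> k" using h(1) by (auto simp: \<phi>_def intro!: divide_pos_pos add_pos_nonneg)
      have "pi / 4 + real k * (pi / 2) \<le> pi / 4 + 3 * (pi / 2)" using that by (intro add_left_mono mult_right_mono) auto
      also have "\<dots> < 2 * pi" by simp
      also have "\<dots> \<le> real n * pi" using n2 by simp
      finally show "\<phi> k < pi" using h(1) by (simp add: \<phi>_def field_simps)
    qed
    have un: "u k ^ n = exp (- \<i> * complex_of_real (pi / 4)) * (- \<i>) ^ k" for k
    proof -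
      have "u k ^ n = exp (of_nat n * (- \<i> * complex_of_real (\<phi> k)))" by (simp only: u_def exp_of_nat_mult)
      also have "of_nat n * (- \<i> * complex_of_real (\<phi> k)) = - \<i> * complex_of_real (pi / 4) + of_nat k * (- \<i> * complex_of_real (pi / 2))"
        using h(1) by (simp add: \<phi>_def field_simps)
      also have "exp \<dots> = exp (- \<i> * complex_of_real (pi / 4)) * exp (- \<i> * complex_of_real (pi / 2)) ^ k"
        by (simp only: exp_add exp_of_nat_mult)
      also have "exp (- \<i> * complex_of_real (pi / 2)) = - \<i>"
        by (simp add: exp_minus exp_eq_polar[symmetric] Euler complex_eq_iff exp_eq_polar Re_exp Im_exp)
      finally show ?thesis .
    qed
    define v where "v = exp (- \<i> * complex_of_real (pi / 4)) * h 0"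
    have v0: "v \<noteq> 0" using h0 by (simp add: v_def)
    have vk: "u k ^ n * h 0 = v * (- \<i>) ^ k" for k by (simp add: un v_def)
    \<comment> \<open>Among the four quarter turns of a nonzero number one has negative real
      part.\<close>
    have "\<exists>k<4. Re (u k ^ n * h 0) < 0"
    proof -
      have "Re v < 0 \<or> Im v < 0 \<or> Re v > 0 \<or> Im v > 0" using v0 by (auto simp: complex_eq_iff)
      then consider "Re v < 0" | "Im v < 0" | "Re v > 0" | "Im v > 0" by blast
      then show ?thesis
      proof cases
        case 1 then show ?thesis by (intro exI[of _ 0]) (simp add: vk)
      next
        case 2 then show ?thesis by (intro exI[of _ 1]) (simp add: vk)
      next
        case 3 then show ?thesis by (intro exI[of _ 2]) (simp add: vk power2_eq_square)
      next
        case 4 then show ?thesis by (intro exI[of _ 3]) (simp add: vk power3_eq_cube)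
      qed
    qed
    then obtain k where k: "k < 4" "Re (u k ^ n * h 0) < 0" by blast
    have tlim: "filterlim (\<lambda>t. complex_of_real t * u k) (at 0) (at_right 0)"
      unfolding filterlim_at
    proof
      show "((\<lambda>t. complex_of_real t * u k) \<longlongrightarrow> 0) (at_right 0)"
        by (rule tendsto_eq_intros | simp)+
      show "\<forall>\<^sub>F t in at_right 0. complex_of_real t * u k \<in> UNIV \<and> complex_of_real t * u k \<noteq> 0"
        by (simp add: u_def eventually_at_filter)
    qed
    have "((\<lambda>t. Re (u k ^ n * h (complex_of_real t * u k))) \<longlongrightarrow> Re (u k ^ n * h 0)) (at_right 0)"
      by (intro tendsto_intros filterlim_compose[OF hc tlim])
    then have "eventually (\<lambda>t. Re (u k ^ n * h (complex_of_real t * u k)) < 0) (at_right 0)"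
      using k(2) by (rule order_tendstoD)
    moreover have "eventually (\<lambda>t. t < d) (at_right 0)"
      using h(2) eventually_at_right by (auto simp: eventually_at_filter intro: eventually_nhds_in_open[of "{..<d}", THEN eventually_mono])
    moreover have "eventually (\<lambda>t::real. t > 0) (at_right 0)" by (simp add: eventually_at_filter)
    ultimately have "eventually (\<lambda>t::real. False) (at_right 0)"
    proof eventually_elim
      case (elim t)
      define w where "w = complex_of_real t * u k"
      have nw: "norm w = t" using elim by (simp add: w_def u_def norm_mult norm_exp_eq_Re)
      have wb: "w \<in> ball 0 d" using nw elim by simp
      have w0: "w \<noteq> 0" using nw elim by auto
      have "q w = complex_of_real (t ^ n) * (u k ^ n * h w)"
        using h(5)[OF wb] by (simp add: w_def power_mult_distrib)
      then have "Re (q w) = t ^ n * Re (u k ^ n * h w)" by (simp only: Re_complex_of_real Im_complex_of_real times_complex.sel mult_zero_left diff_zero)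
      then have neg: "Re (q w) < 0" using elim by (simp add: w_def mult_pos_neg)
      have qw: "q w = p (inverse w)" using w0 by (simp add: q_def)
      have iw: "inverse w = complex_of_real (inverse t) * exp (\<i> * complex_of_real (\<phi> k))"
        by (simp add: w_def u_def exp_minus)
      have "Im (inverse w) = inverse t * sin (\<phi> k)"
        unfolding iw by (simp only: times_complex.sel Re_complex_of_real Im_complex_of_real mult_zero_left add_0_right) (simp add: Im_exp)
      then have "Im (inverse w) > 0" using elim \<phi>[OF k(1)] by (simp add: sin_gt_zero)
      moreover have "norm (inverse w) > R"
      proof -
        have "w \<in> ball 0 (inverse R)" by (rule subsetD[OF h(3) wb])
        then have "t < inverse R" using nw by simp
        then have "inverse (inverse R) < inverse t" using elim by (intro less_imp_inverse_less) auto
        then show ?thesis using nw by (simp add: norm_inverse)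
      qed
      ultimately have "Re (q w) \<ge> 0" using nn qw by simp
      then show False using neg by simp
    qed
    then show False by simp
  qed
  moreover have "inverse z \<in> ball 0 (inverse R)" using z R by (simp add: norm_inverse less_imp_inverse_less)
  moreover have "z \<noteq> 0" using z R by auto
  ultimately show ?thesis by (metis add_0 inverse_inverse_eq inverse_zero_imp_zero q_def)
qed

subsection \<open>Solutions with prescribed jumps\<close>

abbreviation band_jump :: "complex ^ ('r::finite + 'r) ^ ('r + 'r)" where
  "band_jump \<equiv> block_mat 0 (mat 1) (- mat 1) 0"

abbreviation swap_mat :: "complex ^ ('r::finite + 'r) ^ ('r + 'r)" where
  "swap_mat \<equiv> block_mat 0 (mat 1) (mat 1) 0"

lemma open_agree_off_reals:
  fixes f F :: "complex \<Rightarrow> 'a::t2_space"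
  assumes "open W" "continuous_on W f" "continuous_on W F" "\<And>z. z \<in> W - \<real> \<Longrightarrow> F z = f z" "z \<in> W"
  shows "F z = f z"
proof (cases "z \<in> \<real>")
  case False
  then show ?thesis using assms by blast
next
  case True
  then obtain x where x: "z = complex_of_real x" by (auto elim: Reals_cases)
  have lims: "(f \<longlongrightarrow> f z) (at z within - \<real>)" "(F \<longlongrightarrow> F z) (at z within - \<real>)"
    using assms(1,2,3,5) by (auto simp: continuous_on_eq_continuous_at isCont_def intro: tendsto_within_subset)
  have "eventually (\<lambda>v. v \<in> W - \<real>) (at z within - \<real>)"
    unfolding eventually_at_topological using assms(1,5) by (intro exI[of _ W]) auto
  then have "eventually (\<lambda>v. f v = F v) (at z within - \<real>)"
    by eventually_elim (use assms(4) in auto)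
  then have "(F \<longlongrightarrow> f z) (at z within - \<real>)" using lims(1) by (rule Lim_transform_eventually[rotated])
  then show ?thesis using lims(2) at_nonreal_ne_bot[of x] tendsto_unique x by blast
qed

text \<open>The reflection exchanges the half planes, so \<open>sharp\<close> turns boundary values
  from below into adjoint boundary values from above.\<close>

lemma boundary_sharp:
  assumes "boundary_minus F x A" shows "boundary_plus (sharp F) x (adj A)"
proof -
  have "filterlim cnj (at (complex_of_real x) within {z. Im z < 0}) (at (complex_of_real x) within {z. Im z > 0})"
    unfolding filterlim_at
  proof
    have "(cnj \<longlongrightarrow> cnj (complex_of_real x)) (at (complex_of_real x) within {z. Im z > 0})"
      by (intro tendsto_cnj tendsto_ident_at)
    then show "(cnj \<longlongrightarrow> complex_of_real x) (at (complex_of_real x) within {z. Im z > 0})" by simp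
    show "\<forall>\<^sub>F z in at (complex_of_real x) within {z. Im z > 0}. cnj z \<in> {z. Im z < 0} \<and> cnj z \<noteq> complex_of_real x"
      by (auto simp: eventually_at_filter complex_eq_iff)
  qed
  then have "((\<lambda>z. F (cnj z)) \<longlongrightarrow> A) (at (complex_of_real x) within {z. Im z > 0})"
    using assms unfolding boundary_minus_def by (rule filterlim_compose[rotated])
  then show ?thesis unfolding boundary_plus_def sharp_def by (rule tendsto_adj)
qed

lemma boundary_sharp':
  assumes "boundary_plus F x A" shows "boundary_minus (sharp F) x (adj A)"
proof -
  have "filterlim cnj (at (complex_of_real x) within {z. Im z > 0}) (at (complex_of_real x) within {z. Im z < 0})"
    unfolding filterlim_at
  proof
    have "(cnj \<longlongrightarrow> cnj (complex_of_real x)) (at (complex_of_real x) within {z. Im z < 0})"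
      by (intro tendsto_cnj tendsto_ident_at)
    then show "(cnj \<longlongrightarrow> complex_of_real x) (at (complex_of_real x) within {z. Im z < 0})" by simp
    show "\<forall>\<^sub>F z in at (complex_of_real x) within {z. Im z < 0}. cnj z \<in> {z. Im z > 0} \<and> cnj z \<noteq> complex_of_real x"
      by (auto simp: eventually_at_filter complex_eq_iff)
  qed
  then have "((\<lambda>z. F (cnj z)) \<longlongrightarrow> A) (at (complex_of_real x) within {z. Im z < 0})"
    using assms unfolding boundary_plus_def by (rule filterlim_compose[rotated])
  then show ?thesis unfolding boundary_minus_def sharp_def by (rule tendsto_adj)
qed

lemma boundary_mult:
  fixes F :: "complex \<Rightarrow> complex ^ 'n ^ 'm" and G :: "complex \<Rightarrow> complex ^ 'k ^ 'n"
  shows "boundary_plus F x A \<Longrightarrow> boundary_plus G x B \<Longrightarrow> boundary_plus (\<lambda>z. F z ** G z) x (A ** B)"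
    and "boundary_minus F x A \<Longrightarrow> boundary_minus G x B \<Longrightarrow> boundary_minus (\<lambda>z. F z ** G z) x (A ** B)"
  unfolding boundary_plus_def boundary_minus_def by (rule tendsto_matrix_mult; assumption)+

lemma boundary_const: "boundary_plus (\<lambda>z. c) x c" "boundary_minus (\<lambda>z. c) x c"
  by (simp_all add: boundary_plus_def boundary_minus_def)

lemma boundary_isCont:
  assumes "isCont F (complex_of_real x)"
  shows "boundary_plus F x (F (complex_of_real x))" "boundary_minus F x (F (complex_of_real x))"
  using assms by (auto simp: isCont_def boundary_plus_def boundary_minus_def intro: tendsto_within_subset)

section \<open>Bands, gaps and growth at the endpoints\<close>

locale band_system =
  fixes g :: nat and a b :: "nat \<Rightarrow> real"
  assumes ordered: "ordered_endpoints g a b"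
begin

abbreviation "E \<equiv> endpoints g a b"
abbreviation "S \<equiv> slit_plane g a b"

lemma band_less: "k \<le> g \<Longrightarrow> a k < b k" and gap_less: "k < g \<Longrightarrow> b k < a (Suc k)"
  using ordered by (auto simp: ordered_endpoints_def)

lemma b_less_a: "i < j \<Longrightarrow> j \<le> g \<Longrightarrow> b i < a j"
proof (induction j)
  case (Suc j)
  show ?case
  proof (cases "i = j")
    case True then show ?thesis using Suc gap_less[of j] by simp
  next
    case False
    then have "b i < a j" using Suc by simp
    also have "\<dots> < b j" using band_less[of j] Suc by simp
    also have "\<dots> < a (Suc j)" using gap_less[of j] Suc by simp
    finally show ?thesis .
  qed
qed simp

lemma a_mono: "i \<le> j \<Longrightarrow> j \<le> g \<Longrightarrow> a i \<le> a j"
  using b_less_a[of i j] band_less[of i] by (cases "i = j") auto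

lemma b_mono: "i \<le> j \<Longrightarrow> j \<le> g \<Longrightarrow> b i \<le> b j"
  using b_less_a[of i j] band_less[of j] by (cases "i = j") auto

lemma finite_E [simp]: "finite E" by (simp add: endpoints_def)

lemma E_range: "e \<in> E \<Longrightarrow> a 0 \<le> e \<and> e \<le> b g"
proof -
  have "a 0 \<le> a i \<and> a i \<le> b g \<and> a 0 \<le> b i \<and> b i \<le> b g" if "i \<le> g" for i
    using a_mono[of 0 i] b_mono[of i g] band_less[of i] that by auto
  then show "e \<in> E \<Longrightarrow> a 0 \<le> e \<and> e \<le> b g" by (auto simp: endpoints_def)
qed

lemma closed_slit: "closed (complex_of_real ` {a 0..b g})"
  by (intro compact_imp_closed compact_continuous_image continuous_intros) auto

lemma open_S [simp]: "open S"
  using closed_slit by (simp add: slit_plane_def open_Compl)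

lemma nonreal_S: "z \<notin> \<real> \<Longrightarrow> z \<in> S"
  by (auto simp: slit_plane_def)

lemma nonreal_subset_S: "- \<real> \<subseteq> S" using nonreal_S by blast

lemma real_in_S: "complex_of_real x \<in> S \<longleftrightarrow> x < a 0 \<or> b g < x"
  by (auto simp: slit_plane_def)

lemma cnj_S: "z \<in> S \<Longrightarrow> cnj z \<in> S"
  unfolding slit_plane_def by (auto simp: complex_eq_iff image_iff)

lemma upper_S: "{z. Im z > 0} \<subseteq> S" and lower_S: "{z. Im z < 0} \<subseteq> S"
  using nonreal_S by (auto simp: complex_is_Real_iff)

definition R0 :: real where "R0 = \<bar>a 0\<bar> + \<bar>b g\<bar> + 1"

lemma R0_pos: "R0 > 0" by (simp add: R0_def)

lemma exterior_S: "{z. norm z > R0} \<subseteq> S"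
  by (auto simp: slit_plane_def R0_def)

text \<open>The three kinds of real points are put into one relation, with the identity jump outside
  the slit, so that every real point off \<open>E\<close> carries a jump and can be handled
  uniformly.\<close>

definition jumps :: "(nat \<Rightarrow> complex ^ 'r ^ 'r) \<Rightarrow> real \<Rightarrow> complex ^ ('r + 'r) ^ ('r + 'r) \<Rightarrow> bool" where
  "jumps K x W \<longleftrightarrow> (\<exists>k\<le>g. a k < x \<and> x < b k \<and> W = band_jump) \<or>
     (\<exists>j\<in>{1..g}. x \<in> gap a b j \<and> W = block_diag (K j) (matrix_inv (K j))) \<or>
     ((x < a 0 \<or> b g < x) \<and> W = mat 1)"

lemma real_cases:
  assumes "x \<notin> E"
  obtains (band) k where "k \<le> g" "a k < x" "x < b k"
    | (gap) j where "j \<in> {1..g}" "x \<in> gap a b j"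
    | (outside) "x < a 0 \<or> b g < x"
proof (cases "x < a 0 \<or> b g < x")
  case False
  have xe: "x \<noteq> a k" "x \<noteq> b k" if "k \<le> g" for k
    using assms that by (auto simp: endpoints_def)
  \<comment> \<open>The last left endpoint below \<open>x\<close> decides: \<open>x\<close> lies
    either in the band starting there or in the gap following it.\<close>
  define k where "k = (GREATEST k. k \<le> g \<and> a k < x)"
  have ex: "0 \<le> g \<and> a 0 < x" using False xe[of 0] by auto
  have k: "k \<le> g \<and> a k < x" unfolding k_def by (rule GreatestI_nat[where P = "\<lambda>k. k \<le> g \<and> a k < x" and b = g, OF ex]) auto
  show ?thesis
  proof (cases "x < b k")
    case True then show ?thesis using k band by blast
  next
    case nb: False
    then have bk: "b k < x" using xe(2)[of k] k by auto
    have "b g > x" using False xe(2)[of g] by auto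
    then have "k \<noteq> g" using bk by auto
    then have kg: "Suc k \<le> g" using k by auto
    have "\<not> a (Suc k) < x"
    proof
      assume "a (Suc k) < x"
      then have "Suc k \<le> k" using kg unfolding k_def[symmetric]
        by (subst (2) k_def) (intro Greatest_le_nat[where P = "\<lambda>k. k \<le> g \<and> a k < x" and b = g], auto)
      then show False by simp
    qed
    then have "x < a (Suc k)" using xe(1)[of "Suc k"] kg by auto
    then show ?thesis using gap[of "Suc k"] bk kg by (auto simp: gap_def)
  qed
qed (use outside in auto)

lemma jumps_exists: "x \<notin> E \<Longrightarrow> \<exists>W. jumps K x W"
  by (erule real_cases; unfold jumps_def; blast)

lemma jumps_not_E:
  assumes "jumps K x W" shows "x \<notin> E"
proof
  assume "x \<in> E"
  then obtain i where i: "i \<le> g" "x = a i \<or> x = b i" by (auto simp: endpoints_def)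
  have 1: "\<not> (a k < x \<and> x < b k)" if "k \<le> g" for k
  proof -
    consider "i < k" | "i = k" | "k < i" by linarith
    then show ?thesis
      using i that b_less_a[of i k] b_less_a[of k i] band_less[of i] band_less[of k] by cases auto
  qed
  have 2: "x \<notin> gap a b j" if j: "j \<in> {1..g}" for j
  proof -
    consider "i < j" | "j \<le> i" by linarith
    then show ?thesis
    proof cases
      case 1
      then have "b i \<le> b (j - 1)" using j by (intro b_mono) auto
      then show ?thesis using i band_less[of i] by (auto simp: gap_def)
    next
      case 2
      then have "a j \<le> a i" using i by (intro a_mono) auto
      then show ?thesis using i band_less[of i] by (auto simp: gap_def)
    qed
  qed
  show False using assms 1 2 E_range[OF \<open>x \<in> E\<close>] by (auto simp: jumps_def)
qed

definition quarter_growth :: "(complex \<Rightarrow> 'v::real_normed_vector) \<Rightarrow> real \<Rightarrow> bool" where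
  "quarter_growth F e \<longleftrightarrow> (\<exists>C. eventually (\<lambda>z. norm (F z) \<le> C * norm (z - complex_of_real e) powr (- 1 / 4))
      (at (complex_of_real e) within S))"

text \<open>This is the order of a product of two factors of quarter growth. Being below 1, it is
  still removable.\<close>

definition half_growth :: "(complex \<Rightarrow> 'v::real_normed_vector) \<Rightarrow> real \<Rightarrow> bool" where
  "half_growth F e \<longleftrightarrow> (\<exists>C. eventually (\<lambda>z. norm (F z) \<le> C * norm (z - complex_of_real e) powr (- 1 / 2))
      (at (complex_of_real e) within S))"

lemma half_growth_tendsto:
  assumes "half_growth F e"
  shows "((\<lambda>z. norm (F z) * norm (z - complex_of_real e)) \<longlongrightarrow> 0) (at (complex_of_real e) within - \<real>)"
proof -
  obtain C where C: "eventually (\<lambda>z. norm (F z) \<le> C * norm (z - complex_of_real e) powr (- 1 / 2))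
      (at (complex_of_real e) within S)" using assms by (auto simp: half_growth_def)
  then have C': "eventually (\<lambda>z. norm (F z) \<le> C * norm (z - complex_of_real e) powr (- 1 / 2))
      (at (complex_of_real e) within - \<real>)"
    by (rule filter_leD[OF at_le[OF nonreal_subset_S]])
  have "((\<lambda>z. norm (z - complex_of_real e)) \<longlongrightarrow> norm (complex_of_real e - complex_of_real e)) (at (complex_of_real e) within - \<real>)"
    by (intro tendsto_norm tendsto_diff tendsto_ident_at tendsto_const)
  then have "((\<lambda>z. norm (z - complex_of_real e)) \<longlongrightarrow> 0) (at (complex_of_real e) within - \<real>)" by simp
  then have "((\<lambda>z. norm (z - complex_of_real e) powr (1/2)) \<longlongrightarrow> 0 powr (1/2)) (at (complex_of_real e) within - \<real>)"
    by (intro tendsto_powr2 tendsto_const) auto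
  then have l: "((\<lambda>z. C * norm (z - complex_of_real e) powr (1/2)) \<longlongrightarrow> C * 0) (at (complex_of_real e) within - \<real>)"
    by (intro tendsto_mult tendsto_const) simp
  have up: "eventually (\<lambda>z. norm (F z) * norm (z - complex_of_real e) \<le> C * norm (z - complex_of_real e) powr (1/2))
      (at (complex_of_real e) within - \<real>)"
    using C'
  proof eventually_elim
    case (elim z)
    have "norm (z - complex_of_real e) powr (1/2) = norm (z - complex_of_real e) powr (- 1 / 2) * norm (z - complex_of_real e) powr 1"
      by (simp only: powr_add[symmetric]) simp
    also have "\<dots> = norm (z - complex_of_real e) powr (- 1 / 2) * norm (z - complex_of_real e)" by simp
    finally show ?case using mult_right_mono[OF elim, of "norm (z - complex_of_real e)"] by (simp add: mult.assoc)
  qed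
  have lo: "eventually (\<lambda>z. 0 \<le> norm (F z) * norm (z - complex_of_real e)) (at (complex_of_real e) within - \<real>)"
    by (rule always_eventually) simp
  show ?thesis
    by (rule tendsto_sandwich[OF lo up tendsto_const]) (use l in simp)
qed

lemma quarter_growth_mult:
  fixes F :: "complex \<Rightarrow> complex ^ 'n ^ 'm" and G :: "complex \<Rightarrow> complex ^ 'k ^ 'n"
  assumes "quarter_growth F e" "quarter_growth G e"
  shows "half_growth (\<lambda>z. F z ** G z) e"
proof -
  obtain C where C: "eventually (\<lambda>z. norm (F z) \<le> C * norm (z - complex_of_real e) powr (- 1 / 4))
      (at (complex_of_real e) within S)" using assms(1) by (auto simp: quarter_growth_def)
  obtain C' where C': "eventually (\<lambda>z. norm (G z) \<le> C' * norm (z - complex_of_real e) powr (- 1 / 4))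
      (at (complex_of_real e) within S)" using assms(2) by (auto simp: quarter_growth_def)
  have "eventually (\<lambda>z. norm (F z ** G z) \<le> (C * C') * norm (z - complex_of_real e) powr (- 1 / 2))
      (at (complex_of_real e) within S)"
    using C C'
  proof eventually_elim
    case (elim z)
    have "norm (F z ** G z) \<le> norm (F z) * norm (G z)" by (rule norm_matrix_mult)
    also have "\<dots> \<le> (C * norm (z - complex_of_real e) powr (- 1 / 4)) * (C' * norm (z - complex_of_real e) powr (- 1 / 4))"
      by (intro mult_mono elim norm_ge_zero order_trans[OF norm_ge_zero elim(1)] order_trans[OF norm_ge_zero elim(2)])
    also have "\<dots> = (C * C') * (norm (z - complex_of_real e) powr (- 1 / 4) * norm (z - complex_of_real e) powr (- 1 / 4))"
      by simp
    also have "norm (z - complex_of_real e) powr (- 1 / 4) * norm (z - complex_of_real e) powr (- 1 / 4)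
      = norm (z - complex_of_real e) powr (- 1 / 2)" by (simp only: powr_add[symmetric]) simp
    finally show ?case .
  qed
  then show ?thesis unfolding half_growth_def by blast
qed

lemma quarter_growth_bounded_mult:
  fixes F :: "complex \<Rightarrow> complex ^ 'n ^ 'm" and G :: "complex \<Rightarrow> complex ^ 'k ^ 'n"
  assumes "eventually (\<lambda>z. norm (F z) \<le> B) (at (complex_of_real e) within S)" "quarter_growth G e"
  shows "quarter_growth (\<lambda>z. F z ** G z) e"
proof -
  obtain C where C: "eventually (\<lambda>z. norm (G z) \<le> C * norm (z - complex_of_real e) powr (- 1 / 4))
      (at (complex_of_real e) within S)" using assms(2) by (auto simp: quarter_growth_def)
  have "eventually (\<lambda>z. norm (F z ** G z) \<le> (B * C) * norm (z - complex_of_real e) powr (- 1 / 4))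
      (at (complex_of_real e) within S)"
    using C assms(1)
  proof eventually_elim
    case (elim z)
    have "norm (F z ** G z) \<le> norm (F z) * norm (G z)" by (rule norm_matrix_mult)
    also have "\<dots> \<le> B * (C * norm (z - complex_of_real e) powr (- 1 / 4))"
      by (intro mult_mono elim norm_ge_zero order_trans[OF norm_ge_zero elim(1)] order_trans[OF norm_ge_zero elim(2)])
    finally show ?case by simp
  qed
  then show ?thesis unfolding quarter_growth_def by blast
qed

lemma quarter_growth_mult_bounded:
  fixes F :: "complex \<Rightarrow> complex ^ 'n ^ 'm" and G :: "complex \<Rightarrow> complex ^ 'k ^ 'n"
  assumes "quarter_growth F e" "eventually (\<lambda>z. norm (G z) \<le> B) (at (complex_of_real e) within S)"
  shows "quarter_growth (\<lambda>z. F z ** G z) e"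
proof -
  obtain C where C: "eventually (\<lambda>z. norm (F z) \<le> C * norm (z - complex_of_real e) powr (- 1 / 4))
      (at (complex_of_real e) within S)" using assms(1) by (auto simp: quarter_growth_def)
  have "eventually (\<lambda>z. norm (F z ** G z) \<le> (B * C) * norm (z - complex_of_real e) powr (- 1 / 4))
      (at (complex_of_real e) within S)"
    using C assms(2)
  proof eventually_elim
    case (elim z)
    have "norm (F z ** G z) \<le> norm (F z) * norm (G z)" by (rule norm_matrix_mult)
    also have "\<dots> \<le> (C * norm (z - complex_of_real e) powr (- 1 / 4)) * B"
      by (intro mult_mono elim norm_ge_zero order_trans[OF norm_ge_zero elim(1)] order_trans[OF norm_ge_zero elim(2)])
    finally show ?case by (simp add: mult_ac)
  qed
  then show ?thesis unfolding quarter_growth_def by blast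
qed

lemma quarter_growth_sharp:
  assumes "quarter_growth F e" shows "quarter_growth (sharp F) e"
proof -
  obtain C where C: "eventually (\<lambda>z. norm (F z) \<le> C * norm (z - complex_of_real e) powr (- 1 / 4))
      (at (complex_of_real e) within S)" using assms by (auto simp: quarter_growth_def)
  then obtain d where d: "d > 0" "\<And>z. z \<in> S \<Longrightarrow> z \<noteq> complex_of_real e \<Longrightarrow> dist z (complex_of_real e) < d \<Longrightarrow>
     norm (F z) \<le> C * norm (z - complex_of_real e) powr (- 1 / 4)" by (auto simp: eventually_at)
  have "norm (sharp F z) \<le> C * norm (z - complex_of_real e) powr (- 1 / 4)"
    if z: "z \<in> S" "z \<noteq> complex_of_real e" "dist z (complex_of_real e) < d" for z
  proof -
    have *: "norm (cnj z - complex_of_real e) = norm (z - complex_of_real e)"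
      by (metis complex_cnj_complex_of_real complex_cnj_diff complex_mod_cnj)
    moreover have "cnj z \<noteq> complex_of_real e" using * z(2) by auto
    ultimately show ?thesis using d(2)[of "cnj z"] z cnj_S[OF z(1)] by (simp add: sharp_def dist_norm)
  qed
  then show ?thesis unfolding quarter_growth_def eventually_at using d(1) by blast
qed

text \<open>Half growth is weaker than a simple pole, so a function without jumps extends over the
  endpoints as well. On real points of \<open>S\<close> the extension agrees with \<open>f\<close>
  by continuity.\<close>

lemma extend_no_jump:
  fixes f :: "complex \<Rightarrow> complex ^ 'n ^ 'm"
  assumes U: "open U" and hol: "mat_holomorphic_on f (U \<inter> S)"
    and match: "\<And>x. complex_of_real x \<in> U \<Longrightarrow> x \<notin> E \<Longrightarrow> \<exists>L. boundary_plus f x L \<and> boundary_minus f x L"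
    and growth: "\<And>e. e \<in> E \<Longrightarrow> complex_of_real e \<in> U \<Longrightarrow> half_growth f e"
  shows "\<exists>F. mat_holomorphic_on F U \<and> (\<forall>z\<in>U \<inter> S. F z = f z)"
proof -
  have "\<exists>F. mat_holomorphic_on F U \<and> (\<forall>z\<in>U - \<real>. F z = f z)"
  proof (rule mat_holomorphic_extend_across_reals[OF U finite_E])
    show "mat_holomorphic_on f (U - \<real>)"
      by (rule mat_holomorphic_on_subset[OF hol]) (use nonreal_S in auto)
  qed (use match growth half_growth_tendsto in auto)
  then obtain F where F: "mat_holomorphic_on F U" "\<And>z. z \<in> U - \<real> \<Longrightarrow> F z = f z" by blast
  have "F z = f z" if "z \<in> U \<inter> S" for z
  proof (rule open_agree_off_reals[where W = "U \<inter> S"])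
    show "continuous_on (U \<inter> S) f" "continuous_on (U \<inter> S) F"
      using hol F(1) mat_holomorphic_on_subset mat_holomorphic_on_imp_continuous_on by (blast intro: continuous_on_subset)+
  qed (use U that F in auto)
  then show ?thesis using F by blast
qed

text \<open>The value \<open>L\<close> at infinity is left free: \<open>mat 1\<close> gives the
  normalised problem, 0 the homogeneous one of the vanishing lemma. Only a limit is required, since
  the rate 1/z follows from holomorphy.\<close>

definition sol :: "(nat \<Rightarrow> complex ^ 'r ^ 'r) \<Rightarrow> complex ^ ('r + 'r) ^ ('r + 'r)
    \<Rightarrow> (complex \<Rightarrow> complex ^ ('r + 'r) ^ ('r + 'r)) \<Rightarrow> bool" where
  "sol K L F \<longleftrightarrow> mat_holomorphic_on F S \<and> (F \<longlongrightarrow> L) at_infinity \<and> (\<forall>e\<in>E. quarter_growth F e) \<and>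
     (\<forall>x W. jumps K x W \<longrightarrow> jump_at F x W)"

lemma solD:
  assumes "sol K L F"
  shows "mat_holomorphic_on F S" "(F \<longlongrightarrow> L) at_infinity" "\<And>e. e \<in> E \<Longrightarrow> quarter_growth F e"
    "\<And>x W. jumps K x W \<Longrightarrow> \<exists>Fm. boundary_plus F x (Fm ** W) \<and> boundary_minus F x Fm"
  using assms unfolding sol_def jump_at_def by blast+

definition unitary_data :: "(nat \<Rightarrow> complex ^ 'r ^ 'r) \<Rightarrow> bool" where
  "unitary_data K \<longleftrightarrow> (\<forall>j\<in>{1..g}. unitary_mat (K j))"

lemma unitary_matrix_inv: "unitary_mat U \<Longrightarrow> matrix_inv U = adj U"
  unfolding unitary_mat_def using matrix_inv_unique by blast

lemma jumps_swap:
  fixes K :: "nat \<Rightarrow> complex ^ 'a ^ 'a"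
  assumes "unitary_data K" "jumps K x W"
  shows "W ** swap_mat = swap_mat ** adj W"
proof -
  have "adj (- mat 1) = (- mat 1 :: complex ^ 'a ^ 'a)"
    by (simp add: vec_eq_iff mat_def)
  then show ?thesis
    using assms unfolding jumps_def unitary_data_def
    by (auto simp: block_diag_def block_mat_mult adj_block_mat unitary_matrix_inv mat_1_block)
qed

text \<open>Liouville's theorem in the form needed for pairings: an entire continuation with a limit
  at infinity equals that limit everywhere.\<close>

lemma const_at_infinity:
  assumes F: "mat_holomorphic_on F UNIV" and eq: "\<And>z. z \<in> S \<Longrightarrow> F z = f z" and lim: "(f \<longlongrightarrow> L) at_infinity" and z: "z \<in> S"
  shows "f z = L"
proof -
  have "eventually (\<lambda>z. norm z > R0) at_infinity"
    unfolding eventually_at_infinity by (intro exI[of _ "R0 + 1"]) auto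
  then have "eventually (\<lambda>z. f z = F z) at_infinity"
    by eventually_elim (use exterior_S eq in auto)
  then have limF: "(F \<longlongrightarrow> L) at_infinity" using lim Lim_transform_eventually by blast
  have "F z $ i $ j = L $ i $ j" for i j
    using limF F by (intro Liouville_weak) (auto simp: tendsto_matrix_iff mat_holomorphic_on_def)
  then show ?thesis using eq[OF z] by (simp add: vec_eq_iff)
qed

lemma filterlim_cnj_at_infinity: "filterlim cnj at_infinity at_infinity"
  unfolding filterlim_at_infinity_conv_norm_at_top complex_mod_cnj by (rule filterlim_norm_at_top)

lemma tendsto_sharp_at_infinity:
  assumes "(F \<longlongrightarrow> L) at_infinity" shows "(sharp F \<longlongrightarrow> adj L) at_infinity"
  unfolding sharp_def by (intro tendsto_adj filterlim_compose[OF assms filterlim_cnj_at_infinity])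

text \<open>Unitarity of the data makes the swap matrix intertwine each jump with its adjoint, so
  that this product of two solutions has no jump at all.\<close>

lemma pairing:
  assumes K: "unitary_data K" and N1: "sol K L1 N1" and N2: "sol K L2 N2" and z: "z \<in> S"
  shows "N1 z ** swap_mat ** sharp N2 z = L1 ** swap_mat ** adj L2"
proof -
  let ?H = "\<lambda>z. N1 z ** swap_mat ** sharp N2 z"
  have "\<exists>F. mat_holomorphic_on F UNIV \<and> (\<forall>z\<in>UNIV \<inter> S. F z = ?H z)"
  proof (rule extend_no_jump)
    show "mat_holomorphic_on ?H (UNIV \<inter> S)"
      using solD(1)[OF N1] solD(1)[OF N2] cnj_S
      by (auto intro!: mat_holomorphic_on_mult mat_holomorphic_on_sharp)
  next
    fix x assume "x \<notin> E"
    then obtain W where W: "jumps K x W" using jumps_exists by blast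
    obtain M1 where M1: "boundary_plus N1 x (M1 ** W)" "boundary_minus N1 x M1" using solD(4)[OF N1 W] by blast
    obtain M2 where M2: "boundary_plus N2 x (M2 ** W)" "boundary_minus N2 x M2" using solD(4)[OF N2 W] by blast
    have "boundary_plus ?H x (M1 ** W ** swap_mat ** adj M2)"
      by (intro boundary_mult M1 boundary_const boundary_sharp M2)
    moreover have "boundary_minus ?H x (M1 ** swap_mat ** adj (M2 ** W))"
      by (intro boundary_mult M1 boundary_const boundary_sharp' M2)
    moreover have "M1 ** W ** swap_mat ** adj M2 = M1 ** swap_mat ** adj (M2 ** W)"
    proof -
      have "M1 ** W ** swap_mat ** adj M2 = M1 ** (W ** swap_mat) ** adj M2" by (simp only: matrix_mul_assoc)
      also have "\<dots> = M1 ** swap_mat ** (adj W ** adj M2)"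
        unfolding jumps_swap[OF K W] by (simp only: matrix_mul_assoc)
      finally show ?thesis by (simp only: adj_mult)
    qed
    ultimately show "\<exists>L. boundary_plus ?H x L \<and> boundary_minus ?H x L" by auto
  next
    fix e assume e: "e \<in> E"
    have "quarter_growth (\<lambda>z. N1 z ** swap_mat) e"
      by (rule quarter_growth_mult_bounded[OF solD(3)[OF N1 e]]) (rule always_eventually, rule allI, rule order_refl)
    then show "half_growth ?H e"
      using quarter_growth_sharp[OF solD(3)[OF N2 e]] by (rule quarter_growth_mult)
  qed auto
  then obtain F where F: "mat_holomorphic_on F UNIV" "\<And>z. z \<in> S \<Longrightarrow> F z = ?H z" by auto
  have "(?H \<longlongrightarrow> L1 ** swap_mat ** adj L2) at_infinity"
    by (intro tendsto_matrix_mult solD(2)[OF N1] tendsto_const tendsto_sharp_at_infinity[OF solD(2)[OF N2]])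
  from const_at_infinity[OF F this z] show ?thesis .
qed

lemma swap_swap: "swap_mat ** swap_mat = (mat 1 :: complex ^ ('r::finite + 'r) ^ ('r + 'r))"
  by (simp add: block_mat_mult mat_1_block)

text \<open>The pairing of a normalised solution with itself equals Y, which exhibits the inverse
  explicitly. Its growth at the endpoints is therefore again of order 1/4, with no determinant in a
  denominator.\<close>

lemma sol_inverse:
  assumes K: "unitary_data K" and N: "sol K (mat 1) N" and z: "z \<in> S"
  shows "N z ** (swap_mat ** sharp N z ** swap_mat) = mat 1" "(swap_mat ** sharp N z ** swap_mat) ** N z = mat 1"
proof -
  have "N z ** (swap_mat ** sharp N z ** swap_mat) = (N z ** swap_mat ** sharp N z) ** swap_mat"
    by (simp only: matrix_mul_assoc)
  also have "\<dots> = mat 1" unfolding pairing[OF K N N z] by (simp add: swap_swap)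
  finally show 1: "N z ** (swap_mat ** sharp N z ** swap_mat) = mat 1" .
  then show "(swap_mat ** sharp N z ** swap_mat) ** N z = mat 1" using matrix_left_right_inverse by blast
qed

text \<open>By the pairing, one and the same matrix built from \<open>N2\<close> is inverse to both
  \<open>N1 z\<close> and \<open>N2 z\<close>.\<close>

lemma sol_unique:
  assumes K: "unitary_data K" and N1: "sol K (mat 1) N1" and N2: "sol K (mat 1) N2" and z: "z \<in> S"
  shows "N1 z = N2 z"
proof -
  have "N1 z ** (swap_mat ** sharp N2 z ** swap_mat) = (N1 z ** swap_mat ** sharp N2 z) ** swap_mat"
    by (simp only: matrix_mul_assoc)
  also have "\<dots> = mat 1" unfolding pairing[OF K N1 N2 z] by (simp add: swap_swap)
  finally have "N1 z ** (swap_mat ** sharp N2 z ** swap_mat) ** N2 z = N2 z" by simp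
  then show ?thesis using sol_inverse(2)[OF K N2 z] by (simp only: matrix_mul_assoc[symmetric] matrix_mul_rid)
qed

end

section \<open>Scalar tools for the vanishing lemma\<close>

lemma norm_matrix_le_sum:
  fixes A :: "complex ^ 'n ^ 'm"
  shows "norm A \<le> (\<Sum>i\<in>UNIV. \<Sum>j\<in>UNIV. norm (A $ i $ j))"
proof -
  have "norm A \<le> (\<Sum>i\<in>UNIV. norm (A $ i))" unfolding norm_vec_def by (rule L2_set_le_sum) auto
  also have "\<dots> \<le> (\<Sum>i\<in>UNIV. \<Sum>j\<in>UNIV. norm (A $ i $ j))"
    by (intro sum_mono) (simp add: norm_vec_def L2_set_le_sum)
  finally show ?thesis .
qed

lemma identity_upper:
  assumes f: "f holomorphic_on {z. Im z > 0}" and U: "open U" "U \<subseteq> {z. Im z > 0}" "U \<noteq> {}"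
    and zero: "\<And>z. z \<in> U \<Longrightarrow> f z = 0" and z: "Im z > 0"
  shows "f z = (0::complex)"
  using analytic_continuation_open[OF U(1) open_upper U(3) _ U(2) f holomorphic_on_const[of 0]] zero z
  by (simp add: convex_connected convex_upper)

lemma identity_lower:
  assumes f: "f holomorphic_on {z. Im z < 0}" and U: "open U" "U \<subseteq> {z. Im z < 0}" "U \<noteq> {}"
    and zero: "\<And>z. z \<in> U \<Longrightarrow> f z = 0" and z: "Im z < 0"
  shows "f z = (0::complex)"
  using analytic_continuation_open[OF U(1) open_halfspace_Im_lt U(3) _ U(2) f holomorphic_on_const[of 0]] zero z
  by (simp add: convex_connected convex_halfspace_Im_lt)

text \<open>Continued by 0 into the lower half plane, \<open>f\<close> has no jump over the
  interval, so it extends across it. The extension vanishes on an open set and hence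
  everywhere.\<close>

lemma zero_boundary_value_imp_zero:
  fixes f :: "complex \<Rightarrow> complex"
  assumes ab: "\<alpha> < \<beta>" and hol: "f holomorphic_on {z. Im z > 0}"
    and bdry: "\<And>x. \<alpha> < x \<Longrightarrow> x < \<beta> \<Longrightarrow> boundary_plus f x 0" and z: "Im z > 0"
  shows "f z = 0"
proof -
  define c where "c = complex_of_real ((\<alpha> + \<beta>) / 2)"
  define r where "r = (\<beta> - \<alpha>) / 2"
  have r: "r > 0" using ab by (simp add: r_def)
  define \<phi> where "\<phi> z = (if Im z > 0 then f z else 0)" for z
  have "\<phi> holomorphic_on {z. Im z > 0} \<union> {z. Im z < 0}"
  proof (rule holomorphic_on_Un)
    show "\<phi> holomorphic_on {z. Im z > 0}" using hol by (rule holomorphic_transform) (simp add: \<phi>_def)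
    show "\<phi> holomorphic_on {z. Im z < 0}"
      using holomorphic_on_const[of 0] by (rule holomorphic_transform) (simp add: \<phi>_def)
  qed (simp_all add: open_upper open_halfspace_Im_lt)
  then have \<phi>: "\<phi> holomorphic_on - \<real>" by (simp add: nonreal_Un)
  have "\<exists>F. F holomorphic_on ball c r \<and> (\<forall>z\<in>ball c r - \<real>. F z = \<phi> z)"
  proof (rule holomorphic_extend_across_reals[where T = "{}"])
    show "\<phi> holomorphic_on ball c r - \<real>" by (rule holomorphic_on_subset[OF \<phi>]) auto
    fix x assume x: "complex_of_real x \<in> ball c r"
    have "\<bar>x - (\<alpha> + \<beta>) / 2\<bar> < r"
    proof -
      have "norm (c - complex_of_real x) = \<bar>(\<alpha> + \<beta>) / 2 - x\<bar>"
        unfolding c_def of_real_diff[symmetric] by (rule norm_of_real)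
      then show ?thesis using x by (simp add: dist_norm abs_minus_commute)
    qed
    then have "\<alpha> < x" "x < \<beta>" unfolding r_def by (simp_all add: abs_less_iff field_simps)
    then have "boundary_plus f x 0" using bdry by blast
    then have "boundary_plus \<phi> x 0"
      unfolding boundary_plus_def by (rule Lim_transform_eventually) (simp add: eventually_at_filter \<phi>_def)
    moreover have "boundary_minus \<phi> x 0"
      unfolding boundary_minus_def
      by (rule Lim_transform_eventually[OF tendsto_const]) (simp add: eventually_at_filter \<phi>_def)
    ultimately show "\<exists>L. boundary_plus \<phi> x L \<and> boundary_minus \<phi> x L" by blast
  qed auto
  then obtain F where F: "F holomorphic_on ball c r" "\<And>z. z \<in> ball c r - \<real> \<Longrightarrow> F z = \<phi> z" by blast
  have pts: "c - \<i> * complex_of_real (r/2) \<in> ball c r \<inter> {z. Im z < 0}" "c + \<i> * complex_of_real (r/2) \<in> ball c r \<inter> {z. Im z > 0}"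
    using r by (auto simp: dist_norm norm_mult c_def)
  have F0: "F w = 0" if "w \<in> ball c r" for w
  proof (rule analytic_continuation_open[where s = "ball c r \<inter> {z. Im z < 0}" and s' = "ball c r" and g = "\<lambda>z. 0" and f = F])
    show "open (ball c r \<inter> {z. Im z < 0})" by (intro open_Int open_ball open_halfspace_Im_lt)
    show "ball c r \<inter> {z. Im z < 0} \<noteq> {}" using pts by blast
    show "F z = 0" if "z \<in> ball c r \<inter> {z. Im z < 0}" for z
      using F(2)[of z] that by (auto simp: \<phi>_def complex_is_Real_iff)
  qed (use F that in auto)
  show ?thesis
  proof (rule identity_upper[OF hol, where U = "ball c r \<inter> {z. Im z > 0}"])
    show "open (ball c r \<inter> {z. Im z > 0})" by (intro open_Int open_ball open_upper)
    show "ball c r \<inter> {z. Im z > 0} \<noteq> {}" using pts by blast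
    show "f z = 0" if "z \<in> ball c r \<inter> {z. Im z > 0}" for z
      using F(2)[of z] F0[of z] that by (auto simp: \<phi>_def complex_is_Real_iff)
  qed (use z in auto)
qed

lemma mult_swap_nth [simp]:
  fixes A :: "complex ^ ('r::finite + 'r) ^ 'n"
  shows "(A ** swap_mat) $ i $ Inl k = A $ i $ Inr k" "(A ** swap_mat) $ i $ Inr k = A $ i $ Inl k"
  by (simp_all add: matrix_matrix_mult_def sum_UNIV_Plus mat_def if_distrib[of "\<lambda>x. y * x" for y] cong: if_cong)

lemma mult_band_jump_nth [simp]:
  fixes A :: "complex ^ ('r::finite + 'r) ^ 'n"
  shows "(A ** band_jump) $ i $ Inl k = - A $ i $ Inr k" "(A ** band_jump) $ i $ Inr k = A $ i $ Inl k"
  by (simp_all add: matrix_matrix_mult_def sum_UNIV_Plus mat_def if_distrib[of "\<lambda>x. y * x" for y]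
      if_distrib[of "\<lambda>x. - x"] sum_negf cong: if_cong)

abbreviation corner_mat :: "complex ^ ('r::finite + 'r) ^ ('r + 'r)" where
  "corner_mat \<equiv> block_mat 0 (mat 1) 0 0"

lemma mult_corner_nth [simp]:
  fixes A :: "complex ^ ('r::finite + 'r) ^ 'n"
  shows "(A ** corner_mat) $ i $ Inl k = 0" "(A ** corner_mat) $ i $ Inr k = A $ i $ Inl k"
  by (simp_all add: matrix_matrix_mult_def sum_UNIV_Plus mat_def if_distrib[of "\<lambda>x. y * x" for y] cong: if_cong)

lemma corner_form:
  fixes A B :: "complex ^ ('r::finite + 'r) ^ 'n"
  shows "(A ** corner_mat ** adj B) $ i $ i = (\<Sum>k\<in>UNIV. A $ i $ Inl k * cnj (B $ i $ Inr k))"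
  by (simp add: matrix_matrix_mult_def[of "A ** corner_mat" "adj B"] sum_UNIV_Plus)

text \<open>The swap is the corner matrix plus its adjoint. A vanishing swap pairing thus makes the
  corner pairing skew under reflection.\<close>

lemma swap_form:
  fixes A B :: "complex ^ ('r::finite + 'r) ^ 'n"
  shows "(A ** swap_mat ** adj B) $ i $ i = (A ** corner_mat ** adj B) $ i $ i + cnj ((B ** corner_mat ** adj A) $ i $ i)"
  by (simp add: corner_form matrix_matrix_mult_def[of "A ** swap_mat" "adj B"] sum_UNIV_Plus mult.commute)

lemma corner_form_block_diag:
  fixes A :: "complex ^ ('r::finite + 'r) ^ 'n"
  shows "((A ** block_diag U (adj U)) ** corner_mat ** adj A) $ i $ i = (A ** corner_mat ** adj (A ** block_diag U (adj U))) $ i $ i"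
proof -
  have 1: "(A ** block_diag U (adj U)) $ i $ Inl k = (\<Sum>m\<in>UNIV. A $ i $ Inl m * U $ m $ k)" for k
    by (simp add: matrix_matrix_mult_def sum_UNIV_Plus block_diag_def)
  have 2: "(A ** block_diag U (adj U)) $ i $ Inr k = (\<Sum>m\<in>UNIV. A $ i $ Inr m * cnj (U $ k $ m))" for k
    by (simp add: matrix_matrix_mult_def sum_UNIV_Plus block_diag_def)
  show ?thesis
    unfolding corner_form 1 2 by (simp add: sum_distrib_left sum_distrib_right mult_ac) (subst sum.swap, rule refl)
qed

context band_system
begin

lemma holomorphic_S_at_infinity_bigo:
  fixes F :: "complex \<Rightarrow> complex ^ 'n ^ 'm"
  assumes hol: "mat_holomorphic_on F S" and lim: "(F \<longlongrightarrow> L) at_infinity"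
  shows "\<exists>C. eventually (\<lambda>z. norm (F z - L) \<le> C * norm (inverse z)) at_infinity"
proof -
  have "\<exists>C. eventually (\<lambda>z. norm (F z $ i $ j - L $ i $ j) \<le> C * norm (inverse z)) at_infinity" for i j
  proof -
    have "(\<lambda>z. F z $ i $ j) holomorphic_on {z. norm (z - 0) > R0}"
      by (rule holomorphic_on_subset[of _ S]) (use hol exterior_S in \<open>auto simp: mat_holomorphic_on_def\<close>)
    moreover have "((\<lambda>z. F z $ i $ j) \<longlongrightarrow> L $ i $ j) at_infinity" using lim by (simp add: tendsto_matrix_iff)
    ultimately obtain C R where "\<And>z. norm z > R \<Longrightarrow> norm (F z $ i $ j - L $ i $ j) \<le> C * norm (inverse z)"
      using holomorphic_at_infinity_bigo[OF R0_pos] by blast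
    then show ?thesis unfolding eventually_at_infinity by (intro exI[of _ C] exI[of _ "R + 1"]) auto
  qed
  then have ex: "\<exists>C. eventually (\<lambda>z. norm (F z $ i $ j - L $ i $ j) \<le> C * norm (inverse z)) at_infinity" for i j .
  define C where "C i j = (SOME C. eventually (\<lambda>z. norm (F z $ i $ j - L $ i $ j) \<le> C * norm (inverse z)) at_infinity)" for i j
  have C: "eventually (\<lambda>z. norm (F z $ i $ j - L $ i $ j) \<le> C i j * norm (inverse z)) at_infinity" for i j
    unfolding C_def by (rule someI_ex[OF ex])
  have "eventually (\<lambda>z. \<forall>i j. norm (F z $ i $ j - L $ i $ j) \<le> C i j * norm (inverse z)) at_infinity"
    using C by (intro eventually_all_finite)
  then have "eventually (\<lambda>z. norm (F z - L) \<le> (\<Sum>i\<in>UNIV. \<Sum>j\<in>UNIV. C i j) * norm (inverse z)) at_infinity"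
  proof eventually_elim
    case (elim z)
    have "norm (F z - L) \<le> (\<Sum>i\<in>UNIV. \<Sum>j\<in>UNIV. norm ((F z - L) $ i $ j))" by (rule norm_matrix_le_sum)
    also have "\<dots> \<le> (\<Sum>i\<in>UNIV. \<Sum>j\<in>UNIV. C i j * norm (inverse z))"
      using elim by (intro sum_mono) simp
    finally show ?case by (simp add: sum_distrib_right)
  qed
  then show ?thesis by blast
qed

lemma tendsto_inverse_norm_at_infinity: "((\<lambda>z::complex. C * norm (inverse z)) \<longlongrightarrow> 0) at_infinity"
proof -
  have "((\<lambda>z::complex. C * norm (inverse z)) \<longlongrightarrow> C * norm (0::complex)) at_infinity"
    by (intro tendsto_mult tendsto_const tendsto_norm tendsto_inverse_0)
  then show ?thesis by simp
qed

text \<open>The expansion I + O(1/z) may be replaced by a limit, because a function holomorphic near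
  infinity approaches its limit at that rate.\<close>

lemma rh_normalised_iff:
  "rh_normalised g a b N \<longleftrightarrow>
     mat_holomorphic_on N S \<and> (N \<longlongrightarrow> mat 1) at_infinity \<and> (\<forall>e\<in>E. quarter_growth N e)"
proof -
  have growth: "(\<lambda>z. norm (N z)) \<in> O[at (complex_of_real e) within S](\<lambda>z. norm (z - complex_of_real e) powr (- 1 / 4))
     \<longleftrightarrow> quarter_growth N e" for e
  proof
    assume "(\<lambda>z. norm (N z)) \<in> O[at (complex_of_real e) within S](\<lambda>z. norm (z - complex_of_real e) powr (- 1 / 4))"
    then obtain c where "eventually (\<lambda>z. norm (norm (N z)) \<le> c * norm (norm (z - complex_of_real e) powr (- 1 / 4)))
      (at (complex_of_real e) within S)" by (elim landau_o.bigE)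
    then show "quarter_growth N e" unfolding quarter_growth_def by (intro exI[of _ c]) simp
  next
    assume "quarter_growth N e"
    then obtain c where "eventually (\<lambda>z. norm (N z) \<le> c * norm (z - complex_of_real e) powr (- 1 / 4))
      (at (complex_of_real e) within S)" unfolding quarter_growth_def by blast
    then show "(\<lambda>z. norm (N z)) \<in> O[at (complex_of_real e) within S](\<lambda>z. norm (z - complex_of_real e) powr (- 1 / 4))"
      by (intro bigoI[of _ c]) simp
  qed
  have inf: "(\<lambda>z. norm (N z - mat 1)) \<in> O[at_infinity](\<lambda>z. norm (inverse z)) \<longleftrightarrow> (N \<longlongrightarrow> mat 1) at_infinity"
    if hol: "mat_holomorphic_on N S"
  proof
    assume "(\<lambda>z. norm (N z - mat 1)) \<in> O[at_infinity](\<lambda>z. norm (inverse z))"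
    then obtain c where "eventually (\<lambda>z. norm (norm (N z - mat 1)) \<le> c * norm (norm (inverse z))) at_infinity"
      by (elim landau_o.bigE)
    then have "eventually (\<lambda>z. norm (N z - mat 1) \<le> c * norm (inverse z)) at_infinity" by simp
    then have "((\<lambda>z. N z - mat 1) \<longlongrightarrow> 0) at_infinity"
      by (rule Lim_null_comparison) (rule tendsto_inverse_norm_at_infinity)
    then show "(N \<longlongrightarrow> mat 1) at_infinity" by (rule LIM_zero_cancel)
  next
    assume "(N \<longlongrightarrow> mat 1) at_infinity"
    then obtain C where "eventually (\<lambda>z. norm (N z - mat 1) \<le> C * norm (inverse z)) at_infinity"
      using holomorphic_S_at_infinity_bigo[OF hol] by blast
    then show "(\<lambda>z. norm (N z - mat 1)) \<in> O[at_infinity](\<lambda>z. norm (inverse z))"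
      by (intro bigoI[of _ C]) simp
  qed
  show ?thesis unfolding rh_normalised_def growth using inf by blast
qed

lemma isCont_S:
  assumes "mat_holomorphic_on F S" "z \<in> S" shows "isCont F z"
  using mat_holomorphic_on_imp_continuous_on[OF assms(1)] assms(2) by (simp add: continuous_on_eq_continuous_at)

lemma jump_at_outside:
  assumes "mat_holomorphic_on F S" "x < a 0 \<or> b g < x" shows "jump_at F x (mat 1)"
  using boundary_isCont[OF isCont_S[OF assms(1)], of x] assms(2) unfolding jump_at_def real_in_S[symmetric]
  by (intro exI[of _ "F (complex_of_real x)"]) simp

lemma solves_problem_N_iff: "solves_problem_N g a b K N \<longleftrightarrow> sol K (mat 1) N"
  unfolding solves_problem_N_def sol_def rh_normalised_iff jumps_def
  using jump_at_outside by fastforce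

subsection \<open>The vanishing lemma\<close>

text \<open>The scalar \<open>\<theta>\<close> below pairs one row of a decaying solution with its reflection. It has no jump
  on the gaps, it is skew under reflection, and its real part from above is minus a sum of squares on
  the bands. Hence \<open>- \<theta>\<close> has nonnegative real part in the upper half plane, which its quadratic
  decay at infinity only permits if it vanishes.\<close>

lemma sol_zero:
  fixes F :: "complex \<Rightarrow> complex ^ ('r::finite + 'r) ^ ('r + 'r)"
  assumes K: "unitary_data K" and F: "sol K 0 F" and z: "z \<in> S"
  shows "F z = 0"
proof -
  note FD = solD[OF F]
  define G where "G z = F z ** corner_mat ** sharp F z" for z
  have G_hol: "mat_holomorphic_on G S"
    unfolding G_def using FD(1) cnj_S by (auto intro!: mat_holomorphic_on_mult mat_holomorphic_on_sharp)
  have G_growth: "half_growth G e" if e: "e \<in> E" for e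
  proof -
    have "quarter_growth (\<lambda>z. F z ** corner_mat) e"
      by (rule quarter_growth_mult_bounded[OF FD(3)[OF e]]) (rule always_eventually, rule allI, rule order_refl)
    then show ?thesis unfolding G_def using quarter_growth_sharp[OF FD(3)[OF e]] by (rule quarter_growth_mult)
  qed
  \<comment> \<open>Both factors \<open>F\<close> and \<open>sharp F\<close> are O(1/z), so
    \<open>G\<close> is O(1/z^2): one order more than a nonzero function with the sign found below
    could have.\<close>
  have G_lim: "((\<lambda>z. z * G z $ i $ i) \<longlongrightarrow> 0) at_infinity" for i
  proof -
    obtain C where C: "eventually (\<lambda>z. norm (F z) \<le> C * norm (inverse z)) at_infinity"
      using holomorphic_S_at_infinity_bigo[OF FD(1,2)] by auto
    have C': "eventually (\<lambda>z. norm (F (cnj z)) \<le> C * norm (inverse (cnj z))) at_infinity"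
      using filterlim_cnj_at_infinity C by (rule eventually_compose_filterlim[rotated])
    have "eventually (\<lambda>z::complex. z \<noteq> 0) at_infinity" by (rule eventually_not_equal_at_infinity)
    then have "eventually (\<lambda>z. norm (z * G z $ i $ i) \<le> (C * norm (corner_mat :: complex ^ ('r + 'r) ^ ('r + 'r)) * C) * norm (inverse z)) at_infinity"
      using C C'
    proof eventually_elim
      case (elim z)
      have "norm (G z $ i $ i) \<le> norm (F z ** corner_mat ** sharp F z)" unfolding G_def by (rule norm_entry_le)
      also have "\<dots> \<le> norm (F z) * norm (corner_mat :: complex ^ ('r + 'r) ^ ('r + 'r)) * norm (sharp F z)"
        by (rule order_trans[OF norm_matrix_mult]) (intro mult_right_mono norm_matrix_mult norm_ge_zero)
      also have "norm (sharp F z) \<le> C * norm (inverse z)" using elim(3) by (simp add: sharp_def norm_inverse)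
      also have "norm (F z) * norm (corner_mat :: complex ^ ('r + 'r) ^ ('r + 'r)) * (C * norm (inverse z))
        \<le> (C * norm (inverse z)) * norm (corner_mat :: complex ^ ('r + 'r) ^ ('r + 'r)) * (C * norm (inverse z))"
        using elim(2) order_trans[OF norm_ge_zero elim(2)] by (intro mult_right_mono) auto
      finally have "norm (z * G z $ i $ i) \<le> norm z * ((C * norm (inverse z)) * norm (corner_mat :: complex ^ ('r + 'r) ^ ('r + 'r)) * (C * norm (inverse z)))"
        by (simp add: norm_mult mult_left_mono mult_right_mono)
      also have "\<dots> = (norm z * norm (inverse z)) * ((C * norm (corner_mat :: complex ^ ('r + 'r) ^ ('r + 'r)) * C) * norm (inverse z))"
        by (simp only: mult_ac)
      also have "norm z * norm (inverse z) = 1" using elim(1) by (simp add: norm_inverse)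
      finally show ?case by simp
    qed
    then show ?thesis by (rule Lim_null_comparison) (rule tendsto_inverse_norm_at_infinity)
  qed
  \<comment> \<open>The swap pairing of \<open>F\<close> with itself is constant and vanishes at
    infinity; it is the sum of \<open>G\<close> and its conjugate reflection.\<close>
  have skew: "G z $ i $ i = - cnj (G (cnj z) $ i $ i)" if "z \<in> S" for z i
  proof -
    have "(F z ** swap_mat ** sharp F z) $ i $ i = 0" using pairing[OF K F F that] by simp
    then show ?thesis by (simp add: sharp_def swap_form G_def eq_neg_iff_add_eq_0)
  qed
  have Gp: "boundary_plus G x (Fm ** W ** corner_mat ** adj Fm)"
    if "boundary_plus F x (Fm ** W)" "boundary_minus F x Fm" for x Fm W
    unfolding G_def by (intro boundary_mult that boundary_const boundary_sharp)
  have Gm: "boundary_minus G x (Fm ** corner_mat ** adj (Fm ** W))"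
    if "boundary_plus F x (Fm ** W)" "boundary_minus F x Fm" for x Fm W
    unfolding G_def by (intro boundary_mult that boundary_const boundary_sharp')
  \<comment> \<open>The band jump moves the second block column of \<open>Fm\<close> into the first
    with a minus sign, so the corner pairing meets its own conjugate entries.\<close>
  have Gband: "(Fm ** band_jump ** corner_mat ** adj Fm) $ i $ i = - complex_of_real (\<Sum>k\<in>UNIV. (norm (Fm $ i $ Inr k))\<^sup>2)"
    for Fm :: "complex ^ ('r + 'r) ^ ('r + 'r)" and i
    unfolding corner_form by (simp add: sum_negf complex_norm_square del: of_real_power)
  have Re_bdry: "\<exists>l. boundary_plus (\<lambda>z. - G z $ i $ i) x l \<and> Re l \<ge> 0" if x: "x \<notin> E" for x i
  proof -
    obtain W where W: "jumps K x W" using jumps_exists[OF x] by blast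
    obtain Fm where Fm: "boundary_plus F x (Fm ** W)" "boundary_minus F x Fm" using FD(4)[OF W] by blast
    define l where "l = (Fm ** W ** corner_mat ** adj Fm) $ i $ i"
    have bp: "boundary_plus (\<lambda>z. G z $ i $ i) x l"
      using Gp[OF Fm] unfolding boundary_plus_def l_def by (intro tendsto_vec_nth)
    have "Re l \<le> 0"
    proof (cases "W = band_jump")
      case True
      have "Re l = - (\<Sum>k\<in>UNIV. (norm (Fm $ i $ Inr k))\<^sup>2)" unfolding l_def True Gband by simp
      then show ?thesis by (simp add: sum_nonneg)
    next
      case False
      have "\<exists>U. W = block_diag U (adj U)"
      proof -
        have "(mat 1 :: complex ^ ('r + 'r) ^ ('r + 'r)) = block_diag (mat 1) (adj (mat 1))"
          by (simp add: block_diag_def mat_1_block)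
        moreover have "W = mat 1 \<or> (\<exists>U. W = block_diag U (adj U))"
          using W False K unfolding jumps_def unitary_data_def by (auto simp: unitary_matrix_inv)
        ultimately show ?thesis by blast
      qed
      then obtain U where U: "W = block_diag U (adj U)" by blast
      \<comment> \<open>Without a jump the boundary value \<open>l\<close> is also the limit from
        below. Skewness then gives \<open>l\<close> = - \<open>cnj l\<close>, so its real part
        vanishes.\<close>
      have bm: "boundary_minus (\<lambda>z. G z $ i $ i) x l"
        using Gm[OF Fm] unfolding boundary_minus_def l_def U corner_form_block_diag by (intro tendsto_vec_nth)
      have "boundary_plus (\<lambda>z. - cnj (G (cnj z) $ i $ i)) x (- cnj l)"
      proof -
        have "boundary_minus (\<lambda>z. (\<chi> i' j'. G z $ i $ i) :: complex ^ 1 ^ 1) x (\<chi> i' j'. l)"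
          using bm unfolding boundary_minus_def tendsto_matrix_iff by simp
        from boundary_sharp[OF this] show ?thesis
          unfolding boundary_plus_def tendsto_matrix_iff by (intro tendsto_minus) (simp add: sharp_def)
      qed
      then have "boundary_plus (\<lambda>z. G z $ i $ i) x (- cnj l)"
        unfolding boundary_plus_def
        by (rule Lim_transform_eventually) (use skew[of _ i] upper_S in \<open>auto simp: eventually_at_filter subset_iff intro!: always_eventually\<close>)
      then have "l = - cnj l" using bp at_upper_ne_bot[of x] unfolding boundary_plus_def by (metis tendsto_unique)
      then have "Re l = Re (- cnj l)" by (rule arg_cong)
      then show ?thesis by simp
    qed
    then show ?thesis using bp unfolding boundary_plus_def by (intro exI[of _ "- l"] conjI tendsto_minus) auto
  qed
  have Gi_hol: "(\<lambda>z. - G z $ i $ i) holomorphic_on S" for i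
    using G_hol by (intro holomorphic_intros) (simp add: mat_holomorphic_on_def)
  have Re_nn: "Re (- G z $ i $ i) \<ge> 0" if "Im z > 0" for z i
  proof (rule Phragmen_Lindelof_upper[where E = E and p = "\<lambda>z. - G z $ i $ i"])
    show "(\<lambda>z. - G z $ i $ i) holomorphic_on {z. 0 < Im z}"
      using Gi_hol upper_S holomorphic_on_subset by blast
    show "((\<lambda>z. - G z $ i $ i) \<longlongrightarrow> 0) at_infinity"
    proof -
      have "((\<lambda>z. inverse z * - (z * G z $ i $ i)) \<longlongrightarrow> 0 * - 0) at_infinity"
        by (intro tendsto_mult tendsto_inverse_0 tendsto_minus G_lim)
      moreover have "eventually (\<lambda>z. inverse z * - (z * G z $ i $ i) = - G z $ i $ i) at_infinity"
        using eventually_not_equal_at_infinity[of "0::complex"] by eventually_elim simp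
      ultimately have "((\<lambda>z. - G z $ i $ i) \<longlongrightarrow> 0 * - 0) at_infinity" by (rule Lim_transform_eventually)
      then show ?thesis by simp
    qed
    fix e assume "e \<in> E"
    then obtain C where "eventually (\<lambda>z. norm (G z) \<le> C * norm (z - complex_of_real e) powr (- 1 / 2))
      (at (complex_of_real e) within S)" using G_growth unfolding half_growth_def by blast
    then have "eventually (\<lambda>z. norm (G z) \<le> C * norm (z - complex_of_real e) powr (- 1 / 2))
      (at (complex_of_real e) within {z. Im z > 0})" by (rule filter_leD[OF at_le[OF upper_S]])
    then have "eventually (\<lambda>z. norm (- G z $ i $ i) \<le> C * norm (z - complex_of_real e) powr (- 1 / 2))
      (at (complex_of_real e) within {z. Im z > 0})"
    proof eventually_elim
      case (elim z)
      have "norm (- G z $ i $ i) \<le> norm (G z)" using norm_entry_le[of "G z" i i] by simp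
      then show ?case using elim by linarith
    qed
    then show "\<exists>C. eventually (\<lambda>z. norm (- G z $ i $ i) \<le> C * norm (z - complex_of_real e) powr (- 1 / 2))
      (at (complex_of_real e) within {z. Im z > 0})" by blast
  qed (use that Re_bdry in auto)
  have G_far: "- G z $ i $ i = 0" if "norm z > R0" for z i
  proof (rule nonneg_Re_decay_imp_zero[OF R0_pos, where p = "\<lambda>z. - G z $ i $ i"])
    show "(\<lambda>z. - G z $ i $ i) holomorphic_on {z. R0 < cmod z}"
      using Gi_hol exterior_S holomorphic_on_subset by blast
    show "((\<lambda>z. z * - G z $ i $ i) \<longlongrightarrow> 0) at_infinity"
      using tendsto_minus[OF G_lim[of i]] by simp
  qed (use that Re_nn in auto)
  have G_upper: "- G z $ i $ i = 0" if "Im z > 0" for z i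
  proof (rule identity_upper[where f = "\<lambda>z. - G z $ i $ i" and U = "{z. Im z > 0} \<inter> {z. norm z > R0}"])
    show "(\<lambda>z. - G z $ i $ i) holomorphic_on {z. 0 < Im z}"
      using Gi_hol upper_S holomorphic_on_subset by blast
    have "\<i> * complex_of_real (R0 + 1) \<in> {z. Im z > 0} \<inter> {z. norm z > R0}"
      using R0_pos by (simp add: norm_mult del: of_real_add)
    then show "{z. Im z > 0} \<inter> {z. norm z > R0} \<noteq> {}" by blast
    show "open ({z. Im z > 0} \<inter> {z. norm z > R0})"
      by (intro open_Int open_upper open_Collect_less continuous_intros)
  qed (use that G_far in auto)
  \<comment> \<open>Now \<open>G\<close> vanishes, and on the band it is minus a sum of squares.
    Hence the second block column of the boundary value from below is zero; the first band
    suffices.\<close>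
  have Fp0: "\<exists>Fm. boundary_plus F x (Fm ** band_jump) \<and> boundary_minus F x Fm \<and> (\<forall>i k. Fm $ i $ Inr k = 0)"
    if x: "a 0 < x" "x < b 0" for x
  proof -
    have W: "jumps K x band_jump" using x unfolding jumps_def by blast
    obtain Fm where Fm: "boundary_plus F x (Fm ** band_jump)" "boundary_minus F x Fm" using FD(4)[OF W] by blast
    have "Fm $ i $ Inr k = 0" for i k
    proof -
      have "((\<lambda>z. G z $ i $ i) \<longlongrightarrow> (Fm ** band_jump ** corner_mat ** adj Fm) $ i $ i) (at (complex_of_real x) within {z. Im z > 0})"
        using Gp[OF Fm] unfolding boundary_plus_def by (intro tendsto_vec_nth)
      moreover have "((\<lambda>z. G z $ i $ i) \<longlongrightarrow> 0) (at (complex_of_real x) within {z. Im z > 0})"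
        by (rule Lim_transform_eventually[OF tendsto_const]) (use G_upper in \<open>simp add: eventually_at_filter\<close>)
      ultimately have "(Fm ** band_jump ** corner_mat ** adj Fm) $ i $ i = 0"
        using at_upper_ne_bot[of x] tendsto_unique by blast
      then have "(\<Sum>k\<in>UNIV. (norm (Fm $ i $ Inr k))\<^sup>2) = 0" unfolding Gband by (simp del: of_real_sum)
      then have "\<forall>k\<in>UNIV. (norm (Fm $ i $ Inr k))\<^sup>2 = 0" by (subst (asm) sum_nonneg_eq_0_iff) auto
      then show ?thesis by simp
    qed
    then show ?thesis using Fm by blast
  qed
  \<comment> \<open>Vanishing in the upper half plane passes to the lower one through the real axis
    to the right of \<open>b g\<close>, where \<open>f\<close> is holomorphic.\<close>
  have zero_S: "f z = 0" if f: "f holomorphic_on S" and up: "\<And>z. Im z > 0 \<Longrightarrow> f z = 0" and z: "z \<in> S" for f :: "complex \<Rightarrow> complex" and z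
  proof -
    define c where "c = complex_of_real (b g + 1)"
    have "c \<in> S" unfolding c_def real_in_S by simp
    then obtain e where e: "e > 0" "ball c e \<subseteq> S" using open_S openE by blast
    have pts: "c - \<i> * complex_of_real (e/2) \<in> ball c e \<inter> {z. Im z < 0}" "c + \<i> * complex_of_real (e/2) \<in> ball c e \<inter> {z. Im z > 0}"
      using e by (auto simp: dist_norm norm_mult c_def)
    have ball0: "f w = 0" if "w \<in> ball c e" for w
    proof (rule analytic_continuation_open[where s = "ball c e \<inter> {z. Im z > 0}" and s' = "ball c e" and g = "\<lambda>z. 0" and f = f])
      show "open (ball c e \<inter> {z. Im z > 0})" by (intro open_Int open_ball open_upper)
      show "ball c e \<inter> {z. Im z > 0} \<noteq> {}" using pts by blast
      show "f holomorphic_on ball c e" using f e(2) holomorphic_on_subset by blast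
    qed (use up that in auto)
    have low: "f w = 0" if "Im w < 0" for w
    proof (rule identity_lower[where f = f and U = "ball c e \<inter> {z. Im z < 0}"])
      show "f holomorphic_on {z. Im z < 0}" using f lower_S holomorphic_on_subset by blast
      show "open (ball c e \<inter> {z. Im z < 0})" by (intro open_Int open_ball open_halfspace_Im_lt)
      show "ball c e \<inter> {z. Im z < 0} \<noteq> {}" using pts by blast
    qed (use ball0 that in auto)
    have "(\<lambda>_. 0) z = f z"
    proof (rule open_agree_off_reals[where W = S and F = "\<lambda>_. 0" and f = f])
      show "0 = f w" if "w \<in> S - \<real>" for w
      proof -
        have "Im w > 0 \<or> Im w < 0" using that by (auto simp: complex_is_Real_iff)
        then show ?thesis using up low by auto
      qed
    qed (use f z in \<open>auto simp: holomorphic_on_imp_continuous_on\<close>)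
    then show ?thesis by simp
  qed
  \<comment> \<open>The jump J carries the second block column from below, known to vanish, to the
    first block column from above.\<close>
  have Inl0: "F z $ i $ Inl k = 0" if "z \<in> S" for z i k
  proof (rule zero_S[of "\<lambda>z. F z $ i $ Inl k", OF _ _ that])
    show hol: "(\<lambda>z. F z $ i $ Inl k) holomorphic_on S" using FD(1) by (simp add: mat_holomorphic_on_def)
    fix w :: complex assume "Im w > 0"
    then show "F w $ i $ Inl k = 0"
    proof (rule zero_boundary_value_imp_zero[OF band_less[of 0, simplified], rotated 2])
      show "(\<lambda>z. F z $ i $ Inl k) holomorphic_on {z. Im z > 0}"
        using hol upper_S holomorphic_on_subset by blast
      fix x assume "a 0 < x" "x < b 0"
      from Fp0[OF this] obtain Fm where Fm: "boundary_plus F x (Fm ** band_jump)" "\<And>i k. Fm $ i $ Inr k = 0" by blast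
      have "boundary_plus (\<lambda>z. F z $ i $ Inl k) x ((Fm ** band_jump) $ i $ Inl k)"
        using Fm(1) unfolding boundary_plus_def by (intro tendsto_vec_nth)
      then show "boundary_plus (\<lambda>z. F z $ i $ Inl k) x 0" using Fm(2) by simp
    qed
  qed
  \<comment> \<open>The second block column has zero boundary values from below. Reflection by
    \<open>sharp\<close> moves it to the upper half plane, where the same uniqueness principle
    applies.\<close>
  have Inr0': "sharp F z $ Inr k $ i = 0" if "z \<in> S" for z i k
  proof (rule zero_S[of "\<lambda>z. sharp F z $ Inr k $ i", OF _ _ that])
    have "mat_holomorphic_on (sharp F) S" using FD(1) cnj_S by (intro mat_holomorphic_on_sharp) auto
    then show hol: "(\<lambda>z. sharp F z $ Inr k $ i) holomorphic_on S" by (simp add: mat_holomorphic_on_def)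
    fix w :: complex assume "Im w > 0"
    then show "sharp F w $ Inr k $ i = 0"
    proof (rule zero_boundary_value_imp_zero[OF band_less[of 0, simplified], rotated 2])
      show "(\<lambda>z. sharp F z $ Inr k $ i) holomorphic_on {z. Im z > 0}"
        using hol upper_S holomorphic_on_subset by blast
      fix x assume "a 0 < x" "x < b 0"
      from Fp0[OF this] obtain Fm where Fm: "boundary_minus F x Fm" "\<And>i k. Fm $ i $ Inr k = 0" by blast
      have "boundary_plus (\<lambda>z. sharp F z $ Inr k $ i) x (adj Fm $ Inr k $ i)"
        using boundary_sharp[OF Fm(1)] unfolding boundary_plus_def by (intro tendsto_vec_nth)
      then show "boundary_plus (\<lambda>z. sharp F z $ Inr k $ i) x 0" using Fm(2) by simp
    qed
  qed
  have "F z $ i $ Inr k = 0" for i k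
    using Inr0'[OF cnj_S[OF z], of k i] by (simp add: sharp_def)
  then show ?thesis using Inl0[OF z] by (simp add: matrix_eq_block_iff)
qed

end

subsection \<open>Laurent splitting on an annulus\<close>

definition annulus :: "complex \<Rightarrow> real \<Rightarrow> real \<Rightarrow> complex set" where
  "annulus c r s = {z. r < norm (z - c) \<and> norm (z - c) < s}"

lemma open_annulus [simp]: "open (annulus c r s)"
  unfolding annulus_def by (intro open_Collect_conj open_Collect_less continuous_intros)

lemma open_exterior [simp]: "open {z. r < norm (z - c)}"
  by (intro open_Collect_less continuous_intros)

text \<open>This is the part of the Laurent expansion with negative powers; the sign is the one the
  inner circle has in Cauchy's formula for an annulus.\<close>

definition cauchy_outer :: "complex \<Rightarrow> real \<Rightarrow> (complex \<Rightarrow> complex) \<Rightarrow> complex \<Rightarrow> complex" where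
  "cauchy_outer c r \<phi> z = - contour_integral (circlepath c r) (\<lambda>s. \<phi> s / (s - z)) / (2 * of_real pi * \<i>)"

text \<open>This is the part with nonnegative powers. Beyond the circle of radius \<open>r2\<close>
  it is continued as the remainder of \<open>\<phi>\<close>, so that it becomes a function on the
  whole disc and not only on the smaller one.\<close>

definition laurent_inner :: "complex \<Rightarrow> real \<Rightarrow> real \<Rightarrow> (complex \<Rightarrow> complex) \<Rightarrow> complex \<Rightarrow> complex" where
  "laurent_inner c r1 r2 \<phi> z =
     (if norm (z - c) < r2 then contour_integral (circlepath c r2) (\<lambda>s. \<phi> s / (s - z)) / (2 * of_real pi * \<i>)
      else \<phi> z - cauchy_outer c r1 \<phi> z)"

lemma circlepath_integrable:
  assumes "continuous_on (sphere c r) \<phi>" "r > 0" "norm (z - c) \<noteq> r"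
  shows "(\<lambda>s. \<phi> s / (s - z)) contour_integrable_on circlepath c r"
proof (rule contour_integrable_continuous_circlepath)
  have "z \<notin> sphere c r" using assms by (simp add: dist_norm norm_minus_commute)
  then show "continuous_on (path_image (circlepath c r)) (\<lambda>s. \<phi> s / (s - z))"
    using assms by (auto intro!: continuous_intros)
qed

lemma cauchy_integral_derivative:
  assumes cont: "continuous_on (sphere c r) \<phi>" and r: "r > 0" and z: "norm (z - c) \<noteq> r"
  shows "(\<lambda>w. contour_integral (circlepath c r) (\<lambda>s. \<phi> s / (s - w))) field_differentiable at z"
proof -
  have int: "((\<lambda>u. \<phi> u / (u - w) ^ 1) has_contour_integral contour_integral (circlepath c r) (\<lambda>s. \<phi> s / (s - w))) (circlepath c r)"
    if "w \<in> UNIV - path_image (circlepath c r)" for w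
    using that r has_contour_integral_integral[OF circlepath_integrable[OF cont r, of w]]
    by (simp add: dist_norm norm_minus_commute)
  have "((\<lambda>w. contour_integral (circlepath c r) (\<lambda>s. \<phi> s / (s - w))) has_field_derivative
     (of_nat 1 * contour_integral (circlepath c r) (\<lambda>u. \<phi> u / (u - z) ^ Suc 1))) (at z)"
    by (rule Cauchy_next_derivative(2)[where S = UNIV and B = "2 * pi * r"])
       (use int r z cont in \<open>auto simp: vector_derivative_circlepath norm_mult dist_norm norm_minus_commute\<close>)
  then show ?thesis unfolding field_differentiable_def by blast
qed

lemma cauchy_outer_holomorphic:
  assumes "continuous_on (sphere c r) \<phi>" "r > 0"
  shows "cauchy_outer c r \<phi> holomorphic_on {z. r < norm (z - c)}"
proof -
  have "(\<lambda>w. contour_integral (circlepath c r) (\<lambda>s. \<phi> s / (s - w))) holomorphic_on {z. r < norm (z - c)}"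
    unfolding holomorphic_on_open[OF open_exterior] field_differentiable_def[symmetric]
    using cauchy_integral_derivative[OF assms] by auto
  then show ?thesis unfolding cauchy_outer_def by (intro holomorphic_intros) auto
qed

lemma cauchy_outer_bound:
  assumes cont: "continuous_on (sphere c r) \<phi>" and r: "r > 0" and B: "\<And>s. norm (s - c) = r \<Longrightarrow> norm (\<phi> s) \<le> B"
    and z: "norm (z - c) > r"
  shows "norm (cauchy_outer c r \<phi> z) \<le> B * r / (norm (z - c) - r)"
proof -
  have "norm (\<phi> (c + complex_of_real r)) \<le> B" using B[of "c + complex_of_real r"] r by simp
  then have B0: "B \<ge> 0" by (rule order_trans[OF norm_ge_zero])
  have "norm (contour_integral (circlepath c r) (\<lambda>s. \<phi> s / (s - z))) \<le> (B / (norm (z - c) - r)) * (2 * pi * r)"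
  proof (rule has_contour_integral_bound_circlepath)
    show "((\<lambda>s. \<phi> s / (s - z)) has_contour_integral contour_integral (circlepath c r) (\<lambda>s. \<phi> s / (s - z))) (circlepath c r)"
      using z by (intro has_contour_integral_integral circlepath_integrable cont r) auto
    fix s assume s: "norm (s - c) = r"
    have "norm (z - c) \<le> norm (s - z) + norm (s - c)"
      using norm_triangle_ineq4[of "s - c" "s - z"] by (simp add: algebra_simps)
    then have "norm (z - c) - r \<le> norm (s - z)" using s by linarith
    then show "norm (\<phi> s / (s - z)) \<le> B / (norm (z - c) - r)"
      using B[OF s] B0 z by (simp add: norm_divide frac_le)
  qed (use B0 z r in auto)
  then show ?thesis using r by (simp add: cauchy_outer_def norm_divide norm_mult field_simps)
qed

lemma cauchy_outer_at_infinity: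
  assumes cont: "continuous_on (sphere c r) \<phi>" and r: "r > 0"
  shows "(cauchy_outer c r \<phi> \<longlongrightarrow> 0) at_infinity"
proof -
  have "bounded (\<phi> ` sphere c r)" by (intro compact_imp_bounded compact_continuous_image cont) simp
  then obtain B where "\<forall>x\<in>sphere c r. norm (\<phi> x) \<le> B" unfolding bounded_iff by blast
  then have B: "norm (\<phi> s) \<le> B" if "norm (s - c) = r" for s
    using that by (auto simp: dist_norm norm_minus_commute)
  show ?thesis
  proof (rule Lim_null_comparison)
    have "filterlim (\<lambda>z. - c + z) at_infinity at_infinity"
      by (rule tendsto_add_filterlim_at_infinity[OF tendsto_const filterlim_ident])
    then have top: "filterlim (\<lambda>z. norm (z - c)) at_top at_infinity"
      by (simp add: filterlim_at_infinity_conv_norm_at_top)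
    then have "eventually (\<lambda>z. norm (z - c) > r) at_infinity" by (simp add: filterlim_at_top_dense)
    then show "eventually (\<lambda>z. norm (cauchy_outer c r \<phi> z) \<le> B * r / (norm (z - c) - r)) at_infinity"
      by eventually_elim (rule cauchy_outer_bound[OF cont r B])
    have "filterlim (\<lambda>z. - r + norm (z - c)) at_top at_infinity"
      by (rule filterlim_tendsto_add_at_top[OF tendsto_const top])
    then have "filterlim (\<lambda>z. norm (z - c) - r) at_infinity at_infinity"
      by (intro filterlim_at_top_imp_at_infinity) simp
    then show "((\<lambda>z. B * r / (norm (z - c) - r)) \<longlongrightarrow> 0) at_infinity"
      by (intro tendsto_divide_0[OF tendsto_const])
  qed
qed

text \<open>The two circles are homotopic along rays: the segment joining points of equal angle
  stays in the annulus.\<close>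

lemma contour_integral_circlepath_annulus:
  assumes hol: "f holomorphic_on annulus c r0 \<rho>" and r: "0 < r0" "r0 < r1" "r1 \<le> r2" "r2 < \<rho>"
  shows "contour_integral (circlepath c r1) f = contour_integral (circlepath c r2) f"
proof (rule Cauchy_theorem_homotopic_loops[OF _ open_annulus hol])
  show "homotopic_loops (annulus c r0 \<rho>) (circlepath c r1) (circlepath c r2)"
  proof (rule homotopic_loops_linear)
    fix t :: real
    show "closed_segment (circlepath c r1 t) (circlepath c r2 t) \<subseteq> annulus c r0 \<rho>"
    proof
      fix z assume "z \<in> closed_segment (circlepath c r1 t) (circlepath c r2 t)"
      then obtain u where u: "0 \<le> u" "u \<le> 1" "z = (1 - u) *\<^sub>R circlepath c r1 t + u *\<^sub>R circlepath c r2 t"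
        by (auto simp: in_segment)
      have "z - c = complex_of_real ((1 - u) * r1 + u * r2) * exp (2 * of_real pi * \<i> * of_real t)"
        unfolding u(3) by (simp add: circlepath scaleR_conv_of_real algebra_simps)
      then have "norm (z - c) = \<bar>(1 - u) * r1 + u * r2\<bar>" by (simp add: norm_mult norm_exp_eq_Re del: of_real_add)
      moreover have "r1 \<le> (1 - u) * r1 + u * r2" "(1 - u) * r1 + u * r2 \<le> r2"
      proof -
        have "u * (r2 - r1) \<ge> 0" "(1 - u) * (r2 - r1) \<ge> 0" using u r by auto
        then show "r1 \<le> (1 - u) * r1 + u * r2" "(1 - u) * r1 + u * r2 \<le> r2" by (simp_all add: algebra_simps)
      qed
      ultimately show "z \<in> annulus c r0 \<rho>" using r by (auto simp: annulus_def)
    qed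
  qed auto
qed auto

lemma laurent_split_aux:
  assumes hol: "\<phi> holomorphic_on annulus c r0 \<rho>" and r: "0 < r0" "r0 < r1" "r1 < r2" "r2 < \<rho>"
    and z: "r1 < norm (z - c)" "norm (z - c) < r2"
  shows "\<phi> z = contour_integral (circlepath c r2) (\<lambda>s. \<phi> s / (s - z)) / (2 * of_real pi * \<i>) + cauchy_outer c r1 \<phi> z"
proof -
  have zA: "z \<in> annulus c r0 \<rho>" using z r by (auto simp: annulus_def)
  \<comment> \<open>The difference quotient is holomorphic at \<open>z\<close> too, so its integrals
    over both circles agree. Separating the term \<open>\<phi> z\<close> leaves the winding numbers
    1 and 0 of the outer and the inner circle.\<close>
  define h where "h s = (if s = z then deriv \<phi> z else (\<phi> s - \<phi> z) / (s - z))" for s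
  have h: "h holomorphic_on annulus c r0 \<rho>"
    unfolding h_def by (rule pole_lemma_open[OF hol open_annulus])
  have cont: "continuous_on (sphere c r1) \<phi>" "continuous_on (sphere c r2) \<phi>"
    by (rule continuous_on_subset[OF holomorphic_on_imp_continuous_on[OF hol]];
        use r in \<open>auto simp: annulus_def dist_norm norm_minus_commute\<close>)+
  have split: "contour_integral (circlepath c s) h = contour_integral (circlepath c s) (\<lambda>u. \<phi> u / (u - z)) -
      \<phi> z * contour_integral (circlepath c s) (\<lambda>u. 1 / (u - z))"
    if s: "s > 0" "norm (z - c) \<noteq> s" "continuous_on (sphere c s) \<phi>" for s
  proof -
    have i1: "(\<lambda>u. \<phi> u / (u - z)) contour_integrable_on circlepath c s"
      by (rule circlepath_integrable[OF s(3,1,2)])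
    have i2: "(\<lambda>u. 1 / (u - z)) contour_integrable_on circlepath c s"
      by (rule circlepath_integrable[OF continuous_on_const s(1,2)])
    have "contour_integral (circlepath c s) h = contour_integral (circlepath c s) (\<lambda>u. \<phi> u / (u - z) - \<phi> z * (1 / (u - z)))"
    proof (rule contour_integral_cong)
      fix u assume "u \<in> path_image (circlepath c s)"
      then have "u \<noteq> z" using s by (auto simp: dist_norm norm_minus_commute)
      then show "h u = \<phi> u / (u - z) - \<phi> z * (1 / (u - z))" by (simp add: h_def diff_divide_distrib)
    qed simp
    also have "\<dots> = contour_integral (circlepath c s) (\<lambda>u. \<phi> u / (u - z)) -
      contour_integral (circlepath c s) (\<lambda>u. \<phi> z * (1 / (u - z)))"
      by (intro contour_integral_diff i1 contour_integrable_lmul i2)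
    also have "contour_integral (circlepath c s) (\<lambda>u. \<phi> z * (1 / (u - z))) = \<phi> z * contour_integral (circlepath c s) (\<lambda>u. 1 / (u - z))"
      by (rule contour_integral_lmul[OF i2])
    finally show ?thesis .
  qed
  have "contour_integral (circlepath c r1) h = contour_integral (circlepath c r2) h"
    using r by (intro contour_integral_circlepath_annulus[OF h]) auto
  moreover have "contour_integral (circlepath c r2) (\<lambda>u. 1 / (u - z)) = 2 * of_real pi * \<i>"
  proof -
    have "((\<lambda>u. 1 / (u - z)) has_contour_integral (2 * of_real pi * \<i> * 1)) (circlepath c r2)"
      using z(2) by (intro Cauchy_integral_circlepath_simple holomorphic_on_const)
    then show ?thesis using contour_integral_unique by force
  qed
  moreover have "contour_integral (circlepath c r1) (\<lambda>u. 1 / (u - z)) = 0"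
  proof (rule contour_integral_unique, rule Cauchy_theorem_convex_simple[where S = "cball c r1"])
    show "(\<lambda>u. 1 / (u - z)) holomorphic_on cball c r1"
      using z by (intro holomorphic_intros) (auto simp: dist_norm norm_minus_commute)
  qed (use r in auto)
  ultimately have "\<phi> z * (2 * of_real pi * \<i>) = contour_integral (circlepath c r2) (\<lambda>u. \<phi> u / (u - z)) - contour_integral (circlepath c r1) (\<lambda>u. \<phi> u / (u - z))"
    using split[of r1] split[of r2] cont r z by (simp add: algebra_simps)
  then have "\<phi> z = (contour_integral (circlepath c r2) (\<lambda>u. \<phi> u / (u - z)) - contour_integral (circlepath c r1) (\<lambda>u. \<phi> u / (u - z))) / (2 * of_real pi * \<i>)"
    by (simp add: nonzero_eq_divide_eq)
  then show ?thesis by (simp add: cauchy_outer_def diff_divide_distrib)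
qed

lemma laurent_split:
  assumes hol: "\<phi> holomorphic_on annulus c r0 \<rho>" and r: "0 < r0" "r0 < r1" "r1 < r2" "r2 < \<rho>"
    and z: "r1 < norm (z - c)"
  shows "\<phi> z = laurent_inner c r1 r2 \<phi> z + cauchy_outer c r1 \<phi> z"
  using laurent_split_aux[OF hol r z] by (simp add: laurent_inner_def)

lemma continuous_on_sphere_annulus:
  assumes "\<phi> holomorphic_on annulus c r0 \<rho>" "r0 < r" "r < \<rho>"
  shows "continuous_on (sphere c r) \<phi>"
  by (rule continuous_on_subset[OF holomorphic_on_imp_continuous_on[OF assms(1)]])
     (use assms(2,3) in \<open>auto simp: annulus_def dist_norm norm_minus_commute\<close>)

lemma laurent_inner_holomorphic:
  assumes hol: "\<phi> holomorphic_on annulus c r0 \<rho>" and r: "0 < r0" "r0 < r1" "r1 < r2" "r2 < \<rho>"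
  shows "laurent_inner c r1 r2 \<phi> holomorphic_on ball c \<rho>"
proof -
  have "laurent_inner c r1 r2 \<phi> holomorphic_on ball c r2 \<union> annulus c r1 \<rho>"
  proof (rule holomorphic_on_Un)
    have "(\<lambda>w. contour_integral (circlepath c r2) (\<lambda>s. \<phi> s / (s - w))) holomorphic_on ball c r2"
      unfolding holomorphic_on_open[OF open_ball] field_differentiable_def[symmetric]
      using r by (intro ballI cauchy_integral_derivative continuous_on_sphere_annulus[OF hol])
        (auto simp: dist_norm norm_minus_commute)
    then have "(\<lambda>w. contour_integral (circlepath c r2) (\<lambda>s. \<phi> s / (s - w)) / (2 * of_real pi * \<i>)) holomorphic_on ball c r2"
      by (intro holomorphic_intros) auto
    then show "laurent_inner c r1 r2 \<phi> holomorphic_on ball c r2"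
      by (rule holomorphic_transform) (auto simp: laurent_inner_def dist_norm norm_minus_commute)
    have "(\<lambda>z. \<phi> z - cauchy_outer c r1 \<phi> z) holomorphic_on annulus c r1 \<rho>"
    proof (intro holomorphic_intros)
      show "\<phi> holomorphic_on annulus c r1 \<rho>"
        by (rule holomorphic_on_subset[OF hol]) (use r in \<open>auto simp: annulus_def\<close>)
      have "cauchy_outer c r1 \<phi> holomorphic_on {z. r1 < norm (z - c)}"
        using r by (intro cauchy_outer_holomorphic continuous_on_sphere_annulus[OF hol]) auto
      then show "cauchy_outer c r1 \<phi> holomorphic_on annulus c r1 \<rho>"
        by (rule holomorphic_on_subset) (auto simp: annulus_def)
    qed
    then show "laurent_inner c r1 r2 \<phi> holomorphic_on annulus c r1 \<rho>"
    proof (rule holomorphic_transform)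
      fix z assume "z \<in> annulus c r1 \<rho>"
      then show "\<phi> z - cauchy_outer c r1 \<phi> z = laurent_inner c r1 r2 \<phi> z"
        using laurent_split[OF hol r, of z] by (simp add: annulus_def)
    qed
  qed auto
  moreover have "ball c \<rho> \<subseteq> ball c r2 \<union> annulus c r1 \<rho>"
    using r by (auto simp: annulus_def dist_norm norm_minus_commute)
  ultimately show ?thesis using holomorphic_on_subset by blast
qed

text \<open>Beyond \<open>r2\<close> the outer part is bounded by the distance
  \<open>r2 - r1\<close> to its circle of integration; inside, the maximum principle takes over. The
  constant depends on the radii only, which makes the splitting usable in a contraction.\<close>

lemma laurent_inner_bound:
  assumes hol: "\<phi> holomorphic_on annulus c r0 \<rho>" and r: "0 < r0" "r0 < r1" "r1 < r2" "r2 < \<rho>"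
    and B: "\<And>z. r1 \<le> norm (z - c) \<Longrightarrow> norm (z - c) < \<rho> \<Longrightarrow> norm (\<phi> z) \<le> B" and z: "z \<in> ball c \<rho>"
  shows "norm (laurent_inner c r1 r2 \<phi> z) \<le> (1 + r1 / (r2 - r1)) * B"
proof -
  have "norm (\<phi> (c + complex_of_real r1)) \<le> B" using B[of "c + complex_of_real r1"] r by simp
  then have B0: "B \<ge> 0" by (rule order_trans[OF norm_ge_zero])
  have far: "norm (laurent_inner c r1 r2 \<phi> z) \<le> (1 + r1 / (r2 - r1)) * B"
    if z: "r2 \<le> norm (z - c)" "norm (z - c) < \<rho>" for z
  proof -
    have "norm (cauchy_outer c r1 \<phi> z) \<le> B * r1 / (norm (z - c) - r1)"
      by (rule cauchy_outer_bound[OF continuous_on_sphere_annulus[OF hol]]) (use r z B in auto)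
    also have "\<dots> \<le> B * r1 / (r2 - r1)" using r z B0 by (intro divide_left_mono) auto
    finally have "norm (cauchy_outer c r1 \<phi> z) \<le> B * r1 / (r2 - r1)" .
    moreover have "norm (\<phi> z) \<le> B" using B[of z] r z by simp
    ultimately have "norm (\<phi> z - cauchy_outer c r1 \<phi> z) \<le> B + B * r1 / (r2 - r1)"
      using norm_triangle_ineq4[of "\<phi> z" "cauchy_outer c r1 \<phi> z"] by linarith
    then show ?thesis using z by (simp add: laurent_inner_def algebra_simps)
  qed
  show ?thesis
  proof (cases "norm (z - c) < r2")
    case False
    then show ?thesis using far[of z] z by (simp add: dist_norm norm_minus_commute)
  next
    case True
    have hol': "laurent_inner c r1 r2 \<phi> holomorphic_on ball c \<rho>" by (rule laurent_inner_holomorphic[OF hol r])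
    show ?thesis
    proof (rule maximum_modulus_frontier[where f = "laurent_inner c r1 r2 \<phi>" and S = "cball c r2"])
      show "laurent_inner c r1 r2 \<phi> holomorphic_on interior (cball c r2)"
        by (rule holomorphic_on_subset[OF hol']) (use r in auto)
      show "continuous_on (closure (cball c r2)) (laurent_inner c r1 r2 \<phi>)"
        by (rule continuous_on_subset[OF holomorphic_on_imp_continuous_on[OF hol']]) (use r in auto)
      show "norm (laurent_inner c r1 r2 \<phi> w) \<le> (1 + r1 / (r2 - r1)) * B" if "w \<in> frontier (cball c r2)" for w
        using far[of w] that r by (simp add: dist_norm norm_minus_commute)
    qed (use True in \<open>auto simp: dist_norm norm_minus_commute\<close>)
  qed
qed

lemma laurent_inner_diff:
  assumes hol: "\<phi> holomorphic_on annulus c r0 \<rho>" "\<psi> holomorphic_on annulus c r0 \<rho>"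
    and r: "0 < r0" "r0 < r1" "r1 < r2" "r2 < \<rho>"
  shows "laurent_inner c r1 r2 (\<lambda>z. \<phi> z - \<psi> z) z = laurent_inner c r1 r2 \<phi> z - laurent_inner c r1 r2 \<psi> z"
proof -
  have int: "contour_integral (circlepath c s) (\<lambda>u. (\<phi> u - \<psi> u) / (u - z)) =
     contour_integral (circlepath c s) (\<lambda>u. \<phi> u / (u - z)) - contour_integral (circlepath c s) (\<lambda>u. \<psi> u / (u - z))"
    if "r0 < s" "s < \<rho>" "norm (z - c) \<noteq> s" for s
  proof -
    have "s > 0" using that r by linarith
    then show ?thesis unfolding diff_divide_distrib
      using that hol by (intro contour_integral_diff circlepath_integrable continuous_on_sphere_annulus)
  qed
  show ?thesis
  proof (cases "norm (z - c) < r2")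
    case True
    then show ?thesis using int[of r2] r by (simp add: laurent_inner_def diff_divide_distrib)
  next
    case False
    then show ?thesis using int[of r1] r by (simp add: laurent_inner_def cauchy_outer_def diff_divide_distrib)
  qed
qed

definition mat_laurent_inner :: "complex \<Rightarrow> real \<Rightarrow> real \<Rightarrow> (complex \<Rightarrow> complex ^ 'n ^ 'm) \<Rightarrow> complex \<Rightarrow> complex ^ 'n ^ 'm" where
  "mat_laurent_inner c r1 r2 \<phi> z = (\<chi> i j. laurent_inner c r1 r2 (\<lambda>z. \<phi> z $ i $ j) z)"

lemma mat_laurent_inner_holomorphic:
  assumes "mat_holomorphic_on \<phi> (annulus c r0 \<rho>)" "0 < r0" "r0 < r1" "r1 < r2" "r2 < \<rho>"
  shows "mat_holomorphic_on (mat_laurent_inner c r1 r2 \<phi>) (ball c \<rho>)"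
  using assms unfolding mat_holomorphic_on_def mat_laurent_inner_def
  by (auto intro!: laurent_inner_holomorphic[of _ c r0 \<rho> r1 r2])

lemma mat_laurent_inner_bound:
  fixes \<phi> :: "complex \<Rightarrow> complex ^ 'n ^ 'm"
  assumes hol: "mat_holomorphic_on \<phi> (annulus c r0 \<rho>)" and r: "0 < r0" "r0 < r1" "r1 < r2" "r2 < \<rho>"
    and B: "\<And>z. r1 \<le> norm (z - c) \<Longrightarrow> norm (z - c) < \<rho> \<Longrightarrow> norm (\<phi> z) \<le> B" and z: "z \<in> ball c \<rho>"
  shows "norm (mat_laurent_inner c r1 r2 \<phi> z) \<le> real (CARD('m) * CARD('n)) * (1 + r1 / (r2 - r1)) * B"
proof -
  have "norm (mat_laurent_inner c r1 r2 \<phi> z $ i $ j) \<le> (1 + r1 / (r2 - r1)) * B" for i j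
  proof -
    have "norm (laurent_inner c r1 r2 (\<lambda>z. \<phi> z $ i $ j) z) \<le> (1 + r1 / (r2 - r1)) * B"
    proof (rule laurent_inner_bound[OF _ r _ z])
      show "(\<lambda>z. \<phi> z $ i $ j) holomorphic_on annulus c r0 \<rho>" using hol by (simp add: mat_holomorphic_on_def)
      show "norm (\<phi> w $ i $ j) \<le> B" if "r1 \<le> norm (w - c)" "norm (w - c) < \<rho>" for w
        using B[OF that] norm_entry_le[of "\<phi> w" i j] by linarith
    qed
    then show ?thesis by (simp add: mat_laurent_inner_def)
  qed
  then show ?thesis unfolding mult.assoc[of "real (CARD('m) * CARD('n))"] by (rule norm_matrix_le_entries)
qed

lemma mat_laurent_inner_diff:
  assumes "mat_holomorphic_on \<phi> (annulus c r0 \<rho>)" "mat_holomorphic_on \<psi> (annulus c r0 \<rho>)"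
    and r: "0 < r0" "r0 < r1" "r1 < r2" "r2 < \<rho>"
  shows "mat_laurent_inner c r1 r2 (\<lambda>z. \<phi> z - \<psi> z) z = mat_laurent_inner c r1 r2 \<phi> z - mat_laurent_inner c r1 r2 \<psi> z"
  using assms(1,2) laurent_inner_diff[OF _ _ r]
  by (simp add: mat_laurent_inner_def vec_eq_iff mat_holomorphic_on_def)

lemma mat_holomorphic_on_diff:
  "mat_holomorphic_on F S \<Longrightarrow> mat_holomorphic_on G S \<Longrightarrow> mat_holomorphic_on (\<lambda>z. F z - G z) S"
  by (auto simp: mat_holomorphic_on_def intro!: holomorphic_intros)

lemma mat_holomorphic_on_uniform_limit:
  fixes f :: "nat \<Rightarrow> complex \<Rightarrow> complex ^ 'n ^ 'm"
  assumes "open S" "\<And>n. mat_holomorphic_on (f n) S" "uniform_limit S f l sequentially"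
  shows "mat_holomorphic_on l S"
  unfolding mat_holomorphic_on_def
proof (intro allI)
  fix i j
  show "(\<lambda>z. l z $ i $ j) holomorphic_on S"
  proof (rule holomorphic_uniform_sequence[OF \<open>open S\<close>, where f = "\<lambda>n z. f n z $ i $ j"])
  fix n show "(\<lambda>z. f n z $ i $ j) holomorphic_on S" using assms(2) by (simp add: mat_holomorphic_on_def)
next
  fix x assume "x \<in> S"
  then obtain d where d: "d > 0" "cball x d \<subseteq> S" using \<open>open S\<close> open_contains_cball by blast
  have "uniform_limit (cball x d) f l sequentially" by (rule uniform_limit_on_subset[OF assms(3) d(2)])
  then have ul: "\<forall>e>0. \<forall>\<^sub>F n in sequentially. \<forall>x\<in>cball x d. dist (f n x) (l x) < e"
    by (simp only: uniform_limit_iff)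
  have "uniform_limit (cball x d) (\<lambda>n z. f n z $ i $ j) (\<lambda>z. l z $ i $ j) sequentially"
    unfolding uniform_limit_iff
  proof (intro allI impI)
    fix e :: real assume "e > 0"
    with ul have "\<forall>\<^sub>F n in sequentially. \<forall>x\<in>cball x d. dist (f n x) (l x) < e" by blast
    then show "\<forall>\<^sub>F n in sequentially. \<forall>x\<in>cball x d. dist (f n x $ i $ j) (l x $ i $ j) < e"
    proof eventually_elim
      case (elim n)
      show ?case
      proof
        fix y assume "y \<in> cball x d"
        then have "norm (f n y - l y) < e" using elim by (simp add: dist_norm)
        then show "dist (f n y $ i $ j) (l y $ i $ j) < e"
          using norm_entry_le[of "f n y - l y" i j] by (simp add: dist_norm)
      qed
    qed
  qed
  then show "\<exists>d>0. cball x d \<subseteq> S \<and> uniform_limit (cball x d) (\<lambda>n z. f n z $ i $ j) (\<lambda>z. l z $ i $ j) sequentially"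
    using d by blast
  qed
qed

text \<open>Splitting \<open>u ** (G - 1)\<close> into its inner and outer Laurent parts turns the factorization into
  the fixed point equation \<open>u = 1 - (inner part of u ** (G - 1))\<close>, a contraction for \<open>G\<close> near 1.\<close>

lemma near_identity_factorization:
  fixes c :: complex
  assumes r: "0 < r0" "r0 < r1" "r1 < r2" "r2 < \<rho>"
  shows "\<exists>\<epsilon>>0. \<forall>G :: complex \<Rightarrow> complex ^ 'n ^ 'n. mat_holomorphic_on G (annulus c r0 \<rho>) \<longrightarrow>
     (\<forall>z\<in>annulus c r0 \<rho>. norm (G z - mat 1) \<le> \<epsilon>) \<longrightarrow>
     (\<exists>u w. mat_holomorphic_on u (ball c \<rho>) \<and> mat_holomorphic_on w {z. r1 < norm (z - c)} \<and>
        (w \<longlongrightarrow> mat 1) at_infinity \<and> (\<forall>z\<in>annulus c r1 \<rho>. w z = u z ** G z))"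
proof -
  \<comment> \<open>\<open>\<kappa>\<close> bounds the matrix splitting operator in the supremum
    norm. The choice \<open>1 / (2 * \<kappa>)\<close> below makes \<open>Q\<close> a contraction
    with factor 1/2.\<close>
  define \<kappa> where "\<kappa> = real (CARD('n) * CARD('n)) * (1 + r1 / (r2 - r1))"
  have "1 + r1 / (r2 - r1) > 0" using r by (intro add_pos_nonneg divide_nonneg_nonneg) auto
  then have \<kappa>: "\<kappa> > 0" unfolding \<kappa>_def by (intro mult_pos_pos) auto
  show ?thesis
  proof (intro exI[of _ "1 / (2 * \<kappa>)"] conjI allI impI)
    show "1 / (2 * \<kappa>) > 0" using \<kappa> by simp
    fix G :: "complex \<Rightarrow> complex ^ 'n ^ 'n"
    assume hol: "mat_holomorphic_on G (annulus c r0 \<rho>)" and "\<forall>z\<in>annulus c r0 \<rho>. norm (G z - mat 1) \<le> 1 / (2 * \<kappa>)"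
    define \<Delta> where "\<Delta> z = G z - mat 1" for z
    have \<Delta>: "norm (\<Delta> z) \<le> 1 / (2 * \<kappa>)" if "z \<in> annulus c r0 \<rho>" for z
      unfolding \<Delta>_def using \<open>\<forall>z\<in>_. _\<close> that by blast
    have \<Delta>_hol: "mat_holomorphic_on \<Delta> (annulus c r0 \<rho>)"
      unfolding \<Delta>_def by (intro mat_holomorphic_on_diff hol mat_holomorphic_on_const)
    have sub: "annulus c r0 \<rho> \<subseteq> ball c \<rho>" by (auto simp: annulus_def dist_norm norm_minus_commute)
    define Q where "Q v = mat_laurent_inner c r1 r2 (\<lambda>z. v z ** \<Delta> z)" for v :: "complex \<Rightarrow> complex ^ 'n ^ 'n"
    have v\<Delta>: "mat_holomorphic_on (\<lambda>z. v z ** \<Delta> z) (annulus c r0 \<rho>)" if "mat_holomorphic_on v (ball c \<rho>)" for v :: "complex \<Rightarrow> complex ^ 'n ^ 'n"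
      by (intro mat_holomorphic_on_mult \<Delta>_hol mat_holomorphic_on_subset[OF that sub])
    have Q_hol: "mat_holomorphic_on (Q v) (ball c \<rho>)" if "mat_holomorphic_on v (ball c \<rho>)" for v
      unfolding Q_def by (rule mat_laurent_inner_holomorphic[OF v\<Delta>[OF that] r])
    have Q_bound: "norm (Q v z) \<le> B / 2"
      if v: "mat_holomorphic_on v (ball c \<rho>)" and B: "\<And>z. z \<in> ball c \<rho> \<Longrightarrow> norm (v z) \<le> B" and z: "z \<in> ball c \<rho>" for v B z
    proof -
      have "norm (Q v z) \<le> real (CARD('n) * CARD('n)) * (1 + r1 / (r2 - r1)) * (B * (1 / (2 * \<kappa>)))"
        unfolding Q_def
      proof (rule mat_laurent_inner_bound[OF v\<Delta>[OF v] r _ z])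
        fix w assume w: "r1 \<le> norm (w - c)" "norm (w - c) < \<rho>"
        then have wA: "w \<in> annulus c r0 \<rho>" using r by (auto simp: annulus_def)
        have wb: "norm (v w) \<le> B" using B sub wA by blast
        have "norm (v w ** \<Delta> w) \<le> norm (v w) * norm (\<Delta> w)" by (rule norm_matrix_mult)
        also have "\<dots> \<le> B * (1 / (2 * \<kappa>))"
          by (intro mult_mono wb \<Delta>[OF wA] norm_ge_zero order_trans[OF norm_ge_zero wb])
        finally show "norm (v w ** \<Delta> w) \<le> B * (1 / (2 * \<kappa>))" .
      qed
      also have "\<dots> = B / 2" using \<kappa> unfolding \<kappa>_def[symmetric] by simp
      finally show ?thesis .
    qed
    have Q_diff: "Q v z - Q v' z = Q (\<lambda>z. v z - v' z) z"
      if "mat_holomorphic_on v (ball c \<rho>)" "mat_holomorphic_on v' (ball c \<rho>)" for v v' z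
    proof -
      have "(\<lambda>z. (v z - v' z) ** \<Delta> z) = (\<lambda>z. v z ** \<Delta> z - v' z ** \<Delta> z)"
        by (simp add: bounded_bilinear.diff_left[OF bounded_bilinear_matrix_mult])
      then show ?thesis unfolding Q_def using mat_laurent_inner_diff[OF v\<Delta>[OF that(1)] v\<Delta>[OF that(2)] r, of z] by simp
    qed
    \<comment> \<open>The fixed point is constructed by Picard iteration from the constant function
      1. The norm \<open>N1\<close> of the identity appears because the Frobenius norm of the
      identity need not be 1.\<close>
    define U where "U = rec_nat (\<lambda>z. mat 1 :: complex ^ 'n ^ 'n) (\<lambda>_ v z. mat 1 - Q v z)"
    have U0: "U 0 z = mat 1" and U_Suc: "U (Suc n) z = mat 1 - Q (U n) z" for n z by (simp_all add: U_def)
    have U_hol: "mat_holomorphic_on (U n) (ball c \<rho>)" for n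
    proof (induction n)
      case 0
      show ?case by (rule mat_holomorphic_on_cong[OF _ mat_holomorphic_on_const]) (simp add: U0)
    next
      case (Suc n)
      show ?case
        by (rule mat_holomorphic_on_cong[OF _ mat_holomorphic_on_diff[OF mat_holomorphic_on_const Q_hol[OF Suc]]])
           (simp add: U_Suc)
    qed
    define N1 where "N1 = norm (mat 1 :: complex ^ 'n ^ 'n)"
    have step: "norm (U (Suc n) z - U n z) \<le> N1 * (1 / 2) ^ Suc n" if "z \<in> ball c \<rho>" for n z
      using that
    proof (induction n arbitrary: z)
      case 0
      have "norm (Q (U 0) z) \<le> N1 / 2" by (rule Q_bound[OF U_hol _ 0]) (simp add: U0 N1_def)
      then show ?case by (simp add: U_Suc U0)
    next
      case (Suc n)
      have "U (Suc (Suc n)) z - U (Suc n) z = - (Q (U (Suc n)) z - Q (U n) z)" by (simp add: U_Suc)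
      also have "\<dots> = - Q (\<lambda>z. U (Suc n) z - U n z) z" by (simp only: Q_diff[OF U_hol U_hol])
      finally have "norm (U (Suc (Suc n)) z - U (Suc n) z) = norm (Q (\<lambda>z. U (Suc n) z - U n z) z)" by simp
      also have "\<dots> \<le> (N1 * (1 / 2) ^ Suc n) / 2"
        by (rule Q_bound[OF mat_holomorphic_on_diff[OF U_hol U_hol] Suc.IH Suc.prems])
      finally show ?case by simp
    qed
    define u where "u z = U 0 z + (\<Sum>n. U (Suc n) z - U n z)" for z
    have "uniform_limit (ball c \<rho>) (\<lambda>n z. \<Sum>i<n. U (Suc i) z - U i z) (\<lambda>z. \<Sum>n. U (Suc n) z - U n z) sequentially"
    proof (rule Weierstrass_m_test[where M = "\<lambda>n. N1 * (1 / 2) ^ Suc n"])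
      show "summable (\<lambda>n. N1 * (1 / 2) ^ Suc n)" by (intro summable_mult summable_ignore_initial_segment[of _ 1, simplified] summable_geometric) simp
    qed (rule step)
    then have "uniform_limit (ball c \<rho>) (\<lambda>n z. U 0 z + (\<Sum>i<n. U (Suc i) z - U i z)) u sequentially"
      unfolding u_def by (intro uniform_limit_add uniform_limit_const)
    moreover have "U 0 z + (\<Sum>i<n. U (Suc i) z - U i z) = U n z" for n z
      using sum_lessThan_telescope[of "\<lambda>i. U i z" n] by simp
    ultimately have ulim: "uniform_limit (ball c \<rho>) U u sequentially" by simp
    have u_hol: "mat_holomorphic_on u (ball c \<rho>)"
      by (rule mat_holomorphic_on_uniform_limit[OF open_ball U_hol ulim])
    have fix_eq: "u z = mat 1 - Q u z" if z: "z \<in> ball c \<rho>" for z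
    proof -
      have "(\<lambda>n. Q (U n) z) \<longlonglongrightarrow> Q u z"
        unfolding tendsto_iff
      proof (intro allI impI)
        fix e :: real assume "e > 0"
        have "eventually (\<lambda>n. \<forall>z\<in>ball c \<rho>. dist (U n z) (u z) < e) sequentially"
          using ulim \<open>e > 0\<close> by (simp add: uniform_limit_iff)
        then show "eventually (\<lambda>n. dist (Q (U n) z) (Q u z) < e) sequentially"
        proof eventually_elim
          case (elim n)
          have "norm (Q (\<lambda>z. U n z - u z) z) \<le> e / 2"
            using elim by (intro Q_bound[OF mat_holomorphic_on_diff[OF U_hol u_hol] _ z]) (auto simp: dist_norm less_imp_le)
          then show ?case using \<open>e > 0\<close> by (simp add: dist_norm Q_diff[OF U_hol u_hol])
        qed
      qed
      then have "(\<lambda>n. U (Suc n) z) \<longlonglongrightarrow> mat 1 - Q u z" unfolding U_Suc by (intro tendsto_diff tendsto_const)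
      moreover have "(\<lambda>n. U (Suc n) z) \<longlonglongrightarrow> u z"
        using tendsto_uniform_limitI[OF ulim z] by (rule LIMSEQ_Suc)
      ultimately show ?thesis using LIMSEQ_unique by blast
    qed
    \<comment> \<open>The fixed point equation cancels the inner part of u G, leaving 1 plus the
      outer part. This is holomorphic outside the inner circle and normalised at infinity.\<close>
    define w where "w z = mat 1 + (\<chi> i j. cauchy_outer c r1 (\<lambda>z. (u z ** \<Delta> z) $ i $ j) z)" for z
    have ent: "(\<lambda>z. (u z ** \<Delta> z) $ i $ j) holomorphic_on annulus c r0 \<rho>" for i j
      using v\<Delta>[OF u_hol] by (simp add: mat_holomorphic_on_def)
    have contS: "continuous_on (sphere c r1) (\<lambda>z. (u z ** \<Delta> z) $ i $ j)" for i j
      by (rule continuous_on_sphere_annulus[OF ent]) (use r in auto)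
    have r1: "r1 > 0" using r by simp
    show "\<exists>u w. mat_holomorphic_on u (ball c \<rho>) \<and> mat_holomorphic_on w {z. r1 < norm (z - c)} \<and>
        (w \<longlongrightarrow> mat 1) at_infinity \<and> (\<forall>z\<in>annulus c r1 \<rho>. w z = u z ** G z)"
    proof (rule exI[of _ u], rule exI[of _ w], intro conjI ballI u_hol)
      show "mat_holomorphic_on w {z. r1 < norm (z - c)}"
        using cauchy_outer_holomorphic[OF contS r1]
        unfolding w_def mat_holomorphic_on_def by (auto intro!: holomorphic_intros)
      have "((\<lambda>z. (\<chi> i j. cauchy_outer c r1 (\<lambda>z. (u z ** \<Delta> z) $ i $ j) z) :: complex ^ 'n ^ 'n) \<longlongrightarrow> 0) at_infinity"
        using cauchy_outer_at_infinity[OF contS r1] by (simp add: tendsto_matrix_iff)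
      then have "(w \<longlongrightarrow> mat 1 + 0) at_infinity" unfolding w_def by (intro tendsto_add tendsto_const)
      then show "(w \<longlongrightarrow> mat 1) at_infinity" by simp
    next
      fix z assume z: "z \<in> annulus c r1 \<rho>"
      then have zb: "z \<in> ball c \<rho>" by (auto simp: annulus_def dist_norm norm_minus_commute)
      have "u z ** \<Delta> z = Q u z + (\<chi> i j. cauchy_outer c r1 (\<lambda>z. (u z ** \<Delta> z) $ i $ j) z)"
        using laurent_split[OF ent r, of z] z
        by (simp add: vec_eq_iff Q_def mat_laurent_inner_def annulus_def)
      moreover have "u z ** G z = u z + u z ** \<Delta> z"
        unfolding \<Delta>_def bounded_bilinear.diff_right[OF bounded_bilinear_matrix_mult] by simp
      ultimately show "w z = u z ** G z" using fix_eq[OF zb] by (simp add: w_def)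
    qed
  qed
qed

subsection \<open>Normal families of factorizations\<close>

lemma uniform_limit_matrix:
  fixes f :: "'k \<Rightarrow> 'a \<Rightarrow> complex ^ 'n ^ 'm"
  assumes "\<And>i j. uniform_limit K (\<lambda>n z. f n z $ i $ j) (\<lambda>z. l z $ i $ j) F"
  shows "uniform_limit K f l F"
proof (rule uniform_limitI)
  fix e :: real assume e: "e > 0"
  define e' where "e' = e / (2 * real (CARD('m) * CARD('n)))"
  have c: "real (CARD('m) * CARD('n)) > 0" by simp
  have e': "e' > 0" unfolding e'_def using e c by (intro divide_pos_pos mult_pos_pos) auto
  have "eventually (\<lambda>n. \<forall>i j. \<forall>x\<in>K. dist (f n x $ i $ j) (l x $ i $ j) < e') F"
    using assms e' by (intro eventually_all_finite) (auto simp: uniform_limit_iff)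
  then show "eventually (\<lambda>n. \<forall>x\<in>K. dist (f n x) (l x) < e) F"
  proof eventually_elim
    case (elim n)
    show ?case
    proof
      fix x assume "x \<in> K"
      then have "norm ((f n x - l x) $ i $ j) \<le> e'" for i j using elim by (simp add: dist_norm less_imp_le)
      then have "norm (f n x - l x) \<le> real (CARD('m) * CARD('n)) * e'" by (rule norm_matrix_le_entries)
      also have "\<dots> = e / 2" using c by (simp add: e'_def)
      finally show "dist (f n x) (l x) < e" using e by (simp add: dist_norm)
    qed
  qed
qed

text \<open>The scalar theorem is applied to one entry after another. Passing to a further
  subsequence keeps the limits already obtained, and there are finitely many entries.\<close>

lemma mat_Montel:
  fixes F :: "nat \<Rightarrow> complex \<Rightarrow> complex ^ 'n ^ 'm"
  assumes S: "open S" and hol: "\<And>n. mat_holomorphic_on (F n) S" and B: "\<And>n z. z \<in> S \<Longrightarrow> norm (F n z) \<le> B"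
  obtains f r where "mat_holomorphic_on f S" "strict_mono (r :: nat \<Rightarrow> nat)"
    "\<And>K. compact K \<Longrightarrow> K \<subseteq> S \<Longrightarrow> uniform_limit K (\<lambda>n. F (r n)) f sequentially"
proof -
  let ?P = "\<lambda>r p. \<exists>h. h holomorphic_on S \<and> (\<forall>K. compact K \<and> K \<subseteq> S \<longrightarrow>
      uniform_limit K (\<lambda>n z. F (r n) z $ fst p $ snd p) h sequentially)"
  have "\<exists>r. strict_mono (r :: nat \<Rightarrow> nat) \<and> (\<forall>p\<in>I. ?P r p)" if "finite I" for I :: "('m \<times> 'n) set"
    using that
  proof (induction I rule: finite_induct)
    case empty
    show ?case by (intro exI[of _ id]) (auto simp: strict_mono_def)
  next
    case (insert p I)
    then obtain r where r: "strict_mono (r :: nat \<Rightarrow> nat)" "\<And>q. q \<in> I \<Longrightarrow> ?P r q" by blast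
    define \<F> where "\<F> n z = F (r n) z $ fst p $ snd p" for n z
    obtain h r' where h: "h holomorphic_on S" "strict_mono (r' :: nat \<Rightarrow> nat)"
      "\<And>K. compact K \<Longrightarrow> K \<subseteq> S \<Longrightarrow> uniform_limit K (\<F> \<circ> r') h sequentially"
    proof (rule Montel[of S "range \<F>" \<F>])
      show "h holomorphic_on S" if "h \<in> range \<F>" for h
        using that hol by (auto simp: \<F>_def[abs_def] mat_holomorphic_on_def)
      show "\<exists>B. \<forall>h\<in>range \<F>. \<forall>z\<in>K. norm (h z) \<le> B" if "compact K" "K \<subseteq> S" for K
      proof (intro exI[of _ B] ballI)
        fix h z assume "h \<in> range \<F>" "z \<in> K"
        then obtain n where "h = \<F> n" by blast
        then show "norm (h z) \<le> B"
          using B[of z "r n"] norm_entry_le[of "F (r n) z" "fst p" "snd p"] \<open>z \<in> K\<close> that by (auto simp: \<F>_def)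
      qed
    qed (use S that in auto)
    have "?P (r \<circ> r') q" if q: "q \<in> insert p I" for q
    proof (cases "q = p")
      case True
      have "uniform_limit K (\<lambda>n z. F ((r \<circ> r') n) z $ fst q $ snd q) h sequentially" if "compact K" "K \<subseteq> S" for K
        using h(3)[OF that] unfolding True \<F>_def[abs_def] o_def .
      then show ?thesis using h(1) by blast
    next
      case False
      then have "?P r q" using r(2)[of q] q by simp
      then obtain k where k: "k holomorphic_on S" "\<And>K. compact K \<Longrightarrow> K \<subseteq> S \<Longrightarrow>
          uniform_limit K (\<lambda>n z. F (r n) z $ fst q $ snd q) k sequentially" by blast
      have "uniform_limit K (\<lambda>n z. F ((r \<circ> r') n) z $ fst q $ snd q) k sequentially" if "compact K" "K \<subseteq> S" for K
        using filterlim_compose[OF k(2)[OF that] filterlim_subseq[OF h(2)]] by simp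
      then show ?thesis using k(1) by blast
    qed
    then show ?case using strict_mono_o[OF r(1) h(2)] by blast
  qed
  from this[OF finite[of UNIV]] obtain r where r: "strict_mono (r :: nat \<Rightarrow> nat)" "\<And>p. ?P r p" by blast
  define f where "f z = (\<chi> i j. (SOME h. h holomorphic_on S \<and> (\<forall>K. compact K \<and> K \<subseteq> S \<longrightarrow>
      uniform_limit K (\<lambda>n z. F (r n) z $ fst (i, j) $ snd (i, j)) h sequentially)) z)" for z
  have f: "(\<lambda>z. f z $ i $ j) holomorphic_on S \<and> (\<forall>K. compact K \<and> K \<subseteq> S \<longrightarrow>
      uniform_limit K (\<lambda>n z. F (r n) z $ i $ j) (\<lambda>z. f z $ i $ j) sequentially)" for i j
    using someI_ex[OF r(2)[of "(i, j)"]] by (simp add: f_def)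
  show thesis
  proof (rule that[of f r])
    show "mat_holomorphic_on f S" using f by (simp add: mat_holomorphic_on_def)
    show "uniform_limit K (\<lambda>n. F (r n)) f sequentially" if "compact K" "K \<subseteq> S" for K
      using f that by (intro uniform_limit_matrix) blast
  qed (rule r(1))
qed

lemma mat_holomorphic_on_scaleR:
  "mat_holomorphic_on F S \<Longrightarrow> mat_holomorphic_on (\<lambda>z. k *\<^sub>R F z) S"
  by (auto simp: mat_holomorphic_on_def scaleR_conv_of_real intro!: holomorphic_intros)

lemma scaleR_matrix_mult: "(k *\<^sub>R A) ** B = k *\<^sub>R (A ** (B :: complex ^ 'k ^ 'n))" for A :: "complex ^ 'n ^ 'm"
  by (rule bounded_bilinear.scaleR_left[OF bounded_bilinear_matrix_mult])

lemma norm_mult3: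
  fixes A B C :: "complex ^ 'n ^ 'n"
  assumes "norm A \<le> a" "norm B \<le> b" "norm C \<le> c"
  shows "norm (A ** B ** C) \<le> a * b * c"
proof -
  have "norm (A ** B ** C) \<le> norm A * norm B * norm C"
    by (rule order_trans[OF norm_matrix_mult]) (intro mult_right_mono norm_matrix_mult norm_ge_zero)
  also have "\<dots> \<le> a * b * c"
    by (intro mult_mono assms mult_nonneg_nonneg norm_ge_zero order_trans[OF norm_ge_zero assms(1)] order_trans[OF norm_ge_zero assms(2)])
  finally show ?thesis .
qed

lemma exterior_maximum_principle_matrix:
  fixes F :: "complex \<Rightarrow> complex ^ 'n ^ 'm"
  assumes r: "r > 0" "r < s" and hol: "mat_holomorphic_on F {z. r < norm (z - c)}" and lim: "(F \<longlongrightarrow> L) at_infinity"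
    and bnd: "\<And>z. norm (z - c) = s \<Longrightarrow> norm (F z) \<le> B" and z: "norm (z - c) \<ge> s"
  shows "norm (F z) \<le> real (CARD('m) * CARD('n)) * B"
proof (rule norm_matrix_le_entries)
  fix i j
  show "norm (F z $ i $ j) \<le> B"
  proof (rule exterior_maximum_principle[OF r _ _ _ z, where f = "\<lambda>z. F z $ i $ j"])
    show "(\<lambda>z. F z $ i $ j) holomorphic_on {z. norm (z - c) > r}" using hol by (simp add: mat_holomorphic_on_def)
    show "((\<lambda>z. F z $ i $ j) \<longlongrightarrow> L $ i $ j) at_infinity" using lim by (simp add: tendsto_matrix_iff)
    show "norm (F z $ i $ j) \<le> B" if "norm (z - c) = s" for z
      using bnd[OF that] norm_entry_le[of "F z" i j] by linarith
  qed
qed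

lemma maximum_principle_matrix:
  fixes F :: "complex \<Rightarrow> complex ^ 'n ^ 'm"
  assumes r: "0 < s" "s < r" and hol: "mat_holomorphic_on F (ball c r)"
    and bnd: "\<And>z. norm (z - c) = s \<Longrightarrow> norm (F z) \<le> B" and z: "norm (z - c) \<le> s"
  shows "norm (F z) \<le> real (CARD('m) * CARD('n)) * B"
proof (rule norm_matrix_le_entries)
  fix i j
  have hol': "(\<lambda>z. F z $ i $ j) holomorphic_on ball c r" using hol by (simp add: mat_holomorphic_on_def)
  show "norm (F z $ i $ j) \<le> B"
  proof (rule maximum_modulus_frontier[where f = "\<lambda>z. F z $ i $ j" and S = "cball c s"])
    show "(\<lambda>z. F z $ i $ j) holomorphic_on interior (cball c s)"
      by (rule holomorphic_on_subset[OF hol']) (use r in auto)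
    show "continuous_on (closure (cball c s)) (\<lambda>z. F z $ i $ j)"
      by (rule continuous_on_subset[OF holomorphic_on_imp_continuous_on[OF hol']]) (use r in auto)
    show "norm (F z $ i $ j) \<le> B" if "z \<in> frontier (cball c s)" for z
    proof -
      have "norm (z - c) = s" using that r by (simp add: dist_norm norm_minus_commute)
      then show ?thesis using bnd[of z] norm_entry_le[of "F z" i j] by linarith
    qed
  qed (use z in \<open>auto simp: dist_norm norm_minus_commute\<close>)
qed

lemma compact_closed_annulus: "compact {z. r \<le> norm (z - c) \<and> norm (z - c) \<le> (t::real)}" for c :: complex
proof -
  have "{z. r \<le> norm (z - c) \<and> norm (z - c) \<le> t} = cball c t - ball c r"
    by (auto simp: dist_norm norm_minus_commute)
  then show ?thesis by (simp add: compact_diff)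
qed

text \<open>By compactness: if the normalised factorizations were unbounded, a rescaled subsequence would
  converge to a nonzero factorization vanishing at infinity.\<close>

lemma factorization_bound:
  fixes T Ti :: "complex \<Rightarrow> complex ^ 'n ^ 'n" and XX :: "(complex ^ 'n ^ 'n) set"
  assumes r: "0 < r0" "r0 < r" "r < \<rho>"
    and T: "mat_holomorphic_on T (annulus c r0 \<rho>)" and Ti: "mat_holomorphic_on Ti (annulus c r0 \<rho>)"
    and inv: "\<And>z. z \<in> annulus c r0 \<rho> \<Longrightarrow> T z ** Ti z = mat 1"
    and XX: "compact XX" and unit: "\<And>X. X \<in> XX \<Longrightarrow> X ** adj X = mat 1"
    and vanish: "\<And>X (u :: complex \<Rightarrow> complex ^ 'n ^ 'n) w t. X \<in> XX \<Longrightarrow> r < t \<Longrightarrow> t < \<rho> \<Longrightarrow> mat_holomorphic_on u (ball c t) \<Longrightarrow>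
      mat_holomorphic_on w {z. r < norm (z - c)} \<Longrightarrow> (w \<longlongrightarrow> 0) at_infinity \<Longrightarrow>
      (\<forall>z\<in>annulus c r t. w z = u z ** (T z ** X ** Ti z)) \<Longrightarrow> (\<forall>z\<in>ball c t. u z = 0)"
  shows "\<exists>B. \<forall>X\<in>XX. \<forall>(u :: complex \<Rightarrow> complex ^ 'n ^ 'n) w. mat_holomorphic_on u (ball c \<rho>) \<longrightarrow> mat_holomorphic_on w {z. r0 < norm (z - c)} \<longrightarrow>
      (w \<longlongrightarrow> mat 1) at_infinity \<longrightarrow> (\<forall>z\<in>annulus c r0 \<rho>. w z = u z ** (T z ** X ** Ti z)) \<longrightarrow>
      (\<forall>z. norm (z - c) = r \<longrightarrow> norm (u z) \<le> B)" (is "\<exists>B. ?R B")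
proof (rule ccontr)
  assume neg: "\<not> ?thesis"
  define S where "S X z = T z ** X ** Ti z" for X z
  \<comment> \<open>Uniform bounds for \<open>T\<close> and \<open>Ti\<close> are available on
    closed subannuli only, so the compactness argument runs on a slightly smaller disc.\<close>
  define t where "t = (r + \<rho>) / 2"
  have t: "r < t" "t < \<rho>" using r by (auto simp: t_def)
  have inv': "Ti z ** T z = mat 1" if "z \<in> annulus c r0 \<rho>" for z using inv[OF that] matrix_left_right_inverse by blast
  \<comment> \<open>Each counterexample is recorded with a point \<open>\<zeta>\<close> where the
    norm on the circle is largest. Dividing by that maximum makes the circle norms at most 1, with
    the value 1 attained.\<close>
  let ?Q = "\<lambda>n X u w \<zeta>. X \<in> XX \<and> mat_holomorphic_on u (ball c \<rho>) \<and> mat_holomorphic_on w {z. r0 < norm (z - c)} \<and>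
      (w \<longlongrightarrow> mat 1) at_infinity \<and> (\<forall>z\<in>annulus c r0 \<rho>. w z = u z ** S X z) \<and> norm (\<zeta> - c) = r \<and>
      (\<forall>z. norm (z - c) = r \<longrightarrow> norm (u z) \<le> norm (u \<zeta>)) \<and> norm (u \<zeta>) > real n"
  have "\<exists>X u w \<zeta>. ?Q n X u w \<zeta>" for n :: nat
  proof -
    from neg have "\<not> ?R (real n)" by blast
    then obtain X u w z where h: "X \<in> XX" "mat_holomorphic_on u (ball c \<rho>)" "mat_holomorphic_on w {z. r0 < norm (z - c)}"
      "(w \<longlongrightarrow> mat 1) at_infinity" "\<forall>z\<in>annulus c r0 \<rho>. w z = u z ** S X z" "norm (z - c) = r" "norm (u z) > real n"
      unfolding S_def by (auto simp: not_le)
    have "continuous_on (sphere c r) (\<lambda>z. norm (u z))"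
      by (intro continuous_on_norm continuous_on_subset[OF mat_holomorphic_on_imp_continuous_on[OF h(2)]]) (use r in auto)
    moreover have "z \<in> sphere c r" using h(6) by (simp add: dist_norm norm_minus_commute)
    ultimately obtain \<zeta> where \<zeta>: "\<zeta> \<in> sphere c r" "\<forall>z\<in>sphere c r. norm (u z) \<le> norm (u \<zeta>)"
      using continuous_attains_sup[of "sphere c r" "\<lambda>z. norm (u z)"] compact_sphere by blast
    have "norm (u z) \<le> norm (u \<zeta>)" using \<zeta>(2) \<open>z \<in> sphere c r\<close> by blast
    then have "norm (u \<zeta>) > real n" using h(7) by linarith
    moreover have "\<forall>z. norm (z - c) = r \<longrightarrow> norm (u z) \<le> norm (u \<zeta>)" "norm (\<zeta> - c) = r"
      using \<zeta> by (auto simp: dist_norm norm_minus_commute)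
    ultimately show ?thesis using h(1-5) by blast
  qed
  then have "\<forall>n. \<exists>p. ?Q n (fst p) (fst (snd p)) (fst (snd (snd p))) (snd (snd (snd p)))" by (metis fst_conv snd_conv)
  from choice[OF this] obtain p where p: "\<And>n. ?Q n (fst (p n)) (fst (snd (p n))) (fst (snd (snd (p n)))) (snd (snd (snd (p n))))" by blast
  define X where "X n = fst (p n)" for n
  define u where "u n = fst (snd (p n))" for n
  define w where "w n = fst (snd (snd (p n)))" for n
  define \<zeta> where "\<zeta> n = snd (snd (snd (p n)))" for n
  have Q: "?Q n (X n) (u n) (w n) (\<zeta> n)" for n using p[of n] unfolding X_def u_def w_def \<zeta>_def .
  define m where "m n = norm (u n (\<zeta> n))" for n
  have m: "m n > real n" "m n > 0" for n
  proof -
    show "m n > real n" using Q[of n] by (simp add: m_def)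
    then show "m n > 0" by (rule le_less_trans[rotated]) simp
  qed
  define v where "v n z = inverse (m n) *\<^sub>R u n z" for n z
  define y where "y n z = inverse (m n) *\<^sub>R w n z" for n z
  have v_hol: "mat_holomorphic_on (v n) (ball c \<rho>)" for n
    unfolding v_def[abs_def] using Q[of n] by (intro mat_holomorphic_on_scaleR) blast
  have y_hol: "mat_holomorphic_on (y n) {z. r0 < norm (z - c)}" for n
    unfolding y_def[abs_def] using Q[of n] by (intro mat_holomorphic_on_scaleR) blast
  have y_lim: "(y n \<longlongrightarrow> inverse (m n) *\<^sub>R mat 1) at_infinity" for n
    unfolding y_def[abs_def] using Q[of n] by (intro tendsto_scaleR tendsto_const) blast
  have yv: "y n z = v n z ** S (X n) z" if "z \<in> annulus c r0 \<rho>" for n z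
    using Q[of n] that by (simp add: y_def v_def scaleR_matrix_mult)
  have v1: "norm (v n (\<zeta> n)) = 1" for n using m(2)[of n] by (simp add: v_def m_def)
  have v_le1: "norm (v n z) \<le> 1" if "norm (z - c) = r" for n z
  proof -
    have "norm (u n z) \<le> m n" unfolding m_def using Q[of n] that by blast
    then show ?thesis using m(2)[of n] by (simp add: v_def field_simps)
  qed
  let ?A = "{z. r \<le> norm (z - c) \<and> norm (z - c) \<le> t}"
  have A_sub: "?A \<subseteq> annulus c r0 \<rho>" using r t by (auto simp: annulus_def)
  have bddA: "bounded (F ` ?A)" if "mat_holomorphic_on F (annulus c r0 \<rho>)" for F :: "complex \<Rightarrow> complex ^ 'n ^ 'n"
    by (intro compact_imp_bounded compact_continuous_image compact_closed_annulus
        continuous_on_subset[OF mat_holomorphic_on_imp_continuous_on[OF that] A_sub])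
  obtain CT where CT: "\<And>z. z \<in> ?A \<Longrightarrow> norm (T z) \<le> CT" using bddA[OF T] by (auto simp: bounded_iff)
  obtain CU where CU: "\<And>z. z \<in> ?A \<Longrightarrow> norm (Ti z) \<le> CU" using bddA[OF Ti] by (auto simp: bounded_iff)
  obtain CX where CX: "\<And>X. X \<in> XX \<Longrightarrow> norm X \<le> CX" using compact_imp_bounded[OF XX] by (auto simp: bounded_iff)
  define CS where "CS = CT * CX * CU"
  have S_le: "norm (S (X n) z) \<le> CS" if "z \<in> ?A" for n z
    unfolding S_def CS_def using Q[of n] by (intro norm_mult3 CT[OF that] CU[OF that] CX) blast
  have S'_le: "norm (T z ** adj (X n) ** Ti z) \<le> CS" if "z \<in> ?A" for n z
    unfolding CS_def using Q[of n] by (intro norm_mult3 CT[OF that] CU[OF that]) (simp add: CX)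
  \<comment> \<open>Unitarity of \<open>X n\<close> gives an inverse of the jump that is bounded
    independently of \<open>n\<close>. It transports bounds back from \<open>y\<close> to
    \<open>v\<close>.\<close>
  have SS': "S (X n) z ** (T z ** adj (X n) ** Ti z) = mat 1" if "z \<in> annulus c r0 \<rho>" for n z
  proof -
    have "S (X n) z ** (T z ** adj (X n) ** Ti z) = T z ** X n ** (Ti z ** T z) ** adj (X n) ** Ti z"
      unfolding S_def by (simp only: matrix_mul_assoc)
    also have "\<dots> = T z ** (X n ** adj (X n)) ** Ti z" unfolding inv'[OF that] by (simp add: matrix_mul_assoc)
    also have "\<dots> = mat 1" using unit[of "X n"] Q[of n] inv[OF that] by simp
    finally show ?thesis .
  qed
  define N2 where "N2 = real (CARD('n) * CARD('n))"
  have N2: "N2 \<ge> 0" by (simp add: N2_def)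
  have sphereA: "z \<in> ?A" if "norm (z - c) = r" for z using that t by auto
  have y_sphere: "norm (y n z) \<le> CS" if "norm (z - c) = r" for n z
  proof -
    have "norm (y n z) \<le> norm (v n z) * norm (S (X n) z)"
      unfolding yv[OF subsetD[OF A_sub sphereA[OF that]]] by (rule norm_matrix_mult)
    also have "\<dots> \<le> 1 * CS" by (intro mult_mono v_le1[OF that] S_le sphereA[OF that]) auto
    finally show ?thesis by simp
  qed
  \<comment> \<open>The bound travels from \<open>v\<close> on the circle to \<open>y\<close> on the
    circle, by the maximum principle to \<open>y\<close> outside, and then back to \<open>v\<close>
    on the annulus.\<close>
  have y_ext: "norm (y n z) \<le> N2 * CS" if "norm (z - c) \<ge> r" for n z
    unfolding N2_def using r by (intro exterior_maximum_principle_matrix[OF _ _ y_hol y_lim y_sphere that]) auto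
  have v_ann: "norm (v n z) \<le> N2 * CS * CS" if z: "z \<in> ?A" for n z
  proof -
    have zA: "z \<in> annulus c r0 \<rho>" using z A_sub by blast
    have "v n z = y n z ** (T z ** adj (X n) ** Ti z)"
      unfolding yv[OF zA] matrix_mul_assoc[symmetric, of "v n z"] SS'[OF zA] by simp
    then have "norm (v n z) \<le> norm (y n z) * norm (T z ** adj (X n) ** Ti z)" using norm_matrix_mult by simp
    also have "\<dots> \<le> (N2 * CS) * CS"
      using z by (intro mult_mono y_ext S'_le order_trans[OF norm_ge_zero y_ext[of "z" n]]) auto
    finally show ?thesis .
  qed
  have v_in: "norm (v n z) \<le> N2 * 1" if "norm (z - c) \<le> r" for n z
    unfolding N2_def using r by (intro maximum_principle_matrix[OF _ _ v_hol v_le1 that]) auto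
  have v_bd: "norm (v n z) \<le> max (N2 * CS * CS) (N2 * 1)" if "z \<in> ball c t" for n z
  proof (cases "norm (z - c) \<le> r")
    case True then show ?thesis using v_in[OF True, of n] by simp
  next
    case False
    then have "z \<in> ?A" using that by (auto simp: dist_norm norm_minus_commute)
    then show ?thesis using v_ann[of z n] by simp
  qed
  have "\<forall>n. X n \<in> XX" using Q by blast
  then obtain X0 \<sigma>1 where X0: "X0 \<in> XX" "strict_mono (\<sigma>1 :: nat \<Rightarrow> nat)" "(X \<circ> \<sigma>1) \<longlonglongrightarrow> X0"
  proof -
    from \<open>\<forall>n. X n \<in> XX\<close> have "\<exists>l\<in>XX. \<exists>s. strict_mono (s :: nat \<Rightarrow> nat) \<and> (X \<circ> s) \<longlonglongrightarrow> l"
      using XX unfolding compact_def by blast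
    then show thesis using that by blast
  qed
  have tsub: "ball c t \<subseteq> ball c \<rho>" using t by auto
  obtain v0 \<sigma>2 where v0: "mat_holomorphic_on v0 (ball c t)" "strict_mono (\<sigma>2 :: nat \<Rightarrow> nat)"
    "\<And>K. compact K \<Longrightarrow> K \<subseteq> ball c t \<Longrightarrow> uniform_limit K (\<lambda>n. v (\<sigma>1 (\<sigma>2 n))) v0 sequentially"
  proof (rule mat_Montel[of "ball c t" "\<lambda>n. v (\<sigma>1 n)" "max (N2 * CS * CS) (N2 * 1)"])
    show "mat_holomorphic_on (v (\<sigma>1 n)) (ball c t)" for n by (rule mat_holomorphic_on_subset[OF v_hol tsub])
    show "norm (v (\<sigma>1 n) z) \<le> max (N2 * CS * CS) (N2 * 1)" if "z \<in> ball c t" for n z by (rule v_bd[OF that])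
  next
    fix f and s :: "nat \<Rightarrow> nat"
    assume "mat_holomorphic_on f (ball c t)" "strict_mono s"
      "\<And>K. compact K \<Longrightarrow> K \<subseteq> ball c t \<Longrightarrow> uniform_limit K (\<lambda>n. v (\<sigma>1 (s n))) f sequentially"
    then show thesis by (rule that)
  qed simp
  define \<sigma> where "\<sigma> n = \<sigma>1 (\<sigma>2 n)" for n
  have \<sigma>: "strict_mono \<sigma>" using strict_mono_o[OF X0(2) v0(2)] by (simp add: \<sigma>_def[abs_def] o_def)
  have X_lim: "(\<lambda>n. X (\<sigma> n)) \<longlonglongrightarrow> X0"
    using LIMSEQ_subseq_LIMSEQ[OF X0(3) v0(2)] by (simp add: \<sigma>_def o_def)
  have sph_sub: "sphere c r \<subseteq> ball c t" using t by auto
  have v_ulim: "uniform_limit (sphere c r) (\<lambda>n. v (\<sigma> n)) v0 sequentially"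
    unfolding \<sigma>_def using v0(3)[OF compact_sphere sph_sub] .
  have sph_A: "sphere c r \<subseteq> ?A" using t by (auto simp: dist_norm norm_minus_commute)
  have bds: "bounded (T ` sphere c r)" "bounded (Ti ` sphere c r)"
    using bddA[OF T] bddA[OF Ti] sph_A by (meson bounded_subset image_mono)+
  have S0_bd: "bounded (S X0 ` sphere c r)"
    unfolding bounded_iff
  proof (intro exI[of _ CS] ballI)
    fix s assume "s \<in> S X0 ` sphere c r"
    then obtain z where z: "z \<in> sphere c r" "s = S X0 z" by blast
    have zA: "z \<in> ?A" using sph_A z(1) by blast
    show "norm s \<le> CS" unfolding z(2) S_def CS_def by (intro norm_mult3 CT[OF zA] CU[OF zA] CX X0)
  qed
  have S_ulim: "uniform_limit (sphere c r) (\<lambda>n. S (X (\<sigma> n))) (S X0) sequentially"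
  proof -
    have 1: "uniform_limit (sphere c r) (\<lambda>n z. X (\<sigma> n)) (\<lambda>z. X0) sequentially"
      using X_lim unfolding uniform_limit_iff tendsto_iff by (auto elim: eventually_mono)
    have X0b: "bounded ((\<lambda>z. X0) ` sphere c r)" by (simp add: image_constant_conv)
    have "uniform_limit (sphere c r) (\<lambda>n z. T z ** X (\<sigma> n)) (\<lambda>z. T z ** X0) sequentially"
      by (intro bounded_bilinear.bounded_uniform_limit[OF bounded_bilinear_matrix_mult] 1 X0b bds uniform_limit_const)
    moreover have "bounded ((\<lambda>z. T z ** X0) ` sphere c r)"
      unfolding bounded_iff
    proof (intro exI[of _ "CT * CX"] ballI)
      fix s assume "s \<in> (\<lambda>z. T z ** X0) ` sphere c r"
      then obtain z where z: "z \<in> sphere c r" "s = T z ** X0" by blast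
      have zA: "z \<in> ?A" using sph_A z(1) by blast
      show "norm s \<le> CT * CX" unfolding z(2)
        by (rule order_trans[OF norm_matrix_mult])
           (intro mult_mono CT[OF zA] CX X0 norm_ge_zero order_trans[OF norm_ge_zero CT[OF zA]])
    qed
    ultimately show ?thesis unfolding S_def[abs_def]
      by (rule bounded_bilinear.bounded_uniform_limit[OF bounded_bilinear_matrix_mult _ uniform_limit_const bds(2)])
  qed
  have "bounded (v0 ` sphere c r)"
    by (intro compact_imp_bounded compact_continuous_image compact_sphere
        continuous_on_subset[OF mat_holomorphic_on_imp_continuous_on[OF v0(1)] sph_sub])
  then have "uniform_limit (sphere c r) (\<lambda>n z. v (\<sigma> n) z ** S (X (\<sigma> n)) z) (\<lambda>z. v0 z ** S X0 z) sequentially"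
    by (intro bounded_bilinear.bounded_uniform_limit[OF bounded_bilinear_matrix_mult] v_ulim S_ulim S0_bd)
  then have y_ulim: "uniform_limit (sphere c r) (\<lambda>n. y (\<sigma> n)) (\<lambda>z. v0 z ** S X0 z) sequentially"
  proof (rule uniform_limit_cong'[THEN iffD1, rotated 2])
    fix z n assume "z \<in> sphere c r"
    then have "z \<in> annulus c r0 \<rho>" using sph_A A_sub by blast
    then show "v (\<sigma> n) z ** S (X (\<sigma> n)) z = y (\<sigma> n) z" by (simp add: yv)
  qed simp
  let ?D = "{z. r \<le> norm (z - c)}"
  \<comment> \<open>Locally uniform convergence would lose the limit at infinity. The exterior
    maximum principle upgrades convergence on the circle to uniform convergence on the unbounded
    exterior.\<close>
  have "uniformly_Cauchy_on ?D (\<lambda>n. y (\<sigma> n))"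
  proof (rule uniformly_Cauchy_onI)
    fix e :: real assume e: "e > 0"
    have "uniformly_Cauchy_on (sphere c r) (\<lambda>n. y (\<sigma> n))"
      using y_ulim uniformly_convergentI uniformly_convergent_eq_Cauchy by blast
    moreover have "e / (N2 + 1) > 0" using e N2 by simp
    ultimately obtain M where M: "\<And>x n k. x \<in> sphere c r \<Longrightarrow> n \<ge> M \<Longrightarrow> k \<ge> M \<Longrightarrow> dist (y (\<sigma> n) x) (y (\<sigma> k) x) < e / (N2 + 1)"
      unfolding uniformly_Cauchy_on_def by meson
    have "dist (y (\<sigma> n) x) (y (\<sigma> k) x) < e" if "x \<in> ?D" "n \<ge> M" "k \<ge> M" for x n k
    proof -
      have "norm (y (\<sigma> n) x - y (\<sigma> k) x) \<le> N2 * (e / (N2 + 1))"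
        unfolding N2_def[symmetric]
        by (rule exterior_maximum_principle_matrix[OF r(1,2) mat_holomorphic_on_diff[OF y_hol y_hol] tendsto_diff[OF y_lim y_lim], folded N2_def])
           (use M that in \<open>auto simp: dist_norm norm_minus_commute less_imp_le\<close>)
      also have "\<dots> < e" using e N2 by (simp add: field_simps)
      finally show ?thesis by (simp add: dist_norm)
    qed
    then show "\<exists>M. \<forall>x\<in>?D. \<forall>m\<ge>M. \<forall>n\<ge>M. dist (y (\<sigma> m) x) (y (\<sigma> n) x) < e" by blast
  qed
  then obtain w0 where w0: "uniform_limit ?D (\<lambda>n. y (\<sigma> n)) w0 sequentially"
    using uniformly_convergent_eq_Cauchy uniformly_convergent_on_def by blast
  have w0_hol: "mat_holomorphic_on w0 {z. r < norm (z - c)}"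
  proof (rule mat_holomorphic_on_uniform_limit[OF open_exterior])
    show "mat_holomorphic_on (y (\<sigma> n)) {z. r < norm (z - c)}" for n
      by (rule mat_holomorphic_on_subset[OF y_hol]) (use r in auto)
    show "uniform_limit {z. r < norm (z - c)} (\<lambda>n. y (\<sigma> n)) w0 sequentially"
      by (rule uniform_limit_on_subset[OF w0]) auto
  qed
  have m_lim: "(\<lambda>n. inverse (m (\<sigma> n)) *\<^sub>R (mat 1 :: complex ^ 'n ^ 'n)) \<longlonglongrightarrow> 0"
  proof -
    have "filterlim (\<lambda>n. m (\<sigma> n)) at_top sequentially"
    proof (rule filterlim_at_top_mono[OF filterlim_real_sequentially])
      have "real n \<le> m (\<sigma> n)" for n
        using m(1)[of "\<sigma> n"] seq_suble[OF \<sigma>, of n] by linarith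
      then show "eventually (\<lambda>n. real n \<le> m (\<sigma> n)) sequentially" by simp
    qed
    then have "(\<lambda>n. inverse (m (\<sigma> n))) \<longlonglongrightarrow> 0" by (rule tendsto_inverse_0_at_top)
    then have "(\<lambda>n. inverse (m (\<sigma> n)) *\<^sub>R (mat 1 :: complex ^ 'n ^ 'n)) \<longlonglongrightarrow> 0 *\<^sub>R mat 1"
      by (intro tendsto_scaleR tendsto_const)
    then show ?thesis by simp
  qed
  \<comment> \<open>The rescaled normalisations are the identity divided by \<open>m\<close>, and
    \<open>m\<close> tends to infinity. The limit factorization therefore decays and falls under
    \<open>vanish\<close>.\<close>
  have w0_lim: "(w0 \<longlongrightarrow> 0) at_infinity"
  proof (rule swap_uniform_limit'[OF _ m_lim w0])
    have "filterlim (\<lambda>z. - c + z) at_infinity at_infinity"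
      by (rule tendsto_add_filterlim_at_infinity[OF tendsto_const filterlim_ident])
    then have "filterlim (\<lambda>z. norm (z - c)) at_top at_infinity"
      by (simp add: filterlim_at_infinity_conv_norm_at_top)
    then show "eventually (\<lambda>z. z \<in> ?D) at_infinity" by (simp add: filterlim_at_top)
  qed (use y_lim in auto)
  have "\<forall>z\<in>annulus c r t. w0 z = v0 z ** (T z ** X0 ** Ti z)"
  proof
    fix z assume z: "z \<in> annulus c r t"
    then have zA: "z \<in> annulus c r0 \<rho>" "z \<in> ?D" "z \<in> ball c t"
      using r t by (auto simp: annulus_def dist_norm norm_minus_commute)
    have "(\<lambda>n. v (\<sigma> n) z) \<longlonglongrightarrow> v0 z"
      using v0(3)[of "{z}"] zA(3) by (simp add: \<sigma>_def)
    then have "(\<lambda>n. v (\<sigma> n) z ** S (X (\<sigma> n)) z) \<longlonglongrightarrow> v0 z ** (T z ** X0 ** Ti z)"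
      unfolding S_def by (intro tendsto_matrix_mult tendsto_const X_lim)
    then have "(\<lambda>n. y (\<sigma> n) z) \<longlonglongrightarrow> v0 z ** (T z ** X0 ** Ti z)" by (simp add: yv[OF zA(1)])
    moreover have "(\<lambda>n. y (\<sigma> n) z) \<longlonglongrightarrow> w0 z" by (rule tendsto_uniform_limitI[OF w0 zA(2)])
    ultimately show "w0 z = v0 z ** (T z ** X0 ** Ti z)" using LIMSEQ_unique by blast
  qed
  from vanish[OF X0(1) t v0(1) w0_hol w0_lim this] have v0_zero: "\<And>z. z \<in> ball c t \<Longrightarrow> v0 z = 0" by blast
  have "eventually (\<lambda>n. \<forall>x\<in>sphere c r. dist (v (\<sigma> n) x) (v0 x) < 1) sequentially"
    using v_ulim by (simp add: uniform_limit_iff)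
  then obtain n where n: "\<forall>x\<in>sphere c r. dist (v (\<sigma> n) x) (v0 x) < 1"
    unfolding eventually_sequentially by blast
  \<comment> \<open>The convergence is uniform on the circle, so the moving points
    \<open>\<zeta>\<close> need not converge: the norm 1 there is incompatible with a zero
    limit.\<close>
  have "\<zeta> (\<sigma> n) \<in> sphere c r" using Q[of "\<sigma> n"] by (simp add: dist_norm norm_minus_commute)
  then have "dist (v (\<sigma> n) (\<zeta> (\<sigma> n))) 0 < 1" using n v0_zero sph_sub by (metis subsetD)
  then show False using v1[of "\<sigma> n"] by simp
qed

section \<open>One-sided unitary factors\<close>

lemma block_diag_mult: "block_diag A D ** block_diag A' D' = block_diag (A ** A') (D ** D')"
  by (simp add: block_diag_def block_mat_mult)

lemma block_diag_1: "block_diag (mat 1) (mat 1) = mat 1"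
  by (simp add: block_diag_def mat_1_block)

lemma adj_block_diag: "adj (block_diag A D) = block_diag (adj A) (adj D)"
  by (simp add: block_diag_def adj_block_mat)

text \<open>The pair of \<open>upper_factor\<close> and \<open>lower_factor\<close>, used above and
  below the axis, multiplies a gap datum by P and leaves the band jump unchanged.\<close>

definition upper_factor :: "complex ^ 'r ^ 'r \<Rightarrow> complex ^ ('r::finite + 'r) ^ ('r + 'r)" where
  "upper_factor P = block_diag P (mat 1)"

definition lower_factor :: "complex ^ 'r ^ 'r \<Rightarrow> complex ^ ('r::finite + 'r) ^ ('r + 'r)" where
  "lower_factor P = block_diag (mat 1) P"

lemma factor_mult: "upper_factor P ** upper_factor Q = upper_factor (P ** Q)"
  "lower_factor P ** lower_factor Q = lower_factor (P ** Q)"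
  by (simp_all add: upper_factor_def lower_factor_def block_diag_mult)

lemma factor_1: "upper_factor (mat 1) = mat 1" "lower_factor (mat 1) = mat 1"
  by (simp_all add: upper_factor_def lower_factor_def block_diag_1)

lemma neg_matrix_mult:
  fixes A :: "complex ^ 'n ^ 'm" and B :: "complex ^ 'k ^ 'n"
  shows "A ** (- B) = - (A ** B)" "(- A) ** B = - (A ** B)"
  by (simp_all add: bounded_bilinear.minus_right[OF bounded_bilinear_matrix_mult] bounded_bilinear.minus_left[OF bounded_bilinear_matrix_mult])

lemma band_jump_factor: "band_jump ** upper_factor P = lower_factor P ** band_jump"
  by (simp add: upper_factor_def lower_factor_def block_diag_def block_mat_mult neg_matrix_mult)

lemma neg_block_mat: "- block_mat A B C D = block_mat (- A) (- B) (- C) (- D)"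
  by (simp add: matrix_eq_block_iff)

lemma band_jump_inv: "band_jump ** (- band_jump) = mat 1" "(- band_jump) ** band_jump = mat 1"
  by (simp_all add: neg_matrix_mult block_mat_mult neg_block_mat mat_1_block)

lemma adj_band_jump: "adj band_jump = - band_jump"
  by (simp add: matrix_eq_block_iff mat_def)

lemma unitary_matD: "unitary_mat P \<Longrightarrow> P ** adj P = mat 1" "unitary_mat P \<Longrightarrow> adj P ** P = mat 1"
  by (simp_all add: unitary_mat_def)

lemma unitary_adj: "unitary_mat P \<Longrightarrow> unitary_mat (adj P)"
  by (simp add: unitary_mat_def)

lemma unitary_mult: "unitary_mat P \<Longrightarrow> unitary_mat Q \<Longrightarrow> unitary_mat (P ** Q)"
  unfolding unitary_mat_def adj_mult
  by (metis matrix_mul_assoc matrix_mul_rid)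

lemma unitary_1: "unitary_mat (mat 1)"
  by (simp add: unitary_mat_def)

text \<open>In the lower block P (K P)^(-1) = K^(-1); in the upper block K becomes K P.\<close>

lemma gap_jump_factor:
  assumes "unitary_mat K" "unitary_mat P"
  shows "block_diag K (matrix_inv K) ** upper_factor P = lower_factor P ** block_diag (K ** P) (matrix_inv (K ** P))"
proof -
  have "matrix_inv (K ** P) = adj P ** adj K"
    using matrix_inv_unique(1)[OF unitary_matD(1)[OF unitary_mult[OF assms]]] by (simp add: adj_mult)
  moreover have "matrix_inv K = adj K"
    using matrix_inv_unique(1)[OF unitary_matD(1)[OF assms(1)]] .
  moreover have "P ** (adj P ** adj K) = adj K" by (simp add: matrix_mul_assoc unitary_matD assms)
  ultimately show ?thesis by (simp add: upper_factor_def lower_factor_def block_diag_mult)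
qed

text \<open>The rows are unit vectors, so the Frobenius norm is the square root of the size. This
  gives boundedness of the unitary group.\<close>

lemma norm_unitary:
  fixes P :: "complex ^ 'n ^ 'n"
  assumes "P ** adj P = mat 1"
  shows "norm P = sqrt (real CARD('n))"
proof -
  have "(\<Sum>j\<in>UNIV. (norm (P $ i $ j))\<^sup>2) = 1" for i
  proof -
    have "(P ** adj P) $ i $ i = complex_of_real (\<Sum>j\<in>UNIV. (norm (P $ i $ j))\<^sup>2)"
      by (simp add: matrix_matrix_mult_def complex_norm_square del: of_real_power)
    moreover have "(P ** adj P) $ i $ i = 1" unfolding assms by (simp add: mat_def)
    ultimately show ?thesis by (simp del: of_real_sum)
  qed
  then have "(norm P)\<^sup>2 = real CARD('n)" by (simp add: norm_matrix_sq)
  then show ?thesis by (simp add: real_sqrt_unique)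
qed

lemma compact_unitary: "compact {P :: complex ^ 'n ^ 'n. unitary_mat P}"
proof -
  have cadj: "continuous_on UNIV (adj :: complex ^ 'n ^ 'n \<Rightarrow> _)"
    by (rule linear_continuous_on[OF bounded_linear_adj])
  have c1: "continuous_on UNIV (\<lambda>P :: complex ^ 'n ^ 'n. P ** adj P)"
    by (intro bounded_bilinear.continuous_on[OF bounded_bilinear_matrix_mult] continuous_on_id cadj)
  have c2: "continuous_on UNIV (\<lambda>P :: complex ^ 'n ^ 'n. adj P ** P)"
    by (intro bounded_bilinear.continuous_on[OF bounded_bilinear_matrix_mult] continuous_on_id cadj)
  have "closed {P :: complex ^ 'n ^ 'n. P ** adj P = mat 1 \<and> adj P ** P = mat 1}"
    by (intro closed_Collect_conj closed_Collect_eq c1 c2 continuous_on_const)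
  moreover have "bounded {P :: complex ^ 'n ^ 'n. P ** adj P = mat 1 \<and> adj P ** P = mat 1}"
    unfolding bounded_iff by (intro exI[of _ "sqrt (real CARD('n))"]) (auto simp: norm_unitary)
  ultimately show ?thesis by (simp add: compact_eq_bounded_closed unitary_mat_def)
qed

lemma continuous_upper_factor: "continuous_on UNIV (upper_factor :: complex ^ 'r ^ 'r \<Rightarrow> complex ^ ('r::finite + 'r) ^ ('r + 'r))"
  unfolding continuous_on_def upper_factor_def block_diag_def
  by (intro ballI tendsto_block_mat tendsto_const tendsto_ident_at)

lemma bound_off_reals:
  fixes f :: "complex \<Rightarrow> 'a::real_normed_vector"
  assumes W: "open W" and cont: "continuous_on W f" and bnd: "\<And>z. z \<in> W - \<real> \<Longrightarrow> norm (f z) \<le> B" and z: "z \<in> W"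
  shows "norm (f z) \<le> B"
proof (cases "z \<in> \<real>")
  case True
  then obtain x where x: "z = complex_of_real x" by (auto elim: Reals_cases)
  have "(f \<longlongrightarrow> f z) (at z within - \<real>)"
    using W cont z by (auto simp: continuous_on_eq_continuous_at isCont_def intro: tendsto_within_subset)
  moreover have "eventually (\<lambda>v. v \<in> W - \<real>) (at z within - \<real>)"
    unfolding eventually_at_topological using W z by (intro exI[of _ W]) auto
  then have "eventually (\<lambda>v. norm (f v) \<le> B) (at z within - \<real>)"
    by eventually_elim (rule bnd)
  ultimately show ?thesis using at_nonreal_ne_bot[of x] unfolding x by (intro Lim_norm_ubound) auto
qed (use bnd z in auto)

section \<open>Changing the datum in one gap\<close>

locale gap_system = band_system +
  fixes j :: nat
  assumes j: "1 \<le> j" "j \<le> g"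
begin

definition mid :: real where "mid = (b (j - 1) + a j) / 2"

abbreviation c :: complex where "c \<equiv> complex_of_real mid"

definition rin :: real where "rin = (a j - b (j - 1)) / 2"

text \<open>The inner circle passes through both ends of the gap. The minimum of the two band
  lengths keeps the real points of the annulus inside the adjacent bands and away from their far
  endpoints.\<close>

definition rout :: real where "rout = rin + min (b (j - 1) - a (j - 1)) (b j - a j)"

lemma gap_order: "a (j - 1) < b (j - 1)" "b (j - 1) < a j" "a j < b j"
  using band_less[of "j - 1"] gap_less[of "j - 1"] band_less[of j] j by auto

lemma radii: "0 < rin" "rin < rout"
  using gap_order by (auto simp: rin_def rout_def)

lemma norm_real_c: "norm (complex_of_real x - c) = \<bar>x - mid\<bar>"
  by (metis norm_of_real of_real_diff)

lemma ball_real: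
  assumes "\<bar>x - mid\<bar> < rout" shows "a (j - 1) < x" "x < b j"
proof -
  have "rout \<le> rin + (b (j - 1) - a (j - 1))" "rout \<le> rin + (b j - a j)" by (simp_all add: rout_def)
  then show "a (j - 1) < x" "x < b j"
    using assms by (auto simp: mid_def rin_def abs_less_iff field_simps)
qed

lemma ends: "a 0 \<le> a (j - 1)" "b j \<le> b g"
  using a_mono[of 0 "j - 1"] b_mono[of j g] j by auto

lemma inner_real: "\<bar>x - mid\<bar> < rin \<longleftrightarrow> x \<in> gap a b j"
  by (auto simp: mid_def rin_def gap_def abs_less_iff field_simps)

lemma inner_real_E: "\<bar>x - mid\<bar> = rin \<Longrightarrow> x \<in> E"
proof -
  assume "\<bar>x - mid\<bar> = rin"
  then have "x = b (j - 1) \<or> x = a j" by (auto simp: mid_def rin_def abs_if field_simps split: if_splits)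
  then show "x \<in> E" using j by (auto simp: endpoints_def)
qed

lemma annulus_real_band:
  assumes "rin < \<bar>x - mid\<bar>" "\<bar>x - mid\<bar> < rout"
  shows "(a (j - 1) < x \<and> x < b (j - 1)) \<or> (a j < x \<and> x < b j)"
  using assms ball_real[OF assms(2)] by (auto simp: mid_def rin_def field_simps abs_if split: if_splits)

lemma annulus_real_jumps:
  assumes "rin < \<bar>x - mid\<bar>" "\<bar>x - mid\<bar> < rout"
  shows "jumps K x band_jump"
proof -
  have "(j - 1 \<le> g \<and> a (j - 1) < x \<and> x < b (j - 1)) \<or> (j \<le> g \<and> a j < x \<and> x < b j)"
    using annulus_real_band[OF assms] j by auto
  then show ?thesis unfolding jumps_def by blast
qed

lemma ball_S_nonreal: "z \<in> ball c rout \<Longrightarrow> z \<in> S \<Longrightarrow> z \<notin> \<real>"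
proof
  assume z: "z \<in> ball c rout" "z \<in> S" "z \<in> \<real>"
  then obtain x where x: "z = complex_of_real x" by (auto elim: Reals_cases)
  have "\<bar>x - mid\<bar> < rout" using z(1) norm_real_c[of x] by (simp add: x dist_norm norm_minus_commute)
  from ball_real[OF this] have "a 0 < x" "x < b g"
    using ends by auto
  then show False using z(2) by (simp add: x real_in_S)
qed

text \<open>Throughout the disc, gap and bands alike, the change of datum is absorbed by the pair of
  side factors. Outside the disc it is not visible at all.\<close>

lemma jumps_ball:
  assumes K: "unitary_data K" and P: "unitary_mat P" and x: "\<bar>x - mid\<bar> < rout" and W: "jumps (K(j := K j ** P)) x W"
  shows "\<exists>W0. jumps K x W0 \<and> W0 ** upper_factor P = lower_factor P ** W"
proof -
  have xE: "x \<notin> E" by (rule jumps_not_E[OF W])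
  consider (ingap) "x \<in> gap a b j" | (inband) "rin < \<bar>x - mid\<bar>"
    using inner_real[of x] inner_real_E[of x] xE by fastforce
  then show ?thesis
  proof cases
    case inband
    note bnd = annulus_real_band[OF inband x]
    have 1: "W = band_jump"
      using W unfolding jumps_def
    proof (elim disjE bexE conjE exE)
      fix i assume i: "i \<in> {1..g}" "x \<in> gap a b i"
      have "jumps K x band_jump" by (rule annulus_real_jumps[OF inband x])
      consider "i < j" | "i = j" | "j < i" by linarith
      then have False
      proof cases
        case 1
        have "a i \<le> a (j - 1)" using 1 j by (intro a_mono) auto
        then show ?thesis using i(2) ball_real[OF x] by (auto simp: gap_def)
      next
        case 2 then show ?thesis using i(2) bnd by (auto simp: gap_def)
      next
        case 3
        have "b j \<le> b (i - 1)" using 3 i by (intro b_mono) auto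
        then show ?thesis using i(2) ball_real[OF x] by (auto simp: gap_def)
      qed
      then show ?thesis ..
    next
      assume "x < a 0" then show ?thesis using ball_real[OF x] ends by auto
    next
      assume "b g < x" then show ?thesis using ball_real[OF x] ends by auto
    qed
    show ?thesis unfolding 1 using annulus_real_jumps[OF inband x] band_jump_factor by blast
  next
    case ingap
    have 1: "W = block_diag (K j ** P) (matrix_inv (K j ** P))"
      using W unfolding jumps_def
    proof (elim disjE bexE conjE exE)
      fix k assume k: "k \<le> g" "a k < x" "x < b k"
      consider "k < j" | "j \<le> k" by linarith
      then have False
      proof cases
        case 1
        have "b k \<le> b (j - 1)" using 1 j by (intro b_mono) auto
        then show ?thesis using k ingap by (auto simp: gap_def)
      next
        case 2
        have "a j \<le> a k" using 2 k by (intro a_mono) auto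
        then show ?thesis using k ingap by (auto simp: gap_def)
      qed
      then show ?thesis ..
    next
      fix i assume i: "i \<in> {1..g}" "x \<in> gap a b i"
        "W = block_diag ((K(j := K j ** P)) i) (matrix_inv ((K(j := K j ** P)) i))"
      consider "i < j" | "i = j" | "j < i" by linarith
      then show ?thesis
      proof cases
        case 1
        have "a i \<le> a (j - 1)" using 1 j by (intro a_mono) auto
        then show ?thesis using i(2) ingap gap_order by (auto simp: gap_def)
      next
        case 2 then show ?thesis using i(3) by simp
      next
        case 3
        have "b j \<le> b (i - 1)" using 3 i by (intro b_mono) auto
        then show ?thesis using i(2) ingap gap_order by (auto simp: gap_def)
      qed
    next
      assume "x < a 0" then show ?thesis using ball_real[OF x] ends by auto
    next
      assume "b g < x" then show ?thesis using ball_real[OF x] ends by auto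
    qed
    have "jumps K x (block_diag (K j) (matrix_inv (K j)))"
      unfolding jumps_def by (rule disjI2, rule disjI1, rule bexI[of _ j]) (use ingap j in auto)
    moreover have "unitary_mat (K j)" using K j by (auto simp: unitary_data_def)
    ultimately show ?thesis unfolding 1 using gap_jump_factor[OF _ P] by blast
  qed
qed

lemma jumps_exterior:
  assumes "rin < \<bar>x - mid\<bar>" shows "jumps (K(j := K')) x W \<longleftrightarrow> jumps K x W"
proof -
  have "x \<notin> gap a b j" using assms inner_real[of x] by auto
  then show ?thesis unfolding jumps_def by (auto simp: fun_upd_def)
qed

text \<open>The value on the real axis is immaterial, since only the one-sided limits are used
  there.\<close>

definition side_factor :: "complex ^ 'r ^ 'r \<Rightarrow> complex \<Rightarrow> complex ^ ('r + 'r) ^ ('r + 'r)" where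
  "side_factor P z = (if Im z > 0 then upper_factor P else lower_factor P)"

lemma boundary_side_factor:
  "boundary_plus (side_factor P) x (upper_factor P)" "boundary_minus (side_factor P) x (lower_factor P)"
  unfolding boundary_plus_def boundary_minus_def
  by (rule Lim_transform_eventually[OF tendsto_const]; simp add: eventually_at_filter side_factor_def)+

lemma side_factor_hol: "mat_holomorphic_on (side_factor P) (- \<real>)"
  unfolding nonreal_Un
proof (rule mat_holomorphic_on_Un)
  show "mat_holomorphic_on (side_factor P) {z. Im z > 0}"
    by (rule mat_holomorphic_on_cong[OF _ mat_holomorphic_on_const]) (simp add: side_factor_def)
  show "mat_holomorphic_on (side_factor P) {z. Im z < 0}"
    by (rule mat_holomorphic_on_cong[OF _ mat_holomorphic_on_const]) (simp add: side_factor_def)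
qed (simp_all add: open_upper open_halfspace_Im_lt)

lemma side_factor_bound: "norm (side_factor P z) \<le> norm (upper_factor P) + norm (lower_factor P)"
  by (simp add: side_factor_def)

lemma side_factor_mult: "side_factor P z ** side_factor Q z = side_factor (P ** Q) z"
  by (simp add: side_factor_def factor_mult)

lemma side_factor_1: "side_factor (mat 1) z = mat 1"
  by (simp add: side_factor_def factor_1)

abbreviation "A \<equiv> annulus c rin rout"

lemma A_ball: "A \<subseteq> ball c rout"
  by (auto simp: annulus_def dist_norm norm_minus_commute)

text \<open>Near the annulus a solution only sees the jump across the two adjacent bands. Multiplying by
  the band jump in the lower half plane removes it.\<close>

definition local_frame :: "(complex \<Rightarrow> complex ^ ('r::finite + 'r) ^ ('r + 'r)) \<Rightarrow> (complex \<Rightarrow> complex ^ ('r + 'r) ^ ('r + 'r))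
    \<Rightarrow> (complex \<Rightarrow> complex ^ ('r + 'r) ^ ('r + 'r)) \<Rightarrow> bool" where
  "local_frame N T Ti \<longleftrightarrow> mat_holomorphic_on T A \<and> mat_holomorphic_on Ti A \<and>
     (\<forall>z\<in>A. T z ** Ti z = mat 1) \<and>
     (\<forall>z\<in>A. Im z > 0 \<longrightarrow> T z = N z) \<and> (\<forall>z\<in>A. Im z < 0 \<longrightarrow> T z = N z ** band_jump)"

text \<open>By \<open>sol_inverse\<close> this is the inverse of a normalised solution. The
  reflected form makes its holomorphy, growth and boundary values immediate.\<close>

definition sol_inv :: "(complex \<Rightarrow> complex ^ ('r::finite + 'r) ^ ('r + 'r)) \<Rightarrow> complex \<Rightarrow> complex ^ ('r + 'r) ^ ('r + 'r)" where
  "sol_inv N z = swap_mat ** sharp N z ** swap_mat"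

lemma sol_inv_hol: "mat_holomorphic_on N S \<Longrightarrow> mat_holomorphic_on (sol_inv N) S"
  unfolding sol_inv_def[abs_def] using cnj_S
  by (intro mat_holomorphic_on_mult mat_holomorphic_on_const mat_holomorphic_on_sharp) auto

lemma boundary_sol_inv:
  assumes "boundary_plus N x (Fm ** W)" "boundary_minus N x Fm"
  shows "boundary_plus (sol_inv N) x (swap_mat ** adj Fm ** swap_mat)"
    "boundary_minus (sol_inv N) x (swap_mat ** adj (Fm ** W) ** swap_mat)"
proof -
  show "boundary_plus (sol_inv N) x (swap_mat ** adj Fm ** swap_mat)"
    unfolding sol_inv_def[abs_def] by (intro boundary_mult boundary_const boundary_sharp assms(2))
  show "boundary_minus (sol_inv N) x (swap_mat ** adj (Fm ** W) ** swap_mat)"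
    unfolding sol_inv_def[abs_def] by (intro boundary_mult boundary_const boundary_sharp' assms(1))
qed

lemma local_frame_exists:
  fixes N :: "complex \<Rightarrow> complex ^ ('a::finite + 'a) ^ ('a + 'a)"
  assumes K: "unitary_data K" and N: "sol K (mat 1) N"
  shows "\<exists>T Ti. local_frame N T Ti"
proof -
  have nonreal_A: "A - \<real> \<subseteq> S" using nonreal_S by blast
  define f where "f z = N z ** (if Im z > 0 then mat 1 else band_jump)" for z
  \<comment> \<open>The inverse frame is built from \<open>sol_inv\<close> and extended across the
    bands on its own. That it inverts \<open>T\<close> is then an identity off the axis which
    continuity carries over.\<close>
  define f' where "f' z = (if Im z > 0 then mat 1 else - band_jump) ** sol_inv N z" for z
  have pw: "mat_holomorphic_on (\<lambda>z. if Im z > 0 then B else C) (- \<real>)" for B C :: "complex ^ ('a + 'a) ^ ('a + 'a)"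
    unfolding nonreal_Un
  proof (rule mat_holomorphic_on_Un)
    show "mat_holomorphic_on (\<lambda>z. if Im z > 0 then B else C) {z. Im z > 0}"
      by (rule mat_holomorphic_on_cong[OF _ mat_holomorphic_on_const[of B]]) simp
    show "mat_holomorphic_on (\<lambda>z. if Im z > 0 then B else C) {z. Im z < 0}"
      by (rule mat_holomorphic_on_cong[OF _ mat_holomorphic_on_const[of C]]) simp
  qed (simp_all add: open_upper open_halfspace_Im_lt)
  have pwb: "boundary_plus (\<lambda>z. if Im z > 0 then B else C) x B" "boundary_minus (\<lambda>z. if Im z > 0 then B else C) x C"
    for B C :: "complex ^ ('a + 'a) ^ ('a + 'a)" and x
    unfolding boundary_plus_def boundary_minus_def
    by (rule Lim_transform_eventually[OF tendsto_const]; simp add: eventually_at_filter)+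
  have real_x: "\<exists>Fm. boundary_plus N x (Fm ** band_jump) \<and> boundary_minus N x Fm" if "complex_of_real x \<in> A" for x
    using that solD(4)[OF N annulus_real_jumps[of x]] norm_real_c[of x] by (auto simp: annulus_def)
  have "\<exists>T. mat_holomorphic_on T A \<and> (\<forall>z\<in>A - \<real>. T z = f z)"
  proof (rule mat_holomorphic_extend_across_reals[where T = "{}"])
    show "mat_holomorphic_on f (A - \<real>)" unfolding f_def[abs_def]
      by (intro mat_holomorphic_on_mult mat_holomorphic_on_subset[OF solD(1)[OF N] nonreal_A] mat_holomorphic_on_subset[OF pw]) auto
    fix x assume "complex_of_real x \<in> A"
    from real_x[OF this] obtain Fm where Fm: "boundary_plus N x (Fm ** band_jump)" "boundary_minus N x Fm" by blast
    have "boundary_plus f x (Fm ** band_jump ** mat 1)" "boundary_minus f x (Fm ** band_jump)"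
      unfolding f_def[abs_def] by (intro boundary_mult Fm pwb)+
    then show "\<exists>L. boundary_plus f x L \<and> boundary_minus f x L" by auto
  qed auto
  then obtain T where T: "mat_holomorphic_on T A" "\<And>z. z \<in> A - \<real> \<Longrightarrow> T z = f z" by blast
  have "\<exists>T. mat_holomorphic_on T A \<and> (\<forall>z\<in>A - \<real>. T z = f' z)"
  proof (rule mat_holomorphic_extend_across_reals[where T = "{}"])
    show "mat_holomorphic_on f' (A - \<real>)" unfolding f'_def[abs_def]
      by (intro mat_holomorphic_on_mult mat_holomorphic_on_subset[OF sol_inv_hol[OF solD(1)[OF N]] nonreal_A] mat_holomorphic_on_subset[OF pw]) auto
    fix x assume "complex_of_real x \<in> A"
    from real_x[OF this] obtain Fm where Fm: "boundary_plus N x (Fm ** band_jump)" "boundary_minus N x Fm" by blast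
    have p: "boundary_plus f' x (mat 1 ** (swap_mat ** adj Fm ** swap_mat))"
      and m: "boundary_minus f' x (- band_jump ** (swap_mat ** adj (Fm ** band_jump) ** swap_mat))"
      unfolding f'_def[abs_def] by (intro boundary_mult boundary_sol_inv[OF Fm] pwb)+
    \<comment> \<open>The identity J Y J = Y, with J the band jump and Y the swap, makes the two
      one-sided limits coincide.\<close>
    have "- band_jump ** (swap_mat ** adj (Fm ** band_jump) ** swap_mat) = (- band_jump ** swap_mat ** (- band_jump)) ** adj Fm ** swap_mat"
      unfolding adj_mult adj_band_jump by (simp only: matrix_mul_assoc)
    also have "- band_jump ** swap_mat ** (- band_jump) = (swap_mat :: complex ^ ('a + 'a) ^ ('a + 'a))"
      by (simp add: neg_matrix_mult block_mat_mult)
    finally show "\<exists>L. boundary_plus f' x L \<and> boundary_minus f' x L" using p m by auto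
  qed auto
  then obtain Ti where Ti: "mat_holomorphic_on Ti A" "\<And>z. z \<in> A - \<real> \<Longrightarrow> Ti z = f' z" by blast
  have ff': "T z ** Ti z = mat 1" if z: "z \<in> A - \<real>" for z
  proof -
    have zS: "z \<in> S" using z nonreal_S by blast
    have "(if Im z > 0 then mat 1 else band_jump) ** (if Im z > 0 then mat 1 else - band_jump) = (mat 1 :: complex ^ ('a + 'a) ^ ('a + 'a))"
      by (simp add: band_jump_inv)
    moreover have "T z ** Ti z = N z ** ((if Im z > 0 then mat 1 else band_jump) ** (if Im z > 0 then mat 1 else - band_jump)) ** sol_inv N z"
      unfolding T(2)[OF z] Ti(2)[OF z] f_def f'_def by (simp only: matrix_mul_assoc)
    ultimately show ?thesis using sol_inverse(1)[OF K N zS] by (simp add: sol_inv_def)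
  qed
  have "T z ** Ti z = mat 1" if "z \<in> A" for z
  proof (rule open_agree_off_reals[OF open_annulus continuous_on_const _ _ that])
    show "continuous_on A (\<lambda>z. T z ** Ti z)"
      by (intro mat_holomorphic_on_imp_continuous_on mat_holomorphic_on_mult T Ti)
  qed (rule ff')
  then have "local_frame N T Ti"
    unfolding local_frame_def using T Ti by (auto simp: f_def complex_is_Real_iff)
  then show ?thesis by blast
qed

lemma local_frame_inv:
  assumes K: "unitary_data K" and N: "sol K (mat 1) N" and fr: "local_frame N T Ti" and z: "z \<in> A"
  shows "Im z > 0 \<Longrightarrow> Ti z = sol_inv N z" "Im z < 0 \<Longrightarrow> Ti z = - band_jump ** sol_inv N z"
proof -
  have TTi: "T z ** Ti z = mat 1" using fr z by (simp add: local_frame_def)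
  have uniq: "Ti z = B" if "B ** T z = mat 1" for B
  proof -
    have "Ti z = B ** T z ** Ti z" by (simp add: that)
    also have "\<dots> = B" by (simp add: matrix_mul_assoc[symmetric] TTi)
    finally show ?thesis .
  qed
  {
    assume im: "Im z > 0"
    then have "sol_inv N z ** T z = mat 1"
      using sol_inverse(2)[OF K N, of z] fr z upper_S by (auto simp: local_frame_def sol_inv_def)
    then show "Ti z = sol_inv N z" by (rule uniq)
  next
    assume im: "Im z < 0"
    then have TN: "T z = N z ** band_jump" using fr z by (simp add: local_frame_def)
    have "(- band_jump ** sol_inv N z) ** T z = - band_jump ** (sol_inv N z ** N z) ** band_jump"
      unfolding TN by (simp only: matrix_mul_assoc)
    also have "\<dots> = mat 1"
      using sol_inverse(2)[OF K N, of z] im lower_S band_jump_inv by (auto simp: sol_inv_def)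
    finally show "Ti z = - band_jump ** sol_inv N z" by (rule uniq)
  }
qed

text \<open>In the lower half plane the frame contains the factor J, which turns the upper factor
  into the lower one. So a single holomorphic jump on the annulus encodes different factors on the
  two sides of the axis.\<close>

lemma frame_conj:
  assumes K: "unitary_data K" and N: "sol K (mat 1) N" and fr: "local_frame N T Ti" and z: "z \<in> A - \<real>"
  shows "T z ** upper_factor P ** Ti z = N z ** side_factor P z ** sol_inv N z"
proof (cases "Im z > 0")
  case True
  then show ?thesis using fr z local_frame_inv(1)[OF K N fr, of z] by (auto simp: local_frame_def side_factor_def)
next
  case False
  then have im: "Im z < 0" using z by (auto simp: complex_is_Real_iff)
  have "T z ** upper_factor P ** Ti z = N z ** (band_jump ** upper_factor P) ** (- band_jump) ** sol_inv N z"
    using fr z im local_frame_inv(2)[OF K N fr, of z] by (auto simp: local_frame_def matrix_mul_assoc)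
  also have "\<dots> = N z ** lower_factor P ** (band_jump ** (- band_jump)) ** sol_inv N z"
    unfolding band_jump_factor by (simp only: matrix_mul_assoc)
  also have "\<dots> = N z ** lower_factor P ** sol_inv N z" unfolding band_jump_inv by simp
  finally show ?thesis using im by (simp add: side_factor_def)
qed

end

lemma tendsto_jump_transform:
  assumes "(F \<longlongrightarrow> L) (at z within T)" "open U" "z \<in> U" "\<And>w. w \<in> U \<Longrightarrow> w \<in> T \<Longrightarrow> F w = G w"
  shows "(G \<longlongrightarrow> L) (at z within T)"
proof (rule Lim_transform_eventually[OF assms(1)])
  show "eventually (\<lambda>w. F w = G w) (at z within T)"
    unfolding eventually_at_topological using assms(2-4) by blast
qed

lemma eventually_bounded_at:
  fixes F :: "complex \<Rightarrow> complex ^ 'n ^ 'm"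
  assumes "isCont F z"
  shows "\<exists>B. eventually (\<lambda>w. norm (F w) \<le> B) (at z within T)"
proof -
  have "(F \<longlongrightarrow> F z) (at z within T)" using assms by (auto simp: isCont_def intro: tendsto_within_subset)
  then have "((\<lambda>w. norm (F w)) \<longlongrightarrow> norm (F z)) (at z within T)" by (rule tendsto_norm)
  then have "eventually (\<lambda>w. norm (F w) < norm (F z) + 1) (at z within T)" by (rule order_tendstoD) simp
  then show ?thesis by (intro exI[of _ "norm (F z) + 1"]) (auto elim: eventually_mono)
qed

lemma mat_holomorphic_isCont:
  "mat_holomorphic_on F U \<Longrightarrow> open U \<Longrightarrow> z \<in> U \<Longrightarrow> isCont F z"
  using mat_holomorphic_on_imp_continuous_on[of F U] by (simp add: continuous_on_eq_continuous_at)

context band_system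
begin

lemma quarter_growth_transform:
  assumes "quarter_growth F e" "open U" "complex_of_real e \<in> U" "\<And>z. z \<in> U \<inter> S \<Longrightarrow> F z = G z"
  shows "quarter_growth G e"
proof -
  obtain C where C: "eventually (\<lambda>z. norm (F z) \<le> C * norm (z - complex_of_real e) powr (- 1 / 4)) (at (complex_of_real e) within S)"
    using assms(1) by (auto simp: quarter_growth_def)
  have "eventually (\<lambda>z. z \<in> U \<inter> S) (at (complex_of_real e) within S)"
    unfolding eventually_at_topological using assms(2,3) by blast
  then have "eventually (\<lambda>z. norm (G z) \<le> C * norm (z - complex_of_real e) powr (- 1 / 4)) (at (complex_of_real e) within S)"
    using C by eventually_elim (simp add: assms(4))
  then show ?thesis unfolding quarter_growth_def by blast
qed

lemma eventually_exterior: "eventually (\<lambda>z. r < norm (z - d)) at_infinity" for d :: complex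
proof -
  have "filterlim (\<lambda>z. - d + z) at_infinity at_infinity"
    by (rule tendsto_add_filterlim_at_infinity[OF tendsto_const filterlim_ident])
  then have "filterlim (\<lambda>z. norm (z - d)) at_top at_infinity"
    by (simp add: filterlim_at_infinity_conv_norm_at_top)
  then show ?thesis by (simp add: filterlim_at_top_dense)
qed

end

context gap_system
begin

text \<open>A factorization of the conjugated jump on a thin annulus modifies the base solution \<open>N\<close> to a
  solution in which the jump on the gap \<open>j\<close> is multiplied by \<open>P\<close>.\<close>

lemma glue:
  fixes N u w :: "complex \<Rightarrow> complex ^ ('r::finite + 'r) ^ ('r + 'r)"
  assumes K: "unitary_data K" and P: "unitary_mat P" and N: "sol K (mat 1) N" and fr: "local_frame N T Ti"
    and st: "rin \<le> s" "s < t" "t \<le> rout"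
    and u: "mat_holomorphic_on u (ball c t)" and w: "mat_holomorphic_on w {z. s < norm (z - c)}"
    and lim: "(w \<longlongrightarrow> L) at_infinity"
    and eq: "\<And>z. z \<in> annulus c s t \<Longrightarrow> w z = u z ** (T z ** upper_factor P ** Ti z)"
  defines "F \<equiv> \<lambda>z. if norm (z - c) < (s + t) / 2 then u z ** N z ** side_factor P z else w z ** N z"
  shows "sol (K(j := K j ** P)) L F"
    and "\<And>z. z \<in> ball c t - \<real> \<Longrightarrow> F z = u z ** N z ** side_factor P z"
    and "\<And>z. z \<in> S \<Longrightarrow> s < norm (z - c) \<Longrightarrow> F z = w z ** N z"
proof -
  have ann_S: "z \<in> A - \<real>" if "z \<in> annulus c s t" "z \<in> S" for z
  proof -
    have "z \<in> A" using that st by (auto simp: annulus_def)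
    then show ?thesis using ball_S_nonreal[OF subsetD[OF A_ball]] that(2) by auto
  qed
  \<comment> \<open>On the overlap both formulas define the same function: by
    \<open>frame_conj\<close> the inverse of \<open>N\<close> inside the conjugated jump cancels
    against \<open>N\<close>.\<close>
  have agree: "w z ** N z = u z ** N z ** side_factor P z" if z: "z \<in> annulus c s t" "z \<in> S" for z
  proof -
    have "w z ** N z = u z ** (N z ** side_factor P z ** sol_inv N z) ** N z"
      unfolding eq[OF z(1)] frame_conj[OF K N fr ann_S[OF z]] ..
    also have "\<dots> = u z ** N z ** side_factor P z ** (sol_inv N z ** N z)" by (simp only: matrix_mul_assoc)
    also have "\<dots> = u z ** N z ** side_factor P z" using sol_inverse(2)[OF K N z(2)] by (simp add: sol_inv_def)
    finally show ?thesis .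
  qed
  have ball_t: "z \<in> ball c t \<Longrightarrow> z \<in> S \<Longrightarrow> z \<notin> \<real>" for z
    using ball_S_nonreal[of z] st by auto
  show Fin: "F z = u z ** N z ** side_factor P z" if "z \<in> ball c t - \<real>" for z
  proof (cases "norm (z - c) < (s + t) / 2")
    case False
    then have "z \<in> annulus c s t" using that st by (auto simp: annulus_def dist_norm norm_minus_commute)
    then show ?thesis using agree[of z] False that nonreal_S by (auto simp: F_def)
  qed (simp add: F_def)
  show Fout: "F z = w z ** N z" if "z \<in> S" "s < norm (z - c)" for z
  proof (cases "norm (z - c) < (s + t) / 2")
    case True
    then have "z \<in> annulus c s t" using that st by (auto simp: annulus_def)
    then show ?thesis using agree[of z] True that by (simp add: F_def)
  qed (simp add: F_def)
  have ND: "mat_holomorphic_on N S" by (rule solD(1)[OF N])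
  show "sol (K(j := K j ** P)) L F"
    unfolding sol_def
  proof (intro conjI ballI allI impI)
    have "mat_holomorphic_on F ((ball c t - \<real>) \<union> (S \<inter> {z. s < norm (z - c)}))"
    proof (rule mat_holomorphic_on_Un)
      show "mat_holomorphic_on F (ball c t - \<real>)"
      proof (rule mat_holomorphic_on_cong)
        show "mat_holomorphic_on (\<lambda>z. u z ** N z ** side_factor P z) (ball c t - \<real>)"
          using nonreal_S by (intro mat_holomorphic_on_mult mat_holomorphic_on_subset[OF u] mat_holomorphic_on_subset[OF ND]
              mat_holomorphic_on_subset[OF side_factor_hol]) auto
      qed (simp add: Fin)
      show "mat_holomorphic_on F (S \<inter> {z. s < norm (z - c)})"
      proof (rule mat_holomorphic_on_cong)
        show "mat_holomorphic_on (\<lambda>z. w z ** N z) (S \<inter> {z. s < norm (z - c)})"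
          by (intro mat_holomorphic_on_mult mat_holomorphic_on_subset[OF w] mat_holomorphic_on_subset[OF ND]) auto
      qed (simp add: Fout)
    qed (simp_all add: open_Diff closed_complex_Reals open_Int)
    moreover have "S \<subseteq> (ball c t - \<real>) \<union> (S \<inter> {z. s < norm (z - c)})"
    proof
      fix x assume x: "x \<in> S"
      show "x \<in> (ball c t - \<real>) \<union> (S \<inter> {z. s < norm (z - c)})"
      proof (cases "x \<in> ball c t")
        case False
        then have "s < norm (x - c)" using st by (simp add: dist_norm norm_minus_commute)
        then show ?thesis using x by blast
      qed (use ball_t x in blast)
    qed
    ultimately show "mat_holomorphic_on F S" by (rule mat_holomorphic_on_subset)
  next
    have "((\<lambda>z. w z ** N z) \<longlongrightarrow> L ** mat 1) at_infinity" by (intro tendsto_matrix_mult lim solD(2)[OF N])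
    moreover have "eventually (\<lambda>z. w z ** N z = F z) at_infinity"
      using eventually_exterior[of t c] by eventually_elim (use st in \<open>auto simp: F_def\<close>)
    ultimately have "(F \<longlongrightarrow> L ** mat 1) at_infinity" by (rule Lim_transform_eventually)
    then show "(F \<longlongrightarrow> L) at_infinity" by simp
  next
    fix e assume e: "e \<in> E"
    show "quarter_growth F e"
    proof (cases "\<bar>e - mid\<bar> < t")
      case True
      then have eb: "complex_of_real e \<in> ball c t" using norm_real_c[of e] by (simp add: dist_norm norm_minus_commute)
      obtain B where B: "eventually (\<lambda>z. norm (u z) \<le> B) (at (complex_of_real e) within S)"
        using eventually_bounded_at[OF mat_holomorphic_isCont[OF u open_ball eb]] by blast
      have "quarter_growth (\<lambda>z. u z ** N z ** side_factor P z) e"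
        by (rule quarter_growth_mult_bounded[OF quarter_growth_bounded_mult[OF B solD(3)[OF N e]]])
           (rule always_eventually, rule allI, rule side_factor_bound)
      then show ?thesis by (rule quarter_growth_transform[OF _ open_ball eb]) (use Fin ball_t in auto)
    next
      case False
      then have ee: "complex_of_real e \<in> {z. s < norm (z - c)}" using norm_real_c[of e] st by simp
      obtain B where B: "eventually (\<lambda>z. norm (w z) \<le> B) (at (complex_of_real e) within S)"
        using eventually_bounded_at[OF mat_holomorphic_isCont[OF w open_exterior ee]] by blast
      have "quarter_growth (\<lambda>z. w z ** N z) e"
        by (rule quarter_growth_bounded_mult[OF B solD(3)[OF N e]])
      then show ?thesis by (rule quarter_growth_transform[OF _ open_exterior ee]) (use Fout in auto)
    qed
  next
    fix x W assume W: "jumps (K(j := K j ** P)) x W"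
    show "jump_at F x W"
    proof (cases "\<bar>x - mid\<bar> < t")
      case True
      then have xb: "complex_of_real x \<in> ball c t" using norm_real_c[of x] by (simp add: dist_norm norm_minus_commute)
      have "\<bar>x - mid\<bar> < rout" using True st by simp
      from jumps_ball[OF K P this W] obtain W0 where W0: "jumps K x W0" "W0 ** upper_factor P = lower_factor P ** W" by blast
      obtain Nm where Nm: "boundary_plus N x (Nm ** W0)" "boundary_minus N x Nm" using solD(4)[OF N W0(1)] by blast
      note ux = boundary_isCont[OF mat_holomorphic_isCont[OF u open_ball xb]]
      have "boundary_plus (\<lambda>z. u z ** N z ** side_factor P z) x (u (complex_of_real x) ** (Nm ** W0) ** upper_factor P)"
        by (intro boundary_mult ux Nm boundary_side_factor)
      then have p: "boundary_plus F x (u (complex_of_real x) ** (Nm ** W0) ** upper_factor P)"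
        unfolding boundary_plus_def
        by (rule tendsto_jump_transform[OF _ open_ball xb]) (simp add: Fin complex_is_Real_iff)
      have "boundary_minus (\<lambda>z. u z ** N z ** side_factor P z) x (u (complex_of_real x) ** Nm ** lower_factor P)"
        by (intro boundary_mult ux Nm boundary_side_factor)
      then have m: "boundary_minus F x (u (complex_of_real x) ** Nm ** lower_factor P)"
        unfolding boundary_minus_def
        by (rule tendsto_jump_transform[OF _ open_ball xb]) (simp add: Fin complex_is_Real_iff)
      have "u (complex_of_real x) ** (Nm ** W0) ** upper_factor P = u (complex_of_real x) ** Nm ** (W0 ** upper_factor P)"
        by (simp only: matrix_mul_assoc)
      also have "\<dots> = u (complex_of_real x) ** Nm ** lower_factor P ** W" unfolding W0(2) by (simp only: matrix_mul_assoc)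
      finally show ?thesis unfolding jump_at_def using p m by blast
    next
      case False
      then have ee: "complex_of_real x \<in> {z. s < norm (z - c)}" using norm_real_c[of x] st by simp
      have "rin < \<bar>x - mid\<bar>" using False st by simp
      then have W0: "jumps K x W" using W jumps_exterior by blast
      obtain Nm where Nm: "boundary_plus N x (Nm ** W)" "boundary_minus N x Nm" using solD(4)[OF N W0] by blast
      note wx = boundary_isCont[OF mat_holomorphic_isCont[OF w open_exterior ee]]
      have "boundary_plus (\<lambda>z. w z ** N z) x (w (complex_of_real x) ** (Nm ** W))"
        by (intro boundary_mult wx Nm)
      then have p: "boundary_plus F x (w (complex_of_real x) ** (Nm ** W))"
        unfolding boundary_plus_def
        by (rule tendsto_jump_transform[OF _ open_exterior ee]) (use upper_S in \<open>auto simp: Fout\<close>)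
      have "boundary_minus (\<lambda>z. w z ** N z) x (w (complex_of_real x) ** Nm)"
        by (intro boundary_mult wx Nm)
      then have m: "boundary_minus F x (w (complex_of_real x) ** Nm)"
        unfolding boundary_minus_def
        by (rule tendsto_jump_transform[OF _ open_exterior ee]) (use lower_S in \<open>auto simp: Fout\<close>)
      show ?thesis unfolding jump_at_def using p m by (auto simp: matrix_mul_assoc)
    qed
  qed
qed

lemma unitary_data_upd:
  "unitary_data K \<Longrightarrow> unitary_mat P \<Longrightarrow> unitary_data (K(j := K j ** P))"
  using j by (auto simp: unitary_data_def intro: unitary_mult)

lemma quarter_growth_sol_inv:
  fixes N :: "complex \<Rightarrow> complex ^ ('r::finite + 'r) ^ ('r + 'r)"
  assumes "quarter_growth N e" shows "quarter_growth (sol_inv N) e"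
proof -
  have "eventually (\<lambda>z. norm (swap_mat :: complex ^ ('r + 'r) ^ ('r + 'r)) \<le> norm (swap_mat :: complex ^ ('r + 'r) ^ ('r + 'r))) (at (complex_of_real e) within S)"
    by simp
  then show ?thesis unfolding sol_inv_def[abs_def]
    by (intro quarter_growth_mult_bounded[OF quarter_growth_bounded_mult[OF _ quarter_growth_sharp[OF assms]]])
qed

text \<open>Conversely, the quotient of two solutions whose data differ only in the gap \<open>j\<close> is such a
  factorization.\<close>

lemma quotient:
  fixes N N0 :: "complex \<Rightarrow> complex ^ ('r::finite + 'r) ^ ('r + 'r)"
  assumes K: "unitary_data K" and P: "unitary_mat P" and N0: "sol K (mat 1) N0" and fr: "local_frame N0 T Ti"
    and N: "sol (K(j := K j ** P)) (mat 1) N"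
  shows "\<exists>u w. mat_holomorphic_on u (ball c rout) \<and> mat_holomorphic_on w {z. rin < norm (z - c)} \<and>
     (w \<longlongrightarrow> mat 1) at_infinity \<and> (\<forall>z\<in>A. w z = u z ** (T z ** upper_factor P ** Ti z)) \<and>
     (\<forall>z\<in>S. rin < norm (z - c) \<longrightarrow> N z = w z ** N0 z)"
proof -
  note K' = unitary_data_upd[OF K P]
  define f where "f z = N z ** sol_inv N0 z" for z
  \<comment> \<open>Outside the gap both solutions have the same jumps, so their quotient
    \<open>f\<close> has none there. In the disc the factor P^* first undoes the change of datum,
    and then the quotient \<open>h\<close> has no jump either.\<close>
  define h where "h z = N z ** side_factor (adj P) z ** sol_inv N0 z" for z
  have f_hol: "mat_holomorphic_on f S"
    unfolding f_def by (intro mat_holomorphic_on_mult sol_inv_hol solD(1)[OF N] solD(1)[OF N0])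
  have "\<exists>w. mat_holomorphic_on w {z. rin < norm (z - c)} \<and> (\<forall>z\<in>{z. rin < norm (z - c)} \<inter> S. w z = f z)"
  proof (rule extend_no_jump[OF open_exterior])
    show "mat_holomorphic_on f ({z. rin < norm (z - c)} \<inter> S)" by (rule mat_holomorphic_on_subset[OF f_hol]) auto
    show "half_growth f e" if "e \<in> E" for e
      unfolding f_def by (intro quarter_growth_mult quarter_growth_sol_inv solD(3)[OF N that] solD(3)[OF N0 that])
    fix x assume x: "complex_of_real x \<in> {z. rin < norm (z - c)}" "x \<notin> E"
    obtain W where W: "jumps K x W" using jumps_exists x by blast
    then have W': "jumps (K(j := K j ** P)) x W" using jumps_exterior x norm_real_c[of x] by auto
    obtain Nm where Nm: "boundary_plus N x (Nm ** W)" "boundary_minus N x Nm" using solD(4)[OF N W'] by blast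
    obtain Mm where Mm: "boundary_plus N0 x (Mm ** W)" "boundary_minus N0 x Mm" using solD(4)[OF N0 W] by blast
    have p: "boundary_plus f x ((Nm ** W) ** (swap_mat ** adj Mm ** swap_mat))"
      and m: "boundary_minus f x (Nm ** (swap_mat ** adj (Mm ** W) ** swap_mat))"
      unfolding f_def[abs_def] by (intro boundary_mult Nm boundary_sol_inv[OF Mm])+
    have "(Nm ** W) ** (swap_mat ** adj Mm ** swap_mat) = Nm ** (W ** swap_mat) ** adj Mm ** swap_mat"
      by (simp only: matrix_mul_assoc)
    also have "\<dots> = Nm ** (swap_mat ** adj (Mm ** W) ** swap_mat)"
      unfolding jumps_swap[OF K W] adj_mult by (simp only: matrix_mul_assoc)
    finally show "\<exists>L. boundary_plus f x L \<and> boundary_minus f x L" using p m by auto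
  qed
  then obtain w where w: "mat_holomorphic_on w {z. rin < norm (z - c)}" "\<And>z. z \<in> S \<Longrightarrow> rin < norm (z - c) \<Longrightarrow> w z = f z" by blast
  have h_hol: "mat_holomorphic_on h (- \<real>)"
    unfolding h_def[abs_def]
    by (intro mat_holomorphic_on_mult side_factor_hol mat_holomorphic_on_subset[OF sol_inv_hol[OF solD(1)[OF N0]] nonreal_subset_S]
        mat_holomorphic_on_subset[OF solD(1)[OF N] nonreal_subset_S])
  have "\<exists>u. mat_holomorphic_on u (ball c rout) \<and> (\<forall>z\<in>ball c rout \<inter> S. u z = h z)"
  proof (rule extend_no_jump[OF open_ball])
    show "mat_holomorphic_on h (ball c rout \<inter> S)"
      by (rule mat_holomorphic_on_subset[OF h_hol]) (use ball_S_nonreal in auto)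
    show "half_growth h e" if "e \<in> E" for e
    proof -
      have "quarter_growth (\<lambda>z. N z ** side_factor (adj P) z) e"
        by (rule quarter_growth_mult_bounded[OF solD(3)[OF N that]])
           (rule always_eventually, rule allI, rule side_factor_bound)
      then show ?thesis unfolding h_def
        by (rule quarter_growth_mult[OF _ quarter_growth_sol_inv[OF solD(3)[OF N0 that]]])
    qed
    fix x assume x: "complex_of_real x \<in> ball c rout" "x \<notin> E"
    have xr: "\<bar>x - mid\<bar> < rout" using x(1) norm_real_c[of x] by (simp add: dist_norm norm_minus_commute)
    obtain W where W: "jumps (K(j := K j ** P)) x W" using jumps_exists x by blast
    from jumps_ball[OF K P xr W] obtain W0 where W0: "jumps K x W0" "W0 ** upper_factor P = lower_factor P ** W" by blast
    obtain Nm where Nm: "boundary_plus N x (Nm ** W)" "boundary_minus N x Nm" using solD(4)[OF N W] by blast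
    obtain Mm where Mm: "boundary_plus N0 x (Mm ** W0)" "boundary_minus N0 x Mm" using solD(4)[OF N0 W0(1)] by blast
    have p: "boundary_plus h x ((Nm ** W) ** upper_factor (adj P) ** (swap_mat ** adj Mm ** swap_mat))"
      and m: "boundary_minus h x (Nm ** lower_factor (adj P) ** (swap_mat ** adj (Mm ** W0) ** swap_mat))"
      unfolding h_def[abs_def] by (intro boundary_mult Nm boundary_side_factor boundary_sol_inv[OF Mm])+
    have "lower_factor (adj P) ** W0 = lower_factor (adj P) ** (W0 ** upper_factor P) ** upper_factor (adj P)"
      by (simp only: matrix_mul_assoc[symmetric] factor_mult unitary_matD[OF P] factor_1 matrix_mul_rid)
    also have "\<dots> = W ** upper_factor (adj P)"
      unfolding W0(2) by (simp add: matrix_mul_assoc factor_mult unitary_matD[OF P] factor_1)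
    finally have WW: "W ** upper_factor (adj P) = lower_factor (adj P) ** W0" ..
    have "(Nm ** W) ** upper_factor (adj P) ** (swap_mat ** adj Mm ** swap_mat) = Nm ** (W ** upper_factor (adj P)) ** swap_mat ** adj Mm ** swap_mat"
      by (simp only: matrix_mul_assoc)
    also have "\<dots> = Nm ** lower_factor (adj P) ** (W0 ** swap_mat) ** adj Mm ** swap_mat"
      unfolding WW by (simp only: matrix_mul_assoc)
    also have "\<dots> = Nm ** lower_factor (adj P) ** (swap_mat ** adj (Mm ** W0) ** swap_mat)"
      unfolding jumps_swap[OF K W0(1)] adj_mult by (simp only: matrix_mul_assoc)
    finally show "\<exists>L. boundary_plus h x L \<and> boundary_minus h x L" using p m by auto
  qed
  then obtain u where u: "mat_holomorphic_on u (ball c rout)" "\<And>z. z \<in> ball c rout \<Longrightarrow> z \<in> S \<Longrightarrow> u z = h z" by blast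
  have lim: "(w \<longlongrightarrow> mat 1) at_infinity"
  proof -
    have "(f \<longlongrightarrow> mat 1 ** (swap_mat ** adj (mat 1) ** swap_mat)) at_infinity"
      unfolding f_def[abs_def] sol_inv_def
      by (intro tendsto_matrix_mult tendsto_const solD(2)[OF N] tendsto_sharp_at_infinity solD(2)[OF N0])
    moreover have "eventually (\<lambda>z. R0 < norm (z - (0 :: complex))) at_infinity" by (rule eventually_exterior)
    then have "eventually (\<lambda>z. f z = w z) at_infinity"
      using eventually_exterior[of rin c] by eventually_elim (use exterior_S w(2) in auto)
    ultimately have "(w \<longlongrightarrow> mat 1 ** (swap_mat ** adj (mat 1) ** swap_mat)) at_infinity" by (rule Lim_transform_eventually)
    then show ?thesis by (simp add: swap_swap)
  qed
  have eq: "w z = u z ** (T z ** upper_factor P ** Ti z)" if z: "z \<in> A" for z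
  proof (rule open_agree_off_reals[OF open_annulus _ _ _ z, where f = "\<lambda>z. u z ** (T z ** upper_factor P ** Ti z)" and F = w])
    have T: "mat_holomorphic_on T A" "mat_holomorphic_on Ti A" using fr by (auto simp: local_frame_def)
    show "continuous_on A (\<lambda>z. u z ** (T z ** upper_factor P ** Ti z))"
      by (intro mat_holomorphic_on_imp_continuous_on mat_holomorphic_on_mult T mat_holomorphic_on_const mat_holomorphic_on_subset[OF u(1) A_ball])
    show "continuous_on A w"
      by (intro mat_holomorphic_on_imp_continuous_on mat_holomorphic_on_subset[OF w(1)]) (auto simp: annulus_def)
    fix z assume zA: "z \<in> A - \<real>"
    have zS: "z \<in> S" using zA nonreal_S by blast
    have zb: "z \<in> ball c rout" using zA A_ball by blast
    have "u z ** (T z ** upper_factor P ** Ti z) = N z ** side_factor (adj P) z ** (sol_inv N0 z ** N0 z) ** side_factor P z ** sol_inv N0 z"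
      unfolding frame_conj[OF K N0 fr zA] u(2)[OF zb zS] h_def by (simp only: matrix_mul_assoc)
    also have "sol_inv N0 z ** N0 z = mat 1" using sol_inverse(2)[OF K N0 zS] by (simp add: sol_inv_def)
    also have "N z ** side_factor (adj P) z ** mat 1 ** side_factor P z ** sol_inv N0 z = N z ** (side_factor (adj P) z ** side_factor P z) ** sol_inv N0 z"
      by (simp add: matrix_mul_assoc)
    also have "\<dots> = f z" by (simp add: side_factor_mult unitary_matD[OF P] side_factor_1 f_def)
    finally show "w z = u z ** (T z ** upper_factor P ** Ti z)" using w(2)[OF zS] zA by (auto simp: annulus_def)
  qed
  have "N z = w z ** N0 z" if z: "z \<in> S" "rin < norm (z - c)" for z
  proof -
    have "w z ** N0 z = N z ** (sol_inv N0 z ** N0 z)" unfolding w(2)[OF z] f_def by (simp only: matrix_mul_assoc)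
    then show ?thesis using sol_inverse(2)[OF K N0 z(1)] by (simp add: sol_inv_def)
  qed
  then show ?thesis using u(1) w(1) lim eq by blast
qed

end

section \<open>Uniform bounds and step size for one gap\<close>

lemma norm_upper_factor_diff: "norm (upper_factor P - mat 1) = norm (P - mat 1)"
proof -
  have "upper_factor P - mat 1 = block_mat (P - mat 1) 0 0 0"
    by (simp add: matrix_eq_block_iff upper_factor_def block_diag_def mat_def)
  moreover have "(norm (block_mat A 0 0 0))\<^sup>2 = (norm A)\<^sup>2" for A :: "complex ^ 'r ^ 'r"
    by (simp add: norm_matrix_sq sum_UNIV_Plus)
  ultimately show ?thesis by (simp add: power2_eq_iff_nonneg)
qed

context gap_system
begin

lemma intermediate_radii: "\<exists>r r1 r2 t. rin < r \<and> r < r1 \<and> r1 < r2 \<and> r2 < t \<and> t < rout"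
  using radii dense by meson

lemma real_minus_c_cnj: "norm (cnj z - c) = norm (z - c)"
  by (metis complex_cnj_complex_of_real complex_cnj_diff complex_mod_cnj)

text \<open>The frame is continuous across the bands, where \<open>N\<close> itself jumps, so
  compactness of closed subannuli applies to it.\<close>

lemma frame_bounds:
  assumes fr: "local_frame N T Ti" and r: "rin < r" "t < rout"
  shows "\<exists>C. \<forall>z. r \<le> norm (z - c) \<longrightarrow> norm (z - c) \<le> t \<longrightarrow> norm (T z) \<le> C \<and> norm (Ti z) \<le> C"
proof -
  let ?A = "{z. r \<le> norm (z - c) \<and> norm (z - c) \<le> t}"
  have A_sub: "?A \<subseteq> A" using r by (auto simp: annulus_def)
  have T: "mat_holomorphic_on T A" "mat_holomorphic_on Ti A" using fr by (auto simp: local_frame_def)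
  have "bounded (T ` ?A)" "bounded (Ti ` ?A)"
    by (intro compact_imp_bounded compact_continuous_image compact_closed_annulus
        continuous_on_subset[OF mat_holomorphic_on_imp_continuous_on[OF T(1)] A_sub]
        continuous_on_subset[OF mat_holomorphic_on_imp_continuous_on[OF T(2)] A_sub])+
  then obtain C1 C2 where C: "\<forall>z\<in>?A. norm (T z) \<le> C1" "\<forall>z\<in>?A. norm (Ti z) \<le> C2"
    by (auto simp: bounded_iff)
  have "norm (T z) \<le> max C1 C2 \<and> norm (Ti z) \<le> max C1 C2" if "r \<le> norm (z - c)" "norm (z - c) \<le> t" for z
    using C(1)[rule_format, of z] C(2)[rule_format, of z] that by auto
  then show ?thesis by blast
qed

text \<open>Relative to the fixed solution \<open>N0\<close>, any solution with a changed datum is w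
  N0 near the annulus. The factor w is bounded uniformly by compactness of the unitary group, and
  \<open>N0\<close> is bounded through its frame.\<close>

lemma solution_bound:
  fixes N0 :: "complex \<Rightarrow> complex ^ ('r::finite + 'r) ^ ('r + 'r)"
  assumes K: "unitary_data K" and N0: "sol K (mat 1) N0" and r: "rin < r" "r < t" "t < rout"
  shows "\<exists>B. \<forall>P N. unitary_mat P \<longrightarrow> sol (K(j := K j ** P)) (mat 1) N \<longrightarrow> (\<forall>z\<in>annulus c r t - \<real>. norm (N z) \<le> B)"
proof -
  obtain T Ti where fr: "local_frame N0 T Ti" using local_frame_exists[OF K N0] by blast
  then have T: "mat_holomorphic_on T A" "mat_holomorphic_on Ti A" "\<And>z. z \<in> A \<Longrightarrow> T z ** Ti z = mat 1"
    by (auto simp: local_frame_def)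
  let ?XX = "upper_factor ` {P :: complex ^ 'r ^ 'r. unitary_mat P}"
  have "\<exists>B. \<forall>X\<in>?XX. \<forall>(u :: complex \<Rightarrow> complex ^ ('r + 'r) ^ ('r + 'r)) w. mat_holomorphic_on u (ball c rout) \<longrightarrow> mat_holomorphic_on w {z. rin < norm (z - c)} \<longrightarrow>
      (w \<longlongrightarrow> mat 1) at_infinity \<longrightarrow> (\<forall>z\<in>annulus c rin rout. w z = u z ** (T z ** X ** Ti z)) \<longrightarrow>
      (\<forall>z. norm (z - c) = r \<longrightarrow> norm (u z) \<le> B)"
  proof (rule factorization_bound[OF radii(1) _ _ T(1,2) T(3)])
    show "compact ?XX"
      by (intro compact_continuous_image compact_unitary continuous_on_subset[OF continuous_upper_factor]) auto
    show "X ** adj X = mat 1" if "X \<in> ?XX" for X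
      using that by (auto simp: upper_factor_def adj_block_diag block_diag_mult unitary_matD block_diag_1)
    fix X t' and u w :: "complex \<Rightarrow> complex ^ ('r + 'r) ^ ('r + 'r)"
    assume X: "X \<in> ?XX" and t': "r < t'" "t' < rout" and u: "mat_holomorphic_on u (ball c t')"
      and w: "mat_holomorphic_on w {z. r < norm (z - c)}" and lim: "(w \<longlongrightarrow> 0) at_infinity"
      and eq: "\<forall>z\<in>annulus c r t'. w z = u z ** (T z ** X ** Ti z)"
    obtain P where P: "unitary_mat P" "X = upper_factor P" using X by blast
    define F where "F z = (if norm (z - c) < (r + t') / 2 then u z ** N0 z ** side_factor P z else w z ** N0 z)" for z
    have glue': "sol (K(j := K j ** P)) 0 F" "\<And>z. z \<in> ball c t' - \<real> \<Longrightarrow> F z = u z ** N0 z ** side_factor P z"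
      using glue[OF K P(1) N0 fr _ t'(1) _ u w lim] eq r t' P(2) unfolding F_def[abs_def] by auto
    \<comment> \<open>A decaying factorization glues to a solution with value 0 at infinity, which
      vanishes by \<open>sol_zero\<close>. The remaining factors are invertible and can be stripped
      off.\<close>
    have u0: "u z = 0" if z: "z \<in> ball c t' - \<real>" for z
    proof -
      have zS: "z \<in> S" using z nonreal_S by blast
      have "u z ** N0 z ** side_factor P z = 0"
        using sol_zero[OF unitary_data_upd[OF K P(1)] glue'(1) zS] glue'(2)[OF z] by simp
      then have "u z ** N0 z ** (side_factor P z ** side_factor (adj P) z) ** sol_inv N0 z = 0"
        by (simp add: matrix_mul_assoc)
      then have "u z ** (N0 z ** sol_inv N0 z) = 0"
        by (simp add: side_factor_mult unitary_matD[OF P(1)] side_factor_1 matrix_mul_assoc)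
      then show ?thesis using sol_inverse(1)[OF K N0 zS] by (simp add: sol_inv_def)
    qed
    show "\<forall>z\<in>ball c t'. u z = 0"
    proof
      fix z assume "z \<in> ball c t'"
      then show "u z = 0"
        using open_agree_off_reals[OF open_ball continuous_on_const mat_holomorphic_on_imp_continuous_on[OF u], of 0 z] u0 by blast
    qed
  qed (use r in auto)
  then obtain B where B: "\<And>P (u :: complex \<Rightarrow> complex ^ ('r + 'r) ^ ('r + 'r)) w z. unitary_mat P \<Longrightarrow> mat_holomorphic_on u (ball c rout) \<Longrightarrow> mat_holomorphic_on w {z. rin < norm (z - c)} \<Longrightarrow>
      (w \<longlongrightarrow> mat 1) at_infinity \<Longrightarrow> (\<forall>z\<in>A. w z = u z ** (T z ** upper_factor P ** Ti z)) \<Longrightarrow>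
      norm (z - c) = r \<Longrightarrow> norm (u z) \<le> B" by blast
  obtain C where C: "\<And>z. r \<le> norm (z - c) \<Longrightarrow> norm (z - c) \<le> t \<Longrightarrow> norm (T z) \<le> C \<and> norm (Ti z) \<le> C"
    using frame_bounds[OF fr r(1,3)] by blast
  obtain CX where CX: "\<And>P :: complex ^ 'r ^ 'r. unitary_mat P \<Longrightarrow> norm (upper_factor P) \<le> CX"
  proof -
    have "bounded ?XX"
      by (intro compact_imp_bounded compact_continuous_image compact_unitary continuous_on_subset[OF continuous_upper_factor]) auto
    then show thesis using that by (auto simp: bounded_iff)
  qed
  define nJ where "nJ = norm (band_jump :: complex ^ ('r + 'r) ^ ('r + 'r))"
  define N2 where "N2 = real (CARD('r + 'r) * CARD('r + 'r))"
  have "norm (N z) \<le> (N2 * (B * (C * CX * C))) * (C * (1 + nJ))"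
    if P: "unitary_mat P" and N: "sol (K(j := K j ** P)) (mat 1) N" and z: "z \<in> annulus c r t - \<real>" for P N z
  proof -
    obtain u w where uw: "mat_holomorphic_on u (ball c rout)" "mat_holomorphic_on w {z. rin < norm (z - c)}"
      "(w \<longlongrightarrow> mat 1) at_infinity" "\<forall>z\<in>A. w z = u z ** (T z ** upper_factor P ** Ti z)"
      "\<forall>z\<in>S. rin < norm (z - c) \<longrightarrow> N z = w z ** N0 z"
      using quotient[OF K P N0 fr N] by blast
    have ws: "norm (w s) \<le> B * (C * CX * C)" if s: "norm (s - c) = r" for s
    proof -
      have sA: "s \<in> A" using s r by (auto simp: annulus_def)
      have us: "norm (u s) \<le> B" by (rule B[OF P uw(1,2,3,4) s])
      have Cs: "norm (T s) \<le> C" "norm (Ti s) \<le> C" using C[of s] s r by auto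
      have "norm (w s) \<le> norm (u s) * norm (T s ** upper_factor P ** Ti s)"
        using uw(4) sA by (simp add: norm_matrix_mult)
      also have "\<dots> \<le> B * (C * CX * C)"
        by (intro mult_mono us norm_mult3 Cs CX[OF P] norm_ge_zero order_trans[OF norm_ge_zero us])
      finally show ?thesis .
    qed
    have rz: "r \<le> norm (z - c)" "norm (z - c) \<le> t" using z by (auto simp: annulus_def)
    \<comment> \<open>The bound on the circle of radius \<open>r\<close> spreads outward by the
      maximum principle, applied to each entry; this costs the factor \<open>N2\<close>.\<close>
    have wz: "norm (w z) \<le> N2 * (B * (C * CX * C))"
      unfolding N2_def by (rule exterior_maximum_principle_matrix[OF radii(1) r(1) uw(2,3) ws rz(1)])
    have zA: "z \<in> A" using z r by (auto simp: annulus_def)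
    have N0z: "norm (N0 z) \<le> C * (1 + nJ)"
    proof -
      have Cz: "norm (T z) \<le> C" using C[OF rz] by blast
      have C0: "C \<ge> 0" by (rule order_trans[OF norm_ge_zero Cz])
      have nJ: "nJ \<ge> 0" by (simp add: nJ_def)
      show ?thesis
      proof (cases "Im z > 0")
        case True
        then have "N0 z = T z" using fr zA by (simp add: local_frame_def)
        then show ?thesis using Cz C0 nJ by (simp add: distrib_left add_increasing2)
      next
        case False
        then have "Im z < 0" using z by (auto simp: complex_is_Real_iff)
        then have "T z = N0 z ** band_jump" using fr zA by (simp add: local_frame_def)
        then have "T z ** (- band_jump) = N0 z" by (simp add: matrix_mul_assoc[symmetric] band_jump_inv)
        then have "norm (N0 z) \<le> norm (T z) * norm (- band_jump :: complex ^ ('r + 'r) ^ ('r + 'r))"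
          using norm_matrix_mult[of "T z" "- band_jump"] by simp
        also have "\<dots> \<le> C * (1 + nJ)" using Cz C0 nJ by (intro mult_mono) (auto simp: nJ_def)
        finally show ?thesis .
      qed
    qed
    have "norm (N z) \<le> norm (w z) * norm (N0 z)"
      using uw(5) z nonreal_S rz r norm_matrix_mult[of "w z" "N0 z"] by auto
    also have "\<dots> \<le> (N2 * (B * (C * CX * C))) * (C * (1 + nJ))"
      by (intro mult_mono wz N0z norm_ge_zero order_trans[OF norm_ge_zero wz])
    finally show ?thesis .
  qed
  then show ?thesis by blast
qed

text \<open>The solution to be modified, hence also its frame, varies with \<open>P\<close>. The
  step size is nevertheless uniform because frame and inverse frame are bounded through the solution
  bound, which does not depend on \<open>P\<close>.\<close>

lemma gap_step_uniform:
  fixes N0 :: "complex \<Rightarrow> complex ^ ('r::finite + 'r) ^ ('r + 'r)"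
  assumes K: "unitary_data K" and N0: "sol K (mat 1) N0"
  shows "\<exists>\<delta>>0. \<forall>P P'. unitary_mat P \<longrightarrow> unitary_mat P' \<longrightarrow> norm (adj P ** P' - mat 1) < \<delta> \<longrightarrow>
     (\<exists>N :: complex \<Rightarrow> complex ^ ('r + 'r) ^ ('r + 'r). sol (K(j := K j ** P)) (mat 1) N) \<longrightarrow>
     (\<exists>N :: complex \<Rightarrow> complex ^ ('r + 'r) ^ ('r + 'r). sol (K(j := K j ** P')) (mat 1) N)"
proof -
  \<comment> \<open>The solutions are bounded between \<open>r\<close> and \<open>t\<close>, while
    the Laurent splitting takes place on the circles \<open>r1\<close> and \<open>r2\<close>
    strictly in between.\<close>
  obtain r r1 r2 t where r: "rin < r" "r < r1" "r1 < r2" "r2 < t" "t < rout" using intermediate_radii by blast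
  have rt: "r < t" using r by simp
  obtain B where B: "\<And>P (N :: complex \<Rightarrow> complex ^ ('r + 'r) ^ ('r + 'r)) z. unitary_mat P \<Longrightarrow> sol (K(j := K j ** P)) (mat 1) N \<Longrightarrow>
      z \<in> annulus c r t - \<real> \<Longrightarrow> norm (N z) \<le> B"
    using solution_bound[OF K N0 r(1) rt r(5)] by blast
  have r0: "0 < r" using radii(1) r(1) by simp
  obtain \<epsilon> where \<epsilon>: "\<epsilon> > 0" "\<And>G :: complex \<Rightarrow> complex ^ ('r + 'r) ^ ('r + 'r). mat_holomorphic_on G (annulus c r t) \<Longrightarrow>
     \<forall>z\<in>annulus c r t. norm (G z - mat 1) \<le> \<epsilon> \<Longrightarrow>
     \<exists>u w. mat_holomorphic_on u (ball c t) \<and> mat_holomorphic_on w {z. r1 < norm (z - c)} \<and>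
        (w \<longlongrightarrow> mat 1) at_infinity \<and> (\<forall>z\<in>annulus c r1 t. w z = u z ** G z)"
    using near_identity_factorization[where 'n = "'r + 'r", OF r0 r(2,3,4), of c] by blast
  define nJ where "nJ = norm (band_jump :: complex ^ ('r + 'r) ^ ('r + 'r))"
  define nY where "nY = norm (swap_mat :: complex ^ ('r + 'r) ^ ('r + 'r))"
  define C where "C = \<bar>B\<bar> * (1 + nJ)"
  define D where "D = (1 + nJ) * (nY * \<bar>B\<bar> * nY)"
  have nJ: "nJ \<ge> 0" "nY \<ge> 0" by (simp_all add: nJ_def nY_def)
  have CD: "C \<ge> 0" "D \<ge> 0" using nJ by (simp_all add: C_def D_def)
  \<comment> \<open>\<open>C\<close> bounds the frame and \<open>D\<close> its inverse, so
    conjugation enlarges the distance to 1 by at most \<open>C * D\<close>. The summand 1 keeps the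
    denominator positive.\<close>
  define \<delta> where "\<delta> = \<epsilon> / (C * D + 1)"
  have CD1: "C * D + 1 > 0" using mult_nonneg_nonneg[OF CD] by linarith
  have \<delta>: "\<delta> > 0" using \<epsilon>(1) CD1 by (simp add: \<delta>_def)
  have ann_A: "annulus c r t \<subseteq> A" using r by (auto simp: annulus_def)
  show ?thesis
  proof (intro exI[of _ \<delta>] conjI allI impI \<delta>)
    fix P P' :: "complex ^ 'r ^ 'r"
    assume P: "unitary_mat P" "unitary_mat P'" and near: "norm (adj P ** P' - mat 1) < \<delta>"
      and "\<exists>N :: complex \<Rightarrow> complex ^ ('r + 'r) ^ ('r + 'r). sol (K(j := K j ** P)) (mat 1) N"
    then obtain N :: "complex \<Rightarrow> complex ^ ('r + 'r) ^ ('r + 'r)" where N: "sol (K(j := K j ** P)) (mat 1) N" by blast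
    note K1 = unitary_data_upd[OF K P(1)]
    define Q where "Q = adj P ** P'"
    have Q: "unitary_mat Q" unfolding Q_def by (intro unitary_mult unitary_adj P)
    obtain T Ti where fr: "local_frame N T Ti" using local_frame_exists[OF K1 N] by blast
    have T: "mat_holomorphic_on T A" "mat_holomorphic_on Ti A" "\<And>z. z \<in> A \<Longrightarrow> T z ** Ti z = mat 1"
      using fr by (auto simp: local_frame_def)
    have NB: "norm (N z) \<le> \<bar>B\<bar>" if "z \<in> annulus c r t - \<real>" for z
      using B[OF P(1) N that] by linarith
    have T_bd: "norm (T z) \<le> C" if "z \<in> annulus c r t" for z
    proof (rule bound_off_reals[OF open_annulus _ _ that])
      show "continuous_on (annulus c r t) T"
        by (intro mat_holomorphic_on_imp_continuous_on mat_holomorphic_on_subset[OF T(1) ann_A])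
      fix z assume z: "z \<in> annulus c r t - \<real>"
      then have zA: "z \<in> A" using ann_A by blast
      show "norm (T z) \<le> C"
      proof (cases "Im z > 0")
        case True
        then have "T z = N z" using fr zA by (simp add: local_frame_def)
        then show ?thesis using NB[OF z] nJ by (simp add: C_def distrib_left add_increasing2)
      next
        case False
        then have "Im z < 0" using z by (auto simp: complex_is_Real_iff)
        then have "T z = N z ** band_jump" using fr zA by (simp add: local_frame_def)
        then have "norm (T z) \<le> norm (N z) * nJ" unfolding nJ_def by (simp add: norm_matrix_mult)
        also have "\<dots> \<le> C" unfolding C_def using NB[OF z] nJ by (intro mult_mono) auto
        finally show ?thesis .
      qed
    qed
    have Ti_bd: "norm (Ti z) \<le> D" if "z \<in> annulus c r t" for z
    proof (rule bound_off_reals[OF open_annulus _ _ that])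
      show "continuous_on (annulus c r t) Ti"
        by (intro mat_holomorphic_on_imp_continuous_on mat_holomorphic_on_subset[OF T(2) ann_A])
      fix z assume z: "z \<in> annulus c r t - \<real>"
      then have zA: "z \<in> A" using ann_A by blast
      \<comment> \<open>The inverse of \<open>N\<close> is a reflected \<open>N\<close>. The annulus
        is symmetric about the real axis, so the bound for \<open>N\<close> also bounds the
        inverse.\<close>
      have "cnj z \<in> annulus c r t - \<real>" using z by (auto simp: annulus_def real_minus_c_cnj complex_is_Real_iff)
      then have "norm (sharp N z) \<le> \<bar>B\<bar>" using NB by (simp add: sharp_def)
      then have si: "norm (sol_inv N z) \<le> nY * \<bar>B\<bar> * nY"
        unfolding sol_inv_def by (intro norm_mult3) (simp_all add: nY_def)
      show "norm (Ti z) \<le> D"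
      proof (cases "Im z > 0")
        case True
        have "nY * \<bar>B\<bar> * nY \<le> D" unfolding D_def using nJ by (simp add: distrib_right)
        then show ?thesis using si local_frame_inv(1)[OF K1 N fr zA True] by simp
      next
        case False
        then have "Im z < 0" using z by (auto simp: complex_is_Real_iff)
        from local_frame_inv(2)[OF K1 N fr zA this]
        have "norm (Ti z) \<le> norm (- band_jump :: complex ^ ('r + 'r) ^ ('r + 'r)) * norm (sol_inv N z)" by (simp only: norm_matrix_mult)
        also have "\<dots> \<le> D" unfolding D_def using si nJ by (intro mult_mono) (auto simp: nJ_def)
        finally show ?thesis .
      qed
    qed
    define G where "G z = T z ** upper_factor Q ** Ti z" for z
    have G_hol: "mat_holomorphic_on G (annulus c r t)"
      unfolding G_def[abs_def]
      by (intro mat_holomorphic_on_mult mat_holomorphic_on_const mat_holomorphic_on_subset[OF T(1) ann_A] mat_holomorphic_on_subset[OF T(2) ann_A])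
    have "norm (G z - mat 1) \<le> \<epsilon>" if z: "z \<in> annulus c r t" for z
    proof -
      have "T z ** (upper_factor Q - mat 1) ** Ti z = G z - mat 1"
        using T(3)[of z] z ann_A
        by (auto simp: G_def bounded_bilinear.diff_right[OF bounded_bilinear_matrix_mult]
            bounded_bilinear.diff_left[OF bounded_bilinear_matrix_mult])
      then have "norm (G z - mat 1) = norm (T z ** (upper_factor Q - mat 1) ** Ti z)" by simp
      also have "\<dots> \<le> C * \<delta> * D"
        using near by (intro norm_mult3 T_bd[OF z] Ti_bd[OF z]) (simp add: norm_upper_factor_diff Q_def)
      also have "C * \<delta> * D = (C * D) / (C * D + 1) * \<epsilon>" by (simp add: \<delta>_def)
      also have "\<dots> \<le> 1 * \<epsilon>" using CD1 \<epsilon>(1) by (intro mult_right_mono) auto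
      finally show ?thesis by simp
    qed
    then obtain u w where uw: "mat_holomorphic_on u (ball c t)" "mat_holomorphic_on w {z. r1 < norm (z - c)}"
      "(w \<longlongrightarrow> mat 1) at_infinity" "\<forall>z\<in>annulus c r1 t. w z = u z ** G z"
      using \<epsilon>(2)[OF G_hol] by blast
    have "\<exists>F. sol ((K(j := K j ** P))(j := (K(j := K j ** P)) j ** Q)) (mat 1) F"
      using glue(1)[OF K1 Q N fr _ _ _ uw(1,2,3)] uw(4) r unfolding G_def by force
    moreover have "(K(j := K j ** P))(j := (K(j := K j ** P)) j ** Q) = K(j := K j ** P')"
      unfolding Q_def by (simp add: matrix_mul_assoc[symmetric]) (simp add: matrix_mul_assoc unitary_matD[OF P(1)])
    ultimately show "\<exists>N :: complex \<Rightarrow> complex ^ ('r + 'r) ^ ('r + 'r). sol (K(j := K j ** P')) (mat 1) N" by metis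
  qed
qed

end

subsection \<open>Connectedness of the unitary group\<close>

text \<open>The inner product here is the real one, that is, the real part of the Hermitian form; it
  has the same adjoints.\<close>

lemma inner_adj:
  fixes A :: "complex ^ 'n ^ 'n"
  shows "(A *v x) \<bullet> y = x \<bullet> (adj A *v y)"
proof -
  have "(A *v x) \<bullet> y = (\<Sum>i\<in>UNIV. \<Sum>k\<in>UNIV. (A $ i $ k * x $ k) \<bullet> y $ i)"
    by (simp add: inner_vec_def matrix_vector_mult_def inner_sum_left)
  also have "\<dots> = (\<Sum>k\<in>UNIV. \<Sum>i\<in>UNIV. (A $ i $ k * x $ k) \<bullet> y $ i)" by (rule sum.swap)
  also have "\<dots> = (\<Sum>k\<in>UNIV. \<Sum>i\<in>UNIV. x $ k \<bullet> (cnj (A $ i $ k) * y $ i))"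
    by (intro sum.cong refl) (simp add: inner_complex_def algebra_simps)
  also have "\<dots> = x \<bullet> (adj A *v y)" by (simp add: inner_vec_def matrix_vector_mult_def inner_sum_right)
  finally show ?thesis .
qed

lemma norm_unitary_vector:
  assumes "unitary_mat P" shows "norm (P *v x) = norm x"
proof -
  have "(P *v x) \<bullet> (P *v x) = x \<bullet> x"
    unfolding inner_adj by (simp add: matrix_vector_mul_assoc unitary_matD[OF assms])
  then show ?thesis by (simp add: norm_eq_sqrt_inner)
qed

text \<open>The Moebius path \<open>((1 + t) P + (1 - t)) / ((1 - t) P + (1 + t))\<close> joins \<open>1\<close> to \<open>P\<close> inside the
  unitary group as long as \<open>-1\<close> is not an eigenvalue of \<open>P\<close>; the latter is arranged by a small phase.\<close>

definition cayley_num :: "complex ^ 'n ^ 'n \<Rightarrow> real \<Rightarrow> complex ^ 'n ^ 'n" where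
  "cayley_num P t = (1 + t) *\<^sub>R P + (1 - t) *\<^sub>R mat 1"

definition cayley_path :: "complex ^ 'n ^ 'n \<Rightarrow> real \<Rightarrow> complex ^ 'n ^ 'n" where
  "cayley_path P t = matrix_inv (cayley_num P (- t)) ** cayley_num P t"

text \<open>For a kernel vector x one has (1 + t) x = -(1 - t) P x. Since P preserves norms, t > 0
  forces x = 0; the case t = 0 is the hypothesis on P + 1.\<close>

lemma invertible_cayley_den:
  fixes P :: "complex ^ 'n ^ 'n"
  assumes P: "unitary_mat P" and inv: "invertible (P + mat 1)" and t: "0 \<le> t" "t \<le> 1"
  shows "invertible (cayley_num P (- t))"
proof (cases "t = 0")
  case True then show ?thesis using inv by (simp add: cayley_num_def)
next
  case False
  have "x = 0" if "cayley_num P (- t) *v x = 0" for x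
  proof -
    have "cayley_num P (- t) *v x = (1 - t) *\<^sub>R (P *v x) + (1 + t) *\<^sub>R x"
      by (simp add: cayley_num_def vec_eq_iff matrix_vector_mult_def sum.distrib scaleR_sum_right distrib_right
          mat_def if_distrib[of "\<lambda>x. x * y" for y] if_distrib[of "\<lambda>x. r *\<^sub>R x" for r] cong: if_cong)
    then have "(1 + t) *\<^sub>R x = - ((1 - t) *\<^sub>R (P *v x))" using that by (simp add: eq_neg_iff_add_eq_0 add.commute)
    then have "norm ((1 + t) *\<^sub>R x) = norm ((1 - t) *\<^sub>R (P *v x))" by simp
    then have "(1 + t) * norm x = (1 - t) * norm x" using t by (simp add: norm_unitary_vector[OF P])
    then show "x = 0" using False by simp
  qed
  then show ?thesis using matrix_left_invertible_ker[of "cayley_num P (- t)"] invertible_left_inverse by blast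
qed

text \<open>The product (p P + q)(p P + q)^* is symmetric in p and q, and changing the sign of t
  exchanges them. So numerator and denominator have the same product with their adjoints.\<close>

lemma unitary_cayley_path:
  fixes P :: "complex ^ 'n ^ 'n"
  assumes P: "unitary_mat P" and inv: "invertible (P + mat 1)" and t: "0 \<le> t" "t \<le> 1"
  shows "unitary_mat (cayley_path P t)"
proof -
  let ?N = "cayley_num P t" and ?D = "cayley_num P (- t)"
  note bil = bounded_bilinear.add_left[OF bounded_bilinear_matrix_mult] bounded_bilinear.add_right[OF bounded_bilinear_matrix_mult]
    bounded_bilinear.scaleR_left[OF bounded_bilinear_matrix_mult] bounded_bilinear.scaleR_right[OF bounded_bilinear_matrix_mult]
  have adjs: "adj (r *\<^sub>R A) = r *\<^sub>R adj A" for r and A :: "complex ^ 'n ^ 'n" by (simp add: vec_eq_iff)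
  note D = matrix_inv_mult[OF invertible_cayley_den[OF P inv t]]
  have gen: "(p *\<^sub>R P + q *\<^sub>R mat 1) ** adj (p *\<^sub>R P + q *\<^sub>R mat 1) = (p * p + q * q) *\<^sub>R mat 1 + (p * q) *\<^sub>R (P + adj P)" for p q
    by (simp add: adj_add adjs bil unitary_matD[OF P] scaleR_add_left scaleR_add_right mult.commute)
  have ND: "?N ** adj ?N = ?D ** adj ?D"
    unfolding cayley_num_def gen by (simp add: add.commute mult.commute)
  have "cayley_path P t ** adj (cayley_path P t) = matrix_inv ?D ** (?N ** adj ?N) ** adj (matrix_inv ?D)"
    by (simp add: cayley_path_def adj_mult matrix_mul_assoc)
  also have "\<dots> = (matrix_inv ?D ** ?D) ** adj (matrix_inv ?D ** ?D)"
    unfolding ND adj_mult by (simp only: matrix_mul_assoc)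
  also have "\<dots> = mat 1" using D by simp
  finally have "cayley_path P t ** adj (cayley_path P t) = mat 1" .
  then show ?thesis unfolding unitary_mat_def using matrix_left_right_inverse by blast
qed

lemma cayley_path_ends:
  assumes "invertible (P + mat 1)"
  shows "cayley_path P 0 = mat 1" "cayley_path P 1 = P"
proof -
  show "cayley_path P 0 = mat 1" using matrix_inv_mult(2)[OF assms] by (simp add: cayley_path_def cayley_num_def)
  have "(2 *\<^sub>R mat 1 :: complex ^ 'a ^ 'a) ** ((1/2) *\<^sub>R mat 1) = mat 1"
    by (simp add: bounded_bilinear.scaleR_left[OF bounded_bilinear_matrix_mult] bounded_bilinear.scaleR_right[OF bounded_bilinear_matrix_mult])
  then have "matrix_inv (2 *\<^sub>R mat 1 :: complex ^ 'a ^ 'a) = (1/2) *\<^sub>R mat 1" by (rule matrix_inv_unique)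
  then show "cayley_path P 1 = P"
    by (simp add: cayley_path_def cayley_num_def bounded_bilinear.scaleR_left[OF bounded_bilinear_matrix_mult] bounded_bilinear.scaleR_right[OF bounded_bilinear_matrix_mult])
qed

lemma continuous_cayley_path:
  assumes P: "unitary_mat P" and inv: "invertible (P + mat 1)"
  shows "continuous_on {0..1} (cayley_path P)"
  unfolding continuous_on_def cayley_path_def
proof (intro ballI tendsto_matrix_mult tendsto_matrix_inv)
  fix t :: real assume t: "t \<in> {0..1}"
  show "invertible (cayley_num P (- t))" using t by (intro invertible_cayley_den[OF P inv]) auto
  show "eventually (\<lambda>s. invertible (cayley_num P (- s))) (at t within {0..1})"
    unfolding eventually_at_filter using invertible_cayley_den[OF P inv] by (intro always_eventually) auto
  show "((\<lambda>s. cayley_num P (- s)) \<longlongrightarrow> cayley_num P (- t)) (at t within {0..1})"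
    "(cayley_num P \<longlongrightarrow> cayley_num P t) (at t within {0..1})"
    unfolding cayley_num_def by (intro tendsto_intros)+
qed

text \<open>This is connectedness of the unitary group as an induction principle: a property
  preserved by steps of a fixed size spreads from 1 to every unitary matrix.\<close>

lemma unitary_induct:
  fixes P :: "complex ^ 'n ^ 'n"
  assumes \<delta>: "\<delta> > 0" and base: "Q (mat 1)"
    and step: "\<And>P P'. unitary_mat P \<Longrightarrow> unitary_mat P' \<Longrightarrow> norm (adj P ** P' - mat 1) < \<delta> \<Longrightarrow> Q P \<Longrightarrow> Q P'"
    and P: "unitary_mat P"
  shows "Q P"
proof -
  have regular: "Q P" if P: "unitary_mat P" and inv: "invertible (P + mat 1)" for P :: "complex ^ 'n ^ 'n"
  proof -
    let ?\<gamma> = "cayley_path P"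
    \<comment> \<open>\<open>s\<close> is the Frobenius norm of a unitary matrix. Distances along
      the path are kept below \<open>\<delta> / s\<close>, as multiplication by the adjoint may cost
      this factor.\<close>
    define s where "s = sqrt (real CARD('n))"
    have s: "s > 0" by (simp add: s_def)
    have "uniformly_continuous_on {0..1} ?\<gamma>"
      by (intro compact_uniformly_continuous continuous_cayley_path[OF P inv]) simp
    then obtain d where d: "d > 0" "\<And>x x'. x \<in> {0..1} \<Longrightarrow> x' \<in> {0..1} \<Longrightarrow> dist x' x < d \<Longrightarrow> dist (?\<gamma> x') (?\<gamma> x) < \<delta> / s"
    proof -
      have "\<delta> / s > 0" using \<delta> s by simp
      with \<open>uniformly_continuous_on {0..1} ?\<gamma>\<close>
      have "\<exists>d>0. \<forall>x\<in>{0..1}. \<forall>x'\<in>{0..1}. dist x' x < d \<longrightarrow> dist (?\<gamma> x') (?\<gamma> x) < \<delta> / s"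
        unfolding uniformly_continuous_on_def by blast
      then show thesis using that by blast
    qed
    obtain m where "inverse (real (Suc m)) < d" using reals_Archimedean[OF d(1)] by blast
    then obtain n :: nat where n: "n > 0" "inverse (real n) < d" by blast
    have "Q (?\<gamma> (real i / real n))" if "i \<le> n" for i
      using that
    proof (induction i)
      case 0
      then show ?case using base cayley_path_ends[OF inv] by simp
    next
      case (Suc i)
      have t: "real i / real n \<in> {0..1}" "real (Suc i) / real n \<in> {0..1}" using Suc.prems n by (auto simp: field_simps)
      have u: "unitary_mat (?\<gamma> (real i / real n))" "unitary_mat (?\<gamma> (real (Suc i) / real n))"
        using t by (auto intro!: unitary_cayley_path[OF P inv])
      have "dist (real (Suc i) / real n) (real i / real n) < d"
        using n by (simp add: dist_real_def diff_divide_distrib[symmetric] inverse_eq_divide)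
      then have near: "norm (?\<gamma> (real (Suc i) / real n) - ?\<gamma> (real i / real n)) < \<delta> / s"
        using d(2)[OF t] by (simp add: dist_norm)
      let ?A = "?\<gamma> (real i / real n)" and ?B = "?\<gamma> (real (Suc i) / real n)"
      have "adj ?A ** ?B - mat 1 = adj ?A ** (?B - ?A)"
        by (simp add: bounded_bilinear.diff_right[OF bounded_bilinear_matrix_mult] unitary_matD[OF u(1)])
      then have "norm (adj ?A ** ?B - mat 1) \<le> norm (adj ?A) * norm (?B - ?A)" by (simp only: norm_matrix_mult)
      also have "norm (adj ?A) = s" unfolding s_def using unitary_matD[OF u(1)] by (simp add: norm_unitary)
      also have "s * norm (?B - ?A) < \<delta>" using near s by (simp add: field_simps)
      finally show ?case using step[OF u] Suc by simp
    qed
    from this[of n] show ?thesis using n cayley_path_ends[OF inv] by simp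
  qed
  show ?thesis
  proof (cases "invertible (P + mat 1)")
    case True then show ?thesis using regular P by blast
  next
    case False
    \<comment> \<open>The determinant of w P + 1 is a polynomial in w with value 1 at w = 0. Its
      zero at w = 1 is therefore isolated, and a small phase w removes the eigenvalue -1.\<close>
    define f where "f w = det (\<chi> i j. w * P $ i $ j + (if i = j then 1 else 0))" for w
    have f_hol: "f holomorphic_on UNIV"
      unfolding f_def by (rule mat_holomorphic_on_det) (auto simp: mat_holomorphic_on_def intro!: holomorphic_intros)
    have "(\<chi> i j. 1 * P $ i $ j + (if i = j then 1 else 0)) = P + mat 1" by (simp add: vec_eq_iff mat_def)
    then have f1: "f 1 = 0" using False invertible_det_nz unfolding f_def by metis
    have "(\<chi> i j. 0 * P $ i $ j + (if i = j then 1 else 0)) = (mat 1 :: complex ^ 'n ^ 'n)" by (simp add: vec_eq_iff mat_def)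
    then have f0: "f 0 \<noteq> 0" unfolding f_def by simp
    obtain \<rho> where \<rho>: "\<rho> > 0" "\<And>z. z \<in> ball 1 \<rho> - {1} \<Longrightarrow> f z \<noteq> 0"
      using isolated_zeros[OF f_hol open_UNIV connected_UNIV UNIV_I f1 UNIV_I f0] by metis
    define s where "s = sqrt (real CARD('n))"
    have s: "s > 0" by (simp add: s_def)
    have "(cis \<longlongrightarrow> cis 0) (at 0)"
      by (intro tendsto_cis tendsto_ident_at)
    then have "eventually (\<lambda>\<theta>. dist (cis \<theta>) 1 < min \<rho> (\<delta> / s)) (at 0)"
      using \<rho>(1) \<delta> s by (intro tendstoD) auto
    then obtain d where d: "d > 0" "\<And>\<theta>. \<theta> \<noteq> 0 \<Longrightarrow> \<bar>\<theta>\<bar> < d \<Longrightarrow> dist (cis \<theta>) 1 < min \<rho> (\<delta> / s)"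
      unfolding eventually_at by (auto simp: dist_real_def)
    define \<theta> where "\<theta> = min (d / 2) 1"
    have \<theta>: "0 < \<theta>" "\<theta> < d" "\<theta> \<le> 1" using d(1) by (auto simp: \<theta>_def)
    define w where "w = cis \<theta>"
    have w: "dist w 1 < \<rho>" "dist w 1 < \<delta> / s" using d(2)[of \<theta>] \<theta> by (auto simp: w_def)
    have "sin \<theta> > 0" using \<theta> pi_gt3 by (intro sin_gt_zero) auto
    then have w1: "w \<noteq> 1" by (auto simp: w_def complex_eq_iff)
    have ww: "w * cnj w = 1" "cnj w * w = 1" by (simp_all add: w_def cis_cnj cis_mult)
    define P' where "P' = (\<chi> i j. w * P $ i $ j)"
    have "(\<chi> i j. w * P $ i $ j + (if i = j then 1 else 0)) = P' + mat 1" by (simp add: P'_def vec_eq_iff mat_def)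
    then have "det (P' + mat 1) \<noteq> 0" using \<rho>(2)[of w] w w1 unfolding f_def by (simp add: dist_commute)
    then have inv: "invertible (P' + mat 1)" using invertible_det_nz by blast
    have mult: "(\<chi> i j. x * A $ i $ j) ** (\<chi> i j. y * B $ i $ j) = (\<chi> i j. (x * y) * (A ** B) $ i $ j)"
      for x y and A B :: "complex ^ 'n ^ 'n"
      by (simp add: vec_eq_iff matrix_matrix_mult_def sum_distrib_left mult_ac)
    have adjP': "adj P' = (\<chi> i j. cnj w * adj P $ i $ j)" by (simp add: P'_def vec_eq_iff)
    have P': "unitary_mat P'"
      unfolding unitary_mat_def adjP' unfolding P'_def mult unitary_matD[OF P] ww by (simp add: vec_eq_iff)
    have "adj P' ** P - mat 1 = (\<chi> i j. (cnj w - 1) * (mat 1 :: complex ^ 'n ^ 'n) $ i $ j)"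
    proof -
      have "adj P' ** P = (\<chi> i j. cnj w * adj P $ i $ j) ** (\<chi> i j. 1 * P $ i $ j)" by (simp add: adjP' vec_eq_iff)
      also have "\<dots> = (\<chi> i j. cnj w * (mat 1 :: complex ^ 'n ^ 'n) $ i $ j)" unfolding mult unitary_matD[OF P] by simp
      finally show ?thesis by (simp add: vec_eq_iff algebra_simps)
    qed
    moreover have "(norm (\<chi> i j. (cnj w - 1) * (mat 1 :: complex ^ 'n ^ 'n) $ i $ j))\<^sup>2 = (norm (w - 1) * s)\<^sup>2"
    proof -
      have "norm (cnj w - 1) = norm (w - 1)" by (metis complex_cnj_diff complex_cnj_one complex_mod_cnj)
      moreover have "(norm (mat 1 :: complex ^ 'n ^ 'n))\<^sup>2 = s\<^sup>2" unfolding s_def by (simp add: norm_unitary)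
      ultimately show ?thesis
        by (simp add: norm_matrix_sq norm_mult power_mult_distrib sum_distrib_left[symmetric])
    qed
    then have "norm (\<chi> i j. (cnj w - 1) * (mat 1 :: complex ^ 'n ^ 'n) $ i $ j) = norm (w - 1) * s"
      using s by (subst (asm) power2_eq_iff_nonneg) auto
    ultimately have "norm (adj P' ** P - mat 1) < \<delta>" using w(2) s by (simp add: dist_norm field_simps)
    \<comment> \<open>The regular matrix \<open>P'\<close> is reached along its path, and one
      further step leads from it to \<open>P\<close>.\<close>
    then show ?thesis using step[OF P' P] regular[OF P' inv] by blast
  qed
qed

subsection \<open>The scalar solution\<close>

text \<open>The rotation by -i moves the negative axis, where the principal branch jumps, to the
  positive imaginary axis. The right-hand side is thus continuous up to the cut from above.\<close>

lemma powr_quarter_upper: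
  assumes "Im w > 0"
  shows "w powr (1/4) = exp (\<i> * of_real pi / 8) * (- \<i> * w) powr (1/4)"
proof -
  have w0: "- \<i> * w \<noteq> 0" "w \<noteq> 0" using assms by auto
  have "Ln (\<i> * (- \<i> * w)) = Ln (- \<i> * w) + \<i> * of_real pi / 2"
    using Ln_times_ii[OF w0(1)] assms by simp
  then have "Ln w = Ln (- \<i> * w) + \<i> * of_real pi / 2" by simp
  then have "(1/4) * Ln w = (1/4) * Ln (- \<i> * w) + \<i> * of_real pi / 8" by simp
  then have "w powr (1/4) = exp ((1/4) * Ln (- \<i> * w) + \<i> * of_real pi / 8)"
    using w0 by (simp only: powr_def if_False)
  then show ?thesis using w0 by (simp only: powr_def if_False exp_add mult.commute)
qed

lemma powr_quarter_lower:
  assumes "Im w < 0"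
  shows "w powr (1/4) = exp (- \<i> * of_real pi / 8) * (\<i> * w) powr (1/4)"
proof -
  have w0: "\<i> * w \<noteq> 0" "w \<noteq> 0" using assms by auto
  have "Ln (\<i> * w) = Ln w + \<i> * of_real pi / 2"
    using Ln_times_ii[OF w0(2)] assms by simp
  then have "Ln w = Ln (\<i> * w) - \<i> * of_real pi / 2" by simp
  then have "(1/4) * Ln w = (1/4) * Ln (\<i> * w) + - \<i> * of_real pi / 8" by simp
  then have "w powr (1/4) = exp ((1/4) * Ln (\<i> * w) + - \<i> * of_real pi / 8)"
    using w0 by (simp only: powr_def if_False)
  then show ?thesis using w0 by (simp only: powr_def if_False exp_add mult.commute)
qed

text \<open>The arguments pi and -pi on the two sides of the cut differ by a full turn, whose
  quarter contributes the factor i.\<close>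

lemma powr_quarter_sides:
  fixes x :: real
  assumes "x < 0"
  shows "exp (\<i> * of_real pi / 8) * (- \<i> * of_real x) powr (1/4) =
     \<i> * (exp (- \<i> * of_real pi / 8) * (\<i> * of_real x) powr (1/4))"
proof -
  have y: "complex_of_real (- x) \<noteq> 0" using assms by simp
  have 1: "Ln (- \<i> * of_real x) = Ln (of_real (- x)) + \<i> * of_real pi / 2"
    using Ln_times_ii[OF y] assms by simp
  have 2: "Ln (\<i> * of_real x) = Ln (of_real (- x)) - \<i> * of_real pi / 2"
  proof -
    have "\<i> * (\<i> * of_real x) = complex_of_real (- x)" by (simp add: mult.assoc[symmetric])
    moreover have "\<i> * complex_of_real x \<noteq> 0" using assms by simp
    ultimately show ?thesis using Ln_times_ii[of "\<i> * of_real x"] assms by simp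
  qed
  have "exp (\<i> * of_real pi / 8) * (- \<i> * of_real x) powr (1/4) = exp (\<i> * of_real pi / 8 + (1/4) * Ln (- \<i> * of_real x))"
    using assms by (simp add: powr_def exp_add)
  also have "\<i> * of_real pi / 8 + (1/4) * Ln (- \<i> * of_real x) =
     \<i> * of_real pi / 2 + (- \<i> * of_real pi / 8 + (1/4) * Ln (\<i> * of_real x))"
    unfolding 1 2 by (simp add: field_simps)
  also have "exp \<dots> = exp (\<i> * of_real pi / 2) * (exp (- \<i> * of_real pi / 8) * exp ((1/4) * Ln (\<i> * of_real x)))"
    by (simp only: exp_add)
  also have "exp (\<i> * of_real pi / 2) = cis (pi / 2)" by (simp add: cis_conv_exp)
  also have "\<dots> = \<i>" by simp
  finally show ?thesis using assms by (simp add: powr_def)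
qed

text \<open>The denominators have distinct zeros by injectivity, so every pole is at most simple and
  one factor z - e cancels it.\<close>

lemma rational_pole_bound:
  fixes p q :: "nat \<Rightarrow> real" and e :: real
  assumes inj: "inj_on q {0..g}"
  shows "\<exists>C. eventually (\<lambda>z. norm ((z - of_real e) * (\<Prod>k\<in>{0..g}. (z - of_real (p k)) / (z - of_real (q k)))) \<le> C)
     (at (complex_of_real e))"
proof (cases "e \<in> q ` {0..g}")
  case False
  then have "isCont (\<lambda>z. (z - of_real e) * (\<Prod>k\<in>{0..g}. (z - of_real (p k)) / (z - of_real (q k)))) (complex_of_real e)"
    by (intro continuous_intros) auto
  then have "((\<lambda>z. norm ((z - of_real e) * (\<Prod>k\<in>{0..g}. (z - of_real (p k)) / (z - of_real (q k))))) \<longlongrightarrow>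
     norm ((complex_of_real e - of_real e) * (\<Prod>k\<in>{0..g}. (complex_of_real e - of_real (p k)) / (complex_of_real e - of_real (q k))))) (at (complex_of_real e))"
    unfolding isCont_def by (rule tendsto_norm)
  then have "eventually (\<lambda>z. norm ((z - of_real e) * (\<Prod>k\<in>{0..g}. (z - of_real (p k)) / (z - of_real (q k)))) < 1) (at (complex_of_real e))"
    by (rule order_tendstoD) simp
  then show ?thesis by (intro exI[of _ 1]) (auto elim: eventually_mono)
next
  case True
  then obtain m where m: "m \<in> {0..g}" "e = q m" by blast
  define h where "h z = (z - of_real (p m)) * (\<Prod>k\<in>{0..g} - {m}. (z - of_real (p k)) / (z - of_real (q k)))" for z :: complex
  have eq: "(z - of_real e) * (\<Prod>k\<in>{0..g}. (z - of_real (p k)) / (z - of_real (q k))) = h z" if "z \<noteq> of_real e" for z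
    using that m by (simp add: prod.remove[OF _ m(1)] h_def)
  have "isCont h (complex_of_real e)"
    unfolding h_def using inj m by (intro continuous_intros) (auto simp: inj_on_def)
  then have "((\<lambda>z. norm (h z)) \<longlongrightarrow> norm (h (of_real e))) (at (complex_of_real e))"
    unfolding isCont_def by (rule tendsto_norm)
  then have "eventually (\<lambda>z. norm (h z) < norm (h (of_real e)) + 1) (at (complex_of_real e))"
    by (rule order_tendstoD) simp
  moreover have "eventually (\<lambda>z. z \<noteq> complex_of_real e) (at (complex_of_real e))" by (simp add: eventually_at_filter)
  ultimately have "eventually (\<lambda>z. norm ((z - of_real e) * (\<Prod>k\<in>{0..g}. (z - of_real (p k)) / (z - of_real (q k)))) \<le> norm (h (of_real e)) + 1) (at (complex_of_real e))"
    by eventually_elim (simp add: eq)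
  then show ?thesis by blast
qed

context band_system
begin

text \<open>Each factor has its cut exactly on one band and tends to 1 at infinity. Taking the
  quotient before the root puts the cut there, and makes the boundary value from above i times the
  one from below on the bands.\<close>

definition beta :: "complex \<Rightarrow> complex" where
  "beta z = (\<Prod>k\<in>{0..g}. ((z - of_real (b k)) / (z - of_real (a k))) powr (1/4))"

text \<open>For \<alpha> < \<beta> the ratio preserves the sign of the imaginary part, so it meets
  the negative axis from the same side as \<open>z\<close> meets the band.\<close>

lemma ratio_Im: "Im ((z - complex_of_real \<beta>) / (z - complex_of_real \<alpha>)) = (\<beta> - \<alpha>) * Im z / (norm (z - complex_of_real \<alpha>))\<^sup>2"
  by (simp add: Im_divide cmod_power2 algebra_simps add_divide_distrib diff_divide_distrib)

lemma ratio_real: "(complex_of_real x - complex_of_real \<beta>) / (complex_of_real x - complex_of_real \<alpha>) = complex_of_real ((x - \<beta>) / (x - \<alpha>))"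
  by simp

lemma ratio_nonpos:
  assumes k: "k \<le> g" and z: "z \<notin> complex_of_real ` {a k..b k}"
  shows "(z - of_real (b k)) / (z - of_real (a k)) \<notin> \<real>\<^sub>\<le>\<^sub>0"
proof (cases "z \<in> \<real>")
  case True
  then obtain x where x: "z = complex_of_real x" by (auto elim: Reals_cases)
  then have "x < a k \<or> b k < x" using z by force
  then have "(x - b k) / (x - a k) > 0"
    using band_less[OF k] by (auto simp: zero_less_divide_iff)
  then show ?thesis unfolding x ratio_real by (simp only: complex_nonpos_Reals_iff Re_complex_of_real) auto
next
  case False
  then have "Im z \<noteq> 0" by (simp add: complex_is_Real_iff)
  moreover have "z \<noteq> of_real (a k)" using False by auto
  ultimately have "Im ((z - of_real (b k)) / (z - of_real (a k))) \<noteq> 0"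
    unfolding ratio_Im using band_less[OF k] by simp
  then show ?thesis by (auto simp: complex_nonpos_Reals_iff)
qed

lemma S_not_band: "k \<le> g \<Longrightarrow> z \<in> S \<Longrightarrow> z \<notin> complex_of_real ` {a k..b k}"
  using a_mono[of 0 k] b_mono[of k g] by (auto simp: slit_plane_def image_iff)

lemma beta_holomorphic: "beta holomorphic_on S"
  unfolding beta_def
proof (intro holomorphic_on_prod holomorphic_on_powr holomorphic_intros)
  fix k z assume "k \<in> {0..g}" "z \<in> S"
  then have "z \<notin> complex_of_real ` {a k..b k}" using S_not_band by simp
  then show "z - of_real (a k) \<noteq> 0" "(z - of_real (b k)) / (z - of_real (a k)) \<notin> \<real>\<^sub>\<le>\<^sub>0"
    using ratio_nonpos[of k z] band_less[of k] \<open>k \<in> {0..g}\<close> by auto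
qed

lemma beta_nonzero: "z \<in> S \<Longrightarrow> beta z \<noteq> 0"
proof -
  assume z: "z \<in> S"
  have "z - of_real (b k) \<noteq> 0" "z - of_real (a k) \<noteq> 0" if "k \<in> {0..g}" for k
    using S_not_band[of k z] z that band_less[of k] by auto
  then show ?thesis by (simp add: beta_def)
qed

lemma beta_at_infinity: "(beta \<longlongrightarrow> 1) at_infinity"
proof -
  have "((\<lambda>z::complex. ((z - of_real (b k)) / (z - of_real (a k))) powr (1/4)) \<longlongrightarrow> 1 powr (1/4)) at_infinity" for k
  proof -
    have inf: "filterlim (\<lambda>z. z - complex_of_real (a k)) at_infinity at_infinity"
      using tendsto_add_filterlim_at_infinity[OF tendsto_const[of "- complex_of_real (a k)"] filterlim_ident] by simp
    have "((\<lambda>z. 1 + (complex_of_real (a k) - of_real (b k)) / (z - of_real (a k))) \<longlongrightarrow> 1 + 0) at_infinity"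
      by (intro tendsto_add tendsto_const tendsto_divide_0[OF tendsto_const inf])
    moreover have "eventually (\<lambda>z. 1 + (complex_of_real (a k) - of_real (b k)) / (z - of_real (a k)) = (z - of_real (b k)) / (z - of_real (a k))) at_infinity"
      using eventually_not_equal_at_infinity[of "complex_of_real (a k)"] by eventually_elim (simp add: field_simps)
    ultimately have "((\<lambda>z. (z - of_real (b k)) / (z - complex_of_real (a k))) \<longlongrightarrow> 1 + 0) at_infinity"
      by (rule Lim_transform_eventually)
    then show ?thesis by (intro tendsto_powr_complex tendsto_const) (simp_all add: complex_nonpos_Reals_iff)
  qed
  then have "(beta \<longlongrightarrow> (\<Prod>k\<in>{0..g}. 1 powr (1/4))) at_infinity" unfolding beta_def[abs_def] by (intro tendsto_prod) 
  then show ?thesis by simp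
qed

lemma ratio_continuous:
  assumes "x \<noteq> a k"
  shows "isCont (\<lambda>z::complex. (z - of_real (b k)) / (z - of_real (a k))) (complex_of_real x)"
  using assms by (intro continuous_intros) auto

text \<open>Off its own band the ratio avoids the cut of the root. On the band the rotated roots
  give the two one-sided limits, and these differ by the factor i.\<close>

lemma beta_factor_boundary:
  assumes k: "k \<le> g" and x: "x \<notin> E"
  shows "\<exists>m. m \<noteq> 0 \<and> boundary_minus (\<lambda>z. ((z - of_real (b k)) / (z - of_real (a k))) powr (1/4)) x m \<and>
     boundary_plus (\<lambda>z. ((z - of_real (b k)) / (z - of_real (a k))) powr (1/4)) x (if a k < x \<and> x < b k then \<i> * m else m)"
proof (cases "a k < x \<and> x < b k")
  case False
  let ?f = "\<lambda>z::complex. ((z - of_real (b k)) / (z - of_real (a k))) powr (1/4)"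
  have ne: "x \<noteq> a k" "x \<noteq> b k" using x k by (auto simp: endpoints_def)
  then have "complex_of_real x \<notin> complex_of_real ` {a k..b k}" using False by auto
  from ratio_nonpos[OF k this] have "isCont ?f (complex_of_real x)"
    using ratio_continuous[OF ne(1)] unfolding isCont_def by (intro tendsto_powr_complex tendsto_const) auto
  then have "boundary_minus ?f x (?f (of_real x))" "boundary_plus ?f x (?f (of_real x))" by (rule boundary_isCont)+
  moreover have "?f (of_real x) \<noteq> 0" using ne by simp
  ultimately show ?thesis unfolding if_not_P[OF False] by blast
next
  case True
  define y where "y = (x - b k) / (x - a k)"
  define R where "R z = (z - of_real (b k)) / (z - of_real (a k))" for z :: complex
  have y: "y < 0" using True by (auto simp: y_def divide_neg_pos)
  have lim: "(R \<longlongrightarrow> of_real y) (at (complex_of_real x))"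
    using ratio_continuous[of x k] True unfolding isCont_def ratio_real y_def R_def[abs_def] by simp
  have lim_p: "((\<lambda>z. exp (\<i> * of_real pi / 8) * (- \<i> * R z) powr (1/4)) \<longlongrightarrow> exp (\<i> * of_real pi / 8) * (- \<i> * of_real y) powr (1/4)) (at (complex_of_real x) within T)" for T
    by (intro tendsto_mult tendsto_powr_complex tendsto_const tendsto_within_subset[OF lim])
       (use y in \<open>auto simp: complex_nonpos_Reals_iff\<close>)
  have lim_m: "((\<lambda>z. exp (- \<i> * of_real pi / 8) * (\<i> * R z) powr (1/4)) \<longlongrightarrow> exp (- \<i> * of_real pi / 8) * (\<i> * of_real y) powr (1/4)) (at (complex_of_real x) within T)" for T
    by (intro tendsto_mult tendsto_powr_complex tendsto_const tendsto_within_subset[OF lim])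
       (use y in \<open>auto simp: complex_nonpos_Reals_iff\<close>)
  define m where "m = exp (- \<i> * of_real pi / 8) * (\<i> * of_real y) powr (1/4)"
  have Im_R: "Im (R z) > 0 \<longleftrightarrow> Im z > 0" "Im (R z) < 0 \<longleftrightarrow> Im z < 0" if "z \<noteq> of_real (a k)" for z
  proof -
    have "(norm (z - of_real (a k)))\<^sup>2 > 0" using that by simp
    then show "Im (R z) > 0 \<longleftrightarrow> Im z > 0" "Im (R z) < 0 \<longleftrightarrow> Im z < 0"
      unfolding R_def ratio_Im using band_less[OF k] by (auto simp: zero_less_divide_iff zero_less_mult_iff divide_less_0_iff mult_less_0_iff)
  qed
  have "boundary_plus (\<lambda>z. R z powr (1/4)) x (\<i> * m)"
    unfolding boundary_plus_def m_def powr_quarter_sides[OF y, symmetric]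
  proof (rule Lim_transform_eventually[OF lim_p])
    have "exp (\<i> * of_real pi / 8) * (- \<i> * R z) powr (1/4) = R z powr (1/4)" if "Im z > 0" for z
      using powr_quarter_upper[of "R z"] Im_R(1)[of z] that by force
    then show "\<forall>\<^sub>F z in at (complex_of_real x) within {z. 0 < Im z}. exp (\<i> * of_real pi / 8) * (- \<i> * R z) powr (1/4) = R z powr (1/4)"
      by (simp add: eventually_at_filter)
  qed
  moreover have "boundary_minus (\<lambda>z. R z powr (1/4)) x m"
    unfolding boundary_minus_def m_def
  proof (rule Lim_transform_eventually[OF lim_m])
    have "exp (- \<i> * of_real pi / 8) * (\<i> * R z) powr (1/4) = R z powr (1/4)" if "Im z < 0" for z
      using powr_quarter_lower[of "R z"] Im_R(2)[of z] that by force
    then show "\<forall>\<^sub>F z in at (complex_of_real x) within {z. Im z < 0}. exp (- \<i> * of_real pi / 8) * (\<i> * R z) powr (1/4) = R z powr (1/4)"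
      by (simp add: eventually_at_filter)
  qed
  moreover have "m \<noteq> 0" using y by (simp add: m_def)
  ultimately show ?thesis using True unfolding R_def by (intro exI[of _ m]) simp
qed

lemma in_one_band:
  assumes "k \<le> g" "a k < x" "x < b k" "i \<le> g" "a i < x" "x < b i" shows "i = k"
proof (rule ccontr)
  assume "i \<noteq> k"
  then consider "i < k" | "k < i" by linarith
  then show False using b_less_a[of i k] b_less_a[of k i] assms by cases auto
qed

lemma beta_boundary:
  assumes x: "x \<notin> E"
  shows "\<exists>m. m \<noteq> 0 \<and> boundary_minus beta x m \<and>
     boundary_plus beta x (if \<exists>k\<le>g. a k < x \<and> x < b k then \<i> * m else m)"
proof -
  let ?f = "\<lambda>k z. ((z - complex_of_real (b k)) / (z - of_real (a k))) powr (1/4)"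
  have "\<forall>k\<in>{0..g}. \<exists>m. m \<noteq> 0 \<and> boundary_minus (?f k) x m \<and> boundary_plus (?f k) x (if a k < x \<and> x < b k then \<i> * m else m)"
    using beta_factor_boundary[OF _ x] by simp
  from bchoice[OF this] obtain m where m: "\<And>k. k \<in> {0..g} \<Longrightarrow> m k \<noteq> 0 \<and> boundary_minus (?f k) x (m k) \<and>
     boundary_plus (?f k) x (if a k < x \<and> x < b k then \<i> * m k else m k)" by blast
  define P where "P = (\<Prod>k\<in>{0..g}. m k)"
  have "P \<noteq> 0" using m by (simp add: P_def)
  moreover have "boundary_minus beta x P"
    using m unfolding boundary_minus_def beta_def[abs_def] P_def by (intro tendsto_prod) blast
  moreover have pl: "boundary_plus beta x (\<Prod>k\<in>{0..g}. if a k < x \<and> x < b k then \<i> * m k else m k)"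
    using m unfolding boundary_plus_def beta_def[abs_def] by (intro tendsto_prod) blast
  moreover have "(\<Prod>k\<in>{0..g}. if a k < x \<and> x < b k then \<i> * m k else m k) = (if \<exists>k\<le>g. a k < x \<and> x < b k then \<i> * P else P)"
  proof (cases "\<exists>k\<le>g. a k < x \<and> x < b k")
    case False
    then show ?thesis unfolding P_def by (auto intro!: prod.cong)
  next
    case True
    then obtain k where k: "k \<le> g" "a k < x" "x < b k" by blast
    \<comment> \<open>The bands are disjoint, so exactly one factor of the product acquires an
      i.\<close>
    have "(\<Prod>i\<in>{0..g}. if a i < x \<and> x < b i then \<i> * m i else m i) = (\<Prod>i\<in>{0..g}. (if i = k then \<i> else 1) * m i)"
    proof (rule prod.cong[OF refl])
      fix i assume "i \<in> {0..g}"
      then have "(a i < x \<and> x < b i) \<longleftrightarrow> i = k" using k in_one_band[OF k, of i] by auto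
      then show "(if a i < x \<and> x < b i then \<i> * m i else m i) = (if i = k then \<i> else 1) * m i" by simp
    qed
    also have "\<dots> = (\<Prod>i\<in>{0..g}. if i = k then \<i> else 1) * P" unfolding P_def by (rule prod.distrib)
    also have "(\<Prod>i\<in>{0..g}. if i = k then \<i> else 1) = \<i>" using k by (simp add: prod.delta)
    finally show ?thesis using True by simp
  qed
  ultimately show ?thesis by (intro exI[of _ P]) simp
qed

lemma norm_beta:
  "norm (beta z) = norm (\<Prod>k\<in>{0..g}. (z - of_real (b k)) / (z - of_real (a k))) powr (1/4)"
proof -
  have "norm (w powr (1/4)) = norm w powr (1/4)" for w :: complex
    by (simp add: powr_def norm_exp_eq_Re)
  then have "norm (beta z) = (\<Prod>k\<in>{0..g}. norm ((z - of_real (b k)) / (z - of_real (a k))) powr (1/4))"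
    unfolding beta_def prod_norm[symmetric] by simp
  also have "\<dots> = (\<Prod>k\<in>{0..g}. norm ((z - of_real (b k)) / (z - of_real (a k)))) powr (1/4)"
    by (rule prod_powr_distrib[symmetric])
  finally show ?thesis by (simp add: prod_norm)
qed

text \<open>The fourth root of a function with at most a simple pole has order at most 1/4; only the
  modulus of \<open>f\<close> enters.\<close>

lemma quarter_growth_from_pole:
  fixes f :: "complex \<Rightarrow> complex"
  assumes C: "eventually (\<lambda>z. norm ((z - of_real e) * h z) \<le> C) (at (complex_of_real e))"
    and f: "\<And>z. z \<in> S \<Longrightarrow> norm (f z) = norm (h z) powr (1/4)"
  shows "quarter_growth f e"
proof -
  have "eventually (\<lambda>z. norm ((z - of_real e) * h z) \<le> C) (at (complex_of_real e) within S)"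
    using C by (rule filter_leD[OF at_le, rotated]) simp
  moreover have "eventually (\<lambda>z. z \<in> S \<and> z \<noteq> complex_of_real e) (at (complex_of_real e) within S)" by (simp add: eventually_at_filter)
  ultimately have "eventually (\<lambda>z. norm (f z) \<le> C powr (1/4) * norm (z - complex_of_real e) powr (- 1 / 4)) (at (complex_of_real e) within S)"
  proof eventually_elim
    case (elim z)
    have d: "norm (z - of_real e) > 0" using elim by simp
    have "norm (h z) \<le> C / norm (z - of_real e)" using elim(1) d unfolding norm_mult by (simp add: field_simps)
    then have "norm (f z) \<le> (C / norm (z - of_real e)) powr (1/4)"
      using f elim by (simp add: powr_mono2)
    also have "\<dots> = C powr (1/4) * norm (z - of_real e) powr (- 1 / 4)"
      using d order_trans[OF norm_ge_zero elim(1)] by (simp add: powr_divide powr_minus_divide)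
    finally show ?case .
  qed
  then show ?thesis unfolding quarter_growth_def by blast
qed

lemma beta_growth: "quarter_growth beta e" "quarter_growth (\<lambda>z. inverse (beta z)) e"
proof -
  have inj: "inj_on a {0..g}" "inj_on b {0..g}"
  proof -
    have "a i \<noteq> a k \<and> b i \<noteq> b k" if "i < k" "k \<le> g" for i k
      using b_less_a[OF that] band_less[of i] band_less[of k] that by auto
    then show "inj_on a {0..g}" "inj_on b {0..g}"
      unfolding inj_on_def by (metis atLeastAtMost_iff linorder_neqE_nat)+
  qed
  obtain C where C: "eventually (\<lambda>z. norm ((z - of_real e) * (\<Prod>k\<in>{0..g}. (z - of_real (b k)) / (z - of_real (a k)))) \<le> C) (at (complex_of_real e))"
    using rational_pole_bound[OF inj(1)] by blast
  show "quarter_growth beta e" by (rule quarter_growth_from_pole[OF C]) (simp add: norm_beta)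
  obtain C' where C': "eventually (\<lambda>z. norm ((z - of_real e) * (\<Prod>k\<in>{0..g}. (z - of_real (a k)) / (z - of_real (b k)))) \<le> C') (at (complex_of_real e))"
    using rational_pole_bound[OF inj(2)] by blast
  show "quarter_growth (\<lambda>z. inverse (beta z)) e"
  proof (rule quarter_growth_from_pole[OF C'])
    fix z
    have "(\<Prod>k\<in>{0..g}. (z - of_real (a k)) / (z - of_real (b k))) = inverse (\<Prod>k\<in>{0..g}. (z - complex_of_real (b k)) / (z - of_real (a k)))"
      by (simp add: prod_inversef[symmetric] inverse_divide)
    then show "norm (inverse (beta z)) = norm (\<Prod>k\<in>{0..g}. (z - of_real (a k)) / (z - of_real (b k))) powr (1/4)"
      by (simp only: norm_inverse norm_beta) (simp add: inverse_powr)
  qed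
qed

end

section \<open>The explicit solution with trivial data\<close>

lemma mat_mult_mat: "mat x ** mat y = (mat (x * y) :: complex ^ 'n ^ 'n)"
  by (simp add: vec_eq_iff matrix_matrix_mult_def mat_def if_distrib[of "\<lambda>u. v * u" for v]
      if_distrib[of "\<lambda>u. u * v" for v] cong: if_cong)

lemma mat_uminus: "- mat x = (mat (- x) :: complex ^ 'n ^ 'n)"
  by (simp add: vec_eq_iff mat_def)

lemma block_rotation:
  "block_mat (mat p) (mat q) (mat (- q)) (mat p) ** band_jump = block_mat (mat (- q)) (mat p) (mat (- p)) (mat (- q))"
proof -
  have "block_mat (mat p) (mat q) (mat (- q)) (mat p) ** band_jump = block_mat (- mat q) (mat p) (- mat p) (mat (- q))"
    by (simp add: block_mat_mult neg_matrix_mult)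
  then show ?thesis by (simp only: mat_uminus)
qed

lemma tendsto_mat: "(f \<longlongrightarrow> x) F \<Longrightarrow> ((\<lambda>z. mat (f z) :: complex ^ 'n ^ 'n) \<longlongrightarrow> mat x) F"
  unfolding tendsto_matrix_iff
proof (intro allI)
  fix i k assume "(f \<longlongrightarrow> x) F"
  then show "((\<lambda>z. (mat (f z) :: complex ^ 'n ^ 'n) $ i $ k) \<longlongrightarrow> mat x $ i $ k) F"
    by (cases "i = k") (simp_all add: mat_def)
qed

lemma mat_holomorphic_on_mat: "f holomorphic_on U \<Longrightarrow> mat_holomorphic_on (\<lambda>z. mat (f z) :: complex ^ 'n ^ 'n) U"
  unfolding mat_holomorphic_on_def
proof (intro allI)
  fix i k :: 'n assume "f holomorphic_on U"
  then show "(\<lambda>z. (mat (f z) :: complex ^ 'n ^ 'n) $ i $ k) holomorphic_on U"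
    by (cases "i = k") (simp_all add: mat_def)
qed

context band_system
begin

text \<open>With J the band jump this is p + q J, where p + i q = beta and p - i q = 1/beta. On the
  eigenspaces of J for i and -i it acts as beta and 1/beta, so replacing beta by i beta amounts to
  multiplying by J.\<close>

definition base_solution :: "complex \<Rightarrow> complex ^ ('r::finite + 'r) ^ ('r + 'r)" where
  "base_solution z = (let p = (beta z + inverse (beta z)) / 2; q = (beta z - inverse (beta z)) / (2 * \<i>)
     in block_mat (mat p) (mat q) (mat (- q)) (mat p))"

lemma gap_not_band:
  assumes "j \<in> {1..g}" "x \<in> gap a b j" "k \<le> g" shows "\<not> (a k < x \<and> x < b k)"
proof -
  consider "k < j" | "j \<le> k" by linarith
  then show ?thesis
  proof cases
    case 1
    have "b k \<le> b (j - 1)" using 1 assms by (intro b_mono) auto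
    then show ?thesis using assms by (auto simp: gap_def)
  next
    case 2
    have "a j \<le> a k" using 2 assms by (intro a_mono) auto
    then show ?thesis using assms by (auto simp: gap_def)
  qed
qed

lemma sol_base: "sol (\<lambda>_. mat 1) (mat 1) (base_solution :: complex \<Rightarrow> complex ^ ('r::finite + 'r) ^ ('r + 'r))"
  unfolding sol_def
proof (intro conjI ballI allI impI)
  show "mat_holomorphic_on (base_solution :: complex \<Rightarrow> complex ^ ('r + 'r) ^ ('r + 'r)) S"
    unfolding base_solution_def[abs_def] Let_def
    by (intro mat_holomorphic_on_block mat_holomorphic_on_mat holomorphic_intros beta_holomorphic)
       (auto simp: beta_nonzero)
  have lims: "((\<lambda>z. (beta z + inverse (beta z)) / 2) \<longlongrightarrow> (1 + inverse 1) / 2) at_infinity"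
    "((\<lambda>z. (beta z - inverse (beta z)) / (2 * \<i>)) \<longlongrightarrow> (1 - inverse 1) / (2 * \<i>)) at_infinity"
    by (intro tendsto_intros beta_at_infinity; simp)+
  have "((base_solution :: complex \<Rightarrow> complex ^ ('r + 'r) ^ ('r + 'r)) \<longlongrightarrow> block_mat (mat ((1 + inverse 1) / 2)) (mat ((1 - inverse 1) / (2 * \<i>)))
     (mat (- ((1 - inverse 1) / (2 * \<i>)))) (mat ((1 + inverse 1) / 2))) at_infinity"
    unfolding base_solution_def[abs_def] Let_def by (intro tendsto_block_mat tendsto_mat tendsto_minus lims)
  then show "((base_solution :: complex \<Rightarrow> complex ^ ('r + 'r) ^ ('r + 'r)) \<longlongrightarrow> mat 1) at_infinity"
    by (simp add: mat_1_block)
next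
  fix e assume "e \<in> E"
  obtain C1 where C1: "eventually (\<lambda>z. norm (beta z) \<le> C1 * norm (z - complex_of_real e) powr (- 1 / 4)) (at (complex_of_real e) within S)"
    using beta_growth(1)[of e] by (auto simp: quarter_growth_def)
  obtain C2 where C2: "eventually (\<lambda>z. norm (inverse (beta z)) \<le> C2 * norm (z - complex_of_real e) powr (- 1 / 4)) (at (complex_of_real e) within S)"
    using beta_growth(2)[of e] by (auto simp: quarter_growth_def)
  define n where "n = real (CARD('r + 'r) * CARD('r + 'r))"
  have "eventually (\<lambda>z. norm (base_solution z :: complex ^ ('r + 'r) ^ ('r + 'r)) \<le> (n * (C1 + C2)) * norm (z - complex_of_real e) powr (- 1 / 4)) (at (complex_of_real e) within S)"
    using C1 C2
  proof eventually_elim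
    case (elim z)
    have p: "norm ((beta z + inverse (beta z)) / 2) \<le> norm (beta z) + norm (inverse (beta z))"
      using norm_triangle_ineq[of "beta z" "inverse (beta z)"] norm_ge_zero[of "beta z"] norm_ge_zero[of "inverse (beta z)"]
      unfolding norm_divide by (simp del: norm_ge_zero)
    have q: "norm ((beta z - inverse (beta z)) / (2 * \<i>)) \<le> norm (beta z) + norm (inverse (beta z))"
      using norm_triangle_ineq4[of "beta z" "inverse (beta z)"] norm_ge_zero[of "beta z"] norm_ge_zero[of "inverse (beta z)"]
      unfolding norm_divide norm_mult by (simp del: norm_ge_zero)
    have "norm ((base_solution z :: complex ^ ('r + 'r) ^ ('r + 'r)) $ i $ k) \<le> norm (beta z) + norm (inverse (beta z))" for i k
      unfolding base_solution_def Let_def using p q by (cases i; cases k) (auto simp: mat_def norm_minus_commute)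
    from norm_matrix_le_entries[OF this]
    have "norm (base_solution z :: complex ^ ('r + 'r) ^ ('r + 'r)) \<le> n * (norm (beta z) + norm (inverse (beta z)))"
      by (simp only: n_def)
    also have "\<dots> \<le> n * (C1 * norm (z - complex_of_real e) powr (- 1 / 4) + C2 * norm (z - complex_of_real e) powr (- 1 / 4))"
      using elim by (intro mult_left_mono add_mono) (auto simp: n_def)
    finally show ?case by (simp add: algebra_simps)
  qed
  then show "quarter_growth (base_solution :: complex \<Rightarrow> complex ^ ('r + 'r) ^ ('r + 'r)) e" unfolding quarter_growth_def by blast
next
  fix x and W :: "complex ^ ('r + 'r) ^ ('r + 'r)"
  assume W: "jumps (\<lambda>_. mat 1) x W"
  obtain m where m: "m \<noteq> 0" "boundary_minus beta x m" "boundary_plus beta x (if \<exists>k\<le>g. a k < x \<and> x < b k then \<i> * m else m)"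
    using beta_boundary[OF jumps_not_E[OF W]] by blast
  define B :: "complex \<Rightarrow> complex ^ ('r + 'r) ^ ('r + 'r)" where
    "B y = (let p = (y + inverse y) / 2; q = (y - inverse y) / (2 * \<i>) in block_mat (mat p) (mat q) (mat (- q)) (mat p))" for y
  have blim: "((\<lambda>z. base_solution z :: complex ^ ('r + 'r) ^ ('r + 'r)) \<longlongrightarrow> B y) F" if "(beta \<longlongrightarrow> y) F" "y \<noteq> 0" for y F
    unfolding base_solution_def Let_def B_def
    by (intro tendsto_block_mat tendsto_mat tendsto_intros that) auto
  show "jump_at base_solution x W"
  proof (cases "\<exists>k\<le>g. a k < x \<and> x < b k")
    case True
    have "W = band_jump"
      using W True gap_not_band a_mono[of 0] b_mono[of _ g] unfolding jumps_def by force
    moreover have "B (\<i> * m) = B m ** band_jump"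
    proof -
      have im: "inverse (\<i> * m) = - (\<i> * inverse m)" by (simp add: inverse_mult_distrib)
      have half: "(\<i> * c - \<i> * d) / 2 = - ((c - d) / (2 * \<i>))" "(\<i> * c + \<i> * d) / (2 * \<i>) = (c + d) / 2" for c d :: complex
        by (simp_all add: field_simps)
      have "(\<i> * m + inverse (\<i> * m)) / 2 = - ((m - inverse m) / (2 * \<i>))"
        "(\<i> * m - inverse (\<i> * m)) / (2 * \<i>) = (m + inverse m) / 2"
        unfolding im using half[of m "inverse m"] by simp_all
      then show ?thesis unfolding B_def Let_def by (simp only: block_rotation)
    qed
    moreover have "boundary_plus base_solution x (B (\<i> * m))" "boundary_minus base_solution x (B m)"
      using blim[OF m(3)[unfolded if_P[OF True] boundary_plus_def]] blim[OF m(2)[unfolded boundary_minus_def]] m(1)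
      by (simp_all add: boundary_plus_def boundary_minus_def)
    ultimately show ?thesis unfolding jump_at_def by metis
  next
    case False
    have "matrix_inv (mat 1) = (mat 1 :: complex ^ 'r ^ 'r)" by (rule matrix_inv_unique) simp
    then have "W = mat 1" using W False unfolding jumps_def by (auto simp: block_diag_1)
    then show ?thesis
      using blim m unfolding if_not_P[OF False] jump_at_def boundary_plus_def boundary_minus_def
      by (intro exI[of _ "B m"]) auto
  qed
qed

lemma sol_cong:
  assumes "\<And>j. j \<in> {1..g} \<Longrightarrow> K j = K' j" shows "sol K L F \<longleftrightarrow> sol K' L F"
proof -
  have "jumps K x W \<longleftrightarrow> jumps K' x W" for x W unfolding jumps_def using assms by auto
  then show ?thesis unfolding sol_def by simp
qed

section \<open>Existence for arbitrary unitary data\<close>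

lemma sol_exists:
  fixes K :: "nat \<Rightarrow> complex ^ 'r ^ 'r"
  assumes K: "unitary_data K"
  shows "\<exists>N. sol K (mat 1) N"
proof -
  \<comment> \<open>\<open>Kt m\<close> has the target data in the first \<open>m\<close> gaps and
    trivial data in the others. Each induction step changes a single gap, from the identity to its
    final value.\<close>
  define Kt where "Kt m i = (if i \<le> m then K i else mat 1)" for m i
  have Kt: "unitary_data (Kt m)" for m
    using K by (auto simp: unitary_data_def Kt_def unitary_1)
  have "\<exists>N. sol (Kt m) (mat 1) N" if "m \<le> g" for m
    using that
  proof (induction m)
    case 0
    have "sol (Kt 0) (mat 1) base_solution" using sol_base by (subst sol_cong[of "Kt 0" "\<lambda>_. mat 1"]) (auto simp: Kt_def)
    then show ?case by blast
  next
    case (Suc m)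
    interpret gap_system g a b "Suc m" by unfold_locales (use Suc.prems in auto)
    obtain N0 where N0: "sol (Kt m) (mat 1) N0" using Suc by auto
    obtain \<delta> where \<delta>: "\<delta> > 0" "\<And>P P' :: complex ^ 'r ^ 'r. unitary_mat P \<Longrightarrow> unitary_mat P' \<Longrightarrow> norm (adj P ** P' - mat 1) < \<delta> \<Longrightarrow>
      \<exists>N :: complex \<Rightarrow> complex ^ ('r + 'r) ^ ('r + 'r). sol ((Kt m)(Suc m := Kt m (Suc m) ** P)) (mat 1) N \<Longrightarrow>
      \<exists>N :: complex \<Rightarrow> complex ^ ('r + 'r) ^ ('r + 'r). sol ((Kt m)(Suc m := Kt m (Suc m) ** P')) (mat 1) N"
      using gap_step_uniform[OF Kt N0] by blast
    \<comment> \<open>Solvability is the property carried along the unitary group; the uniform step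
      size is what the induction principle asks for.\<close>
    have "\<exists>N. sol ((Kt m)(Suc m := Kt m (Suc m) ** K (Suc m))) (mat 1) N"
    proof (rule unitary_induct[OF \<delta>(1), where Q = "\<lambda>P. \<exists>N. sol ((Kt m)(Suc m := Kt m (Suc m) ** P)) (mat 1) N"])
      show "\<exists>N. sol ((Kt m)(Suc m := Kt m (Suc m) ** mat 1)) (mat 1) N" using N0 by auto
      show "unitary_mat (K (Suc m))" using K Suc.prems by (auto simp: unitary_data_def)
    qed (rule \<delta>(2))
    moreover have "(Kt m)(Suc m := Kt m (Suc m) ** K (Suc m)) = Kt (Suc m)"
      by (auto simp: Kt_def fun_eq_iff le_Suc_eq)
    ultimately show ?case by simp
  qed
  from this[of g] obtain N where "sol (Kt g) (mat 1) N" by auto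
  then have "sol K (mat 1) N" by (subst sol_cong[of K "Kt g"]) (auto simp: Kt_def)
  then show ?thesis by blast
qed

subsection \<open>Conjugation by the Szego function\<close>

lemma sandwich_jump:
  assumes "jump_at F x W" "boundary_plus B x Bp" "boundary_minus B x Bm" "W ** Bp = Bm ** W'"
  shows "jump_at (\<lambda>z. A ** F z ** B z) x W'"
proof -
  obtain Fm where Fm: "boundary_plus F x (Fm ** W)" "boundary_minus F x Fm"
    using assms(1) unfolding jump_at_def by blast
  have p: "boundary_plus (\<lambda>z. A ** F z ** B z) x (A ** (Fm ** W) ** Bp)"
    and m: "boundary_minus (\<lambda>z. A ** F z ** B z) x (A ** Fm ** Bm)"
    by (intro boundary_mult boundary_const Fm assms(2,3))+
  have "A ** (Fm ** W) ** Bp = A ** Fm ** (W ** Bp)" by (simp only: matrix_mul_assoc)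
  also have "\<dots> = A ** Fm ** Bm ** W'" unfolding assms(4) by (simp only: matrix_mul_assoc)
  finally show ?thesis using p m unfolding jump_at_def by blast
qed

text \<open>A bounded right factor preserves the order 1/4 at the endpoints, and the constant left
  factor is chosen to restore the value 1 at infinity.\<close>

lemma sandwich_normalised:
  assumes F: "rh_normalised g a b F" and B: "mat_holomorphic_on B S" "bounded (B ` S)" "(B \<longlongrightarrow> L) at_infinity"
    and AL: "A ** L = mat 1"
  shows "rh_normalised g a b (\<lambda>z. A ** F z ** B z)"
  unfolding rh_normalised_iff
proof (intro conjI ballI)
  note FD = F[unfolded rh_normalised_iff]
  show "mat_holomorphic_on (\<lambda>z. A ** F z ** B z) S"
    using FD B(1) by (intro mat_holomorphic_on_mult mat_holomorphic_on_const) auto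
  have "((\<lambda>z. A ** F z ** B z) \<longlongrightarrow> A ** mat 1 ** L) at_infinity"
    using FD by (intro tendsto_matrix_mult tendsto_const B(3)) auto
  then show "((\<lambda>z. A ** F z ** B z) \<longlongrightarrow> mat 1) at_infinity" by (simp add: AL)
  obtain c where "\<forall>y\<in>B ` S. norm y \<le> c" using B(2) unfolding bounded_iff by blast
  then have c: "eventually (\<lambda>z. norm (B z) \<le> c) (at (complex_of_real e) within S)" for e
    by (auto simp: eventually_at_filter)
  fix e assume "e \<in> E"
  then have "quarter_growth F e" using FD by blast
  then have "quarter_growth (\<lambda>z. A ** F z) e"
    by (rule quarter_growth_bounded_mult[rotated]) (rule always_eventually, rule allI, rule order_refl)
  then show "quarter_growth (\<lambda>z. A ** F z ** B z) e" by (rule quarter_growth_mult_bounded[OF _ c])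
qed

text \<open>Uniformly bounded inverses give a lower bound |C| \<le> B |F z C|, which survives in the
  limit and excludes a kernel.\<close>

lemma invertible_limit:
  fixes F :: "'a \<Rightarrow> complex ^ 'n ^ 'n"
  assumes lim: "(F \<longlongrightarrow> A) G" and nb: "G \<noteq> bot"
    and ev: "eventually (\<lambda>z. invertible (F z) \<and> norm (matrix_inv (F z)) \<le> B) G"
  shows "invertible A"
proof -
  have "v = 0" if v: "A *v v = 0" for v
  proof -
    \<comment> \<open>The kernel vector is repeated in all columns, so that the matrix norm estimate
      applies to it.\<close>
    define C :: "complex ^ 'n ^ 'n" where "C = (\<chi> i j. v $ i)"
    have AC: "A ** C = 0"
      using v by (simp add: vec_eq_iff C_def matrix_matrix_mult_def matrix_vector_mult_def)
    have "((\<lambda>z. B * norm (F z ** C)) \<longlongrightarrow> B * norm (A ** C)) G"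
      by (intro tendsto_mult tendsto_const tendsto_norm tendsto_matrix_mult lim)
    moreover have "eventually (\<lambda>z. norm C \<le> B * norm (F z ** C)) G"
      using ev
    proof eventually_elim
      case (elim z)
      have "C = matrix_inv (F z) ** (F z ** C)" using elim by (simp add: matrix_mul_assoc matrix_inv_mult)
      then have "norm C \<le> norm (matrix_inv (F z)) * norm (F z ** C)" using norm_matrix_mult by metis
      also have "\<dots> \<le> B * norm (F z ** C)" using elim by (intro mult_right_mono) auto
      finally show ?case .
    qed
    ultimately have "norm C \<le> B * norm (A ** C)" using nb by (intro tendsto_lowerbound)
    then have "C = 0" by (simp add: AC)
    then have "\<forall>i. C $ i $ i = 0" by simp
    then show ?thesis by (simp add: C_def vec_eq_iff)
  qed
  then show ?thesis using matrix_left_invertible_ker[of A] invertible_left_inverse by blast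
qed

end

locale szego_system = band_system +
  fixes M :: "real \<Rightarrow> complex ^ 'r ^ 'r" and D :: "complex \<Rightarrow> complex ^ 'r ^ 'r" and Dinf :: "complex ^ 'r ^ 'r"
  assumes szego: "szego_function g a b M D Dinf"
begin

definition Dv where "Dv z = matrix_inv (D z)"

definition inv_block where "inv_block z = block_diag (D z) (sharp Dv z)"

lemma D_hol: "mat_holomorphic_on D S" and D_inv: "z \<in> S \<Longrightarrow> invertible (D z)" and Dinf_inv: "invertible Dinf"
  and D_bd: "bounded (D ` S)" and Dv_bd: "bounded (Dv ` S)"
  using szego by (auto simp: szego_function_def Dv_def[abs_def])

lemma D_Dv: "z \<in> S \<Longrightarrow> D z ** Dv z = mat 1" "z \<in> S \<Longrightarrow> Dv z ** D z = mat 1"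
  using matrix_inv_mult[OF D_inv] by (auto simp: Dv_def)

lemma Dv_hol: "mat_holomorphic_on Dv S"
  unfolding Dv_def[abs_def] by (rule mat_holomorphic_on_matrix_inv[OF D_hol D_inv])

lemma eventually_S: "eventually (\<lambda>z. z \<in> S) at_infinity"
proof -
  have "eventually (\<lambda>z. R0 < norm (z - (0::complex))) at_infinity" by (rule eventually_exterior)
  then show ?thesis by eventually_elim (use exterior_S in auto)
qed

lemma D_lim: "(D \<longlongrightarrow> Dinf) at_infinity"
proof -
  let ?h = "\<lambda>w. if w = 0 then Dinf else D (1 / w)"
  have "mat_holomorphic_on ?h {w. w = 0 \<or> 1 / w \<in> S}" using szego by (simp add: szego_function_def)
  moreover have "ball 0 (inverse R0) \<subseteq> {w. w = 0 \<or> 1 / w \<in> S}"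
  proof
    fix w :: complex assume w: "w \<in> ball 0 (inverse R0)"
    have "1 / w \<in> S" if "w \<noteq> 0"
    proof -
      have "inverse (inverse R0) < inverse (norm w)" using w that by (intro less_imp_inverse_less) auto
      then have "norm (1 / w) > R0" by (simp add: norm_divide inverse_eq_divide)
      then show ?thesis using exterior_S by blast
    qed
    then show "w \<in> {w. w = 0 \<or> 1 / w \<in> S}" by blast
  qed
  ultimately have "mat_holomorphic_on ?h (ball 0 (inverse R0))" by (rule mat_holomorphic_on_subset)
  then have "isCont ?h 0" by (rule mat_holomorphic_isCont) (use R0_pos in auto)
  then have "(?h \<longlongrightarrow> Dinf) (at 0)" by (simp add: isCont_def)
  moreover have "filterlim (\<lambda>z::complex. inverse z) (at 0) at_infinity" by (rule filterlim_inverse_at_iff[THEN iffD2, OF filterlim_ident])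
  ultimately have "((\<lambda>z. ?h (inverse z)) \<longlongrightarrow> Dinf) at_infinity" by (rule filterlim_compose)
  moreover have "eventually (\<lambda>z. ?h (inverse z) = D z) at_infinity"
    using eventually_not_equal_at_infinity[of "0::complex"] by eventually_elim (simp add: divide_inverse)
  ultimately show ?thesis by (rule Lim_transform_eventually)
qed

lemma Dv_lim: "(Dv \<longlongrightarrow> matrix_inv Dinf) at_infinity"
  unfolding Dv_def[abs_def]
  by (rule tendsto_matrix_inv[OF D_lim _ Dinf_inv]) (use eventually_S in \<open>eventually_elim\<close>, rule D_inv)

lemma szego_block_alt: "szego_block D z = block_diag (Dv z) (sharp D z)"
  by (simp add: szego_block_def Dv_def)

lemma block_hol: "mat_holomorphic_on (szego_block D) S" "mat_holomorphic_on inv_block S"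
  unfolding szego_block_alt[abs_def] inv_block_def[abs_def] block_diag_def
  by (intro mat_holomorphic_on_block mat_holomorphic_on_const D_hol Dv_hol mat_holomorphic_on_sharp cnj_S; simp)+

lemma block_mult:
  assumes "z \<in> S" shows "szego_block D z ** inv_block z = mat 1" "inv_block z ** szego_block D z = mat 1"
proof -
  have "sharp D z ** sharp Dv z = mat 1" "sharp Dv z ** sharp D z = mat 1"
    using D_Dv[OF cnj_S[OF assms]] by (simp_all add: sharp_def adj_mult[symmetric])
  then show "szego_block D z ** inv_block z = mat 1" "inv_block z ** szego_block D z = mat 1"
    using D_Dv[OF assms] by (simp_all add: szego_block_alt inv_block_def block_diag_mult block_diag_1)
qed

lemma bounded_block_diag:
  fixes F G :: "complex \<Rightarrow> complex ^ 'n ^ 'n"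
  assumes "bounded (F ` S)" "bounded (G ` S)"
  shows "bounded ((\<lambda>z. block_diag (F z) (sharp G z)) ` S)"
proof -
  obtain C1 C2 where C: "\<And>z. z \<in> S \<Longrightarrow> norm (F z) \<le> C1" "\<And>z. z \<in> S \<Longrightarrow> norm (G z) \<le> C2"
    using assms by (auto simp: bounded_iff)
  have "norm (block_diag (F z) (sharp G z)) \<le> C1 + C2" if z: "z \<in> S" for z
  proof -
    have "(norm (block_diag (F z) (sharp G z)))\<^sup>2 = (norm (F z))\<^sup>2 + (norm (sharp G z))\<^sup>2"
      by (simp add: norm_matrix_sq sum_UNIV_Plus block_diag_def)
    also have "\<dots> \<le> (norm (F z) + norm (sharp G z))\<^sup>2" by (simp add: power2_sum)
    finally have "norm (block_diag (F z) (sharp G z)) \<le> norm (F z) + norm (sharp G z)"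
      by (rule power2_le_imp_le) simp
    also have "norm (sharp G z) \<le> C2" using C(2)[OF cnj_S[OF z]] by (simp add: sharp_def)
    finally show ?thesis using C(1)[OF z] by simp
  qed
  then show ?thesis unfolding bounded_iff by blast
qed

lemma block_bounded: "bounded (szego_block D ` S)" "bounded (inv_block ` S)"
  unfolding szego_block_alt[abs_def] inv_block_def[abs_def]
  by (intro bounded_block_diag D_bd Dv_bd)+

lemma block_lim:
  "(szego_block D \<longlongrightarrow> block_diag (matrix_inv Dinf) (adj Dinf)) at_infinity"
  "(inv_block \<longlongrightarrow> szego_block_inf Dinf) at_infinity"
  unfolding szego_block_alt[abs_def] inv_block_def[abs_def] szego_block_inf_def block_diag_def
  by (intro tendsto_block_mat tendsto_const Dv_lim D_lim tendsto_sharp_at_infinity)+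

lemma inf_mult:
  "szego_block_inf Dinf ** block_diag (matrix_inv Dinf) (adj Dinf) = mat 1"
  "block_diag (matrix_inv Dinf) (adj Dinf) ** szego_block_inf Dinf = mat 1"
proof -
  note i = matrix_inv_mult[OF Dinf_inv]
  have "adj (matrix_inv Dinf) ** adj Dinf = mat 1" "adj Dinf ** adj (matrix_inv Dinf) = mat 1"
    unfolding adj_mult[symmetric] i by simp_all
  then show "szego_block_inf Dinf ** block_diag (matrix_inv Dinf) (adj Dinf) = mat 1"
    "block_diag (matrix_inv Dinf) (adj Dinf) ** szego_block_inf Dinf = mat 1"
    by (simp_all add: szego_block_inf_def block_diag_mult block_diag_1 i)
qed

text \<open>Boundedness of the inverse of \<open>D\<close> on \<open>S\<close> keeps the boundary
  values from degenerating, and inversion is continuous at an invertible limit.\<close>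

lemma D_boundary_invertible:
  "boundary_plus D x Dp \<Longrightarrow> invertible Dp \<and> boundary_plus Dv x (matrix_inv Dp)"
  "boundary_minus D x Dm \<Longrightarrow> invertible Dm \<and> boundary_minus Dv x (matrix_inv Dm)"
proof -
  obtain B where B: "\<And>z. z \<in> S \<Longrightarrow> norm (Dv z) \<le> B" using Dv_bd by (auto simp: bounded_iff)
  have ev: "eventually (\<lambda>z. invertible (D z) \<and> norm (matrix_inv (D z)) \<le> B) (at (complex_of_real x) within T)" if "T \<subseteq> S" for T
    unfolding eventually_at_filter using that D_inv B by (auto simp: Dv_def intro!: always_eventually)
  have ev': "eventually (\<lambda>z. invertible (D z)) (at (complex_of_real x) within T)" if "T \<subseteq> S" for T
    using ev[OF that] by eventually_elim blast
  show "invertible Dp \<and> boundary_plus Dv x (matrix_inv Dp)" if "boundary_plus D x Dp"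
  proof -
    have "invertible Dp"
      using that unfolding boundary_plus_def by (rule invertible_limit[OF _ at_upper_ne_bot ev[OF upper_S]])
    then show ?thesis
      using that unfolding boundary_plus_def Dv_def[abs_def] by (auto intro: tendsto_matrix_inv ev'[OF upper_S])
  qed
  show "invertible Dm \<and> boundary_minus Dv x (matrix_inv Dm)" if "boundary_minus D x Dm"
  proof -
    have "invertible Dm"
      using that unfolding boundary_minus_def by (rule invertible_limit[OF _ at_lower_ne_bot ev[OF lower_S]])
    then show ?thesis
      using that unfolding boundary_minus_def Dv_def[abs_def] by (auto intro: tendsto_matrix_inv ev'[OF lower_S])
  qed
qed

text \<open>Because \<open>sharp\<close> exchanges the sides, the value from above combines the
  inverse of \<open>Dp\<close> with the adjoint of \<open>Dm\<close>. This mixing of the two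
  boundary values is what turns the constant band jump into one containing \<open>M\<close>.\<close>

lemma block_boundary:
  assumes "boundary_plus D x Dp" "boundary_minus D x Dm"
  shows "boundary_plus (szego_block D) x (block_diag (matrix_inv Dp) (adj Dm))"
    "boundary_minus (szego_block D) x (block_diag (matrix_inv Dm) (adj Dp))"
    "boundary_plus inv_block x (block_diag Dp (adj (matrix_inv Dm)))"
    "boundary_minus inv_block x (block_diag Dm (adj (matrix_inv Dp)))"
proof -
  note i = D_boundary_invertible(1)[OF assms(1), THEN conjunct2] D_boundary_invertible(2)[OF assms(2), THEN conjunct2]
  have "boundary_plus (\<lambda>z. block_diag (F z) (G z)) x (block_diag X Y)"
    if "boundary_plus F x X" "boundary_plus G x Y" for F G :: "complex \<Rightarrow> complex ^ 'r ^ 'r" and X Y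
    using that unfolding boundary_plus_def block_diag_def by (intro tendsto_block_mat tendsto_const)
  moreover have "boundary_minus (\<lambda>z. block_diag (F z) (G z)) x (block_diag X Y)"
    if "boundary_minus F x X" "boundary_minus G x Y" for F G :: "complex \<Rightarrow> complex ^ 'r ^ 'r" and X Y
    using that unfolding boundary_minus_def block_diag_def by (intro tendsto_block_mat tendsto_const)
  ultimately show "boundary_plus (szego_block D) x (block_diag (matrix_inv Dp) (adj Dm))"
    "boundary_minus (szego_block D) x (block_diag (matrix_inv Dm) (adj Dp))"
    "boundary_plus inv_block x (block_diag Dp (adj (matrix_inv Dm)))"
    "boundary_minus inv_block x (block_diag Dm (adj (matrix_inv Dp)))"
    unfolding szego_block_alt[abs_def] inv_block_def[abs_def]
    using assms i boundary_sharp boundary_sharp' by blast+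
qed

text \<open>Both directions of the correspondence follow from one intertwining identity per jump.\<close>

lemma jump_transfer:
  assumes D: "boundary_plus D x Dp" "boundary_minus D x Dm"
    and W: "W ** block_diag (matrix_inv Dp) (adj Dm) = block_diag (matrix_inv Dm) (adj Dp) ** W'"
  shows "jump_at F x W \<Longrightarrow> jump_at (\<lambda>z. A ** F z ** szego_block D z) x W'"
    "jump_at F x W' \<Longrightarrow> jump_at (\<lambda>z. A ** F z ** inv_block z) x W"
proof -
  note b = block_boundary[OF D]
  show "jump_at F x W \<Longrightarrow> jump_at (\<lambda>z. A ** F z ** szego_block D z) x W'"
    by (rule sandwich_jump[OF _ b(1,2) W])
  note ip = matrix_inv_mult[OF D_boundary_invertible(1)[OF D(1), THEN conjunct1]]
  note im = matrix_inv_mult[OF D_boundary_invertible(2)[OF D(2), THEN conjunct1]]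
  let ?Bp = "block_diag (matrix_inv Dp) (adj Dm)" and ?Bm = "block_diag (matrix_inv Dm) (adj Dp)"
  let ?Ip = "block_diag Dp (adj (matrix_inv Dm))" and ?Im = "block_diag Dm (adj (matrix_inv Dp))"
  have p: "?Bp ** ?Ip = mat 1"
    by (simp add: block_diag_mult ip im adj_mult[symmetric] block_diag_1)
  have m: "?Im ** ?Bm = mat 1"
    by (simp add: block_diag_mult ip im adj_mult[symmetric] block_diag_1)
  have "W' ** ?Ip = ?Im ** (?Bm ** W') ** ?Ip" by (simp add: matrix_mul_assoc m)
  also have "\<dots> = ?Im ** W ** (?Bp ** ?Ip)" unfolding W[symmetric] by (simp only: matrix_mul_assoc)
  also have "\<dots> = ?Im ** W" by (simp add: p)
  finally have "W' ** ?Ip = ?Im ** W" .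
  then show "jump_at F x W' \<Longrightarrow> jump_at (\<lambda>z. A ** F z ** inv_block z) x W"
    using sandwich_jump[OF _ b(3,4)] by blast
qed

lemma band_transfer:
  assumes k: "k \<le> g" and x: "a k < x" "x < b k"
  shows "jump_at F x band_jump \<Longrightarrow> jump_at (\<lambda>z. A ** F z ** szego_block D z) x (block_mat 0 (M x) (- matrix_inv (M x)) 0)"
    "jump_at F x (block_mat 0 (M x) (- matrix_inv (M x)) 0) \<Longrightarrow> jump_at (\<lambda>z. A ** F z ** inv_block z) x band_jump"
proof -
  have "x \<in> bands g a b" using k x by (auto simp: bands_def intro!: bexI[of _ k])
  then obtain Dp Dm where D: "boundary_plus D x Dp" "boundary_minus D x Dm" "M x = Dp ** adj Dp" "M x = Dm ** adj Dm"
    using szego unfolding szego_function_def by blast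
  note ip = matrix_inv_mult[OF D_boundary_invertible(1)[OF D(1), THEN conjunct1]]
  note im = matrix_inv_mult[OF D_boundary_invertible(2)[OF D(2), THEN conjunct1]]
  have Mi: "matrix_inv (M x) = adj (matrix_inv Dp) ** matrix_inv Dp"
  proof (rule matrix_inv_unique)
    have "M x ** (adj (matrix_inv Dp) ** matrix_inv Dp) = Dp ** adj (matrix_inv Dp ** Dp) ** matrix_inv Dp"
      unfolding D(3) adj_mult by (simp only: matrix_mul_assoc)
    then show "M x ** (adj (matrix_inv Dp) ** matrix_inv Dp) = mat 1" by (simp add: ip)
  qed
  \<comment> \<open>Both factorizations of \<open>M\<close> enter: the lower boundary value serves
    the upper right block, and the upper one serves the lower left block.\<close>
  have 1: "matrix_inv Dm ** M x = adj Dm" unfolding D(4) by (simp add: matrix_mul_assoc im)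
  have 2: "adj Dp ** matrix_inv (M x) = matrix_inv Dp"
  proof -
    have "adj Dp ** matrix_inv (M x) = adj (matrix_inv Dp ** Dp) ** matrix_inv Dp" unfolding Mi adj_mult by (simp only: matrix_mul_assoc)
    then show ?thesis by (simp add: ip)
  qed
  have W: "band_jump ** block_diag (matrix_inv Dp) (adj Dm) = block_diag (matrix_inv Dm) (adj Dp) ** block_mat 0 (M x) (- matrix_inv (M x)) 0"
    by (simp add: block_diag_def block_mat_mult neg_matrix_mult 1 2)
  show "jump_at F x band_jump \<Longrightarrow> jump_at (\<lambda>z. A ** F z ** szego_block D z) x (block_mat 0 (M x) (- matrix_inv (M x)) 0)"
    "jump_at F x (block_mat 0 (M x) (- matrix_inv (M x)) 0) \<Longrightarrow> jump_at (\<lambda>z. A ** F z ** inv_block z) x band_jump"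
    using jump_transfer[OF D(1,2) W] by blast+
qed

lemma cscale_eq: "cscale s X = mat s ** X"
  by (simp add: cscale_def vec_eq_iff matrix_matrix_mult_def mat_def if_distrib[of "\<lambda>u. u * v" for v] cong: if_cong)

lemma mat_commute: "mat s ** X = X ** (mat s :: complex ^ 'n ^ 'n)"
  by (simp add: vec_eq_iff matrix_matrix_mult_def mat_def if_distrib[of "\<lambda>u. u * v" for v]
      if_distrib[of "\<lambda>u. v * u" for v] mult.commute cong: if_cong)

text \<open>From D_+ = D_- U one gets U D_+^(-1) = D_-^(-1) and U^* D_-^* = D_+^*. So U disappears
  from both diagonal blocks and only the scalar s remains.\<close>

lemma gap_transfer:
  assumes U: "unitary_mat U" "jump_at D x U" and s: "norm s = 1"
  shows "jump_at F x (block_diag (cscale s U) (matrix_inv (cscale s U))) \<Longrightarrow> jump_at (\<lambda>z. A ** F z ** szego_block D z) x (sigma3_power s)"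
    "jump_at F x (sigma3_power s) \<Longrightarrow> jump_at (\<lambda>z. A ** F z ** inv_block z) x (block_diag (cscale s U) (matrix_inv (cscale s U)))"
proof -
  obtain Dm where D: "boundary_plus D x (Dm ** U)" "boundary_minus D x Dm"
    using U(2) unfolding jump_at_def by blast
  note im = matrix_inv_mult[OF D_boundary_invertible(2)[OF D(2), THEN conjunct1]]
  have s0: "s \<noteq> 0" using s by auto
  have Di: "matrix_inv (Dm ** U) = adj U ** matrix_inv Dm"
  proof (rule matrix_inv_unique)
    have "Dm ** U ** (adj U ** matrix_inv Dm) = Dm ** (U ** adj U) ** matrix_inv Dm" by (simp only: matrix_mul_assoc)
    then show "Dm ** U ** (adj U ** matrix_inv Dm) = mat 1" by (simp add: unitary_matD[OF U(1)] im)
  qed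
  have Ki: "matrix_inv (cscale s U) = mat (inverse s) ** adj U"
  proof (rule matrix_inv_unique)
    have "cscale s U ** (mat (inverse s) ** adj U) = mat s ** (U ** mat (inverse s)) ** adj U"
      unfolding cscale_eq by (simp only: matrix_mul_assoc)
    also have "\<dots> = (mat s ** mat (inverse s)) ** (U ** adj U)"
      unfolding mat_commute[of "inverse s" U, symmetric] by (simp only: matrix_mul_assoc)
    also have "\<dots> = mat 1" using s0 by (simp add: mat_mult_mat unitary_matD[OF U(1)])
    finally show "cscale s U ** (mat (inverse s) ** adj U) = mat 1" .
  qed
  have 1: "cscale s U ** matrix_inv (Dm ** U) = matrix_inv Dm ** mat s"
  proof -
    have "cscale s U ** matrix_inv (Dm ** U) = mat s ** (U ** adj U) ** matrix_inv Dm"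
      unfolding Di cscale_eq by (simp only: matrix_mul_assoc)
    then show ?thesis by (simp add: unitary_matD[OF U(1)] mat_commute)
  qed
  have 2: "matrix_inv (cscale s U) ** adj Dm = adj (Dm ** U) ** mat (inverse s)"
    unfolding Ki adj_mult by (simp add: matrix_mul_assoc[symmetric] mat_commute)
  have W: "block_diag (cscale s U) (matrix_inv (cscale s U)) ** block_diag (matrix_inv (Dm ** U)) (adj Dm) =
     block_diag (matrix_inv Dm) (adj (Dm ** U)) ** sigma3_power s"
    unfolding sigma3_power_def block_diag_mult 1 2 ..
  show "jump_at F x (block_diag (cscale s U) (matrix_inv (cscale s U))) \<Longrightarrow> jump_at (\<lambda>z. A ** F z ** szego_block D z) x (sigma3_power s)"
    "jump_at F x (sigma3_power s) \<Longrightarrow> jump_at (\<lambda>z. A ** F z ** inv_block z) x (block_diag (cscale s U) (matrix_inv (cscale s U)))"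
    using jump_transfer[OF D W] by blast+
qed

lemma unitary_cscale:
  assumes "unitary_mat U" "norm s = 1" shows "unitary_mat (cscale s U)"
proof -
  have "s * cnj s = 1" using assms(2) by (simp add: complex_norm_square[symmetric])
  then have ss: "s * cnj s = 1" "cnj s * s = 1" by (simp_all add: mult.commute)
  have a: "adj (mat s :: complex ^ 'a ^ 'a) = mat (cnj s)" by (simp add: vec_eq_iff mat_def)
  have "mat s ** U ** (adj U ** mat (cnj s)) = mat s ** (U ** adj U) ** mat (cnj s)" by (simp only: matrix_mul_assoc)
  then have "cscale s U ** adj (cscale s U) = mat 1"
    unfolding cscale_eq adj_mult a by (simp add: unitary_matD[OF assms(1)] mat_mult_mat ss)
  then show ?thesis unfolding unitary_mat_def using matrix_left_right_inverse by blast
qed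

lemma N_to_calN:
  assumes "\<And>j. j \<in> {1..g} \<Longrightarrow> unitary_mat (U j)"
    and "\<And>j x. j \<in> {1..g} \<Longrightarrow> x \<in> gap a b j \<Longrightarrow> jump_at D x (U j)"
    and "\<And>j. j \<in> {1..g} \<Longrightarrow> K j = cscale (exp (- \<i> * of_nat n * of_real (\<omega> j))) (U j)"
    and N: "solves_problem_N g a b K N"
  shows "solves_problem_calN g a b M \<omega> n (\<lambda>z. szego_block_inf Dinf ** N z ** szego_block D z)"
  unfolding solves_problem_calN_def
proof (intro conjI ballI)
  note ND = N[unfolded solves_problem_N_def]
  show "rh_normalised g a b (\<lambda>z. szego_block_inf Dinf ** N z ** szego_block D z)"
    by (rule sandwich_normalised[OF conjunct1[OF ND] block_hol(1) block_bounded(1) block_lim(1) inf_mult(1)])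
  show "jump_at (\<lambda>z. szego_block_inf Dinf ** N z ** szego_block D z) x (block_mat 0 (M x) (- matrix_inv (M x)) 0)"
    if "k \<in> {0..g}" "x \<in> {a k<..<b k}" for k x
    using that ND by (intro band_transfer(1)[of k]) auto
  show "jump_at (\<lambda>z. szego_block_inf Dinf ** N z ** szego_block D z) x (sigma3_power (exp (- \<i> * of_nat n * of_real (\<omega> j))))"
    if j: "j \<in> {1..g}" and x: "x \<in> gap a b j" for j x
  proof -
    have "jump_at N x (block_diag (K j) (matrix_inv (K j)))" using ND j x by blast
    then show ?thesis unfolding assms(3)[OF j]
      by (rule gap_transfer(1)[OF assms(1)[OF j] assms(2)[OF j x], rotated]) (simp add: norm_exp_eq_Re)
  qed
qed

lemma calN_to_N:
  assumes "\<And>j. j \<in> {1..g} \<Longrightarrow> unitary_mat (U j)"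
    and "\<And>j x. j \<in> {1..g} \<Longrightarrow> x \<in> gap a b j \<Longrightarrow> jump_at D x (U j)"
    and "\<And>j. j \<in> {1..g} \<Longrightarrow> K j = cscale (exp (- \<i> * of_nat n * of_real (\<omega> j))) (U j)"
    and X: "solves_problem_calN g a b M \<omega> n X"
  shows "solves_problem_N g a b K (\<lambda>z. block_diag (matrix_inv Dinf) (adj Dinf) ** X z ** inv_block z)"
  unfolding solves_problem_N_def
proof (intro conjI ballI)
  note XD = X[unfolded solves_problem_calN_def]
  show "rh_normalised g a b (\<lambda>z. block_diag (matrix_inv Dinf) (adj Dinf) ** X z ** inv_block z)"
    by (rule sandwich_normalised[OF conjunct1[OF XD] block_hol(2) block_bounded(2) block_lim(2) inf_mult(2)])
  show "jump_at (\<lambda>z. block_diag (matrix_inv Dinf) (adj Dinf) ** X z ** inv_block z) x band_jump"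
    if "k \<in> {0..g}" "x \<in> {a k<..<b k}" for k x
    using that XD by (intro band_transfer(2)[of k]) auto
  show "jump_at (\<lambda>z. block_diag (matrix_inv Dinf) (adj Dinf) ** X z ** inv_block z) x (block_diag (K j) (matrix_inv (K j)))"
    if j: "j \<in> {1..g}" and x: "x \<in> gap a b j" for j x
    unfolding assms(3)[OF j]
    using XD j x by (intro gap_transfer(2)[OF assms(1)[OF j] assms(2)[OF j x]]) (auto simp: norm_exp_eq_Re)
qed

end

theorem proposition6p11:
  fixes g n :: nat
    and a b :: "nat \<Rightarrow> real"
    and V :: "real \<Rightarrow> real"
    and \<mu> :: "real measure"
    and M Q :: "real \<Rightarrow> complex ^ 'r ^ 'r"
    and D :: "complex \<Rightarrow> complex ^ 'r ^ 'r"
    and Dinf :: "complex ^ 'r ^ 'r"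
    and U K :: "nat \<Rightarrow> complex ^ 'r ^ 'r"
    and \<omega> :: "nat \<Rightarrow> real"
  assumes ordered: "ordered_endpoints g a b"
    and V_analytic: "real_analytic_on V UNIV"
    and V_growth: "filterlim (\<lambda>x. V x / ln (1 + \<bar>x\<bar>\<^sup>2)) at_top at_infinity"
    and equilibrium: "equilibrium_measure V \<mu>"
    and regular: "regular_equilibrium g a b V \<mu>"
    and M_eq: "\<And>x. M x = Q x ** adj (Q x)"
    and M_pos: "\<And>x. hermitian_pos_def (M x)"
    and Q_analytic: "real_analytic_on Q (bands g a b)"
    and Q_growth: "\<exists>m::nat. (\<lambda>x. norm (Q x)) \<in> O[at_infinity](\<lambda>x. \<bar>x\<bar> ^ m)"
    and szego: "szego_function g a b M D Dinf"
    and U_unitary: "\<And>j. j \<in> {1..g} \<Longrightarrow> unitary_mat (U j)"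
    and U_jump: "\<And>j x. j \<in> {1..g} \<Longrightarrow> x \<in> gap a b j \<Longrightarrow> jump_at D x (U j)"
    and omega: "\<And>j. j \<in> {1..g} \<Longrightarrow> \<omega> j = 2 * pi * measure \<mu> {a j..b g}"
    and n: "n \<ge> 1"
    and K: "\<And>j. j \<in> {1..g} \<Longrightarrow>
              K j = cscale (exp (- \<i> * of_nat n * of_real (\<omega> j))) (U j)"
  shows "(\<forall>j\<in>{1..g}. unitary_mat (K j)) \<and>
    (\<forall>N. solves_problem_N g a b K N \<longrightarrow>
       solves_problem_calN g a b M \<omega> n
         (\<lambda>z. szego_block_inf Dinf ** N z ** szego_block D z)) \<and>
    (\<forall>X. solves_problem_calN g a b M \<omega> n X \<longrightarrow>
       (\<exists>N. solves_problem_N g a b K N \<and>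
          (\<forall>z\<in>slit_plane g a b. X z = szego_block_inf Dinf ** N z ** szego_block D z))) \<and>
    (\<exists>X. solves_problem_calN g a b M \<omega> n X \<and>
       (\<forall>Y. solves_problem_calN g a b M \<omega> n Y \<longrightarrow> (\<forall>z\<in>slit_plane g a b. Y z = X z)))"
proof -
  interpret szego_system g a b M D Dinf by unfold_locales (rule ordered, rule szego)
  have K_unitary: "\<forall>j\<in>{1..g}. unitary_mat (K j)"
    using unitary_cscale[OF U_unitary] K by (simp add: norm_exp_eq_Re)
  then have Ku: "unitary_data K" by (simp add: unitary_data_def)
  have fwd: "solves_problem_calN g a b M \<omega> n (\<lambda>z. szego_block_inf Dinf ** N z ** szego_block D z)"
    if "solves_problem_N g a b K N" for N
    by (rule N_to_calN[OF U_unitary U_jump K that])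
  have bwd: "\<exists>N. solves_problem_N g a b K N \<and> (\<forall>z\<in>S. X z = szego_block_inf Dinf ** N z ** szego_block D z)"
    if X: "solves_problem_calN g a b M \<omega> n X" for X
  proof (intro exI conjI ballI)
    show "solves_problem_N g a b K (\<lambda>z. block_diag (matrix_inv Dinf) (adj Dinf) ** X z ** inv_block z)"
      by (rule calN_to_N[OF U_unitary U_jump K X])
    fix z assume z: "z \<in> S"
    \<comment> \<open>The outer factors cancel in pairs, at infinity on the left and pointwise on
      \<open>S\<close> on the right.\<close>
    have "szego_block_inf Dinf ** (block_diag (matrix_inv Dinf) (adj Dinf) ** X z ** inv_block z) ** szego_block D z =
       (szego_block_inf Dinf ** block_diag (matrix_inv Dinf) (adj Dinf)) ** X z ** (inv_block z ** szego_block D z)"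
      by (simp only: matrix_mul_assoc)
    then show "X z = szego_block_inf Dinf ** (block_diag (matrix_inv Dinf) (adj Dinf) ** X z ** inv_block z) ** szego_block D z"
      by (simp add: inf_mult block_mult[OF z])
  qed
  obtain N where N: "sol K (mat 1) N" using sol_exists[OF Ku] by blast
  then have NN: "solves_problem_N g a b K N" by (simp add: solves_problem_N_iff)
  \<comment> \<open>Uniqueness is pulled back: any solution comes from a solution with data
    \<open>K\<close>, and there is only one of these on \<open>S\<close>.\<close>
  have uniq: "Y z = szego_block_inf Dinf ** N z ** szego_block D z"
    if Y: "solves_problem_calN g a b M \<omega> n Y" and z: "z \<in> S" for Y z
  proof -
    obtain N' where N': "solves_problem_N g a b K N'" "Y z = szego_block_inf Dinf ** N' z ** szego_block D z"
      using bwd[OF Y] z by blast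
    have "N' z = N z" using N'(1) N z by (intro sol_unique[OF Ku]) (simp_all add: solves_problem_N_iff)
    then show ?thesis using N'(2) by simp
  qed
  show ?thesis using K_unitary fwd bwd fwd[OF NN] uniq by blast
qed

end
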